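(* Let $\epsilon>0$ and $n^{5/4+\epsilon}<m=m(n)<n^{4/3+\epsilon}$, and set $p=m/\binom n2$. Suppose $k=k(n)$ satisfies condition $(\star)$, $r=r(n)=O\big((\log n)^3/(np^2)\big)$, and $\mathbb{E}[X_{k,r}]\to\infty$. Then $\mathrm{Var}[X_{k,r}]=o\big(\mathbb{E}[X_{k,r}]^2\big)$.
   Context: $G_{n,m}$ is a uniformly random graph on vertex set $[n]$ with exactly $m$ edges, and $p:=m/\binom n2$. Condition $(\star)$ on $k=k(n)$: $k=\frac{2}{p}\big[\log(np)-\log\log(np)+\log(e/2)+a(n)\big]$ for some function $a(n)\to0$. For integers $0\le r\le k$ and a graph $G$ on $[n]$, $X_{k,r}(G)$ is the number of pairs $(K,M)$ where $K\subseteq[n]$ with $|K|=k+r$ and $M$ is a set of $r$ pairwise disjoint 2-element subsets of $K$ (write $V(M)$ for the union of the pairs in $M$, so $|V(M)|=2r$), such that: (i) every pair in $M$ is an edge of $G$; (ii) every edge of $G$ with both endpoints in $K$ has both endpoints in $V(M)$; (iii) every vertex $v\notin K$ has at least two neighbours in $K\setminus V(M)$. Expectations and variances are with respect to $G=G_{n,m}$. *)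

theory Defs
  imports "HOL-Probability.Probability" "HOL-Library.Landau_Symbols"
begin

text \<open>Vertex set [n] = {1..n}; a graph on [n] is its set of edges,
  each edge being a 2-element subset of [n].\<close>

definition all_edges :: "nat \<Rightarrow> nat set set" where
  "all_edges n = {e. e \<subseteq> {1..n} \<and> card e = 2}"

definition graphs_nm :: "nat \<Rightarrow> nat \<Rightarrow> nat set set set" where
  "graphs_nm n m = {G. G \<subseteq> all_edges n \<and> card G = m}"

definition Gnm :: "nat \<Rightarrow> nat \<Rightarrow> nat set set pmf" where
  "Gnm n m = pmf_of_set (graphs_nm n m)"

definition X :: "nat \<Rightarrow> nat \<Rightarrow> nat \<Rightarrow> nat set set \<Rightarrow> nat" where
  "X n k r G = card {(K, M). K \<subseteq> {1..n} \<and> card K = k + r \<and>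
      M \<subseteq> {e. e \<subseteq> K \<and> card e = 2} \<and> card M = r \<and> pairwise disjnt M \<and>
      M \<subseteq> G \<and>
      (\<forall>e\<in>G. e \<subseteq> K \<longrightarrow> e \<subseteq> \<Union>M) \<and>
      (\<forall>v\<in>{1..n} - K. card {u \<in> K - \<Union>M. {u, v} \<in> G} \<ge> 2)}"

definition EX_X :: "nat \<Rightarrow> nat \<Rightarrow> nat \<Rightarrow> nat \<Rightarrow> real" where
  "EX_X n m k r = measure_pmf.expectation (Gnm n m) (\<lambda>G. real (X n k r G))"

definition VarX :: "nat \<Rightarrow> nat \<Rightarrow> nat \<Rightarrow> nat \<Rightarrow> real" where
  "VarX n m k r = measure_pmf.variance (Gnm n m) (\<lambda>G. real (X n k r G))"

end

theory Submission
  imports Defs "HOL-Real_Asymp.Real_Asymp"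
begin

text \<open>The second moment is a sum over pairs of configurations \<open>(K, M)\<close>, \<open>(K', M')\<close> of joint
  probabilities. Conditioning on the forced edges and non-edges leaves a uniformly random edge
  set of fixed size, which for increasing events is sandwiched between two product measures
  whose densities differ by about \<open>log n\<close> standard deviations; the degree conditions (iii) then
  become nearly independent. For \<open>|K \<inter> K'| \<le> \<delta>|K|\<close> the joint probability exceeds the product of
  the two probabilities by a factor of about \<open>exp (p (l^2 - \<mu>^2) / 2)\<close>, where \<open>l = |K \<inter> K'|\<close> has mean \<open>\<mu>\<close>, and averaging over the
  hypergeometric \<open>l\<close> gives \<open>1 + o(1)\<close>. For larger overlaps every vertex of \<open>K' - K\<close> needs two
  neighbours in a small set, which costs more than the number of choices of \<open>(K', M')\<close>; these
  pairs contribute only \<open>O(E[X])\<close>. All error terms have the form \<open>(log n)^a n^b p^c\<close>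
  and vanish because \<open>p \<ge> n^(-3/4 + \<epsilon>)\<close>.\<close>

section \<open>Random subsets: product measures and fixed size\<close>

text \<open>At p = n^(-3/4) several errors become constant at once, up to logarithms: n^(-3/2)
  p^(-2) from the fluctuation of the overlap in exp (p (l^2 - \<mu>^2) / 2), and n^(-3) p^(-4) from
  r times the failure probability of a vertex, from n times the probability that a vertex fails for
  both sets, and from r f / N, where each set forces f non-edges among N pairs. The degree condition
  over all vertices may have probability exp (- n^c), far below the tail exp (- (log n)^2) of the
  size of a product random set. In the lower bound that tail cannot simply be subtracted; it is
  estimated jointly with the event. The cut-off \<delta> is \<epsilon> itself and is squeezed from
  two sides. Overlaps up to \<delta>|K| lose n^(3 \<delta>) in the failure probabilities, where n^(4
  \<epsilon>) is to spare. For larger overlaps the factor per vertex of K' - K is n |K| p^2 times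
  exp (- p |K| / 2), about log n / (n p); that is only bounded by a power of log n, and the cut-off
  improves it by (n p)^(-\<delta>). Edges common to both matchings need separate counting, since
  each saves a factor of order 1 / p.\<close>

definition BE :: "'a set \<Rightarrow> real \<Rightarrow> ('a set \<Rightarrow> real) \<Rightarrow> real" where
  "BE \<Omega> p f = (\<Sum>S\<in>Pow \<Omega>. p ^ card S * (1 - p) ^ card (\<Omega> - S) * f S)"

lemma BE_empty [simp]: "BE {} p f = f {}"
  by (simp add: BE_def)

text \<open>Conditioning on the single element \<open>x\<close>. This recursion is what the later
  inductions on \<open>\<Omega>\<close> rest on: independence, Harris' inequality and tilting all
  reduce to one coordinate.\<close>

lemma BE_insert:
  assumes "finite \<Omega>" "x \<notin> \<Omega>"
  shows "BE (insert x \<Omega>) p f = p * BE \<Omega> p (\<lambda>S. f (insert x S)) + (1 - p) * BE \<Omega> p f"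
proof -
  have disj: "Pow \<Omega> \<inter> insert x ` Pow \<Omega> = {}" using assms by auto
  have inj: "inj_on (insert x) (Pow \<Omega>)" using assms by (auto simp: inj_on_def)
  have fin: "finite (Pow \<Omega>)" using assms by simp
  have a: "p ^ card S * (1 - p) ^ card (insert x \<Omega> - S) = (1 - p) * (p ^ card S * (1 - p) ^ card (\<Omega> - S))"
    if "S \<in> Pow \<Omega>" for S
  proof -
    have "insert x \<Omega> - S = insert x (\<Omega> - S)" using that assms by auto
    then show ?thesis using assms by (simp add: mult_ac)
  qed
  have b: "p ^ card (insert x S) * (1 - p) ^ card (insert x \<Omega> - insert x S)
      = p * (p ^ card S * (1 - p) ^ card (\<Omega> - S))" if "S \<in> Pow \<Omega>" for S
  proof -
    have "insert x \<Omega> - insert x S = \<Omega> - S" "x \<notin> S" "finite S"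
      using that assms finite_subset by auto
    then show ?thesis by simp
  qed
  have "BE (insert x \<Omega>) p f
    = (\<Sum>S\<in>Pow \<Omega>. p ^ card S * (1 - p) ^ card (insert x \<Omega> - S) * f S)
    + (\<Sum>S\<in>insert x ` Pow \<Omega>. p ^ card S * (1 - p) ^ card (insert x \<Omega> - S) * f S)"
    unfolding BE_def Pow_insert using fin disj by (subst sum.union_disjoint) auto
  also have "(\<Sum>S\<in>insert x ` Pow \<Omega>. p ^ card S * (1 - p) ^ card (insert x \<Omega> - S) * f S)
    = p * BE \<Omega> p (\<lambda>S. f (insert x S))"
    unfolding BE_def sum.reindex[OF inj] sum_distrib_left o_def
    by (rule sum.cong) (simp_all only: b mult.assoc)
  also have "(\<Sum>S\<in>Pow \<Omega>. p ^ card S * (1 - p) ^ card (insert x \<Omega> - S) * f S) = (1 - p) * BE \<Omega> p f"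
    unfolding BE_def sum_distrib_left by (rule sum.cong) (auto simp: a mult_ac)
  finally show ?thesis by simp
qed

lemma BE_cong: "(\<And>S. S \<subseteq> \<Omega> \<Longrightarrow> f S = g S) \<Longrightarrow> BE \<Omega> p f = BE \<Omega> p g"
  by (auto simp: BE_def intro!: sum.cong)

lemma BE_mono:
  assumes "0 \<le> p" "p \<le> 1" "\<And>S. S \<subseteq> \<Omega> \<Longrightarrow> f S \<le> g S"
  shows "BE \<Omega> p f \<le> BE \<Omega> p g"
  unfolding BE_def using assms by (intro sum_mono mult_left_mono) auto

lemma BE_nonneg:
  assumes "0 \<le> p" "p \<le> 1" "\<And>S. S \<subseteq> \<Omega> \<Longrightarrow> 0 \<le> f S"
  shows "0 \<le> BE \<Omega> p f"
  unfolding BE_def using assms by (intro sum_nonneg) auto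

lemma BE_add: "BE \<Omega> p (\<lambda>S. f S + g S) = BE \<Omega> p f + BE \<Omega> p g"
  by (simp add: BE_def sum.distrib algebra_simps)

lemma BE_diff: "BE \<Omega> p (\<lambda>S. f S - g S) = BE \<Omega> p f - BE \<Omega> p g"
  by (simp add: BE_def sum_subtractf algebra_simps)

lemma BE_cmult: "BE \<Omega> p (\<lambda>S. c * f S) = c * BE \<Omega> p f"
  by (simp add: BE_def sum_distrib_left algebra_simps)

lemma BE_const [simp]: "finite \<Omega> \<Longrightarrow> BE \<Omega> p (\<lambda>S. c) = c"
  by (induction \<Omega> rule: finite_induct) (auto simp: BE_insert algebra_simps)

lemma BE_sum: "BE \<Omega> p (\<lambda>S. \<Sum>i\<in>I. f i S) = (\<Sum>i\<in>I. BE \<Omega> p (f i))"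
  unfolding BE_def by (subst sum.swap) (simp add: sum_distrib_left)

lemma BE_mult_indep:
  assumes "finite A" "finite B" "A \<inter> B = {}"
  shows "BE (A \<union> B) p (\<lambda>S. f (S \<inter> A) * g (S \<inter> B)) = BE A p f * BE B p g"
  using assms(1,3)
proof (induction A arbitrary: f rule: finite_induct)
  case empty
  have "BE B p (\<lambda>S. f {} * g (S \<inter> B)) = BE B p (\<lambda>S. f {} * g S)"
    by (rule BE_cong) (simp add: inf.absorb1)
  then show ?case by (simp add: BE_cmult)
next
  case (insert x A)
  have x: "x \<notin> A \<union> B" using insert by auto
  have "BE (insert x A \<union> B) p (\<lambda>S. f (S \<inter> insert x A) * g (S \<inter> B))
    = p * BE (A \<union> B) p (\<lambda>S. f (insert x S \<inter> insert x A) * g (insert x S \<inter> B))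
      + (1 - p) * BE (A \<union> B) p (\<lambda>S. f (S \<inter> insert x A) * g (S \<inter> B))"
    using x insert assms(2) by (simp add: BE_insert)
  also have "BE (A \<union> B) p (\<lambda>S. f (insert x S \<inter> insert x A) * g (insert x S \<inter> B))
     = BE (A \<union> B) p (\<lambda>S. f (insert x (S \<inter> A)) * g (S \<inter> B))"
    using x by (intro BE_cong arg_cong2[where f="(*)"] arg_cong[where f=f] arg_cong[where f=g]) auto
  also have "BE (A \<union> B) p (\<lambda>S. f (S \<inter> insert x A) * g (S \<inter> B))
     = BE (A \<union> B) p (\<lambda>S. f (S \<inter> A) * g (S \<inter> B))"
    using x by (intro BE_cong arg_cong2[where f="(*)"] arg_cong[where f=f]) auto
  also have "BE (A \<union> B) p (\<lambda>S. f (insert x (S \<inter> A)) * g (S \<inter> B)) = BE A p (\<lambda>S. f (insert x S)) * BE B p g"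
    using insert.IH[of "\<lambda>S. f (insert x S)"] insert.prems by auto
  also have "BE (A \<union> B) p (\<lambda>S. f (S \<inter> A) * g (S \<inter> B)) = BE A p f * BE B p g"
    using insert by auto
  finally show ?case using insert by (simp add: BE_insert algebra_simps)
qed

lemma BE_restrict:
  assumes "finite \<Omega>" "A \<subseteq> \<Omega>"
  shows "BE \<Omega> p (\<lambda>S. f (S \<inter> A)) = BE A p f"
proof -
  have e: "A \<union> (\<Omega> - A) = \<Omega>" using assms by auto
  have "BE (A \<union> (\<Omega> - A)) p (\<lambda>S. f (S \<inter> A) * 1) = BE A p f * BE (\<Omega> - A) p (\<lambda>_. 1)"
    using assms finite_subset[of A \<Omega>] by (intro BE_mult_indep) auto
  then show ?thesis unfolding e using assms by simp
qed

text \<open>Dependence on the coordinates in \<open>A\<close> only is expressed by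
  \<open>f S = f (S \<inter> A)\<close>. Degree events are never literally compositions with an
  intersection, so this is the form in which independence is applied to them.\<close>

lemma BE_split_indep:
  assumes "finite \<Omega>" "A \<subseteq> \<Omega>" "B \<subseteq> \<Omega>" "A \<inter> B = {}"
    and f: "\<And>S. S \<subseteq> \<Omega> \<Longrightarrow> f S = f (S \<inter> A)" and g: "\<And>S. S \<subseteq> \<Omega> \<Longrightarrow> g S = g (S \<inter> B)"
  shows "BE \<Omega> p (\<lambda>S. f S * g S) = BE \<Omega> p f * BE \<Omega> p g"
proof -
  have fin: "finite A" "finite B" using finite_subset[OF assms(2,1)] finite_subset[OF assms(3,1)] by auto
  have "BE \<Omega> p (\<lambda>S. f S * g S) = BE \<Omega> p (\<lambda>S. (\<lambda>T. f (T \<inter> A) * g (T \<inter> B)) (S \<inter> (A \<union> B)))"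
  proof (rule BE_cong)
    fix S assume S: "S \<subseteq> \<Omega>"
    have "S \<inter> (A \<union> B) \<inter> A = S \<inter> A" "S \<inter> (A \<union> B) \<inter> B = S \<inter> B" by auto
    then show "f S * g S = f (S \<inter> (A \<union> B) \<inter> A) * g (S \<inter> (A \<union> B) \<inter> B)"
      using f[OF S] g[OF S] by simp
  qed
  also have "\<dots> = BE (A \<union> B) p (\<lambda>T. f (T \<inter> A) * g (T \<inter> B))"
    using assms by (intro BE_restrict) auto
  also have "\<dots> = BE A p f * BE B p g" using fin assms by (intro BE_mult_indep) auto
  also have "BE A p f = BE \<Omega> p (\<lambda>S. f (S \<inter> A))" using assms by (simp add: BE_restrict)
  also have "\<dots> = BE \<Omega> p f" using f by (intro BE_cong) auto
  also have "BE B p g = BE \<Omega> p (\<lambda>S. g (S \<inter> B))" using assms by (simp add: BE_restrict)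
  also have "\<dots> = BE \<Omega> p g" using g by (intro BE_cong) auto
  finally show ?thesis .
qed

lemma BE_prod:
  assumes "finite \<Omega>" "finite V" "\<And>v. v \<in> V \<Longrightarrow> A v \<subseteq> \<Omega>"
    "\<And>v w. v \<in> V \<Longrightarrow> w \<in> V \<Longrightarrow> v \<noteq> w \<Longrightarrow> A v \<inter> A w = {}"
  shows "BE \<Omega> p (\<lambda>S. \<Prod>v\<in>V. g v (S \<inter> A v)) = (\<Prod>v\<in>V. BE (A v) p (g v))"
  using assms(2,3,4)
proof (induction V rule: finite_induct)
  case empty
  then show ?case using assms by simp
next
  case (insert v V)
  have "BE \<Omega> p (\<lambda>S. \<Prod>v\<in>insert v V. g v (S \<inter> A v)) = BE \<Omega> p (\<lambda>S. g v (S \<inter> A v) * (\<Prod>v\<in>V. g v (S \<inter> A v)))"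
    using insert by simp
  also have "\<dots> = BE \<Omega> p (\<lambda>S. g v (S \<inter> A v)) * BE \<Omega> p (\<lambda>S. \<Prod>v\<in>V. g v (S \<inter> A v))"
  proof (rule BE_split_indep[where A = "A v" and B = "\<Union>(A ` V)"])
    show "\<Union> (A ` V) \<subseteq> \<Omega>" by (rule UN_least) (simp add: insert.prems(1))
    show "A v \<inter> \<Union> (A ` V) = {}" using insert.prems(2) insert.hyps by fastforce
    fix S assume "S \<subseteq> \<Omega>"
    show "(\<Prod>w\<in>V. g w (S \<inter> A w)) = (\<Prod>w\<in>V. g w (S \<inter> \<Union> (A ` V) \<inter> A w))"
      by (intro prod.cong arg_cong2[where f=g]) auto
  qed (use assms insert in auto)
  also have "BE \<Omega> p (\<lambda>S. g v (S \<inter> A v)) = BE (A v) p (g v)"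
    using assms insert by (intro BE_restrict) auto
  also have "BE \<Omega> p (\<lambda>S. \<Prod>v\<in>V. g v (S \<inter> A v)) = (\<Prod>v\<in>V. BE (A v) p (g v))"
    using insert by auto
  finally show ?case using insert by simp
qed

section \<open>Correlation inequalities for monotone functions\<close>

lemma harris:
  assumes "finite \<Omega>" "0 \<le> p" "p \<le> 1"
    and "\<And>S T. S \<subseteq> T \<Longrightarrow> T \<subseteq> \<Omega> \<Longrightarrow> f S \<le> f T" and "\<And>S T. S \<subseteq> T \<Longrightarrow> T \<subseteq> \<Omega> \<Longrightarrow> g S \<le> g T"
  shows "BE \<Omega> p f * BE \<Omega> p g \<le> BE \<Omega> p (\<lambda>S. f S * g S)"
  using assms(1,4,5)
proof (induction \<Omega> arbitrary: f g rule: finite_induct)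
  case (insert x \<Omega>)
  let ?f1 = "BE \<Omega> p (\<lambda>S. f (insert x S))" and ?f0 = "BE \<Omega> p f"
  let ?g1 = "BE \<Omega> p (\<lambda>S. g (insert x S))" and ?g0 = "BE \<Omega> p g"
  have 1: "?f1 * ?g1 \<le> BE \<Omega> p (\<lambda>S. f (insert x S) * g (insert x S))"
    by (rule insert.IH; rule insert.prems; auto)
  have 0: "?f0 * ?g0 \<le> BE \<Omega> p (\<lambda>S. f S * g S)"
    by (rule insert.IH; rule insert.prems; auto)
  have "?f0 \<le> ?f1" by (intro BE_mono assms insert.prems) auto
  moreover have "?g0 \<le> ?g1" by (intro BE_mono assms insert.prems) auto
  \<comment> \<open>The gap between the averaged product and the product of the averages over one
    coordinate is exactly this expression; both increments are nonnegative by monotonicity.\<close>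
  ultimately have "0 \<le> p * (1 - p) * ((?f1 - ?f0) * (?g1 - ?g0))"
    using assms by (intro mult_nonneg_nonneg) auto
  then have "(p * ?f1 + (1 - p) * ?f0) * (p * ?g1 + (1 - p) * ?g0)
      \<le> p * (?f1 * ?g1) + (1 - p) * (?f0 * ?g0)"
    by (simp add: algebra_simps)
  also have "\<dots> \<le> p * BE \<Omega> p (\<lambda>S. f (insert x S) * g (insert x S)) + (1 - p) * BE \<Omega> p (\<lambda>S. f S * g S)"
    using 0 1 assms by (intro add_mono mult_left_mono) auto
  finally show ?case using insert by (simp add: BE_insert)
qed simp

text \<open>\<open>harris\<close> carries no sign condition, so it applies to the increasing
  function \<open>- g\<close>.\<close>

lemma harris_neg:
  assumes "finite \<Omega>" "0 \<le> p" "p \<le> 1"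
    and "\<And>S T. S \<subseteq> T \<Longrightarrow> T \<subseteq> \<Omega> \<Longrightarrow> f S \<le> f T" and "\<And>S T. S \<subseteq> T \<Longrightarrow> T \<subseteq> \<Omega> \<Longrightarrow> g T \<le> g S"
  shows "BE \<Omega> p (\<lambda>S. f S * g S) \<le> BE \<Omega> p f * BE \<Omega> p g"
proof -
  have "BE \<Omega> p f * BE \<Omega> p (\<lambda>S. -1 * g S) \<le> BE \<Omega> p (\<lambda>S. f S * (-1 * g S))"
    using assms by (intro harris) auto
  moreover have "BE \<Omega> p (\<lambda>S. -1 * g S) = -1 * BE \<Omega> p g" by (rule BE_cmult)
  moreover have "BE \<Omega> p (\<lambda>S. f S * (-1 * g S)) = -1 * BE \<Omega> p (\<lambda>S. f S * g S)"
    by (subst BE_cmult[symmetric]) (simp add: mult_ac)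
  ultimately show ?thesis by simp
qed

text \<open>A weight \<open>z\<close> per chosen element changes the weights 1 - p and p of one
  coordinate into 1 - p and p z. Normalising by their sum gives a product measure of density p z /
  (1 - p + p z). With \<open>f = 1\<close> this is the generating function of the size, which drives
  the Chernoff bounds.\<close>

lemma BE_tilt:
  assumes "finite \<Omega>" "1 - p + p * z \<noteq> 0"
  shows "BE \<Omega> p (\<lambda>S. z ^ card S * f S) = (1 - p + p * z) ^ card \<Omega> * BE \<Omega> (p * z / (1 - p + p * z)) f"
  using assms(1)
proof (induction \<Omega> arbitrary: f rule: finite_induct)
  case (insert x \<Omega>)
  let ?c = "1 - p + p * z"
  have q: "1 - p * z / ?c = (1 - p) / ?c" using assms(2) by (simp add: field_simps)
  have aux: "c * (a / c * x + b / c * y) = a * x + b * y" if "c \<noteq> 0" for a b c x y :: real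
    using that by (simp add: field_simps)
  have "BE (insert x \<Omega>) p (\<lambda>S. z ^ card S * f S)
    = p * BE \<Omega> p (\<lambda>S. z ^ card (insert x S) * f (insert x S)) + (1 - p) * BE \<Omega> p (\<lambda>S. z ^ card S * f S)"
    using insert by (simp add: BE_insert)
  also have "BE \<Omega> p (\<lambda>S. z ^ card (insert x S) * f (insert x S)) = BE \<Omega> p (\<lambda>S. z * (z ^ card S * f (insert x S)))"
  proof (rule BE_cong)
    fix S assume "S \<subseteq> \<Omega>"
    then have "x \<notin> S" "finite S" using insert finite_subset by auto
    then show "z ^ card (insert x S) * f (insert x S) = z * (z ^ card S * f (insert x S))" by simp
  qed
  also have "\<dots> = z * (?c ^ card \<Omega> * BE \<Omega> (p * z / ?c) (\<lambda>S. f (insert x S)))"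
    by (simp only: BE_cmult insert.IH)
  also have "BE \<Omega> p (\<lambda>S. z ^ card S * f S) = ?c ^ card \<Omega> * BE \<Omega> (p * z / ?c) f"
    by (rule insert.IH)
  finally have "BE (insert x \<Omega>) p (\<lambda>S. z ^ card S * f S)
    = ?c ^ card \<Omega> * (p * z * BE \<Omega> (p * z / ?c) (\<lambda>S. f (insert x S)) + (1 - p) * BE \<Omega> (p * z / ?c) f)"
    by (simp add: algebra_simps)
  also have "\<dots> = ?c ^ card \<Omega> * (?c * (p * z / ?c * BE \<Omega> (p * z / ?c) (\<lambda>S. f (insert x S))
      + (1 - p * z / ?c) * BE \<Omega> (p * z / ?c) f))"
    unfolding q using aux[OF assms(2)] by simp
  finally show ?case using insert by (simp add: BE_insert mult_ac)
qed simp

lemma BE_by_size: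
  assumes "finite \<Omega>"
  shows "BE \<Omega> p f = (\<Sum>j\<le>card \<Omega>. p ^ j * (1 - p) ^ (card \<Omega> - j) * (\<Sum>S | S \<subseteq> \<Omega> \<and> card S = j. f S))"
proof -
  have "BE \<Omega> p f = (\<Sum>j\<le>card \<Omega>. \<Sum>S | S \<in> Pow \<Omega> \<and> card S = j. p ^ card S * (1 - p) ^ card (\<Omega> - S) * f S)"
    unfolding BE_def using assms by (intro sum.group[symmetric]) (auto simp: card_mono)
  also have "\<dots> = (\<Sum>j\<le>card \<Omega>. p ^ j * (1 - p) ^ (card \<Omega> - j) * (\<Sum>S | S \<subseteq> \<Omega> \<and> card S = j. f S))"
    unfolding sum_distrib_left
    using assms finite_subset[OF _ assms] by (intro sum.cong) (auto simp: card_Diff_subset)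
  finally show ?thesis .
qed

section \<open>Uniform sets of fixed size sandwiched between product measures\<close>

definition Unif :: "'a set \<Rightarrow> nat \<Rightarrow> ('a set \<Rightarrow> bool) \<Rightarrow> real" where
  "Unif \<Omega> j B = card {S. S \<subseteq> \<Omega> \<and> card S = j \<and> B S} / (card \<Omega> choose j)"

abbreviation (input) incr :: "'a set \<Rightarrow> ('a set \<Rightarrow> bool) \<Rightarrow> bool" where
  "incr \<Omega> B \<equiv> (\<forall>S T. S \<subseteq> T \<longrightarrow> T \<subseteq> \<Omega> \<longrightarrow> B S \<longrightarrow> B T)"

text \<open>Local LYM argument: a j-set in \<open>B\<close> has \<open>card \<Omega> - j\<close>
  supersets with one more element, all in \<open>B\<close>, while a set of size j + 1 arises in at
  most j + 1 ways. Counting the pairs (set, added element) on both sides gives the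
  inequality.\<close>

lemma Unif_step:
  assumes "finite \<Omega>" "incr \<Omega> B" "j < card \<Omega>"
  shows "Unif \<Omega> j B \<le> Unif \<Omega> (Suc j) B"
proof -
  let ?b = "\<lambda>j. {S. S \<subseteq> \<Omega> \<and> card S = j \<and> B S}"
  let ?N = "card \<Omega>"
  have fin: "finite (?b j)" for j by (rule finite_subset[of _ "Pow \<Omega>"]) (use assms in auto)
  define P where "P = (SIGMA S:?b j. \<Omega> - S)"
  define Q where "Q = (SIGMA T:?b (Suc j). T)"
  have cP: "card P = card (?b j) * (?N - j)"
  proof -
    have "card (\<Omega> - S) = ?N - j" if "S \<in> ?b j" for S
      using that assms(1) finite_subset[of S \<Omega>] by (auto simp: card_Diff_subset)
    then show ?thesis unfolding P_def using fin assms(1) by (subst card_SigmaI) auto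
  qed
  have cQ: "card Q = card (?b (Suc j)) * Suc j"
    unfolding Q_def using fin assms(1) finite_subset by (subst card_SigmaI) auto
  have finQ: "finite Q" unfolding Q_def using fin assms(1) finite_subset by (intro finite_SigmaI) auto
  have "card P \<le> card Q"
  proof (rule card_inj_on_le[where f = "\<lambda>(S, x). (insert x S, x)"])
    show "inj_on (\<lambda>(S, x). (insert x S, x)) P" unfolding P_def
      by (rule inj_onI) (clarsimp, metis Diff_insert_absorb)
    show "(\<lambda>(S, x). (insert x S, x)) ` P \<subseteq> Q"
    proof (clarsimp simp: P_def Q_def)
      fix S x assume "S \<subseteq> \<Omega>" "B S" "j = card S" "x \<in> \<Omega>" "x \<notin> S"
      moreover then have "finite S" using assms(1) finite_subset by auto
      ultimately show "card (insert x S) = Suc (card S) \<and> B (insert x S)"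
        using assms(2)[rule_format, of S "insert x S"] by auto
    qed
  qed (rule finQ)
  then have le: "card (?b j) * (?N - j) \<le> card (?b (Suc j)) * Suc j" by (simp only: cP cQ)
  have ch: "Suc j * (?N choose Suc j) = (?N - j) * (?N choose j)"
    using binomial_absorb_comp[of ?N j] by (metis Suc_times_binomial_add add_diff_inverse_nat assms(3) binomial_absorption mult.commute not_less_iff_gr_or_eq)
  have cross: "a / c \<le> b / d" if "c > 0" "d > 0" "a * d \<le> b * c" for a b c d :: real
    using that by (simp add: field_simps)
  have gen: "a * c * (s * d) = (a * d) * (s * c)" for a c s d :: nat by simp
  have gen2: "(b * s) * (d * e) = b * e * (s * d)" for b s d e :: nat by simp
  have pos: "(?N choose j) > 0" "(?N choose Suc j) > 0" using assms(3) by auto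
  have "card (?b j) * (?N choose Suc j) * (Suc j * (?N - j)) \<le> card (?b (Suc j)) * (?N choose j) * (Suc j * (?N - j))"
  proof -
    have "card (?b j) * (?N choose Suc j) * (Suc j * (?N - j)) = (card (?b j) * (?N - j)) * (Suc j * (?N choose Suc j))"
      by (rule gen)
    also have "\<dots> \<le> (card (?b (Suc j)) * Suc j) * (Suc j * (?N choose Suc j))" using le by (rule mult_right_mono) simp
    also have "\<dots> = card (?b (Suc j)) * (?N choose j) * (Suc j * (?N - j))" unfolding ch by (rule gen2)
    finally show ?thesis .
  qed
  then have "card (?b j) * (?N choose Suc j) \<le> card (?b (Suc j)) * (?N choose j)"
    by (rule mult_right_le_imp_le) (use assms(3) in simp)
  then have "real (card (?b j)) * real (?N choose Suc j) \<le> real (card (?b (Suc j))) * real (?N choose j)"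
    unfolding of_nat_mult[symmetric] of_nat_le_iff .
  then show ?thesis unfolding Unif_def using pos by (intro cross) auto
qed

lemma Unif_mono:
  assumes "finite \<Omega>" "incr \<Omega> B" "i \<le> j" "j \<le> card \<Omega>"
  shows "Unif \<Omega> i B \<le> Unif \<Omega> j B"
  using assms(3,4)
proof (induction rule: dec_induct)
  case (step j)
  then show ?case using Unif_step[OF assms(1,2), of j] by simp
qed simp

lemma sum_of_bool_card:
  "finite A \<Longrightarrow> (\<Sum>x\<in>A. of_bool (P x)) = real (card {x \<in> A. P x})"
proof (induction A rule: finite_induct)
  case (insert x A)
  have "{y \<in> insert x A. P y} = (if P x then insert x {y \<in> A. P y} else {y \<in> A. P y})" by auto
  then show ?case using insert by simp
qed simp

text \<open>A product measure is a binomial mixture of the uniform measures on sets of fixed size.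
  The extra factor \<open>g\<close> carries size restrictions.\<close>

lemma BE_by_size_Unif:
  fixes g :: "nat \<Rightarrow> real" and p :: real
  assumes "finite \<Omega>"
  shows "BE \<Omega> p (\<lambda>S. of_bool (B S) * g (card S))
    = (\<Sum>j\<le>card \<Omega>. real (card \<Omega> choose j) * p ^ j * (1 - p) ^ (card \<Omega> - j) * g j * Unif \<Omega> j B)"
  unfolding BE_by_size[OF assms]
proof (rule sum.cong[OF refl])
  fix j assume "j \<in> {..card \<Omega>}"
  then have pos: "card \<Omega> choose j > 0" by simp
  have fin: "finite {S. S \<subseteq> \<Omega> \<and> card S = j}" by (rule finite_subset[of _ "Pow \<Omega>"]) (use assms in auto)
  have 1: "(\<Sum>S | S \<subseteq> \<Omega> \<and> card S = j. of_bool (B S) * g (card S)) = (\<Sum>S | S \<subseteq> \<Omega> \<and> card S = j. of_bool (B S)) * g j"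
    unfolding sum_distrib_right by (rule sum.cong) auto
  have 2: "(\<Sum>S | S \<subseteq> \<Omega> \<and> card S = j. of_bool (B S)) = real (card {S. S \<subseteq> \<Omega> \<and> card S = j \<and> B S})"
    using sum_of_bool_card[OF fin, of B] by (simp add: conj_assoc)
  show "p ^ j * (1 - p) ^ (card \<Omega> - j) * (\<Sum>S | S \<subseteq> \<Omega> \<and> card S = j. of_bool (B S) * g (card S)) =
         real (card \<Omega> choose j) * p ^ j * (1 - p) ^ (card \<Omega> - j) * g j * Unif \<Omega> j B"
    unfolding 1 2 using pos by (simp add: Unif_def)
qed

lemma Unif_True: "j \<le> card \<Omega> \<Longrightarrow> finite \<Omega> \<Longrightarrow> Unif \<Omega> j (\<lambda>_. True) = 1"
  by (simp add: Unif_def n_subsets)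

lemma Unif_nonneg: "0 \<le> Unif \<Omega> j B" by (simp add: Unif_def)

text \<open>Discard the part of the mixture with fewer than \<open>j\<close> elements; on the rest
  \<open>Unif\<close> is at least its value at \<open>j\<close>. The loss is a plain factor, so an
  unweighted tail bound is enough in this direction.\<close>

lemma Unif_le_BE:
  assumes "finite \<Omega>" "incr \<Omega> B" "0 \<le> p" "p \<le> 1" "j \<le> card \<Omega>"
  shows "Unif \<Omega> j B * (1 - BE \<Omega> p (\<lambda>S. of_bool (card S < j))) \<le> BE \<Omega> p (\<lambda>S. of_bool (B S))"
proof -
  let ?N = "card \<Omega>"
  let ?w = "\<lambda>i. real (?N choose i) * p ^ i * (1 - p) ^ (?N - i)"
  have "1 - BE \<Omega> p (\<lambda>S. of_bool (card S < j)) = BE \<Omega> p (\<lambda>S. 1 - of_bool (card S < j))"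
    using assms(1) by (simp add: BE_diff)
  also have "\<dots> = BE \<Omega> p (\<lambda>S. of_bool True * of_bool (j \<le> card S))"
    by (intro BE_cong) auto
  also have "\<dots> = (\<Sum>i\<le>?N. ?w i * of_bool (j \<le> i) * Unif \<Omega> i (\<lambda>_. True))"
    using BE_by_size_Unif[OF assms(1), of p "\<lambda>_. True" "\<lambda>i. of_bool (j \<le> i)"] by simp
  also have "\<dots> = (\<Sum>i\<le>?N. ?w i * of_bool (j \<le> i))"
    using assms(1) by (intro sum.cong) (auto simp: Unif_True)
  finally have "Unif \<Omega> j B * (1 - BE \<Omega> p (\<lambda>S. of_bool (card S < j))) = (\<Sum>i\<le>?N. ?w i * (of_bool (j \<le> i) * Unif \<Omega> j B))"
    by (simp add: sum_distrib_left mult_ac)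
  also have "\<dots> \<le> (\<Sum>i\<le>?N. ?w i * Unif \<Omega> i B)"
    using assms Unif_mono[OF assms(1,2)] by (intro sum_mono mult_left_mono) (auto simp: Unif_nonneg)
  also have "\<dots> = BE \<Omega> p (\<lambda>S. of_bool (B S))"
    using BE_by_size_Unif[OF assms(1), of p B "\<lambda>_. 1"] by (simp add: mult_ac)
  finally show ?thesis .
qed

text \<open>The size restriction stays inside the expectation. The event \<open>B\<close> can be
  much rarer than an atypical size, so the part with more than \<open>j\<close> elements has to be
  bounded together with \<open>B\<close>.\<close>

lemma BE_le_Unif:
  assumes "finite \<Omega>" "incr \<Omega> B" "0 \<le> p" "p \<le> 1" "j \<le> card \<Omega>"
  shows "BE \<Omega> p (\<lambda>S. of_bool (B S) * of_bool (card S \<le> j)) \<le> Unif \<Omega> j B"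
proof -
  let ?N = "card \<Omega>"
  let ?w = "\<lambda>i. real (?N choose i) * p ^ i * (1 - p) ^ (?N - i)"
  have "BE \<Omega> p (\<lambda>S. of_bool (B S) * of_bool (card S \<le> j)) = (\<Sum>i\<le>?N. ?w i * of_bool (i \<le> j) * Unif \<Omega> i B)"
    using BE_by_size_Unif[OF assms(1), of p B "\<lambda>i. of_bool (i \<le> j)"] by simp
  also have "\<dots> \<le> (\<Sum>i\<le>?N. ?w i * Unif \<Omega> j B)"
    using assms Unif_mono[OF assms(1,2)] unfolding mult.assoc
    by (intro sum_mono mult_left_mono) (auto simp: Unif_nonneg)
  also have "\<dots> = (\<Sum>i\<le>?N. ?w i * 1 * Unif \<Omega> i (\<lambda>_. True)) * Unif \<Omega> j B"
    unfolding sum_distrib_right using assms(1) by (intro sum.cong) (auto simp: Unif_True)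
  also have "(\<Sum>i\<le>?N. ?w i * 1 * Unif \<Omega> i (\<lambda>_. True)) = 1"
    using BE_by_size_Unif[OF assms(1), of p "\<lambda>_. True" "\<lambda>_. 1"] assms(1) by simp
  finally show ?thesis by simp
qed

lemma BE_of_bool_le_1:
  fixes p :: real
  assumes "finite \<Omega>" "0 \<le> p" "p \<le> 1"
  shows "BE \<Omega> p (\<lambda>S. of_bool (B S)) \<le> 1"
  using BE_mono[OF assms(2,3), of \<Omega> "\<lambda>S. of_bool (B S)" "\<lambda>_. 1"] assms(1) by simp

lemma BE_lower_tail:
  fixes p :: real
  assumes "finite \<Omega>" "0 \<le> p" "p \<le> 1" and j: "real j \<le> M" and M: "M > 0"
    and mean: "M + 3 * w * sqrt M \<le> p * card \<Omega>" and w: "0 < w" "w \<le> sqrt M / 2"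
  shows "BE \<Omega> p (\<lambda>S. of_bool (card S < j)) \<le> exp (- w\<^sup>2)"
proof -
  \<comment> \<open>The tilt \<open>z = 1 - w / sqrt M\<close>: the surplus
    \<open>3 * w * sqrt M\<close> of the mean contributes -3 w^2 to the exponent and the quadratic
    error of \<open>ln z\<close> contributes 2 w^2, which leaves -w^2. The bound
    \<open>y \<le> 1/2\<close> is what the lower bound on the logarithm requires.\<close>
  define y where "y = w / sqrt M"
  have y: "0 < y" "y \<le> 1/2" using w M by (auto simp: y_def field_simps)
  have wy: "w = y * sqrt M" using M by (simp add: y_def)
  define z where "z = 1 - y"
  have z: "0 < z" "z \<le> 1" using y by (auto simp: z_def)
  have c: "1 - p + p * z = 1 - p * y" by (simp add: z_def algebra_simps)
  have py: "p * y \<le> 1/2" using mult_mono[of p 1 y "1/2"] assms y by simp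
  have "BE \<Omega> p (\<lambda>S. of_bool (card S < j)) \<le> BE \<Omega> p (\<lambda>S. inverse (z ^ j) * (z ^ card S * 1))"
  proof (rule BE_mono[OF assms(2,3)])
    fix S
    have "1 \<le> inverse (z ^ j) * z ^ card S" if "card S < j"
    proof -
      have "z ^ j \<le> z ^ card S" using that z by (intro power_decreasing) auto
      then show ?thesis using z by (simp add: field_simps)
    qed
    then show "of_bool (card S < j) \<le> inverse (z ^ j) * (z ^ card S * 1)" using z by auto
  qed
  also have "\<dots> = inverse (z ^ j) * (1 - p * y) ^ card \<Omega>"
    using BE_tilt[OF assms(1), of p z "\<lambda>_. 1"] py assms(1) unfolding BE_cmult c by simp
  also have "\<dots> \<le> exp (M * (y + 2 * y\<^sup>2)) * exp (- (p * y * card \<Omega>))"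
  proof (rule mult_mono)
    have "- y - 2 * y\<^sup>2 \<le> ln z" unfolding z_def using y by (intro ln_one_minus_pos_lower_bound) auto
    then have "real j * (- ln z) \<le> M * (y + 2 * y\<^sup>2)"
      using j M z by (intro mult_mono) (auto simp: ln_le_zero_iff)
    moreover have "inverse (z ^ j) = exp (real j * (- ln z))"
      using z by (simp add: exp_minus exp_of_nat_mult)
    ultimately show "inverse (z ^ j) \<le> exp (M * (y + 2 * y\<^sup>2))" by simp
    have "(1 - p * y) ^ card \<Omega> \<le> exp (- (p * y)) ^ card \<Omega>"
      using py exp_ge_add_one_self[of "- (p * y)"] by (intro power_mono) auto
    also have "\<dots> = exp (- (p * y * card \<Omega>))" by (simp add: exp_of_nat_mult[symmetric] mult_ac)
    finally show "(1 - p * y) ^ card \<Omega> \<le> exp (- (p * y * card \<Omega>))" .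
    show "0 \<le> (1 - p * y) ^ card \<Omega>" using py by auto
  qed simp
  also have "\<dots> \<le> exp (- w\<^sup>2)"
  proof -
    have "y * (M + 3 * w * sqrt M) = y * M + 3 * (y\<^sup>2 * M)"
      using M by (simp add: wy algebra_simps power2_eq_square)
    then have "y * M + 3 * (y\<^sup>2 * M) \<le> y * (p * card \<Omega>)" using mean y mult_left_mono[OF mean, of y] by simp
    moreover have "w\<^sup>2 = y\<^sup>2 * M" using M by (auto simp: wy power_mult_distrib)
    ultimately have "M * (y + 2 * y\<^sup>2) - p * y * card \<Omega> \<le> - w\<^sup>2"
      by (simp add: algebra_simps power2_eq_square)
    then show ?thesis by (simp add: exp_add[symmetric])
  qed
  finally show ?thesis .
qed

lemma Unif_upper:
  fixes p :: real
  assumes "finite \<Omega>" "incr \<Omega> B" "0 \<le> p" "p \<le> 1" "j \<le> card \<Omega>" "real j \<le> M" "M > 0"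
    "M + 3 * w * sqrt M \<le> p * card \<Omega>" "0 < w" "w \<le> sqrt M / 2"
  shows "Unif \<Omega> j B * (1 - exp (- w\<^sup>2)) \<le> BE \<Omega> p (\<lambda>S. of_bool (B S))"
proof -
  have "Unif \<Omega> j B * (1 - exp (- w\<^sup>2)) \<le> Unif \<Omega> j B * (1 - BE \<Omega> p (\<lambda>S. of_bool (card S < j)))"
    using BE_lower_tail[OF assms(1,3,4,6,7,8,9,10)] by (intro mult_left_mono) (auto simp: Unif_nonneg)
  also have "\<dots> \<le> BE \<Omega> p (\<lambda>S. of_bool (B S))" using assms by (intro Unif_le_BE) auto
  finally show ?thesis .
qed

text \<open>The upper tail is weighted by the event: exponential tilting turns the weighted
  expectation into one over a product measure again, where product events are explicit.\<close>

lemma Unif_lower: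
  fixes p :: real and \<Omega> :: "'a set"
  assumes "finite \<Omega>" "incr \<Omega> B" "0 \<le> p" "p \<le> 1" "j \<le> card \<Omega>" and j: "real j \<le> M" and M: "M > 0"
    and mean: "p * card \<Omega> \<le> j - 2 * w * sqrt M" and w: "0 < w" "w \<le> sqrt M"
  defines "y \<equiv> w / sqrt M"
  shows "BE \<Omega> p (\<lambda>S. of_bool (B S)) - exp (- w\<^sup>2) * BE \<Omega> (p * (1 + y) / (1 + p * y)) (\<lambda>S. of_bool (B S)) \<le> Unif \<Omega> j B"
proof -
  have y: "0 < y" "y \<le> 1" using w M by (auto simp: y_def field_simps)
  have wy: "w = y * sqrt M" using M by (simp add: y_def)
  define z where "z = 1 + y"
  have z: "1 \<le> z" using y by (auto simp: z_def)
  have c: "1 - p + p * z = 1 + p * y" by (simp add: z_def algebra_simps)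
  have py: "0 \<le> p * y" using assms y by simp
  let ?E = "BE \<Omega> (p * z / (1 + p * y)) (\<lambda>S. of_bool (B S))"
  have pz: "0 \<le> p * z / (1 + p * y)" "p * z / (1 + p * y) \<le> 1"
  proof -
    show "0 \<le> p * z / (1 + p * y)" using py z assms(3) by auto
    have "p * z \<le> 1 + p * y" using assms(4) by (simp add: z_def algebra_simps)
    then show "p * z / (1 + p * y) \<le> 1" using py by (simp add: divide_le_eq_1)
  qed
  have E0: "0 \<le> ?E" using pz by (intro BE_nonneg) auto
  have "BE \<Omega> p (\<lambda>S. of_bool (B S)) - Unif \<Omega> j B
      \<le> BE \<Omega> p (\<lambda>S. of_bool (B S)) - BE \<Omega> p (\<lambda>S. of_bool (B S) * of_bool (card S \<le> j))"
    using BE_le_Unif[OF assms(1,2,3,4,5)] by simp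
  also have "\<dots> = BE \<Omega> p (\<lambda>S. of_bool (B S) - of_bool (B S) * of_bool (card S \<le> j))"
    by (simp add: BE_diff)
  also have "\<dots> \<le> BE \<Omega> p (\<lambda>S. inverse (z ^ j) * (z ^ card S * of_bool (B S)))"
  proof (rule BE_mono[OF assms(3,4)])
    fix S :: "'a set"
    have "1 \<le> inverse (z ^ j) * z ^ card S" if "\<not> card S \<le> j"
    proof -
      have "z ^ j \<le> z ^ card S" using that z by (intro power_increasing) auto
      then show ?thesis using z by (simp add: field_simps)
    qed
    then show "of_bool (B S) - of_bool (B S) * of_bool (card S \<le> j) \<le> inverse (z ^ j) * (z ^ card S * of_bool (B S))"
      using z by auto
  qed
  also have "\<dots> = inverse (z ^ j) * ((1 + p * y) ^ card \<Omega> * ?E)"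
    using BE_tilt[OF assms(1), of p z "\<lambda>S. of_bool (B S)"] py unfolding BE_cmult c by simp
  also have "\<dots> = inverse (z ^ j) * (1 + p * y) ^ card \<Omega> * ?E" by (simp only: mult.assoc)
  also have "\<dots> \<le> exp (- w\<^sup>2) * ?E"
  proof (rule mult_right_mono[OF _ E0])
    have "inverse (z ^ j) * (1 + p * y) ^ card \<Omega> \<le> exp (- (real j * (y - y\<^sup>2))) * exp (p * y * card \<Omega>)"
    proof (rule mult_mono)
      have "y - y\<^sup>2 \<le> ln z" unfolding z_def using y by (intro ln_one_plus_pos_lower_bound) auto
      then have "real j * (y - y\<^sup>2) \<le> real j * ln z" by (intro mult_left_mono) auto
      moreover have "inverse (z ^ j) = exp (- (real j * ln z))"
        using z by (simp add: exp_minus exp_of_nat_mult)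
      ultimately show "inverse (z ^ j) \<le> exp (- (real j * (y - y\<^sup>2)))" by simp
      have "(1 + p * y) ^ card \<Omega> \<le> exp (p * y) ^ card \<Omega>"
        using py exp_ge_add_one_self[of "p * y"] by (intro power_mono) auto
      also have "\<dots> = exp (p * y * card \<Omega>)" by (simp add: exp_of_nat_mult[symmetric] mult_ac)
      finally show "(1 + p * y) ^ card \<Omega> \<le> exp (p * y * card \<Omega>)" .
    qed (use py in auto)
    \<comment> \<open>The gap \<open>2 * w * sqrt M\<close> gains 2 w^2, and the quadratic loss in
      \<open>ln (1 + y)\<close> is at most y^2 M = w^2.\<close>
    also have "\<dots> \<le> exp (- w\<^sup>2)"
    proof -
      have "y * (j - 2 * w * sqrt M) = y * j - 2 * (y\<^sup>2 * M)"
        using M by (simp add: wy algebra_simps power2_eq_square)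
      then have "y * (p * card \<Omega>) \<le> y * j - 2 * (y\<^sup>2 * M)" using mult_left_mono[OF mean, of y] y by simp
      moreover have "y\<^sup>2 * j \<le> y\<^sup>2 * M" using j by (intro mult_left_mono) auto
      moreover have "w\<^sup>2 = y\<^sup>2 * M" using M by (auto simp: wy power_mult_distrib)
      ultimately have "- (real j * (y - y\<^sup>2)) + p * y * card \<Omega> \<le> - w\<^sup>2"
        by (simp add: algebra_simps power2_eq_square)
      then show ?thesis by (simp add: exp_add[symmetric])
    qed
    finally show "inverse (z ^ j) * (1 + p * y) ^ card \<Omega> \<le> exp (- w\<^sup>2)" .
  qed
  finally show ?thesis unfolding z_def by simp
qed

section \<open>Small values of binomial variables\<close>

lemma BE_card_fun:
  fixes g :: "nat \<Rightarrow> real"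
  assumes "finite A"
  shows "BE A p (\<lambda>S. g (card S)) = (\<Sum>i\<le>card A. real (card A choose i) * p ^ i * (1 - p) ^ (card A - i) * g i)"
proof -
  have "BE A p (\<lambda>S. g (card S)) = BE A p (\<lambda>S. of_bool True * g (card S))" by simp
  also have "\<dots> = (\<Sum>i\<le>card A. real (card A choose i) * p ^ i * (1 - p) ^ (card A - i) * g i * Unif A i (\<lambda>_. True))"
    using BE_by_size_Unif[OF assms, of p "\<lambda>_. True" g] by simp
  also have "\<dots> = (\<Sum>i\<le>card A. real (card A choose i) * p ^ i * (1 - p) ^ (card A - i) * g i)"
    using assms by (intro sum.cong) (auto simp: Unif_True)
  finally show ?thesis .
qed

text \<open>The probability that a binomial variable with parameters \<open>h\<close> and
  \<open>p\<close> is at most 1, hence that an outside vertex violates (iii) when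
  \<open>K - \<Union>M\<close> has \<open>h\<close> elements. For \<open>h = 0\<close> the truncated
  exponent \<open>h - 1\<close> is harmless because of the factor \<open>h\<close>.\<close>

definition qf :: "nat \<Rightarrow> real \<Rightarrow> real" where
  "qf h p = (1 - p) ^ h + real h * p * (1 - p) ^ (h - 1)"

lemma BE_card_le1:
  assumes "finite A"
  shows "BE A p (\<lambda>S. of_bool (card S \<le> 1)) = qf (card A) p"
proof -
  have "BE A p (\<lambda>S. of_bool (card S \<le> 1)) = (\<Sum>i\<le>card A. real (card A choose i) * p ^ i * (1 - p) ^ (card A - i) * of_bool (i \<le> 1))"
    using BE_card_fun[OF assms, of p "\<lambda>i. of_bool (i \<le> 1)"] .
  also have "\<dots> = (\<Sum>i\<in>{0,1}. real (card A choose i) * p ^ i * (1 - p) ^ (card A - i))"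
    by (rule sum.mono_neutral_cong) (auto simp: not_le)
  finally show ?thesis by (simp add: qf_def)
qed

lemma BE_card_ge2:
  assumes "finite A"
  shows "BE A p (\<lambda>S. of_bool (2 \<le> card S)) = 1 - qf (card A) p"
proof -
  have "BE A p (\<lambda>S. of_bool (2 \<le> card S)) = BE A p (\<lambda>S. 1 - of_bool (card S \<le> 1))"
    by (intro BE_cong) auto
  then show ?thesis using assms by (simp only: BE_diff BE_card_le1 BE_const)
qed

lemma BE_card_le2:
  fixes p :: real
  assumes "finite A" "2 \<le> card A" "0 \<le> p" "p \<le> 1"
  shows "BE A p (\<lambda>S. of_bool (card S \<le> 2)) \<le> (1 - p) ^ (card A - 2) * (1 + card A * p + (card A * p)\<^sup>2)"
proof -
  let ?h = "card A"
  have "BE A p (\<lambda>S. of_bool (card S \<le> 2)) = (\<Sum>i\<le>?h. real (?h choose i) * p ^ i * (1 - p) ^ (?h - i) * of_bool (i \<le> 2))"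
    using BE_card_fun[OF assms(1), of p "\<lambda>i. of_bool (i \<le> 2)"] .
  also have "\<dots> = (\<Sum>i\<in>{0,1,2}. real (?h choose i) * p ^ i * (1 - p) ^ (?h - i))"
    using assms(2) by (intro sum.mono_neutral_cong) auto
  also have "\<dots> \<le> (\<Sum>i\<in>{0,1,2}. (?h * p) ^ i * (1 - p) ^ (?h - 2))"
  proof (rule sum_mono)
    fix i :: nat assume i: "i \<in> {0,1,2}"
    have "real (?h choose i) \<le> real (?h ^ i)" using binomial_le_pow2 i assms(2) binomial_le_pow[of i ?h] by (intro of_nat_mono) auto
    then have "real (?h choose i) * p ^ i \<le> (?h * p) ^ i" using assms by (auto simp: power_mult_distrib intro!: mult_right_mono)
    moreover have "(1 - p) ^ (?h - i) \<le> (1 - p) ^ (?h - 2)" using assms i by (intro power_decreasing) auto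
    ultimately show "real (?h choose i) * p ^ i * (1 - p) ^ (?h - i) \<le> (?h * p) ^ i * (1 - p) ^ (?h - 2)"
      using assms by (intro mult_mono) auto
  qed
  also have "\<dots> = (1 - p) ^ (card A - 2) * (1 + card A * p + (card A * p)\<^sup>2)" by (simp add: algebra_simps power2_eq_square)
  finally show ?thesis .
qed

text \<open>Both bounds are proved together: once \<open>x\<close> is chosen, a second element is
  needed only in the sense of the first bound.\<close>

lemma BE_card_ge_small:
  fixes p :: real
  assumes "finite A" "0 \<le> p" "p \<le> 1"
  shows "BE A p (\<lambda>S. of_bool (1 \<le> card S)) \<le> card A * p" "BE A p (\<lambda>S. of_bool (2 \<le> card S)) \<le> (card A * p)\<^sup>2"
proof -
  have "BE A p (\<lambda>S. of_bool (1 \<le> card S)) \<le> card A * p \<and> BE A p (\<lambda>S. of_bool (2 \<le> card S)) \<le> (card A * p)\<^sup>2"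
    using assms(1)
  proof (induction A rule: finite_induct)
    case (insert x A)
    have ins: "card (insert x S) = Suc (card S)" if "S \<subseteq> A" for S
    proof -
      have "x \<notin> S" "finite S" using that insert.hyps finite_subset[of S A] by auto
      then show ?thesis by simp
    qed
    have 1: "BE A p (\<lambda>S. of_bool (1 \<le> card (insert x S))) = BE A p (\<lambda>S. 1)"
      by (intro BE_cong) (auto simp: ins)
    have 2: "BE A p (\<lambda>S. of_bool (2 \<le> card (insert x S))) = BE A p (\<lambda>S. of_bool (1 \<le> card S))"
      by (intro BE_cong) (auto simp: ins)
    let ?a = "BE A p (\<lambda>S. of_bool (1 \<le> card S))" and ?b = "BE A p (\<lambda>S. of_bool (2 \<le> card S))"
    have nn: "0 \<le> ?a" "0 \<le> ?b" using assms by (auto intro!: BE_nonneg)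
    have a: "(1 - p) * ?a \<le> ?a" and b: "(1 - p) * ?b \<le> ?b"
      using nn assms by (simp_all add: algebra_simps)
    have "BE (insert x A) p (\<lambda>S. of_bool (1 \<le> card S)) = p * 1 + (1 - p) * ?a"
      using insert 1 by (simp add: BE_insert)
    also have "\<dots> \<le> card (insert x A) * p" using a insert by (simp add: algebra_simps)
    finally have r1: "BE (insert x A) p (\<lambda>S. of_bool (1 \<le> card S)) \<le> card (insert x A) * p" .
    have "BE (insert x A) p (\<lambda>S. of_bool (2 \<le> card S)) = p * ?a + (1 - p) * ?b"
      using insert 2 by (simp add: BE_insert)
    also have "\<dots> \<le> p * (card A * p) + (card A * p)\<^sup>2"
      using b insert.IH assms by (intro add_mono mult_left_mono) auto
    also have "\<dots> \<le> (card (insert x A) * p)\<^sup>2"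
      using insert.hyps assms by (simp add: power2_eq_square algebra_simps)
    finally show ?case using r1 by simp
  qed simp
  then show "BE A p (\<lambda>S. of_bool (1 \<le> card S)) \<le> card A * p" "BE A p (\<lambda>S. of_bool (2 \<le> card S)) \<le> (card A * p)\<^sup>2" by auto
qed

lemma qf_nonneg: "0 \<le> p \<Longrightarrow> p \<le> 1 \<Longrightarrow> 0 \<le> qf h p"
  by (simp add: qf_def)

lemma qf_le_1: "0 \<le> p \<Longrightarrow> p \<le> 1 \<Longrightarrow> qf h p \<le> 1"
  using BE_card_le1[of "{..<h}" p] BE_of_bool_le_1[of "{..<h}" p "\<lambda>S. card S \<le> 1"] by simp

text \<open>Coupling: the restriction of a random subset of \<open>{..<h'}\<close> to
  \<open>{..<h}\<close> is never larger than the set itself.\<close>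

lemma qf_antimono_h:
  fixes p :: real
  assumes "h \<le> h'" "0 \<le> p" "p \<le> 1"
  shows "qf h' p \<le> qf h p"
proof -
  have "qf h' p = BE {..<h'} p (\<lambda>S. of_bool (card S \<le> 1))" by (simp add: BE_card_le1[simplified])
  also have "\<dots> \<le> BE {..<h'} p (\<lambda>S. of_bool (card (S \<inter> {..<h}) \<le> 1))"
  proof (rule BE_mono[OF assms(2,3)])
    fix S assume "S \<subseteq> {..<h'}"
    then have "card (S \<inter> {..<h}) \<le> card S" by (intro card_mono finite_subset[of S]) auto
    then show "of_bool (card S \<le> 1) \<le> (of_bool (card (S \<inter> {..<h}) \<le> 1) :: real)" by auto
  qed
  also have "\<dots> = qf h p" using assms by (subst BE_restrict[where f = "\<lambda>S. of_bool (card S \<le> 1)"]) (auto simp: BE_card_le1[simplified])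
  finally show ?thesis .
qed

text \<open>The two terms of \<open>qf\<close> have derivatives that nearly cancel, which leaves -h
  (h - 1) p (1 - p)^(h - 2). The mean value theorem then yields a bound that keeps the exponentially
  small factor; the cost of passing between the two sandwiching densities is estimated through
  it.\<close>

lemma qf_lipschitz:
  fixes p1 p2 :: real
  assumes "2 \<le> h" "0 \<le> p1" "p1 \<le> p2" "p2 \<le> 1"
  shows "qf h p2 \<le> qf h p1" "qf h p1 - qf h p2 \<le> (p2 - p1) * (real h ^ 2 * p2 * (1 - p1) ^ (h - 2))"
proof -
  have "qf h p2 \<le> qf h p1 \<and> qf h p1 - qf h p2 \<le> (p2 - p1) * (real h ^ 2 * p2 * (1 - p1) ^ (h - 2))"
  proof (cases "p1 = p2")
    case False
    then have lt: "p1 < p2" using assms by simp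
    let ?d = "\<lambda>p. - (real h * (real h - 1) * p * (1 - p) ^ (h - 2))"
    have "(qf h has_real_derivative ?d p) (at p)" for p
    proof -
      have e: "(1 - p) ^ (h - Suc 0) = (1 - p) * (1 - p) ^ (h - 2)"
        using assms(1) by (metis One_nat_def Suc_diff_Suc Suc_1 less_eq_Suc_le power_Suc)
      show ?thesis unfolding qf_def[abs_def]
        by (rule derivative_eq_intros refl)+ (use assms(1) in \<open>simp add: e of_nat_diff diff_diff_eq numeral_2_eq_2 algebra_simps\<close>)
    qed
    from MVT2[OF lt, of "qf h" ?d] this obtain z where z: "p1 < z" "z < p2" "qf h p2 - qf h p1 = (p2 - p1) * ?d z" by auto
    have d1: "0 \<le> real h * (real h - 1) * z * (1 - z) ^ (h - 2)" using z assms by auto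
    have "real h * (real h - 1) * z * (1 - z) ^ (h - 2) \<le> real h ^ 2 * p2 * (1 - p1) ^ (h - 2)"
      using z assms by (intro mult_mono power_mono) (auto simp: power2_eq_square algebra_simps)
    then have "(p2 - p1) * (real h * (real h - 1) * z * (1 - z) ^ (h - 2)) \<le> (p2 - p1) * (real h ^ 2 * p2 * (1 - p1) ^ (h - 2))"
      using lt by (intro mult_left_mono) auto
    moreover have "0 \<le> (p2 - p1) * (real h * (real h - 1) * z * (1 - z) ^ (h - 2))" using d1 lt by auto
    ultimately show ?thesis using z(3) by (auto simp: algebra_simps)
  qed (use assms in auto)
  then show "qf h p2 \<le> qf h p1" "qf h p1 - qf h p2 \<le> (p2 - p1) * (real h ^ 2 * p2 * (1 - p1) ^ (h - 2))" by auto
qed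

lemma BE_ball_prod:
  fixes p :: real
  assumes "finite \<Omega>" "finite V" "\<And>v. v \<in> V \<Longrightarrow> A v \<subseteq> \<Omega>"
    "\<And>v w. v \<in> V \<Longrightarrow> w \<in> V \<Longrightarrow> v \<noteq> w \<Longrightarrow> A v \<inter> A w = {}"
  shows "BE \<Omega> p (\<lambda>S. of_bool (\<forall>v\<in>V. P v (S \<inter> A v))) = (\<Prod>v\<in>V. BE (A v) p (\<lambda>S. of_bool (P v S)))"
proof -
  have "of_bool (\<forall>v\<in>V. Q v) = (\<Prod>v\<in>V. of_bool (Q v) :: real)" for Q
    using assms(2) by (induction V rule: finite_induct) auto
  then show ?thesis using BE_prod[OF assms, where p = p and g = "\<lambda>v S. of_bool (P v S)"] by simp
qed

text \<open>A positively correlated upper bound: both the row and the column events are increasing,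
  so independence fails in the unfavourable direction.  Adding the columns one at a time, Harris'
  inequality shows that each new column still fails with almost its unconditional probability.\<close>

lemma bipartite_min_degree:
  fixes p :: real
  assumes fin: "finite \<Omega>" "finite W" "finite V" and p: "0 \<le> p" "p \<le> 1"
    and A: "\<And>w. w \<in> W \<Longrightarrow> A w \<subseteq> \<Omega>" "\<And>w w'. w \<in> W \<Longrightarrow> w' \<in> W \<Longrightarrow> w \<noteq> w' \<Longrightarrow> A w \<inter> A w' = {}"
      "\<And>w. w \<in> W \<Longrightarrow> card (A w) = a"
    and B: "\<And>v. v \<in> V \<Longrightarrow> B v \<subseteq> \<Omega>" "\<And>v v'. v \<in> V \<Longrightarrow> v' \<in> V \<Longrightarrow> v \<noteq> v' \<Longrightarrow> B v \<inter> B v' = {}"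
      "\<And>v. v \<in> V \<Longrightarrow> card (B v) = b"
    and AB: "\<And>w v. w \<in> W \<Longrightarrow> v \<in> V \<Longrightarrow> card (A w \<inter> B v) \<le> 1"
    and qa: "qf a p < 1"
  shows "BE \<Omega> p (\<lambda>S. of_bool ((\<forall>w\<in>W. 2 \<le> card (S \<inter> A w)) \<and> (\<forall>v\<in>V. 2 \<le> card (S \<inter> B v))))
    \<le> (1 - qf a p) ^ card W * (1 - qf b p * (1 - card W * p * qf (a - 1) p / (1 - qf a p))) ^ card V"
  using fin(3) B AB
proof (induction V rule: finite_induct)
  case empty
  have "BE \<Omega> p (\<lambda>S. of_bool (\<forall>w\<in>W. 2 \<le> card (S \<inter> A w))) = (\<Prod>w\<in>W. BE (A w) p (\<lambda>S. of_bool (2 \<le> card S)))"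
    by (rule BE_ball_prod[OF fin(1,2), of A p "\<lambda>_ S. 2 \<le> card S"]) (use A in auto)
  also have "\<dots> = (\<Prod>w\<in>W. 1 - qf a p)"
  proof (rule prod.cong[OF refl])
    fix w assume w: "w \<in> W"
    then have "finite (A w)" using A(1) fin(1) finite_subset by blast
    then show "BE (A w) p (\<lambda>S. of_bool (2 \<le> card S)) = 1 - qf a p" using A(3)[OF w] by (simp add: BE_card_ge2)
  qed
  finally show ?case by simp
next
  case (insert v V)
  have finS: "finite S" if "S \<subseteq> \<Omega>" for S using that fin(1) finite_subset by blast
  define R where "R X S = (\<forall>w\<in>X. 2 \<le> card (S \<inter> A w))" for X S
  \<comment> \<open>The row conditions with all coordinates of column \<open>v\<close> deleted,
    hence independent of that column.\<close>
  define R' where "R' S = (\<forall>w\<in>W. 2 \<le> card (S \<inter> (A w - B v)))" for S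
  define C where "C S = (\<forall>v\<in>V. 2 \<le> card (S \<inter> B v))" for S
  define f where "f = BE \<Omega> p (\<lambda>S. of_bool (R W S \<and> C S))"
  let ?q = "qf a p" and ?q' = "qf (a - 1) p" and ?qb = "qf b p"
  let ?eta = "card W * p * ?q' / (1 - ?q)"
  have Bv: "B v \<subseteq> \<Omega>" using insert by auto
  have R'R: "R W S" if "R' S" "S \<subseteq> \<Omega>" for S
    unfolding R_def
  proof
    fix w assume "w \<in> W"
    then have "2 \<le> card (S \<inter> (A w - B v))" using that unfolding R'_def by auto
    also have "\<dots> \<le> card (S \<inter> A w)" using finS[OF that(2)] by (intro card_mono) auto
    finally show "2 \<le> card (S \<inter> A w)" .
  qed
  have Bdisj: "B v' \<inter> B v = {}" if "v' \<in> V" for v' using insert.prems(2)[of v' v] insert.hyps that by auto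
  have C_dep: "C S = C (S \<inter> X)" if "\<And>v'. v' \<in> V \<Longrightarrow> B v' \<subseteq> X" for S X
  proof -
    have "S \<inter> X \<inter> B v' = S \<inter> B v'" if "v' \<in> V" for v' using \<open>\<And>v'. v' \<in> V \<Longrightarrow> B v' \<subseteq> X\<close>[OF that] by auto
    then show ?thesis unfolding C_def by auto
  qed
  have B_sub: "B v' \<subseteq> \<Omega> - B v" if "v' \<in> V" for v' using Bdisj[OF that] insert.prems(1)[of v'] that by auto
  have incrC: "C T" if "C S" "S \<subseteq> T" "T \<subseteq> \<Omega>" for S T
    unfolding C_def
  proof
    fix v' assume "v' \<in> V"
    then have "2 \<le> card (S \<inter> B v')" using that unfolding C_def by auto
    also have "\<dots> \<le> card (T \<inter> B v')" using finS[OF that(3)] that by (intro card_mono) auto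
    finally show "2 \<le> card (T \<inter> B v')" .
  qed
  have incrR: "R X T" if "R X S" "S \<subseteq> T" "T \<subseteq> \<Omega>" for X S T
    unfolding R_def
  proof
    fix w assume "w \<in> X"
    then have "2 \<le> card (S \<inter> A w)" using that unfolding R_def by auto
    also have "\<dots> \<le> card (T \<inter> A w)" using finS[OF that(3)] that by (intro card_mono) auto
    finally show "2 \<le> card (T \<inter> A w)" .
  qed
  have fail: "BE \<Omega> p (\<lambda>S. of_bool (card (S \<inter> X) \<le> 1)) = qf (card X) p" if "X \<subseteq> \<Omega>" for X
    using BE_restrict[OF fin(1) that, of p "\<lambda>S. of_bool (card S \<le> 1)"] finS[OF that] by (simp add: BE_card_le1[simplified])
  \<comment> \<open>If the rows survive with column \<open>v\<close> but not without it, some row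
    \<open>w\<close> has its element of \<open>A w \<inter> B v\<close> present and at most one
    other element. The shared coordinate contributes \<open>p\<close>, Harris contributes
    \<open>qf (a - 1) p\<close> for the deficient row, and division by \<open>1 - qf a p\<close>
    puts row \<open>w\<close> back among the satisfied rows. Summing over \<open>W\<close> gives
    \<open>?eta\<close>.\<close>
  have Q': "BE \<Omega> p (\<lambda>S. of_bool (R' S \<and> C S)) \<ge> (1 - ?eta) * f"
  proof -
    have "f - BE \<Omega> p (\<lambda>S. of_bool (R' S \<and> C S)) = BE \<Omega> p (\<lambda>S. of_bool (R W S \<and> C S) - of_bool (R' S \<and> C S))"
      unfolding f_def by (simp add: BE_diff)
    also have "\<dots> \<le> BE \<Omega> p (\<lambda>S. \<Sum>w\<in>W. of_bool (S \<inter> (A w \<inter> B v) \<noteq> {}) * of_bool (R (W - {w}) S \<and> C S \<and> card (S \<inter> (A w - B v)) \<le> 1))"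
    proof (rule BE_mono[OF p])
      fix S assume S: "S \<subseteq> \<Omega>"
      let ?t = "\<lambda>w. of_bool (S \<inter> (A w \<inter> B v) \<noteq> {}) * of_bool (R (W - {w}) S \<and> C S \<and> card (S \<inter> (A w - B v)) \<le> 1) :: real"
      show "of_bool (R W S \<and> C S) - of_bool (R' S \<and> C S) \<le> (\<Sum>w\<in>W. ?t w)"
      proof (cases "R W S \<and> C S \<and> \<not> R' S")
        case True
        then obtain w where w: "w \<in> W" "card (S \<inter> (A w - B v)) \<le> 1" unfolding R'_def by force
        have "S \<inter> (A w \<inter> B v) \<noteq> {}"
        proof
          assume "S \<inter> (A w \<inter> B v) = {}"
          then have "S \<inter> (A w - B v) = S \<inter> A w" by auto
          then show False using w True unfolding R_def by force
        qed
        then have "1 = ?t w" using True w unfolding R_def by auto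
        also have "\<dots> \<le> (\<Sum>w\<in>W. ?t w)" using fin(2) w by (intro member_le_sum) auto
        finally show ?thesis using True by simp
      next
        case False
        have "0 \<le> (\<Sum>w\<in>W. ?t w)" by (intro sum_nonneg) auto
        then show ?thesis using False R'R[OF _ S] by auto
      qed
    qed
    also have "\<dots> = (\<Sum>w\<in>W. BE \<Omega> p (\<lambda>S. of_bool (S \<inter> (A w \<inter> B v) \<noteq> {}) * of_bool (R (W - {w}) S \<and> C S \<and> card (S \<inter> (A w - B v)) \<le> 1)))"
      by (rule BE_sum)
    also have "\<dots> \<le> (\<Sum>w\<in>W. p * ?q' / (1 - ?q) * f)"
    proof (rule sum_mono)
      fix w assume w: "w \<in> W"
      let ?D = "A w \<inter> B v"
      define G where "G = BE \<Omega> p (\<lambda>S. of_bool (R (W - {w}) S \<and> C S))"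
      have G0: "0 \<le> G" unfolding G_def using p by (intro BE_nonneg) auto
      have Aw: "A w \<subseteq> \<Omega>" using A w by auto
      have A_sub: "A w' \<subseteq> \<Omega> - ?D" if "w' \<in> W - {w}" for w' using A(1)[of w'] A(2)[of w' w] that w by auto
      have 1: "BE \<Omega> p (\<lambda>S. of_bool (S \<inter> ?D \<noteq> {}) * of_bool (R (W - {w}) S \<and> C S \<and> card (S \<inter> (A w - B v)) \<le> 1))
        = BE \<Omega> p (\<lambda>S. of_bool (S \<inter> ?D \<noteq> {})) * BE \<Omega> p (\<lambda>S. of_bool (R (W - {w}) S \<and> C S \<and> card (S \<inter> (A w - B v)) \<le> 1))"
      proof (rule BE_split_indep[OF fin(1), of ?D "\<Omega> - ?D"])
        fix S assume "S \<subseteq> \<Omega>"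
        have "R (W - {w}) S = R (W - {w}) (S \<inter> (\<Omega> - ?D))"
        proof -
          have "S \<inter> (\<Omega> - ?D) \<inter> A w' = S \<inter> A w'" if "w' \<in> W - {w}" for w' using A_sub[OF that] by auto
          then show ?thesis unfolding R_def by auto
        qed
        moreover have "C S = C (S \<inter> (\<Omega> - ?D))" using B_sub by (intro C_dep) blast
        moreover have "S \<inter> (A w - B v) = S \<inter> (\<Omega> - ?D) \<inter> (A w - B v)" using Aw by auto
        ultimately show "of_bool (R (W - {w}) S \<and> C S \<and> card (S \<inter> (A w - B v)) \<le> 1) =
          (of_bool (R (W - {w}) (S \<inter> (\<Omega> - ?D)) \<and> C (S \<inter> (\<Omega> - ?D)) \<and> card (S \<inter> (\<Omega> - ?D) \<inter> (A w - B v)) \<le> 1) :: real)"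
          by simp
      qed (use Aw in \<open>auto simp: Int_assoc\<close>)
      have 2: "BE \<Omega> p (\<lambda>S. of_bool (S \<inter> ?D \<noteq> {})) \<le> p"
      proof -
        have "BE \<Omega> p (\<lambda>S. of_bool (S \<inter> ?D \<noteq> {})) = BE ?D p (\<lambda>S. of_bool (S \<noteq> {}))"
          using BE_restrict[OF fin(1), of ?D p "\<lambda>S. of_bool (S \<noteq> {})"] Aw by auto
        also have "\<dots> = BE ?D p (\<lambda>S. of_bool (1 \<le> card S))"
        proof (rule BE_cong)
          fix S assume "S \<subseteq> ?D"
          then have "finite S" using Aw finS by blast
          then show "of_bool (S \<noteq> {}) = (of_bool (1 \<le> card S) :: real)" using card_gt_0_iff[of S] by auto
        qed
        also have "\<dots> \<le> card ?D * p" using p finS[of ?D] Aw by (intro BE_card_ge_small) auto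
        also have "\<dots> \<le> 1 * p" using insert.prems(4)[OF w, of v] p by (intro mult_right_mono) auto
        finally show ?thesis by simp
      qed
      have 3: "BE \<Omega> p (\<lambda>S. of_bool (R (W - {w}) S \<and> C S \<and> card (S \<inter> (A w - B v)) \<le> 1)) \<le> G * ?q'"
      proof -
        have "BE \<Omega> p (\<lambda>S. of_bool (R (W - {w}) S \<and> C S \<and> card (S \<inter> (A w - B v)) \<le> 1))
          = BE \<Omega> p (\<lambda>S. of_bool (R (W - {w}) S \<and> C S) * of_bool (card (S \<inter> (A w - B v)) \<le> 1))"
          by (intro BE_cong) auto
        also have "\<dots> \<le> G * BE \<Omega> p (\<lambda>S. of_bool (card (S \<inter> (A w - B v)) \<le> 1))"
          unfolding G_def
        proof (rule harris_neg[OF fin(1) p])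
          fix S T assume ST: "S \<subseteq> T" "T \<subseteq> \<Omega>"
          show "of_bool (R (W - {w}) S \<and> C S) \<le> (of_bool (R (W - {w}) T \<and> C T) :: real)"
            using incrR[OF _ ST] incrC[OF _ ST] by auto
          have "card (S \<inter> (A w - B v)) \<le> card (T \<inter> (A w - B v))" using ST finS by (intro card_mono) auto
          then show "of_bool (card (T \<inter> (A w - B v)) \<le> 1) \<le> (of_bool (card (S \<inter> (A w - B v)) \<le> 1) :: real)" by auto
        qed
        also have "BE \<Omega> p (\<lambda>S. of_bool (card (S \<inter> (A w - B v)) \<le> 1)) = qf (card (A w - B v)) p"
          using Aw by (intro fail) auto
        also have "G * qf (card (A w - B v)) p \<le> G * ?q'"
        proof (rule mult_left_mono[OF qf_antimono_h[OF _ p] G0])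
          have "card (A w) = card (A w - B v) + card ?D" using finS[OF Aw] by (metis card_Diff_subset_Int card_mono finite_Int inf_le1 le_add_diff_inverse2)
          then show "a - 1 \<le> card (A w - B v)" using A(3)[OF w] insert.prems(4)[OF w, of v] by auto
        qed
        finally show ?thesis .
      qed
      have 4: "G * (1 - ?q) \<le> f"
      proof -
        have "G * (1 - ?q) = G * BE \<Omega> p (\<lambda>S. of_bool (2 \<le> card (S \<inter> A w)))"
          using BE_restrict[OF fin(1) Aw, of p "\<lambda>S. of_bool (2 \<le> card S)"] BE_card_ge2[of "A w" p] finS[OF Aw] A(3)[OF w] by simp
        also have "\<dots> \<le> BE \<Omega> p (\<lambda>S. of_bool (R (W - {w}) S \<and> C S) * of_bool (2 \<le> card (S \<inter> A w)))"
          unfolding G_def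
        proof (rule harris[OF fin(1) p])
          fix S T assume ST: "S \<subseteq> T" "T \<subseteq> \<Omega>"
          show "of_bool (R (W - {w}) S \<and> C S) \<le> (of_bool (R (W - {w}) T \<and> C T) :: real)"
            using incrR[OF _ ST] incrC[OF _ ST] by auto
          have "card (S \<inter> A w) \<le> card (T \<inter> A w)" using ST finS by (intro card_mono) auto
          then show "of_bool (2 \<le> card (S \<inter> A w)) \<le> (of_bool (2 \<le> card (T \<inter> A w)) :: real)" by auto
        qed
        also have "\<dots> = f" unfolding f_def R_def using w by (intro BE_cong) auto
        finally show ?thesis .
      qed
      have "BE \<Omega> p (\<lambda>S. of_bool (S \<inter> ?D \<noteq> {})) * BE \<Omega> p (\<lambda>S. of_bool (R (W - {w}) S \<and> C S \<and> card (S \<inter> (A w - B v)) \<le> 1)) \<le> p * (G * ?q')"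
        using 2 3 p by (intro mult_mono BE_nonneg) auto
      also have "\<dots> \<le> p * (f / (1 - ?q) * ?q')"
        using 4 qa p qf_nonneg[OF p] by (intro mult_left_mono mult_right_mono) (auto simp: field_simps)
      also have "\<dots> = p * ?q' / (1 - ?q) * f" by simp
      finally show "BE \<Omega> p (\<lambda>S. of_bool (S \<inter> ?D \<noteq> {}) * of_bool (R (W - {w}) S \<and> C S \<and> card (S \<inter> (A w - B v)) \<le> 1)) \<le> p * ?q' / (1 - ?q) * f"
        unfolding 1 .
    qed
    also have "\<dots> = ?eta * f" by simp
    finally show ?thesis by (simp add: algebra_simps)
  qed
  have "BE \<Omega> p (\<lambda>S. of_bool ((\<forall>w\<in>W. 2 \<le> card (S \<inter> A w)) \<and> (\<forall>v\<in>insert v V. 2 \<le> card (S \<inter> B v))))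
      = BE \<Omega> p (\<lambda>S. of_bool (R W S \<and> C S) - of_bool (R W S \<and> C S) * of_bool (card (S \<inter> B v) \<le> 1))"
    unfolding R_def C_def by (intro BE_cong) auto
  also have "\<dots> = f - BE \<Omega> p (\<lambda>S. of_bool (R W S \<and> C S) * of_bool (card (S \<inter> B v) \<le> 1))"
    unfolding f_def by (rule BE_diff)
  \<comment> \<open>A smaller event is subtracted, namely \<open>R'\<close> in place of
    \<open>R\<close>. In exchange the failure of column \<open>v\<close> becomes independent of
    it.\<close>
  also have "\<dots> \<le> f - BE \<Omega> p (\<lambda>S. of_bool (R' S \<and> C S) * of_bool (card (S \<inter> B v) \<le> 1))"
    using R'R p by (intro diff_left_mono BE_mono) auto
  also have "BE \<Omega> p (\<lambda>S. of_bool (R' S \<and> C S) * of_bool (card (S \<inter> B v) \<le> 1))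
      = BE \<Omega> p (\<lambda>S. of_bool (R' S \<and> C S)) * BE \<Omega> p (\<lambda>S. of_bool (card (S \<inter> B v) \<le> 1))"
  proof (rule BE_split_indep[OF fin(1), of "\<Omega> - B v" "B v"])
    fix S assume S: "S \<subseteq> \<Omega>"
    have "S \<inter> (A w - B v) = S \<inter> (\<Omega> - B v) \<inter> (A w - B v)" for w using S by auto
    moreover have "C S = C (S \<inter> (\<Omega> - B v))" using B_sub by (intro C_dep) blast
    ultimately show "of_bool (R' S \<and> C S) = (of_bool (R' (S \<inter> (\<Omega> - B v)) \<and> C (S \<inter> (\<Omega> - B v))) :: real)"
      unfolding R'_def by simp
  qed (use Bv in auto)
  also have "BE \<Omega> p (\<lambda>S. of_bool (card (S \<inter> B v) \<le> 1)) = ?qb" using fail[OF Bv] insert.prems(3) by simp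
  also have "f - BE \<Omega> p (\<lambda>S. of_bool (R' S \<and> C S)) * ?qb \<le> f - (1 - ?eta) * f * ?qb"
    using Q' qf_nonneg[OF p] by (intro diff_left_mono mult_right_mono) auto
  also have "\<dots> = f * (1 - ?qb * (1 - ?eta))" by (simp add: algebra_simps)
  also have "\<dots> \<le> ((1 - ?q) ^ card W * (1 - ?qb * (1 - ?eta)) ^ card V) * (1 - ?qb * (1 - ?eta))"
  proof (rule mult_right_mono)
    show "f \<le> (1 - ?q) ^ card W * (1 - ?qb * (1 - ?eta)) ^ card V"
      unfolding f_def R_def C_def using insert.prems by (intro insert.IH) auto
    have "0 \<le> ?eta" using p qa qf_nonneg[OF p] by auto
    then have "?qb * (1 - ?eta) \<le> ?qb * 1" using qf_nonneg[OF p] by (intro mult_left_mono) auto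
    also have "\<dots> \<le> 1" using qf_le_1[OF p] by simp
    finally show "0 \<le> 1 - ?qb * (1 - ?eta)" by simp
  qed
  also have "\<dots> = (1 - ?q) ^ card W * (1 - ?qb * (1 - ?eta)) ^ card (insert v V)"
    using insert.hyps by (simp add: mult_ac)
  finally show ?case .
qed

section \<open>Ratios of binomial coefficients\<close>

text \<open>For \<open>N = n choose 2\<close>, \<open>a \<le> m\<close> and
  \<open>a + b \<le> N\<close> this is the probability that a uniform graph with \<open>m\<close>
  edges contains \<open>a\<close> prescribed pairs and avoids \<open>b\<close> other prescribed
  pairs.\<close>

definition cc :: "nat \<Rightarrow> nat \<Rightarrow> nat \<Rightarrow> nat \<Rightarrow> real" where
  "cc N m a b = real ((N - a - b) choose (m - a)) / real (N choose m)"

lemma cc_nonneg: "0 \<le> cc N m a b"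
  by (simp add: cc_def)

lemma cc_0_0: "m \<le> N \<Longrightarrow> cc N m 0 0 = 1"
  by (simp add: cc_def)

lemma cc_Suc_b:
  assumes "a \<le> m" "m + b \<le> N" "a + b < N"
  shows "cc N m a (Suc b) = cc N m a b * ((real N - m - b) / (real N - a - b))"
proof -
  define n where "n = N - a - b"
  define k where "k = m - a"
  have n: "n > 0" "k \<le> n" using assms by (auto simp: n_def k_def)
  have "(n - k) * (n choose k) = n * ((n - 1) choose k)"
    using binomial_absorb_comp[of n k] by simp
  then have "real (n - k) * real (n choose k) = real n * real ((n - 1) choose k)"
    by (metis of_nat_mult)
  moreover have "real (n - k) = real N - m - b" "real n = real N - a - b"
    using assms by (auto simp: n_def k_def of_nat_diff)
  ultimately have "real ((n - 1) choose k) = real (n choose k) * ((real N - m - b) / (real N - a - b))"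
    using n by (simp add: field_simps)
  then have "real ((n - 1) choose k) / Z = real (n choose k) / Z * ((real N - m - b) / (real N - a - b))" for Z :: real
    by simp
  moreover have "N - a - Suc b = n - 1" by (simp add: n_def)
  ultimately show ?thesis unfolding cc_def n_def[symmetric] k_def[symmetric] by simp
qed

lemma cc_Suc_a:
  assumes "a < m" "m + b \<le> N"
  shows "cc N m (Suc a) b = cc N m a b * ((real m - a) / (real N - a - b))"
proof -
  define n where "n = N - a - b"
  define k where "k = m - a"
  have n: "n > 0" "k > 0" using assms by (auto simp: n_def k_def)
  have "k * (n choose k) = n * ((n - 1) choose (k - 1))"
    using n times_binomial_minus1_eq[of k n] by simp
  then have "real k * real (n choose k) = real n * real ((n - 1) choose (k - 1))"
    by (metis of_nat_mult)
  moreover have "real k = real m - a" "real n = real N - a - b"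
    using assms by (auto simp: n_def k_def of_nat_diff)
  ultimately have "real ((n - 1) choose (k - 1)) = real (n choose k) * ((real m - a) / (real N - a - b))"
    using n by (simp add: field_simps)
  then have "real ((n - 1) choose (k - 1)) / Z = real (n choose k) / Z * ((real m - a) / (real N - a - b))" for Z :: real
    by simp
  moreover have "N - Suc a - b = n - 1" "m - Suc a = k - 1" by (auto simp: n_def k_def)
  ultimately show ?thesis unfolding cc_def n_def[symmetric] k_def[symmetric] by simp
qed

lemma cc_prod:
  assumes "a \<le> m" "m + b \<le> N"
  shows "cc N m a b = (\<Prod>t<a. (real m - real t) / (real N - real t)) * (\<Prod>t<b. (real N - m - real t) / (real N - a - real t))"
proof -
  have 1: "cc N m a 0 = (\<Prod>t<a. (real m - real t) / (real N - real t))"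
    using assms(1)
  proof (induction a)
    case (Suc a)
    then show ?case using assms(2) cc_Suc_a[of a m 0 N] by simp
  qed (use assms in \<open>auto simp: cc_0_0\<close>)
  show ?thesis
    using assms(2)
  proof (induction b)
    case (Suc b)
    then show ?case using assms(1) cc_Suc_b[of a m b N] by simp
  qed (simp add: 1)
qed

text \<open>The price of a second configuration on top of a first: each of \<open>u\<close> new
  matching edges costs at most 2 p, the factor 2 covering the shrinking denominator, and each of
  \<open>x\<close> new non-edges costs at most exp (- (p - 2 r' / N)), since at most 2 r' of the
  edges are already placed.\<close>

lemma cc_add_upper:
  fixes r' :: nat and p :: real
  assumes "r + u \<le> m" "m + f + x \<le> N" "2 * (r + u + f) \<le> N" "r + u \<le> 2 * r'" "0 < N" "0 < m"
    and p: "p = real m / real N"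
  shows "cc N m (r + u) (f + x) \<le> cc N m r f * (2 * p) ^ u * exp (- (real x * (p - 2 * r' / N)))"
proof -
  have 1: "cc N m (r + u) f \<le> cc N m r f * (2 * p) ^ u"
    using assms(1,3)
  proof (induction u)
    case (Suc u)
    have "cc N m (r + Suc u) f = cc N m (r + u) f * ((real m - (r + u)) / (real N - (r + u) - f))"
      using cc_Suc_a[of "r + u" m f N] Suc.prems assms(2) by simp
    also have "\<dots> \<le> cc N m (r + u) f * (real m / (real N / 2))"
    proof (intro mult_left_mono cc_nonneg frac_le)
      have "2 * (real r + real u + real f) \<le> real N" using Suc.prems
      proof -
        have "real (2 * (r + u + f)) \<le> real N" using Suc.prems unfolding of_nat_le_iff by simp
        then show ?thesis by simp
      qed
      then show "real N / 2 \<le> real N - (r + u) - f" by simp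
    qed (use assms in auto)
    also have "\<dots> = cc N m (r + u) f * (2 * p)" by (simp add: p)
    also have "cc N m (r + u) f * (2 * p) \<le> cc N m r f * (2 * p) ^ u * (2 * p)"
      using Suc p by (intro mult_right_mono) auto
    finally show ?case by (simp add: mult_ac)
  qed simp
  define c where "c = p - 2 * real r' / real N"
  have 2: "cc N m (r + u) (f + x) \<le> cc N m (r + u) f * exp (- (real x * c))"
    using assms(2)
  proof (induction x)
    case (Suc x)
    let ?a = "r + u"
    let ?b = "f + x"
    have lt: "?a + ?b < N" using Suc.prems assms(1) by simp
    have lt': "real ?a + real ?b < real N" using lt by linarith
    have ma: "real ?a \<le> real m" using assms(1) by linarith
    have ra: "real ?a \<le> 2 * real r'" using assms(4) by linarith
    have "cc N m ?a (Suc ?b) = cc N m ?a ?b * ((real N - m - ?b) / (real N - ?a - ?b))"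
      using cc_Suc_b[of ?a m ?b N] Suc.prems assms(1) lt by simp
    also have "(real N - m - ?b) / (real N - ?a - ?b) = 1 - (real m - ?a) / (real N - ?a - ?b)"
      using lt' by (simp add: field_simps)
    also have "\<dots> \<le> 1 - (real m - ?a) / real N"
      using lt' ma by (intro diff_left_mono frac_le) auto
    also have "\<dots> \<le> 1 - c"
    proof -
      have "real m - 2 * real r' \<le> real m - real ?a" using ra by simp
      then have "(real m - 2 * real r') / N \<le> (real m - real ?a) / N" by (intro divide_right_mono) auto
      then show ?thesis by (simp add: c_def p diff_divide_distrib)
    qed
    also have "\<dots> \<le> exp (- c)" using exp_ge_add_one_self[of "- c"] by linarith
    finally have "cc N m ?a (Suc ?b) \<le> cc N m ?a ?b * exp (- c)"
      by (simp add: cc_nonneg mult_left_mono)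
    also have "\<dots> \<le> cc N m (r + u) f * exp (- (real x * c)) * exp (- c)"
      using Suc by (intro mult_right_mono) auto
    also have "\<dots> = cc N m (r + u) f * exp (- (real (Suc x) * c))"
      by (simp add: exp_add[symmetric] algebra_simps)
    finally show ?case by simp
  qed simp
  have "cc N m (r + u) (f + x) \<le> cc N m r f * (2 * p) ^ u * exp (- (real x * c))"
    by (rule order_trans[OF 2 mult_right_mono[OF 1]]) simp
  then show ?thesis by (simp add: c_def)
qed

lemma cc_0_upper:
  assumes "m \<le> N" "0 < N"
  shows "cc N m 0 b \<le> (1 - real m / N) ^ b"
proof (induction b)
  case (Suc b)
  show ?case
  proof (cases "m + b < N")
    case True
    have "cc N m 0 (Suc b) = cc N m 0 b * ((real N - m - b) / (real N - b))"
      using cc_Suc_b[of 0 m b N] True by simp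
    also have "\<dots> \<le> (1 - real m / N) ^ b * (1 - real m / N)"
    proof (rule mult_mono)
      have "(real N - m - b) / (real N - b) = 1 - real m / (real N - b)" using True by (simp add: field_simps)
      also have "\<dots> \<le> 1 - real m / N" using True by (intro diff_left_mono frac_le) auto
      finally show "(real N - m - b) / (real N - b) \<le> 1 - real m / N" .
    qed (use Suc assms True in \<open>auto simp: field_simps\<close>)
    finally show ?thesis by (simp add: mult_ac)
  next
    case False
    show ?thesis
    proof (cases "m = 0")
      case True
      then show ?thesis by (simp add: cc_def)
    next
      case False
      then have "N - Suc b < m" using \<open>\<not> m + b < N\<close> assms by auto
      then have "cc N m 0 (Suc b) = 0" by (simp add: cc_def binomial_eq_0)
      moreover have "0 \<le> (1 - real m / N) ^ Suc b" using assms by (intro zero_le_power) (simp add: field_simps)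
      ultimately show ?thesis by simp
    qed
  qed
qed (use assms in \<open>simp add: cc_0_0\<close>)

lemma frac_le_cross:
  fixes a b c d :: real
  assumes "0 < c" "0 < d" "a * d \<le> b * c"
  shows "a / c \<le> b / d"
  using assms by (simp add: field_simps)

lemma prod_double:
  fixes h :: "nat \<Rightarrow> real"
  shows "(\<Prod>t<2 * a. h t) = (\<Prod>t<a. h t * h (a + t))"
proof -
  have "(\<Prod>t<a + b. h t) = (\<Prod>t<a. h t) * (\<Prod>t<b. h (a + t))" for b
    by (induction b) (auto simp: mult_ac)
  from this[of a] show ?thesis by (simp add: prod.distrib mult_2)
qed

text \<open>Compares the joint requirement with the square of the single one. Each of
  \<open>j\<close> common edges saves at most 2 / p, each of \<open>g\<close> common non-edges at
  most exp (m / (N - m - 2 f)). The negative term must be kept: with f about \<kappa>^2 / 2 and N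
  about n^2 / 2 it is close to p \<mu>^2 / 2, and it cancels the contribution of the common
  non-edges at the mean overlap \<mu>.\<close>

lemma cc_joint_ratio:
  assumes jr: "j \<le> r" and gf: "g \<le> f" and rm: "4 * r \<le> m" and fN: "m + 2 * f < N"
    and m0: "0 < m"
    and p: "p = real m / real N"
  shows "cc N m (2 * r - j) (2 * f - g) \<le> (cc N m r f)\<^sup>2 * (2 / p) ^ j *
    exp (2 * r * f / (real N - 2 * r - f) + g * (m / (real N - m - 2 * f)) - (real f)\<^sup>2 * (real m - 2 * r) / (real N)\<^sup>2)"
proof -
  define P1 where "P1 a = (\<Prod>t<a. (real m - real t) / (real N - real t))" for a
  define P2 where "P2 s b = (\<Prod>t<b. (real N - m - real t) / (real N - s - real t))" for s b :: nat
  have N0: "0 < real N" and rN: "4 * real r \<le> real m" "real m + 2 * real f < real N" "m \<le> N"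
  proof -
    have "real (m + 2 * f) < real N" using fN by (simp only: of_nat_less_iff)
    then show "real m + 2 * real f < real N" by simp
    have "real (4 * r) \<le> real m" using rm by (simp only: of_nat_le_iff)
    then show "4 * real r \<le> real m" by simp
    show "0 < real N" "m \<le> N" using fN by auto
  qed
  have p0: "0 < p" using m0 N0 by (simp add: p)
  have P1_nn: "0 \<le> P1 a" if "a \<le> 2 * r" for a
  proof -
    have "0 \<le> real m - real t" "0 \<le> real N - real t" if "t < a" for t
    proof -
      have "t \<le> 2 * r" using that \<open>a \<le> 2 * r\<close> by simp
      then have "real t \<le> 2 * real r" by linarith
      then show "0 \<le> real m - real t" "0 \<le> real N - real t" using rN by linarith+
    qed
    then show ?thesis unfolding P1_def by (intro prod_nonneg) auto
  qed
  have P1_low: "P1 a * (p / 2) ^ i \<le> P1 (a + i)" if "a + i \<le> 2 * r" for a i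
    using that
  proof (induction i)
    case (Suc i)
    have ai: "real (a + i) \<le> 2 * real r" using Suc.prems by linarith
    have "p / 2 \<le> (real m - real (a + i)) / (real N - real (a + i))"
    proof -
      have "p / 2 = (real m / 2) / real N" by (simp add: p)
      also have "\<dots> \<le> (real m - real (a + i)) / (real N - real (a + i))"
        using ai rN N0 by (intro frac_le) auto
      finally show ?thesis .
    qed
    then have "P1 (a + i) * (p / 2) \<le> P1 (a + i) * ((real m - real (a + i)) / (real N - real (a + i)))"
      using P1_nn[of "a + i"] Suc.prems by (intro mult_left_mono) auto
    also have "\<dots> = P1 (a + Suc i)" unfolding P1_def by simp
    finally have "P1 (a + i) * (p / 2) \<le> P1 (a + Suc i)" .
    moreover have "P1 a * (p / 2) ^ i * (p / 2) \<le> P1 (a + i) * (p / 2)"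
      using Suc p0 by (intro mult_right_mono) auto
    ultimately show ?case by (simp add: mult_ac)
  qed simp
  have P1_sq: "P1 (2 * r) \<le> (P1 r)\<^sup>2"
  proof -
    have "P1 (2 * r) = (\<Prod>t<r. (real m - real t) / (real N - real t) * ((real m - real (r + t)) / (real N - real (r + t))))"
      unfolding P1_def by (rule prod_double)
    also have "\<dots> \<le> (\<Prod>t<r. (real m - real t) / (real N - real t) * ((real m - real t) / (real N - real t)))"
    proof (rule prod_mono)
      fix t assume "t \<in> {..<r}"
      then have t: "real t \<le> real r" by simp
      have "(real m - real (r + t)) / (real N - real (r + t)) \<le> (real m - real t) / (real N - real t)"
      proof -
        have "(real m - real (r + t)) * (real N - real t) \<le> (real m - real t) * (real N - real (r + t))"
        proof -
          have "(real m - real t) * (real N - real (r + t)) - (real m - real (r + t)) * (real N - real t) = r * (real N - real m)"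
            by (simp add: algebra_simps)
          moreover have "0 \<le> real r * (real N - real m)" using rN by auto
          ultimately show ?thesis by linarith
        qed
        then show ?thesis using t rN by (intro frac_le_cross) auto
      qed
      then show "0 \<le> (real m - real t) / (real N - real t) * ((real m - real (r + t)) / (real N - real (r + t))) \<and>
        (real m - real t) / (real N - real t) * ((real m - real (r + t)) / (real N - real (r + t))) \<le> (real m - real t) / (real N - real t) * ((real m - real t) / (real N - real t))"
        using t rN by (intro conjI mult_left_mono mult_nonneg_nonneg divide_nonneg_nonneg) auto
    qed
    also have "\<dots> = (P1 r)\<^sup>2" unfolding P1_def power2_eq_square by (rule prod.distrib)
    finally show ?thesis .
  qed
  have c1: "P1 (2 * r - j) \<le> (P1 r)\<^sup>2 * (2 / p) ^ j"
  proof -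
    have "P1 (2 * r - j) * (p / 2) ^ j \<le> (P1 r)\<^sup>2"
      using P1_low[of "2 * r - j" j] P1_sq jr by simp
    then have "P1 (2 * r - j) * (p / 2) ^ j * (2 / p) ^ j \<le> (P1 r)\<^sup>2 * (2 / p) ^ j"
      using p0 by (intro mult_right_mono) auto
    moreover have "(p / 2) ^ j * (2 / p) ^ j = 1" using p0 by (simp add: power_mult_distrib[symmetric])
    ultimately show ?thesis by (simp add: mult.assoc)
  qed
  have P2_nn: "0 \<le> P2 s b" if "b \<le> 2 * f" "s \<le> 2 * r" for s b
  proof -
    have "0 \<le> real N - m - real t" "0 \<le> real N - s - real t" if "t < b" for t
    proof -
      have "real t \<le> 2 * real f" "real s \<le> 2 * real r" using that \<open>b \<le> 2 * f\<close> \<open>s \<le> 2 * r\<close> by linarith+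
      then show "0 \<le> real N - m - real t" "0 \<le> real N - s - real t" using rN by linarith+
    qed
    then show ?thesis unfolding P2_def by (intro prod_nonneg) auto
  qed
  define x where "x = exp (- (m / (real N - m - 2 * f)))"
  have P2_low: "P2 (2 * r) b * x ^ i \<le> P2 (2 * r) (b + i)" if "b + i \<le> 2 * f" for b i
    using that
  proof (induction i)
    case (Suc i)
    have bi: "real (b + i) \<le> 2 * real f" using Suc.prems by linarith
    have "x \<le> (real N - m - real (b + i)) / (real N - real (2 * r) - real (b + i))"
    proof -
      define A where "A = real N - m - 2 * f"
      have A: "0 < A" using rN by (simp add: A_def)
      have "1 + m / A \<le> exp (m / A)" using exp_ge_add_one_self[of "m / A"] by simp
      moreover have "0 < 1 + m / A" using A by (simp add: add_pos_nonneg)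
      ultimately have "x \<le> 1 / (1 + m / A)"
        unfolding x_def A_def[symmetric] exp_minus by (simp add: inverse_eq_divide frac_le)
      also have "\<dots> = A / (A + m)" using A by (simp add: field_simps)
      also have "\<dots> \<le> (real N - m - real (b + i)) / (real N - real (2 * r) - real (b + i))"
      proof -
        define y where "y = 2 * real f - real (b + i)"
        have y: "0 \<le> y" using bi by (simp add: y_def)
        have e: "real N - m - real (b + i) = A + y" "real N - real (2 * r) - real (b + i) = A + m + y - 2 * r"
          by (auto simp: A_def y_def)
        have "A * (A + m + y - 2 * r) \<le> (A + y) * (A + m)"
        proof -
          have "(A + y) * (A + m) - A * (A + m + y - 2 * r) = y * m + A * (2 * r)" by (simp add: algebra_simps)
          moreover have "0 \<le> y * m + A * (2 * r)" using y A by auto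
          ultimately show ?thesis by linarith
        qed
        moreover have "0 < A + m + y - 2 * r" "0 < A + m" using A y rN by auto
        ultimately show ?thesis unfolding e by (intro frac_le_cross)
      qed
      finally show ?thesis .
    qed
    then have "P2 (2 * r) (b + i) * x \<le> P2 (2 * r) (b + i) * ((real N - m - real (b + i)) / (real N - real (2 * r) - real (b + i)))"
      using P2_nn[of "b + i" "2 * r"] Suc.prems by (intro mult_left_mono) auto
    also have "\<dots> = P2 (2 * r) (b + Suc i)" unfolding P2_def by simp
    finally have "P2 (2 * r) (b + i) * x \<le> P2 (2 * r) (b + Suc i)" .
    moreover have "P2 (2 * r) b * x ^ i * x \<le> P2 (2 * r) (b + i) * x"
      using Suc by (intro mult_right_mono) (auto simp: x_def)
    ultimately show ?case by (simp add: mult_ac)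
  qed simp
  define D where "D = exp (2 * r / (real N - 2 * r - f)) * exp (- (f * (real m - 2 * r) / (real N)\<^sup>2))"
  \<comment> \<open>The first \<open>f\<close> factors are matched with the last \<open>f\<close>,
    so that each product of two can be compared with the square of one factor of the single
    probability.\<close>
  have P2_sq: "P2 (2 * r) (2 * f) \<le> (P2 r f)\<^sup>2 * D ^ f"
  proof -
    have "P2 (2 * r) (2 * f) = (\<Prod>t<f. (real N - m - real t) / (real N - real (2 * r) - real t) * ((real N - m - real (f + t)) / (real N - real (2 * r) - real (f + t))))"
      unfolding P2_def by (rule prod_double)
    also have "\<dots> \<le> (\<Prod>t<f. (real N - m - real t) / (real N - r - real t) * ((real N - m - real t) / (real N - r - real t)) * D)"
    proof (rule prod_mono)
      fix t assume "t \<in> {..<f}"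
      then have t: "real t < real f" by simp
      define a where "a = real N - m - real t"
      define b where "b = real N - 2 * r - real t"
      have ab: "0 < a - f" "0 < b - f" "a \<le> real N" "b \<le> real N" "a \<le> b - (real m - 2 * r)" "0 \<le> real m - 2 * r" "b - a = real m - 2 * r"
        using t rN by (auto simp: a_def b_def)
      have i1: "(b + r) / b \<le> exp (r / (real N - 2 * r - f))"
      proof -
        have "(b + r) / b = 1 + r / b" using ab by (simp add: field_simps)
        also have "\<dots> \<le> exp (r / b)" by (rule exp_ge_add_one_self)
        also have "\<dots> \<le> exp (r / (real N - 2 * r - f))" using t rN by (auto simp: b_def intro!: frac_le)
        finally show ?thesis .
      qed
      \<comment> \<open>The single probability has \<open>r\<close> in its denominators where the
        joint one has \<open>2 * r\<close>; this is the price of changing them.\<close>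
      have i2: "((b + r) / b)\<^sup>2 \<le> exp (2 * r / (real N - 2 * r - f))"
      proof -
        have "((b + r) / b)\<^sup>2 \<le> (exp (r / (real N - 2 * r - f)))\<^sup>2" using i1 ab by (intro power_mono) auto
        also have "\<dots> = exp (2 * r / (real N - 2 * r - f))" by (simp add: exp_double[symmetric])
        finally show ?thesis .
      qed
      \<comment> \<open>Depletion: a factor met \<open>f\<close> steps later is smaller by the
        relative amount f (b - a) / (a (b - f)). Over \<open>f\<close> pairs of factors this
        produces the square of \<open>f\<close> in the negative exponent.\<close>
      have i3: "((a - f) / (b - f)) / (a / b) \<le> exp (- (f * (real m - 2 * r) / (real N)\<^sup>2))"
      proof -
        have "((a - f) / (b - f)) / (a / b) = 1 - f * (b - a) / (a * (b - f))" proof -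
          have "((u - w) / (v - w)) / (u / v) = 1 - w * (v - u) / (u * (v - w))" if "u \<noteq> 0" "v \<noteq> 0" "v - w \<noteq> 0" for u v w :: real
            using that by (simp add: field_simps)
          from this[of a b f] show ?thesis using ab(1,2) by simp
        qed
        also have "\<dots> \<le> 1 - f * (b - a) / (real N)\<^sup>2"
          using ab unfolding power2_eq_square by (intro diff_left_mono frac_le mult_mono mult_pos_pos) auto
        also have "\<dots> \<le> exp (- (f * (b - a) / (real N)\<^sup>2))" using exp_ge_add_one_self[of "- (f * (b - a) / (real N)\<^sup>2)"] by simp
        finally show ?thesis using ab by simp
      qed
      have "(a / b) * ((a - f) / (b - f)) = (a / (b + r))\<^sup>2 * (((b + r) / b)\<^sup>2 * (((a - f) / (b - f)) / (a / b)))"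
      proof -
        have "u / w * y = (u / v)\<^sup>2 * ((v / w)\<^sup>2 * (y / (u / w)))" if "u \<noteq> 0" "v \<noteq> 0" "w \<noteq> 0" for u v w y :: real
          using that by (simp add: field_simps power2_eq_square)
        from this[of a "b + r" b] show ?thesis using ab by simp
      qed
      also have "\<dots> \<le> (a / (b + r))\<^sup>2 * D"
        unfolding D_def using i2 i3 ab by (intro mult_left_mono mult_mono) auto
      finally have "(a / b) * ((a - f) / (b - f)) \<le> (a / (b + r))\<^sup>2 * D" .
      moreover have "0 \<le> (a / b) * ((a - f) / (b - f))" using ab by auto
      moreover have "real N - m - real (f + t) = a - f" "real N - real (2 * r) - real (f + t) = b - f"
        "real N - real (2 * r) - real t = b" "real N - real r - real t = b + r" "real N - real m - real t = a" by (auto simp: a_def b_def)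
      ultimately show "0 \<le> (real N - m - real t) / (real N - real (2 * r) - real t) * ((real N - m - real (f + t)) / (real N - real (2 * r) - real (f + t))) \<and>
        (real N - m - real t) / (real N - real (2 * r) - real t) * ((real N - m - real (f + t)) / (real N - real (2 * r) - real (f + t)))
        \<le> (real N - m - real t) / (real N - r - real t) * ((real N - m - real t) / (real N - r - real t)) * D"
        by (simp only: power2_eq_square mult.assoc simp_thms)
    qed
    also have "\<dots> = (P2 r f)\<^sup>2 * D ^ f" unfolding P2_def power2_eq_square by (simp only: prod.distrib prod_constant card_lessThan)
    finally show ?thesis .
  qed
  have c2: "P2 (2 * r - j) (2 * f - g) \<le> (P2 r f)\<^sup>2 * D ^ f * inverse (x ^ g)"
  proof -
    have "P2 (2 * r - j) (2 * f - g) \<le> P2 (2 * r) (2 * f - g)"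
      unfolding P2_def
    proof (rule prod_mono)
      fix t assume "t \<in> {..<2 * f - g}"
      then have "real t \<le> 2 * real f" "real (2 * r - j) \<le> 2 * real r" by auto
      then show "0 \<le> (real N - m - real t) / (real N - real (2 * r - j) - real t) \<and>
        (real N - m - real t) / (real N - real (2 * r - j) - real t) \<le> (real N - m - real t) / (real N - real (2 * r) - real t)"
        using rN by (intro conjI divide_nonneg_nonneg frac_le) auto
    qed
    moreover have "P2 (2 * r) (2 * f - g) * x ^ g \<le> (P2 r f)\<^sup>2 * D ^ f"
      using P2_low[of "2 * f - g" g] P2_sq gf by simp
    moreover have "0 < x" by (simp add: x_def)
    ultimately have "P2 (2 * r) (2 * f - g) \<le> (P2 r f)\<^sup>2 * D ^ f * inverse (x ^ g)"
      by (simp add: field_simps)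
    then show ?thesis using \<open>P2 (2 * r - j) (2 * f - g) \<le> P2 (2 * r) (2 * f - g)\<close> by linarith
  qed
  have e2: "D ^ f * inverse (x ^ g) = exp (2 * real r * real f / (real N - 2 * real r - real f) + real g * (real m / (real N - real m - 2 * real f)) - (real f)\<^sup>2 * (real m - 2 * real r) / (real N)\<^sup>2)"
  proof -
    define A where "A = 2 * real r / (real N - 2 * real r - real f)"
    define B where "B = real f * (real m - 2 * real r) / (real N)\<^sup>2"
    define C where "C = real m / (real N - real m - 2 * real f)"
    have "D = exp (A + - B)" unfolding D_def A_def B_def exp_add by simp
    then have "D ^ f = exp (real f * (A + - B))" by (simp add: exp_of_nat_mult)
    moreover have "inverse (x ^ g) = exp (real g * C)"
    proof -
      have "x ^ g = exp (real g * - C)" unfolding exp_of_nat_mult by (simp add: x_def C_def)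
      then show ?thesis by (simp add: exp_minus)
    qed
    ultimately have "D ^ f * inverse (x ^ g) = exp (real f * (A + - B) + real g * C)"
      by (simp only: exp_add)
    moreover have "real f * (A + - B) + real g * C = real f * A + real g * C - real f * B"
      by (simp add: algebra_simps)
    moreover have "real f * A = 2 * real r * real f / (real N - 2 * real r - real f)" by (simp add: A_def)
    moreover have "real f * B = (real f)\<^sup>2 * (real m - 2 * real r) / (real N)\<^sup>2" by (simp add: B_def power2_eq_square)
    ultimately show ?thesis by (simp only: C_def)
  qed
  have e0: "cc N m (2 * r - j) (2 * f - g) = P1 (2 * r - j) * P2 (2 * r - j) (2 * f - g)"
    unfolding P1_def P2_def by (rule cc_prod) (use rm fN in auto)
  have e1: "cc N m r f = P1 r * P2 r f"
    unfolding P1_def P2_def by (rule cc_prod) (use rm fN in auto)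
  have e3: "P1 (2 * r - j) * P2 (2 * r - j) (2 * f - g) \<le> ((P1 r)\<^sup>2 * (2 / p) ^ j) * ((P2 r f)\<^sup>2 * D ^ f * inverse (x ^ g))"
  proof (rule mult_mono[OF c1 c2])
    show "0 \<le> (P1 r)\<^sup>2 * (2 / p) ^ j" using p0 by simp
    show "0 \<le> P2 (2 * r - j) (2 * f - g)" by (rule P2_nn) auto
  qed
  have rearrange: "(u\<^sup>2 * w) * (v\<^sup>2 * y * z) = (u * v)\<^sup>2 * w * (y * z)" for u v w y z :: real
    unfolding power2_eq_square by (simp only: mult_ac)
  show ?thesis
    by (rule ord_eq_le_trans[OF e0 ord_le_eq_trans[OF e3]])
      (simp only: rearrange e1 e2)
qed

section \<open>Configurations and their probabilities\<close>

definition configs :: "nat \<Rightarrow> nat \<Rightarrow> nat \<Rightarrow> (nat set \<times> nat set set) set" where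
  "configs n k r = {(K, M). K \<subseteq> {1..n} \<and> card K = k + r \<and>
      M \<subseteq> {e. e \<subseteq> K \<and> card e = 2} \<and> card M = r \<and> pairwise disjnt M}"

definition good :: "nat \<Rightarrow> nat set \<Rightarrow> nat set set \<Rightarrow> nat set set \<Rightarrow> bool" where
  "good n K M G \<longleftrightarrow> M \<subseteq> G \<and> (\<forall>e\<in>G. e \<subseteq> K \<longrightarrow> e \<subseteq> \<Union>M) \<and>
      (\<forall>v\<in>{1..n} - K. card {u \<in> K - \<Union>M. {u, v} \<in> G} \<ge> 2)"

definition forb :: "nat set \<Rightarrow> nat set set \<Rightarrow> nat set set" where
  "forb K M = {e. e \<subseteq> K \<and> card e = 2 \<and> \<not> e \<subseteq> \<Union>M}"

definition star :: "nat \<Rightarrow> nat set \<Rightarrow> nat set set" where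
  "star z Y = (\<lambda>y. {z, y}) ` Y"

definition Pr :: "nat \<Rightarrow> nat \<Rightarrow> (nat set set \<Rightarrow> bool) \<Rightarrow> real" where
  "Pr n m Q = card {G \<in> graphs_nm n m. Q G} / card (graphs_nm n m)"

lemma X_eq: "X n k r G = card {c \<in> configs n k r. good n (fst c) (snd c) G}"
  unfolding X_def configs_def good_def
  by (rule arg_cong[where f = card], rule set_eqI) (simp only: mem_Collect_eq case_prod_beta conj_assoc)

lemma finite_configs [simp]: "finite (configs n k r)"
proof (rule finite_subset)
  show "configs n k r \<subseteq> Pow {1..n} \<times> Pow (Pow {1..n})"
    unfolding configs_def by auto
qed simp

lemma finite_all_edges [simp]: "finite (all_edges n)"
  unfolding all_edges_def by (rule finite_subset[of _ "Pow {1..n}"]) auto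

lemma card_pairs: "finite K \<Longrightarrow> card {e. e \<subseteq> K \<and> card e = 2} = card K choose 2"
  by (rule n_subsets)

lemma finite_pairs: "finite K \<Longrightarrow> finite {e. e \<subseteq> K \<and> card e = 2}"
  by (rule finite_subset[of _ "Pow K"]) auto

lemma card_all_edges [simp]: "card (all_edges n) = n choose 2"
  unfolding all_edges_def using card_pairs[of "{1..n}"] by simp

lemma finite_graphs [simp]: "finite (graphs_nm n m)"
  unfolding graphs_nm_def by (rule finite_subset[of _ "Pow (all_edges n)"]) auto

lemma card_graphs: "card (graphs_nm n m) = (n choose 2) choose m"
  unfolding graphs_nm_def using n_subsets[of "all_edges n" m] by simp

lemma Pr_nonneg: "0 \<le> Pr n m Q"
  by (simp add: Pr_def)

lemma expectation_Gnm:
  assumes "m \<le> n choose 2"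
  shows "measure_pmf.expectation (Gnm n m) f = (\<Sum>G\<in>graphs_nm n m. f G) / card (graphs_nm n m)"
proof -
  have "graphs_nm n m \<noteq> {}"
  proof -
    have "0 < card (graphs_nm n m)" unfolding card_graphs using assms by (rule zero_less_binomial)
    then show ?thesis by (simp add: card_gt_0_iff)
  qed
  then show ?thesis unfolding Gnm_def by (subst integral_pmf_of_set) auto
qed

lemma sum_card_eq_sum_Pr:
  assumes "finite A"
  shows "(\<Sum>G\<in>graphs_nm n m. real (card {c \<in> A. Q c G})) / card (graphs_nm n m) = (\<Sum>c\<in>A. Pr n m (Q c))"
proof -
  have "(\<Sum>G\<in>graphs_nm n m. real (card {c \<in> A. Q c G})) = (\<Sum>G\<in>graphs_nm n m. \<Sum>c\<in>A. of_bool (Q c G))"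
    by (intro sum.cong refl) (simp only: sum_of_bool_card[OF assms])
  also have "\<dots> = (\<Sum>c\<in>A. \<Sum>G\<in>graphs_nm n m. of_bool (Q c G))" by (rule sum.swap)
  also have "\<dots> = (\<Sum>c\<in>A. real (card {G \<in> graphs_nm n m. Q c G}))"
    by (intro sum.cong refl) (simp only: sum_of_bool_card[OF finite_graphs])
  finally show ?thesis by (simp add: Pr_def sum_divide_distrib)
qed

lemma EX_eq:
  assumes "m \<le> n choose 2"
  shows "EX_X n m k r = (\<Sum>c\<in>configs n k r. Pr n m (good n (fst c) (snd c)))"
  unfolding EX_X_def expectation_Gnm[OF assms] X_eq
  by (rule sum_card_eq_sum_Pr[where Q = "\<lambda>c G. good n (fst c) (snd c) G"]) simp

lemma VarX_eq:
  assumes "m \<le> n choose 2"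
  shows "VarX n m k r = (\<Sum>c\<in>configs n k r. \<Sum>c'\<in>configs n k r.
      Pr n m (\<lambda>G. good n (fst c) (snd c) G \<and> good n (fst c') (snd c') G)) - (EX_X n m k r)\<^sup>2"
proof -
  let ?C = "configs n k r"
  let ?g = "\<lambda>c G. good n (fst c) (snd c) G"
  have ne: "graphs_nm n m \<noteq> {}"
  proof -
    have "0 < card (graphs_nm n m)" unfolding card_graphs using assms by (rule zero_less_binomial)
    then show ?thesis by (simp add: card_gt_0_iff)
  qed
  have fin: "finite (set_pmf (Gnm n m))" unfolding Gnm_def using ne by (simp add: set_pmf_of_set)
  have "VarX n m k r = measure_pmf.expectation (Gnm n m) (\<lambda>G. (real (X n k r G))\<^sup>2) - (EX_X n m k r)\<^sup>2"
    unfolding VarX_def EX_X_def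
    by (rule measure_pmf.variance_eq) (rule integrable_measure_pmf_finite[OF fin])+
  also have "measure_pmf.expectation (Gnm n m) (\<lambda>G. (real (X n k r G))\<^sup>2)
    = (\<Sum>G\<in>graphs_nm n m. real (card {cc \<in> ?C \<times> ?C. ?g (fst cc) G \<and> ?g (snd cc) G})) / card (graphs_nm n m)"
  proof -
    have "(X n k r G)\<^sup>2 = card {cc \<in> ?C \<times> ?C. ?g (fst cc) G \<and> ?g (snd cc) G}" for G
    proof -
      have "{cc \<in> ?C \<times> ?C. ?g (fst cc) G \<and> ?g (snd cc) G} = {c \<in> ?C. ?g c G} \<times> {c \<in> ?C. ?g c G}" by auto
      then show ?thesis unfolding X_eq power2_eq_square by (simp add: card_cartesian_product)
    qed
    then show ?thesis unfolding expectation_Gnm[OF assms] of_nat_power[symmetric] by simp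
  qed
  also have "\<dots> = (\<Sum>cc\<in>?C \<times> ?C. Pr n m (\<lambda>G. ?g (fst cc) G \<and> ?g (snd cc) G))"
    by (rule sum_card_eq_sum_Pr[where Q = "\<lambda>cc G. ?g (fst cc) G \<and> ?g (snd cc) G"]) simp
  also have "\<dots> = (\<Sum>c\<in>?C. \<Sum>c'\<in>?C. Pr n m (\<lambda>G. ?g c G \<and> ?g c' G))"
    by (subst sum.cartesian_product) (auto intro!: sum.cong)
  finally show ?thesis .
qed

lemma card_Omega:
  assumes "R \<subseteq> all_edges n" "Fb \<subseteq> all_edges n" "R \<inter> Fb = {}"
  shows "card (all_edges n - R - Fb) = (n choose 2) - card R - card Fb"
proof -
  have "finite R" "finite Fb" using assms finite_subset[OF _ finite_all_edges] by auto
  moreover have "Fb \<subseteq> all_edges n - R" using assms by auto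
  ultimately show ?thesis using assms by (simp add: card_Diff_subset)
qed

text \<open>Once the edges \<open>R\<close> and the non-edges \<open>Fb\<close> are fixed,
  \<open>G - R\<close> ranges over the sets of size \<open>m - card R\<close> in the remaining
  pairs. \<open>Q\<close> only has to imply \<open>B\<close>, so a non-monotone event can be
  replaced by an increasing consequence to which the sandwich applies.\<close>

lemma Pr_upper:
  assumes R: "R \<subseteq> all_edges n" and Fb: "Fb \<subseteq> all_edges n" "R \<inter> Fb = {}" and m: "card R \<le> m"
    and Q: "\<And>G. G \<in> graphs_nm n m \<Longrightarrow> Q G \<Longrightarrow> R \<subseteq> G \<and> G \<inter> Fb = {} \<and> B (G - R)"
    and mN: "m + card Fb \<le> n choose 2"
  shows "Pr n m Q \<le> cc (n choose 2) m (card R) (card Fb) * Unif (all_edges n - R - Fb) (m - card R) B"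
proof -
  let ?\<Omega> = "all_edges n - R - Fb"
  have finR: "finite R" using R finite_subset[OF _ finite_all_edges] by auto
  have fin: "finite {S. S \<subseteq> ?\<Omega> \<and> card S = m - card R \<and> B S}" by (rule finite_subset[of _ "Pow ?\<Omega>"]) auto
  have "card {G \<in> graphs_nm n m. Q G} \<le> card {S. S \<subseteq> ?\<Omega> \<and> card S = m - card R \<and> B S}"
  proof (rule card_inj_on_le[OF _ _ fin, of "\<lambda>G. G - R"])
    show "inj_on (\<lambda>G. G - R) {G \<in> graphs_nm n m. Q G}"
    proof (rule inj_on_inverseI[where g = "\<lambda>S. S \<union> R"])
      fix G assume "G \<in> {G \<in> graphs_nm n m. Q G}"
      then have "R \<subseteq> G" using Q by auto
      then show "G - R \<union> R = G" by auto
    qed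
    show "(\<lambda>G. G - R) ` {G \<in> graphs_nm n m. Q G} \<subseteq> {S. S \<subseteq> ?\<Omega> \<and> card S = m - card R \<and> B S}"
    proof clarify
      fix G assume G: "G \<in> graphs_nm n m" "Q G"
      note q = Q[OF G]
      have GE: "G \<subseteq> all_edges n" "card G = m" using G unfolding graphs_nm_def by auto
      then have "finite G" using finite_subset[OF _ finite_all_edges] by auto
      then show "G - R \<subseteq> ?\<Omega> \<and> card (G - R) = m - card R \<and> B (G - R)"
        using q GE finR by (auto simp: card_Diff_subset)
    qed
  qed
  then have le: "real (card {G \<in> graphs_nm n m. Q G}) \<le> real (card {S. S \<subseteq> ?\<Omega> \<and> card S = m - card R \<and> B S})" by simp
  have cO: "card ?\<Omega> = (n choose 2) - card R - card Fb" by (rule card_Omega[OF R Fb])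
  have pos: "0 < card ?\<Omega> choose (m - card R)" unfolding cO using m mN by (simp add: zero_less_binomial_iff)
  have "Pr n m Q \<le> real (card {S. S \<subseteq> ?\<Omega> \<and> card S = m - card R \<and> B S}) / ((n choose 2) choose m)"
    unfolding Pr_def card_graphs using le by (rule divide_right_mono) simp
  also have "\<dots> = real (card ?\<Omega> choose (m - card R)) / ((n choose 2) choose m) * Unif ?\<Omega> (m - card R) B"
    unfolding Unif_def using pos by simp
  finally show ?thesis unfolding cc_def cO .
qed

text \<open>The reverse injection adds \<open>R\<close> to a set of free pairs; here
  \<open>B\<close> has to imply \<open>Q\<close>.\<close>

lemma Pr_lower:
  assumes R: "R \<subseteq> all_edges n" and Fb: "Fb \<subseteq> all_edges n" "R \<inter> Fb = {}" and m: "card R \<le> m"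
    and Q: "\<And>S. S \<subseteq> all_edges n - R - Fb \<Longrightarrow> B S \<Longrightarrow> Q (S \<union> R)"
    and mN: "m + card Fb \<le> n choose 2"
  shows "cc (n choose 2) m (card R) (card Fb) * Unif (all_edges n - R - Fb) (m - card R) B \<le> Pr n m Q"
proof -
  let ?\<Omega> = "all_edges n - R - Fb"
  have finR: "finite R" using R finite_subset[OF _ finite_all_edges] by auto
  have "card {S. S \<subseteq> ?\<Omega> \<and> card S = m - card R \<and> B S} \<le> card {G \<in> graphs_nm n m. Q G}"
  proof (rule card_inj_on_le[of "\<lambda>S. S \<union> R"])
    show "inj_on (\<lambda>S. S \<union> R) {S. S \<subseteq> ?\<Omega> \<and> card S = m - card R \<and> B S}"
      by (rule inj_on_inverseI[where g = "\<lambda>G. G - R"]) auto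
    show "(\<lambda>S. S \<union> R) ` {S. S \<subseteq> ?\<Omega> \<and> card S = m - card R \<and> B S} \<subseteq> {G \<in> graphs_nm n m. Q G}"
    proof clarify
      fix S assume S: "S \<subseteq> ?\<Omega>" "card S = m - card R" "B S"
      then have "finite S" using finite_subset[of S "all_edges n"] by auto
      moreover have "S \<inter> R = {}" using S by auto
      ultimately have "card (S \<union> R) = m" using finR S m by (simp add: card_Un_disjoint)
      then show "S \<union> R \<in> graphs_nm n m \<and> Q (S \<union> R)" using Q[OF S(1,3)] S(1) R unfolding graphs_nm_def by auto
    qed
  qed simp
  then have le: "real (card {S. S \<subseteq> ?\<Omega> \<and> card S = m - card R \<and> B S}) \<le> real (card {G \<in> graphs_nm n m. Q G})" by simp
  have cO: "card ?\<Omega> = (n choose 2) - card R - card Fb" by (rule card_Omega[OF R Fb])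
  have pos: "0 < card ?\<Omega> choose (m - card R)" unfolding cO using m mN by (simp add: zero_less_binomial_iff)
  have "cc (n choose 2) m (card R) (card Fb) * Unif ?\<Omega> (m - card R) B
    = real (card {S. S \<subseteq> ?\<Omega> \<and> card S = m - card R \<and> B S}) / ((n choose 2) choose m)"
    unfolding cc_def cO[symmetric] Unif_def using pos by simp
  also have "\<dots> \<le> Pr n m Q"
    unfolding Pr_def card_graphs using le by (rule divide_right_mono) simp
  finally show ?thesis .
qed

lemma star_card: "finite Y \<Longrightarrow> card (star z Y) = card Y"
  unfolding star_def by (intro card_image) (auto simp: inj_on_def doubleton_eq_iff)

lemma finite_star [simp]: "finite Y \<Longrightarrow> finite (star z Y)"
  by (simp add: star_def)

lemma card_Int_star: "card (G \<inter> star z Y) = card {y \<in> Y. {y, z} \<in> G}"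
proof -
  have "G \<inter> star z Y = (\<lambda>y. {z, y}) ` {y \<in> Y. {y, z} \<in> G}"
    unfolding star_def by (auto simp: insert_commute)
  also have "card \<dots> = card {y \<in> Y. {y, z} \<in> G}"
    by (intro card_image) (auto simp: inj_on_def doubleton_eq_iff)
  finally show ?thesis .
qed

lemma star_subset_edges:
  assumes "z \<in> {1..n}" "Y \<subseteq> {1..n}" "z \<notin> Y"
  shows "star z Y \<subseteq> all_edges n"
  using assms unfolding star_def all_edges_def by (auto simp: card_insert_if)

lemma star_disjoint:
  assumes "z \<noteq> z'" "\<not> (z' \<in> Y \<and> z \<in> Y')"
  shows "star z Y \<inter> star z' Y' = {}"
  using assms unfolding star_def by (auto simp: doubleton_eq_iff)

lemma star_Un: "star z (Y \<union> Y') = star z Y \<union> star z Y'"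
  by (auto simp: star_def)

lemma card_Union_edges:
  assumes "M \<subseteq> {e. e \<subseteq> K \<and> card e = 2}" "pairwise disjnt M"
  shows "card (\<Union>M) = 2 * card M"
proof -
  have "finite e" if "e \<in> M" for e
    using that assms(1) by (metis (mono_tags, lifting) card.infinite mem_Collect_eq subsetD zero_neq_numeral)
  then have "card (\<Union>M) = (\<Sum>e\<in>M. card e)"
    using assms(2) by (intro card_Union_disjoint) auto
  also have "\<dots> = (\<Sum>e\<in>M. 2)" using assms(1) by (intro sum.cong) auto
  finally show ?thesis by simp
qed

context
  fixes n k r :: nat and K M
  assumes cfg: "(K, M) \<in> configs n k r"
begin

lemma cfg_K: "K \<subseteq> {1..n}" "card K = k + r" "finite K"
  using cfg finite_subset[of K "{1..n}"] unfolding configs_def by auto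

lemma cfg_M: "M \<subseteq> {e. e \<subseteq> K \<and> card e = 2}" "card M = r" "pairwise disjnt M" "finite M"
  using cfg finite_subset[OF _ finite_pairs[OF cfg_K(3)]] unfolding configs_def by auto

lemma cfg_U: "\<Union>M \<subseteq> K" "card (\<Union>M) = 2 * r" "finite (\<Union>M)"
  proof -
  show "\<Union>M \<subseteq> K" using cfg_M by auto
  then show "finite (\<Union>M)" using cfg_K(3) finite_subset by blast
  show "card (\<Union>M) = 2 * r" using card_Union_edges[OF cfg_M(1,3)] cfg_M(2) by simp
qed

lemma cfg_I: "card (K - \<Union>M) = k - r" "r \<le> k"
proof -
  have "card (K - \<Union>M) = card K - card (\<Union>M)" using cfg_U by (intro card_Diff_subset) auto
  then show "card (K - \<Union>M) = k - r" using cfg_U cfg_K by simp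
  have "card (\<Union>M) \<le> card K" using cfg_U cfg_K by (intro card_mono) auto
  then show "r \<le> k" using cfg_U cfg_K by simp
qed

lemma cfg_edges: "M \<subseteq> all_edges n" "forb K M \<subseteq> all_edges n" "M \<inter> forb K M = {}"
  using cfg_M(1) cfg_K(1) unfolding all_edges_def forb_def by auto

lemma cfg_finite_forb: "finite (forb K M)"
  using finite_subset[OF cfg_edges(2)] by simp

lemma cfg_forb_card: "card (forb K M) = ((k + r) choose 2) - ((2 * r) choose 2)"
proof -
  have "forb K M = {e. e \<subseteq> K \<and> card e = 2} - {e. e \<subseteq> \<Union>M \<and> card e = 2}" unfolding forb_def by auto
  moreover have "{e. e \<subseteq> \<Union>M \<and> card e = 2} \<subseteq> {e. e \<subseteq> K \<and> card e = 2}" using cfg_U by auto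
  ultimately have "card (forb K M) = card {e. e \<subseteq> K \<and> card e = 2} - card {e. e \<subseteq> \<Union>M \<and> card e = 2}"
    using finite_pairs[OF cfg_U(3)] by (simp add: card_Diff_subset)
  then show ?thesis using card_pairs[OF cfg_U(3)] card_pairs[OF cfg_K(3)] cfg_U cfg_K by simp
qed

text \<open>Rewrites (iii) as a lower bound on intersections of the edge set with stars. In this
  form it depends on explicit coordinates and is visibly increasing.\<close>

lemma good_iff:
  assumes "G \<subseteq> all_edges n"
  shows "good n K M G \<longleftrightarrow> M \<subseteq> G \<and> G \<inter> forb K M = {} \<and> (\<forall>v\<in>{1..n} - K. 2 \<le> card (G \<inter> star v (K - \<Union>M)))"
proof -
  have "card e = 2" if "e \<in> G" for e using that assms unfolding all_edges_def by auto
  then have "(\<forall>e\<in>G. e \<subseteq> K \<longrightarrow> e \<subseteq> \<Union>M) \<longleftrightarrow> G \<inter> forb K M = {}"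
    unfolding forb_def disjoint_iff mem_Collect_eq by metis
  then show ?thesis unfolding good_def card_Int_star by (simp only:)
qed

end

section \<open>Probabilities for one configuration and for pairs with small overlap\<close>

lemma BE_outer:
  fixes p :: real
  assumes "finite \<Omega>" "finite V0" "finite I" "card I = h" "\<And>v. v \<in> V0 \<Longrightarrow> star v I \<subseteq> \<Omega>" "V0 \<inter> I = {}"
  shows "BE \<Omega> p (\<lambda>S. of_bool (\<forall>v\<in>V0. 2 \<le> card (S \<inter> star v I))) = (1 - qf h p) ^ card V0"
proof -
  have "BE \<Omega> p (\<lambda>S. of_bool (\<forall>v\<in>V0. 2 \<le> card (S \<inter> star v I))) = (\<Prod>v\<in>V0. BE (star v I) p (\<lambda>S. of_bool (2 \<le> card S)))"
  proof (rule BE_ball_prod[OF assms(1,2), of "\<lambda>v. star v I" p "\<lambda>_ S. 2 \<le> card S"])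
    fix v w assume "v \<in> V0" "w \<in> V0" "v \<noteq> w"
    then show "star v I \<inter> star w I = {}" using assms(6) by (intro star_disjoint) auto
  qed (rule assms(5))
  then show ?thesis using assms(3,4) by (simp add: BE_card_ge2 star_card)
qed

lemma incr_card_Int:
  assumes "finite \<Omega>" "S \<subseteq> T" "T \<subseteq> \<Omega>" "d \<le> card (S \<inter> A)"
  shows "d \<le> card (T \<inter> A)"
proof -
  have "finite T" using assms(1,3) finite_subset by blast
  then have "card (S \<inter> A) \<le> card (T \<inter> A)" using assms(2) by (intro card_mono) auto
  then show ?thesis using assms(4) by simp
qed

text \<open>The stars from outside vertices into \<open>K - \<Union>M\<close> are disjoint and avoid
  all forced pairs, so under a product measure (iii) has exactly the probability of a power. The
  subtracted term is the same event at the tilted density, multiplied by the size tail; it is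
  comparable with the main term instead of merely being small in absolute value.\<close>

lemma single_lower:
  fixes p p2 w :: real
  assumes cfg: "(K, M) \<in> configs n k r"
    and m: "m + card (forb K M) \<le> n choose 2" "r \<le> m" "0 < m"
    and p: "0 \<le> p" "p \<le> 1" "p * (n choose 2) \<le> real m - r - 2 * w * sqrt m"
    and w: "0 < w" "w \<le> sqrt m" and h: "2 \<le> k - r"
    and p2: "p * (1 + w / sqrt m) / (1 + p * (w / sqrt m)) \<le> p2" "p2 \<le> 1"
  shows "cc (n choose 2) m r (card (forb K M)) *
      ((1 - qf (k - r) p) ^ (n - (k + r)) - exp (- w\<^sup>2) * (1 - qf (k - r) p2) ^ (n - (k + r)))
    \<le> Pr n m (good n K M)"
proof -
  note K = cfg_K[OF cfg] and M = cfg_M[OF cfg] and U = cfg_U[OF cfg] and E = cfg_edges[OF cfg]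
  define \<Omega> where "\<Omega> = all_edges n - M - forb K M"
  define I where "I = K - \<Union>M"
  define V0 where "V0 = {1..n} - K"
  define B where "B S = (\<forall>v\<in>V0. 2 \<le> card (S \<inter> star v I))" for S
  define pz where "pz = p * (1 + w / sqrt m) / (1 + p * (w / sqrt m))"
  have fin: "finite \<Omega>" by (simp add: \<Omega>_def)
  have I: "finite I" "card I = k - r" "V0 \<inter> I = {}" "finite V0" "card V0 = n - (k + r)"
    using K cfg_I[OF cfg] by (auto simp: I_def V0_def card_Diff_subset)
  have st: "star v I \<subseteq> \<Omega>" if "v \<in> V0" for v
  proof -
    have v: "v \<in> {1..n}" "v \<notin> K" using that by (auto simp: V0_def)
    have "star v I \<subseteq> all_edges n" using v K(1) by (intro star_subset_edges) (auto simp: I_def)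
    moreover have "star v I \<inter> {e. e \<subseteq> K} = {}" using v by (auto simp: star_def)
    ultimately show ?thesis using M(1) unfolding \<Omega>_def forb_def by blast
  qed
  have BE: "BE \<Omega> q (\<lambda>S. of_bool (B S)) = (1 - qf (k - r) q) ^ (n - (k + r))" for q
    unfolding B_def using BE_outer[OF fin I(4,1,2) st I(3)] I(5) by simp
  have inc: "incr \<Omega> B" unfolding B_def using incr_card_Int[OF fin] by blast
  have cO: "card \<Omega> = (n choose 2) - r - card (forb K M)"
    unfolding \<Omega>_def card_Omega[OF E(1,2,3)] M(2) ..
  have y0: "0 < w / sqrt m" using w m by simp
  have pz: "0 \<le> pz" "p \<le> pz"
  proof -
    have py0: "0 \<le> p * (w / sqrt m)" using p y0 by (intro mult_nonneg_nonneg) auto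
    then show "0 \<le> pz" unfolding pz_def using p y0 w by (intro divide_nonneg_nonneg mult_nonneg_nonneg add_nonneg_nonneg) auto
    have "p * (1 + p * (w / sqrt m)) \<le> p * (1 + 1 * (w / sqrt m))"
      using p y0 by (intro mult_left_mono add_left_mono mult_right_mono) auto
    moreover have "0 < 1 + p * (w / sqrt m)" using py0 by linarith
    ultimately show "p \<le> pz" unfolding pz_def by (simp add: pos_le_divide_eq)
  qed
  have "BE \<Omega> p (\<lambda>S. of_bool (B S)) - exp (- w\<^sup>2) * BE \<Omega> pz (\<lambda>S. of_bool (B S)) \<le> Unif \<Omega> (m - r) B"
    unfolding pz_def
  proof (rule Unif_lower[OF fin inc p(1,2), where M = "real m"])
    show "m - r \<le> card \<Omega>" unfolding cO using m by simp
    have "p * card \<Omega> \<le> p * (n choose 2)" using p unfolding cO by (intro mult_left_mono) auto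
    also have "\<dots> \<le> real (m - r) - 2 * w * sqrt m" using p m by (simp add: of_nat_diff)
    finally show "p * card \<Omega> \<le> real (m - r) - 2 * w * sqrt m" .
  qed (use w m in auto)
  \<comment> \<open>Any upper bound \<open>p2\<close> of the tilted density serves, because
    \<open>qf\<close> decreases in the density. Later one density is used both here and for the
    upper bounds.\<close>
  moreover have "(1 - qf (k - r) pz) ^ (n - (k + r)) \<le> (1 - qf (k - r) p2) ^ (n - (k + r))"
    using qf_lipschitz(1)[OF h pz(1), of p2] p2 pz qf_le_1[of pz "k - r"] by (intro power_mono) (auto simp: pz_def)
  ultimately have "(1 - qf (k - r) p) ^ (n - (k + r)) - exp (- w\<^sup>2) * (1 - qf (k - r) p2) ^ (n - (k + r)) \<le> Unif \<Omega> (m - r) B"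
    unfolding BE by (smt (verit) exp_gt_zero mult_left_mono)
  then have "cc (n choose 2) m r (card (forb K M)) *
      ((1 - qf (k - r) p) ^ (n - (k + r)) - exp (- w\<^sup>2) * (1 - qf (k - r) p2) ^ (n - (k + r)))
    \<le> cc (n choose 2) m (card M) (card (forb K M)) * Unif \<Omega> (m - card M) B"
    unfolding M(2) by (intro mult_left_mono cc_nonneg)
  also have "\<dots> \<le> Pr n m (good n K M)"
    unfolding \<Omega>_def
  proof (rule Pr_lower[OF E(1,2,3)])
    fix S assume S: "S \<subseteq> all_edges n - M - forb K M" "B S"
    have "2 \<le> card ((S \<union> M) \<inter> star v I)" if "v \<in> V0" for v
      using incr_card_Int[OF finite_all_edges[of n], of S "S \<union> M" 2 "star v I"] S that E unfolding B_def by blast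
    then show "good n K M (S \<union> M)"
      using S E by (subst good_iff[OF cfg]) (auto simp: I_def V0_def)
  qed (use M m in auto)
  finally show ?thesis .
qed

text \<open>Inclusion and exclusion: both conditions hold with probability 1 minus the two failures
  plus the probability of a double failure. A double failure leaves at most two edges from
  \<open>v\<close> into \<open>I \<union> I'\<close>, a set of at least \<open>2 * h - l\<close>
  vertices.\<close>

lemma joint_outer:
  fixes p :: real
  assumes I: "finite I" "finite I'" "card I = h" "card I' = h" and c: "2 * h - l \<le> card (I \<union> I')" "2 \<le> 2 * h - l"
    and p: "0 \<le> p" "p \<le> 1"
  shows "BE (star v (I \<union> I')) p (\<lambda>S. of_bool (2 \<le> card (S \<inter> star v I) \<and> 2 \<le> card (S \<inter> star v I')))
    \<le> 1 - 2 * qf h p + (1 - p) ^ (2 * h - l - 2) * (1 + 2 * h * p + (2 * h * p)\<^sup>2)"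
proof -
  let ?A = "star v (I \<union> I')"
  have fin: "finite ?A" using I by simp
  have sub: "star v I \<subseteq> ?A" "star v I' \<subseteq> ?A" by (auto simp: star_Un)
  have q: "BE ?A p (\<lambda>S. of_bool (card (S \<inter> star v J) \<le> 1)) = qf (card J) p" if "star v J \<subseteq> ?A" "finite J" for J
    using BE_restrict[OF fin that(1), of p "\<lambda>S. of_bool (card S \<le> 1)"] BE_card_le1[of "star v J" p] that star_card by simp
  have "BE ?A p (\<lambda>S. of_bool (2 \<le> card (S \<inter> star v I) \<and> 2 \<le> card (S \<inter> star v I')))
    \<le> BE ?A p (\<lambda>S. ((1 - of_bool (card (S \<inter> star v I) \<le> 1)) - of_bool (card (S \<inter> star v I') \<le> 1)) + of_bool (card S \<le> 2))"
  proof (rule BE_mono[OF p])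
    fix S assume S: "S \<subseteq> ?A"
    then have "S = (S \<inter> star v I) \<union> (S \<inter> star v I')" by (auto simp: star_Un)
    then have "card S \<le> card (S \<inter> star v I) + card (S \<inter> star v I')" by (metis card_Un_le)
    then show "of_bool (2 \<le> card (S \<inter> star v I) \<and> 2 \<le> card (S \<inter> star v I'))
      \<le> ((1 - of_bool (card (S \<inter> star v I) \<le> 1)) - of_bool (card (S \<inter> star v I') \<le> 1)) + (of_bool (card S \<le> 2) :: real)"
      by (auto simp: not_le)
  qed
  also have "\<dots> = 1 - qf h p - qf h p + BE ?A p (\<lambda>S. of_bool (card S \<le> 2))"
    unfolding BE_add BE_diff using q[OF sub(1) I(1)] q[OF sub(2) I(2)] fin I by simp
  also have "BE ?A p (\<lambda>S. of_bool (card S \<le> 2)) \<le> (1 - p) ^ (2 * h - l - 2) * (1 + 2 * h * p + (2 * h * p)\<^sup>2)"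
  proof -
    have cA: "card ?A = card (I \<union> I')" using I by (simp add: star_card)
    have "card ?A \<le> 2 * h" unfolding cA using card_Un_le[of I I'] I by simp
    then have cle: "real (card ?A) \<le> 2 * real h" by linarith
    have "BE ?A p (\<lambda>S. of_bool (card S \<le> 2)) \<le> (1 - p) ^ (card ?A - 2) * (1 + card ?A * p + (card ?A * p)\<^sup>2)"
      using c cA by (intro BE_card_le2[OF fin _ p]) auto
    also have "\<dots> \<le> (1 - p) ^ (2 * h - l - 2) * (1 + 2 * h * p + (2 * h * p)\<^sup>2)"
    proof (intro mult_mono power_decreasing add_mono power_mono)
      show "2 * h - l - 2 \<le> card ?A - 2" using c cA by simp
    qed (use p cle in auto)
    finally show ?thesis .
  qed
  finally show ?thesis by simp
qed

text \<open>Extracts (1 - q)^(2 a), the square of the single probability. The exponents may fall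
  short of 2 a by 4 r, since up to 2 r vertices of \<open>\<Union>M\<close> and of
  \<open>\<Union>M'\<close> contribute no factor; a missing factor costs at most exp (2 q), because
  (1 - q) exp (2 q) is at least 1 for q at most 1/2.\<close>

lemma joint_numeric:
  fixes q Q2 e :: real and a n0 \<alpha> \<beta> r n h :: nat
  assumes q: "0 \<le> q" "q \<le> 1/2" and "0 \<le> Q2" "0 \<le> e" "2 * a \<le> 2 * n0 + \<alpha> + \<beta> + 4 * r" "n0 \<le> n" "\<alpha> \<le> h"
  shows "(1 - 2 * q + Q2) ^ n0 * ((1 - q) ^ \<beta> * (1 - q + e) ^ \<alpha>) \<le> (1 - q) ^ (2 * a) * exp (8 * real r * q + 4 * real n * Q2 + 2 * real h * e)"
proof -
  have inv: "1 \<le> (1 - q) * exp (2 * q)"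
  proof -
    have "0 \<le> q * (1 - 2 * q)" using q by (intro mult_nonneg_nonneg) auto
    then have "1 \<le> (1 - q) * (1 + 2 * q)" by (simp add: algebra_simps)
    also have "\<dots> \<le> (1 - q) * exp (2 * q)" using q exp_ge_add_one_self[of "2 * q"] by (intro mult_left_mono) auto
    finally show ?thesis .
  qed
  have 1: "1 - 2 * q + Q2 \<le> (1 - q)\<^sup>2 * exp (4 * Q2)"
  proof -
    have "(1/2)\<^sup>2 \<le> (1 - q)\<^sup>2" using q by (intro power_mono) auto
    then have "Q2 \<le> (1 - q)\<^sup>2 * (4 * Q2)" using mult_right_mono[of "1/4" "(1 - q)\<^sup>2" "4 * Q2"] assms by (simp add: power2_eq_square)
    moreover have "1 - 2 * q \<le> (1 - q)\<^sup>2" using zero_le_power2[of q] by (simp add: power2_eq_square algebra_simps)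
    ultimately have "1 - 2 * q + Q2 \<le> (1 - q)\<^sup>2 * (1 + 4 * Q2)" by (simp only: distrib_left mult_1_right add_mono)
    also have "\<dots> \<le> (1 - q)\<^sup>2 * exp (4 * Q2)" by (intro mult_left_mono exp_ge_add_one_self) auto
    finally show ?thesis .
  qed
  have 2: "1 - q + e \<le> (1 - q) * exp (2 * e)"
  proof -
    have "e \<le> (1 - q) * (2 * e)" using mult_right_mono[of "1/2" "1 - q" "2 * e"] assms by simp
    then have "1 - q + e \<le> (1 - q) * (1 + 2 * e)" by (simp add: algebra_simps)
    also have "\<dots> \<le> (1 - q) * exp (2 * e)" using q by (intro mult_left_mono exp_ge_add_one_self) auto
    finally show ?thesis .
  qed
  have "(1 - 2 * q + Q2) ^ n0 * ((1 - q) ^ \<beta> * (1 - q + e) ^ \<alpha>)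
      \<le> ((1 - q)\<^sup>2 * exp (4 * Q2)) ^ n0 * ((1 - q) ^ \<beta> * ((1 - q) * exp (2 * e)) ^ \<alpha>)"
    using 1 2 assms by (intro mult_mono power_mono) auto
  also have "\<dots> = (1 - q) ^ (2 * n0 + \<alpha> + \<beta>) * (exp (4 * n0 * Q2) * exp (2 * \<alpha> * e))"
  proof -
    have "exp (4 * Q2) ^ n0 = exp (4 * n0 * Q2)" "exp (2 * e) ^ \<alpha> = exp (2 * \<alpha> * e)"
      by (simp_all add: exp_of_nat_mult[symmetric] mult_ac)
    then show ?thesis unfolding power_mult_distrib power_mult[symmetric] power_add by (simp add: mult_ac)
  qed
  also have "\<dots> \<le> (1 - q) ^ (2 * n0 + \<alpha> + \<beta>) * (exp (4 * n * Q2) * exp (2 * h * e))"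
    using assms by (intro mult_left_mono mult_mono) (auto intro!: mult_right_mono)
  also have "(1 - q) ^ (2 * n0 + \<alpha> + \<beta>) \<le> (1 - q) ^ (2 * a) * exp (8 * r * q)"
  proof -
    have "1 \<le> ((1 - q) * exp (2 * q)) ^ (4 * r)" using inv by (rule one_le_power)
    then have "(1 - q) ^ (2 * n0 + \<alpha> + \<beta>) * 1 \<le> (1 - q) ^ (2 * n0 + \<alpha> + \<beta>) * ((1 - q) * exp (2 * q)) ^ (4 * r)"
      using q by (intro mult_left_mono) auto
    also have "\<dots> = (1 - q) ^ (2 * n0 + \<alpha> + \<beta> + 4 * r) * exp (8 * r * q)"
    proof -
      have "exp (2 * q) ^ (4 * r) = exp (8 * r * q)" by (simp add: exp_of_nat_mult[symmetric] mult_ac)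
      then show ?thesis unfolding power_mult_distrib power_add by (simp add: mult_ac)
    qed
    also have "\<dots> \<le> (1 - q) ^ (2 * a) * exp (8 * r * q)"
      using q assms by (intro mult_right_mono power_decreasing) auto
    finally show ?thesis by simp
  qed
  finally have "(1 - 2 * q + Q2) ^ n0 * ((1 - q) ^ \<beta> * (1 - q + e) ^ \<alpha>)
    \<le> (1 - q) ^ (2 * a) * exp (8 * r * q) * (exp (4 * n * Q2) * exp (2 * h * e))"
    by (simp add: mult_right_mono)
  then show ?thesis by (simp add: exp_add mult_ac)
qed

text \<open>A vertex of \<open>K' - K\<close> outside \<open>V(M')\<close> has no neighbour in \<open>K \<inter> K'\<close>, so its neighbours in
  \<open>K - V(M)\<close> lie in \<open>K - K'\<close>; the two symmetric families of such vertices share all their relevant edges.\<close>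

lemma joint_small_overlap:
  fixes p w :: real
  assumes cfg: "(K, M) \<in> configs n k r" and cfg': "(K', M') \<in> configs n k r"
    and l: "card (K \<inter> K') = l" and f: "card (forb K M) = f" "card (forb K' M') = f"
    and m: "m + 2 * f \<le> n choose 2" "2 * r \<le> m" "0 < m"
    and p: "0 \<le> p" "p \<le> 1" "real m + 3 * w * sqrt m \<le> p * (real (n choose 2) - 2 * r - 2 * f)"
    and w: "0 < w" "w \<le> sqrt m / 2"
    and h0: "h0 + 1 + 2 * r + l \<le> k + r" "qf h0 p \<le> 1/2" and hl: "2 \<le> 2 * (k - r) - l"
  defines "q \<equiv> qf (k - r) p" and "Q \<equiv> qf h0 p"
    and "Q2 \<equiv> (1 - p) ^ (2 * (k - r) - l - 2) * (1 + 2 * real (k - r) * p + (2 * real (k - r) * p)\<^sup>2)"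
  shows "Pr n m (\<lambda>G. good n K M G \<and> good n K' M' G) * (1 - exp (- w\<^sup>2))
    \<le> cc (n choose 2) m (2 * r - card (M \<inter> M')) (2 * f - card (forb K M \<inter> forb K' M')) *
      ((1 - q) ^ (2 * (n - (k + r))) * exp (8 * real r * q + 4 * real n * Q2 + 2 * real (k - r) * (2 * real (k - r) * p * Q\<^sup>2)))"
proof -
  note K = cfg_K[OF cfg] and M = cfg_M[OF cfg] and U = cfg_U[OF cfg] and E = cfg_edges[OF cfg]
  note K' = cfg_K[OF cfg'] and M' = cfg_M[OF cfg'] and U' = cfg_U[OF cfg'] and E' = cfg_edges[OF cfg']
  define h where "h = k - r"
  define R where "R = M \<union> M'"
  define Fb where "Fb = forb K M \<union> forb K' M'"
  define I where "I = K - \<Union>M"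
  define I' where "I' = K' - \<Union>M'"
  define VI where "VI = (K - K') - \<Union>M"
  define WI where "WI = (K' - K) - \<Union>M'"
  define V0 where "V0 = {1..n} - (K \<union> K')"
  define \<Omega> where "\<Omega> = all_edges n - R - Fb"
  define Bo where "Bo S = (\<forall>v\<in>V0. 2 \<le> card (S \<inter> star v I) \<and> 2 \<le> card (S \<inter> star v I'))" for S
  define Bi where "Bi S = ((\<forall>w\<in>WI. 2 \<le> card (S \<inter> star w VI)) \<and> (\<forall>v\<in>VI. 2 \<le> card (S \<inter> star v WI)))" for S
  define B where "B S = (Bo S \<and> Bi S)" for S
  let ?J = "\<lambda>G. good n K M G \<and> good n K' M' G"
  have fin: "finite \<Omega>" by (simp add: \<Omega>_def)
  have I: "finite I" "card I = h" "finite I'" "card I' = h"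
    using K K' cfg_I[OF cfg] cfg_I[OF cfg'] by (auto simp: I_def I'_def h_def)
  have fins: "finite VI" "finite WI" "finite V0" using K K' by (auto simp: VI_def WI_def V0_def)
  have q: "0 \<le> q" "q \<le> Q" "Q \<le> 1/2" "0 \<le> Q"
  proof -
    have "h0 \<le> k - r" using h0(1) by linarith
    then show "q \<le> Q" unfolding q_def Q_def using p by (intro qf_antimono_h)
  qed (use p h0 in \<open>auto simp: q_def Q_def intro!: qf_nonneg\<close>)
  have Q2: "0 \<le> Q2" unfolding Q2_def using p by (intro mult_nonneg_nonneg add_nonneg_nonneg) auto
  have cR: "card R = 2 * r - card (M \<inter> M')"
    unfolding R_def using card_Un_Int[OF M(4) M'(4)] M(2) M'(2) by simp
  have cF: "card Fb = 2 * f - card (forb K M \<inter> forb K' M')"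
    unfolding Fb_def using card_Un_Int[OF cfg_finite_forb[OF cfg] cfg_finite_forb[OF cfg']] f by simp
  have RE: "R \<subseteq> all_edges n" "Fb \<subseteq> all_edges n" using E E' by (auto simp: R_def Fb_def)
  let ?rhs = "(1 - q) ^ (2 * (n - (k + r))) * exp (8 * real r * q + 4 * real n * Q2 + 2 * real (k - r) * (2 * real (k - r) * p * Q\<^sup>2))"
  have rhs0: "0 \<le> ?rhs" using q by auto
  have graphE: "G \<subseteq> all_edges n" if "G \<in> graphs_nm n m" for G using that by (auto simp: graphs_nm_def)
  show ?thesis
  proof (cases "R \<inter> Fb = {}")
    case False
    \<comment> \<open>A pair required as an edge by one configuration is forbidden by the
      other.\<close>
    have "{G \<in> graphs_nm n m. ?J G} = {}"
    proof (rule ccontr)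
      assume "{G \<in> graphs_nm n m. ?J G} \<noteq> {}"
      then obtain G where G: "G \<in> graphs_nm n m" "good n K M G" "good n K' M' G" by auto
      then have "R \<subseteq> G" "G \<inter> Fb = {}"
        using good_iff[OF cfg graphE[OF G(1)]] good_iff[OF cfg' graphE[OF G(1)]] by (auto simp: R_def Fb_def)
      then show False using False by auto
    qed
    then have "Pr n m ?J = 0" unfolding Pr_def by simp
    then show ?thesis using rhs0 by (simp add: cc_nonneg mult_nonneg_nonneg del: mult_eq_0_iff)
  next
    case disj: True
    have cO: "card \<Omega> = (n choose 2) - card R - card Fb" unfolding \<Omega>_def by (rule card_Omega[OF RE disj])
    have v0: "star v J \<subseteq> \<Omega>" if "v \<in> V0" "J \<subseteq> K \<union> K'" for v J
    proof -
      have v: "v \<in> {1..n}" "v \<notin> K" "v \<notin> K'" using that by (auto simp: V0_def)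
      have "star v J \<subseteq> all_edges n" using v K(1) K'(1) that by (intro star_subset_edges) auto
      moreover have "star v J \<inter> {e. e \<subseteq> K \<or> e \<subseteq> K'} = {}" using v by (auto simp: star_def)
      ultimately show ?thesis using M(1) M'(1) unfolding \<Omega>_def R_def Fb_def forb_def by blast
    qed
    have wv: "star w VI \<subseteq> \<Omega>" if "w \<in> WI" for w
    proof -
      have v: "w \<in> {1..n}" "w \<notin> K" "w \<in> K'" using that K'(1) by (auto simp: WI_def)
      have "star w VI \<subseteq> all_edges n" using v K(1) by (intro star_subset_edges) (auto simp: VI_def)
      moreover have "star w VI \<inter> {e. e \<subseteq> K \<or> e \<subseteq> K'} = {}" using v by (auto simp: star_def VI_def)
      ultimately show ?thesis using M(1) M'(1) unfolding \<Omega>_def R_def Fb_def forb_def by blast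
    qed
    have vw: "star v WI \<subseteq> \<Omega>" if "v \<in> VI" for v
    proof -
      have v: "v \<in> {1..n}" "v \<notin> K'" "v \<in> K" using that K(1) by (auto simp: VI_def)
      have "star v WI \<subseteq> all_edges n" using v K'(1) by (intro star_subset_edges) (auto simp: WI_def)
      moreover have "star v WI \<inter> {e. e \<subseteq> K \<or> e \<subseteq> K'} = {}" using v by (auto simp: star_def WI_def)
      ultimately show ?thesis using M(1) M'(1) unfolding \<Omega>_def R_def Fb_def forb_def by blast
    qed
    have inc: "incr \<Omega> B"
    proof (intro allI impI)
      fix S T assume ST: "S \<subseteq> T" "T \<subseteq> \<Omega>" "B S"
      then show "B T" unfolding B_def Bo_def Bi_def using incr_card_Int[OF fin ST(1,2)] by blast
    qed
    have "Pr n m ?J \<le> cc (n choose 2) m (card R) (card Fb) * Unif \<Omega> (m - card R) B"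
      unfolding \<Omega>_def
    proof (rule Pr_upper[OF RE disj])
      show "card R \<le> m" "m + card Fb \<le> n choose 2" using cR cF m by auto
      fix G assume G: "G \<in> graphs_nm n m" "?J G"
      have GE: "G \<subseteq> all_edges n" using graphE[OF G(1)] .
      have g: "M \<subseteq> G" "G \<inter> forb K M = {}" "\<And>v. v \<in> {1..n} - K \<Longrightarrow> 2 \<le> card (G \<inter> star v I)"
        using good_iff[OF cfg GE] G(2) by (auto simp: I_def)
      have g': "M' \<subseteq> G" "G \<inter> forb K' M' = {}" "\<And>v. v \<in> {1..n} - K' \<Longrightarrow> 2 \<le> card (G \<inter> star v I')"
        using good_iff[OF cfg' GE] G(2) by (auto simp: I'_def)
      have "Bo (G - R)"
        unfolding Bo_def
      proof
        fix v assume v: "v \<in> V0"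
        have "star v I \<inter> R = {}" "star v I' \<inter> R = {}"
          using v0[OF v, of I] v0[OF v, of I'] by (auto simp: \<Omega>_def I_def I'_def)
        then have "(G - R) \<inter> star v I = G \<inter> star v I" "(G - R) \<inter> star v I' = G \<inter> star v I'" by auto
        then show "2 \<le> card ((G - R) \<inter> star v I) \<and> 2 \<le> card ((G - R) \<inter> star v I')"
          using g(3)[of v] g'(3)[of v] v by (auto simp: V0_def)
      qed
      moreover have "Bi (G - R)"
        unfolding Bi_def
      proof (intro conjI ballI)
        fix w assume w: "w \<in> WI"
        have "G \<inter> star w I \<subseteq> (G - R) \<inter> star w VI"
        proof
          fix e assume e: "e \<in> G \<inter> star w I"
          then obtain y where y: "e = {w, y}" "y \<in> I" unfolding star_def by auto
          have "y \<notin> K'"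
          proof
            assume "y \<in> K'"
            then have "e \<subseteq> K'" using y w by (auto simp: WI_def)
            moreover have "\<not> e \<subseteq> \<Union>M'" "w \<noteq> y" using y w by (auto simp: WI_def I_def)
            ultimately have "e \<in> forb K' M'" using y by (auto simp: forb_def card_insert_if)
            then show False using e g' by auto
          qed
          then have "e \<in> star w VI" using y by (auto simp: star_def VI_def I_def)
          then show "e \<in> (G - R) \<inter> star w VI" using e wv[OF w] by (auto simp: \<Omega>_def)
        qed
        then have "card (G \<inter> star w I) \<le> card ((G - R) \<inter> star w VI)" using fins by (intro card_mono) auto
        moreover have "w \<in> {1..n} - K" using w K' by (auto simp: WI_def)
        ultimately show "2 \<le> card ((G - R) \<inter> star w VI)" using g(3)[of w] by simp
      next
        fix v assume v: "v \<in> VI"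
        have "G \<inter> star v I' \<subseteq> (G - R) \<inter> star v WI"
        proof
          fix e assume e: "e \<in> G \<inter> star v I'"
          then obtain y where y: "e = {v, y}" "y \<in> I'" unfolding star_def by auto
          have "y \<notin> K"
          proof
            assume "y \<in> K"
            then have "e \<subseteq> K" using y v by (auto simp: VI_def)
            moreover have "\<not> e \<subseteq> \<Union>M" "v \<noteq> y" using y v by (auto simp: VI_def I'_def)
            ultimately have "e \<in> forb K M" using y by (auto simp: forb_def card_insert_if)
            then show False using e g by auto
          qed
          then have "e \<in> star v WI" using y by (auto simp: star_def WI_def I'_def)
          then show "e \<in> (G - R) \<inter> star v WI" using e vw[OF v] by (auto simp: \<Omega>_def)
        qed
        then have "card (G \<inter> star v I') \<le> card ((G - R) \<inter> star v WI)" using fins by (intro card_mono) auto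
        moreover have "v \<in> {1..n} - K'" using v K by (auto simp: VI_def)
        ultimately show "2 \<le> card ((G - R) \<inter> star v WI)" using g'(3)[of v] by simp
      qed
      ultimately show "R \<subseteq> G \<and> G \<inter> Fb = {} \<and> B (G - R)"
        using g g' by (auto simp: R_def Fb_def B_def)
    qed
    then have "Pr n m ?J * (1 - exp (- w\<^sup>2)) \<le> cc (n choose 2) m (card R) (card Fb) * Unif \<Omega> (m - card R) B * (1 - exp (- w\<^sup>2))"
      by (rule mult_right_mono) simp
    also have "\<dots> \<le> cc (n choose 2) m (card R) (card Fb) * BE \<Omega> p (\<lambda>S. of_bool (B S))"
      unfolding mult.assoc
    proof (intro mult_left_mono cc_nonneg Unif_upper[OF fin inc p(1,2), where M = "real m"])
      show "m - card R \<le> card \<Omega>" unfolding cO using cR cF m by simp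
      have "real (n choose 2) - 2 * r - 2 * f \<le> card \<Omega>" unfolding cO using cR cF m by (simp add: of_nat_diff)
      then have "p * (real (n choose 2) - 2 * r - 2 * f) \<le> p * card \<Omega>" using p by (intro mult_left_mono) auto
      then show "real m + 3 * w * sqrt (real m) \<le> p * card \<Omega>" using p by simp
    qed (use m w in auto)
    also have "\<dots> \<le> cc (n choose 2) m (card R) (card Fb) * ?rhs"
    proof (rule mult_left_mono[OF _ cc_nonneg])
      have cVI: "card VI \<le> h" "card WI \<le> h"
        using I card_mono[of I VI] card_mono[of I' WI] by (auto simp: VI_def WI_def I_def I'_def)
      have cKK: "card (K - K') = k + r - l" "card (K' - K) = k + r - l"
        using K K' l card_Diff_subset_Int[of K K'] card_Diff_subset_Int[of K' K] by (auto simp: Int_commute)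
      have lo: "k + r - l \<le> card VI + 2 * r" "k + r - l \<le> card WI + 2 * r"
      proof -
        have "K - K' \<subseteq> VI \<union> \<Union>M" "K' - K \<subseteq> WI \<union> \<Union>M'" by (auto simp: VI_def WI_def)
        then have "card (K - K') \<le> card (VI \<union> \<Union>M)" "card (K' - K) \<le> card (WI \<union> \<Union>M')"
          using fins U U' by (auto intro!: card_mono)
        then show "k + r - l \<le> card VI + 2 * r" "k + r - l \<le> card WI + 2 * r"
          using card_Un_le[of VI "\<Union>M"] card_Un_le[of WI "\<Union>M'"] U U' cKK by auto
      qed
      have cV0: "card V0 = n - (k + r) - (k + r - l)"
      proof -
        have "card (K \<union> K') = (k + r) + (k + r - l)"
          using card_Un_disjoint[of K "K' - K"] K K' cKK by auto
        moreover have "K \<union> K' \<subseteq> {1..n}" using K K' by auto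
        ultimately show ?thesis unfolding V0_def using K K' by (simp add: card_Diff_subset)
      qed
      have cII: "2 * h - l \<le> card (I \<union> I')"
      proof -
        have "card (I \<inter> I') \<le> l" unfolding l[symmetric] using K by (intro card_mono) (auto simp: I_def I'_def)
        then show ?thesis using card_Un_Int[of I I'] I by simp
      qed
      have "BE \<Omega> p (\<lambda>S. of_bool (B S)) = BE \<Omega> p (\<lambda>S. of_bool (Bo S) * of_bool (Bi S))"
        unfolding B_def by (intro BE_cong) auto
      \<comment> \<open>\<open>Bo\<close> reads only pairs with a vertex outside
        \<open>K \<union> K'\<close>, and \<open>Bi\<close> only pairs between \<open>VI\<close> and
        \<open>WI\<close>.\<close>
      also have "\<dots> = BE \<Omega> p (\<lambda>S. of_bool (Bo S)) * BE \<Omega> p (\<lambda>S. of_bool (Bi S))"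
      proof (rule BE_split_indep[OF fin, of "\<Union>v\<in>V0. star v (I \<union> I')" "(\<Union>w\<in>WI. star w VI) \<union> (\<Union>v\<in>VI. star v WI)"])
        show "(\<Union>v\<in>V0. star v (I \<union> I')) \<subseteq> \<Omega>"
        proof (rule UN_least)
          fix v assume "v \<in> V0" then show "star v (I \<union> I') \<subseteq> \<Omega>" by (rule v0) (auto simp: I_def I'_def)
        qed
        show "(\<Union>w\<in>WI. star w VI) \<union> (\<Union>v\<in>VI. star v WI) \<subseteq> \<Omega>"
          by (intro Un_least UN_least wv vw)
        have "star v (I \<union> I') \<inter> star x VI = {}" if "v \<in> V0" "x \<in> WI" for v x
          using that by (intro star_disjoint) (auto simp: V0_def WI_def VI_def)
        moreover have "star v (I \<union> I') \<inter> star x WI = {}" if "v \<in> V0" "x \<in> VI" for v x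
          using that by (intro star_disjoint) (auto simp: V0_def WI_def VI_def)
        ultimately show "(\<Union>v\<in>V0. star v (I \<union> I')) \<inter> ((\<Union>w\<in>WI. star w VI) \<union> (\<Union>v\<in>VI. star v WI)) = {}"
          by blast
        fix S
        let ?A = "\<Union>v\<in>V0. star v (I \<union> I')" and ?B = "(\<Union>w\<in>WI. star w VI) \<union> (\<Union>v\<in>VI. star v WI)"
        have "S \<inter> ?A \<inter> star v I = S \<inter> star v I" "S \<inter> ?A \<inter> star v I' = S \<inter> star v I'" if "v \<in> V0" for v
          using that by (auto simp: star_Un)
        then show "of_bool (Bo S) = (of_bool (Bo (S \<inter> ?A)) :: real)" unfolding Bo_def by simp
        have "S \<inter> ?B \<inter> star v VI = S \<inter> star v VI" if "v \<in> WI" for v using that by auto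
        moreover have "S \<inter> ?B \<inter> star v WI = S \<inter> star v WI" if "v \<in> VI" for v using that by auto
        ultimately show "of_bool (Bi S) = (of_bool (Bi (S \<inter> ?B)) :: real)" unfolding Bi_def by simp
      qed
      also have "\<dots> \<le> (1 - 2 * q + Q2) ^ card V0 * ((1 - q) ^ card WI * (1 - q + 2 * real h * p * Q\<^sup>2) ^ card VI)"
      proof (rule mult_mono)
        have "BE \<Omega> p (\<lambda>S. of_bool (Bo S)) = BE \<Omega> p (\<lambda>S. of_bool (\<forall>v\<in>V0. (\<lambda>v T. 2 \<le> card (T \<inter> star v I) \<and> 2 \<le> card (T \<inter> star v I')) v (S \<inter> star v (I \<union> I'))))"
        proof (rule BE_cong)
          fix S
          have "S \<inter> star v (I \<union> I') \<inter> star v I = S \<inter> star v I" "S \<inter> star v (I \<union> I') \<inter> star v I' = S \<inter> star v I'" for v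
            by (auto simp: star_Un)
          then show "of_bool (Bo S) = (of_bool (\<forall>v\<in>V0. (\<lambda>v T. 2 \<le> card (T \<inter> star v I) \<and> 2 \<le> card (T \<inter> star v I')) v (S \<inter> star v (I \<union> I'))) :: real)"
            unfolding Bo_def by simp
        qed
        also have "\<dots> = (\<Prod>v\<in>V0. BE (star v (I \<union> I')) p (\<lambda>T. of_bool (2 \<le> card (T \<inter> star v I) \<and> 2 \<le> card (T \<inter> star v I'))))"
        proof (rule BE_ball_prod[OF fin fins(3)])
          fix v assume "v \<in> V0" then show "star v (I \<union> I') \<subseteq> \<Omega>" by (rule v0) (auto simp: I_def I'_def)
        next
          fix v v' assume "v \<in> V0" "v' \<in> V0" "v \<noteq> v'"
          then show "star v (I \<union> I') \<inter> star v' (I \<union> I') = {}"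
            by (intro star_disjoint) (auto simp: V0_def I_def I'_def)
        qed
        also have "\<dots> \<le> (\<Prod>v\<in>V0. 1 - 2 * q + Q2)"
        proof (rule prod_mono)
          fix v assume "v \<in> V0"
          have "0 \<le> BE (star v (I \<union> I')) p (\<lambda>T. of_bool (2 \<le> card (T \<inter> star v I) \<and> 2 \<le> card (T \<inter> star v I')))"
            using p by (intro BE_nonneg) auto
          moreover have "BE (star v (I \<union> I')) p (\<lambda>T. of_bool (2 \<le> card (T \<inter> star v I) \<and> 2 \<le> card (T \<inter> star v I'))) \<le> 1 - 2 * q + Q2"
            using joint_outer[OF I(1,3,2,4) cII _ p(1,2)] hl unfolding q_def Q2_def h_def[symmetric] by simp
          ultimately show "0 \<le> BE (star v (I \<union> I')) p (\<lambda>T. of_bool (2 \<le> card (T \<inter> star v I) \<and> 2 \<le> card (T \<inter> star v I'))) \<and>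
             BE (star v (I \<union> I')) p (\<lambda>T. of_bool (2 \<le> card (T \<inter> star v I) \<and> 2 \<le> card (T \<inter> star v I'))) \<le> 1 - 2 * q + Q2"
            by blast
        qed
        finally show "BE \<Omega> p (\<lambda>S. of_bool (Bo S)) \<le> (1 - 2 * q + Q2) ^ card V0" by simp
        \<comment> \<open>\<open>h0\<close> is a lower bound even for \<open>card VI - 1\<close>,
          the size left in a row of \<open>bipartite_min_degree\<close> after one shared pair is
          removed. This is the reason for the summand 1 in the hypothesis on
          \<open>h0\<close>.\<close>
        have qVI: "qf (card VI) p \<le> Q" "qf (card VI - 1) p \<le> Q" "qf (card WI) p \<le> Q"
          unfolding Q_def using lo h0 p by (auto intro!: qf_antimono_h)
        have qh: "q \<le> qf (card VI) p" "q \<le> qf (card WI) p"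
          unfolding q_def using cVI p by (auto intro!: qf_antimono_h simp: h_def)
        let ?eta = "card WI * p * qf (card VI - 1) p / (1 - qf (card VI) p)"
        have "BE \<Omega> p (\<lambda>S. of_bool (Bi S)) \<le> (1 - qf (card VI) p) ^ card WI * (1 - qf (card WI) p * (1 - ?eta)) ^ card VI"
          unfolding Bi_def
        proof (rule bipartite_min_degree[OF fin fins(2,1) p(1,2)])
          fix w v assume "w \<in> WI" "v \<in> VI"
          have "star w VI \<inter> star v WI \<subseteq> {{w, v}}"
            unfolding star_def using \<open>w \<in> WI\<close> \<open>v \<in> VI\<close> by (auto simp: doubleton_eq_iff WI_def VI_def)
          then have "card (star w VI \<inter> star v WI) \<le> card {{w, v}}" by (intro card_mono) auto
          then show "card (star w VI \<inter> star v WI) \<le> 1" by simp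
        next
          fix w w' assume "w \<in> WI" "w' \<in> WI" "w \<noteq> w'"
          then show "star w VI \<inter> star w' VI = {}" by (intro star_disjoint) (auto simp: WI_def VI_def)
        next
          fix v v' assume "v \<in> VI" "v' \<in> VI" "v \<noteq> v'"
          then show "star v WI \<inter> star v' WI = {}" by (intro star_disjoint) (auto simp: WI_def VI_def)
        qed (use wv vw fins qVI q in \<open>auto simp: star_card\<close>)
        also have "\<dots> \<le> (1 - q) ^ card WI * (1 - q + 2 * real h * p * Q\<^sup>2) ^ card VI"
        proof (intro mult_mono power_mono)
          have e0: "0 \<le> ?eta" using p qf_nonneg[OF p(1,2)] qVI q by (intro divide_nonneg_nonneg mult_nonneg_nonneg) auto
          have "?eta \<le> (h * p * Q) / (1/2)"
            using p qf_nonneg[OF p(1,2)] qVI q cVI by (intro frac_le mult_mono mult_nonneg_nonneg) auto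
          then have "qf (card WI) p * ?eta \<le> Q * ((h * p * Q) / (1/2))"
            using qVI q e0 by (intro mult_mono) auto
          then have e1: "qf (card WI) p * ?eta \<le> 2 * real h * p * Q\<^sup>2" by (simp add: power2_eq_square mult_ac)
          have "1 - qf (card WI) p * (1 - ?eta) = 1 - qf (card WI) p + qf (card WI) p * ?eta"
            by (simp only: right_diff_distrib mult_1_right diff_diff_eq2 diff_add_eq)
          then show "1 - qf (card WI) p * (1 - ?eta) \<le> 1 - q + 2 * real h * p * Q\<^sup>2" using e1 qh by linarith
          have "0 \<le> qf (card WI) p * ?eta" using e0 qf_nonneg[OF p(1,2)] by (intro mult_nonneg_nonneg)
          then show "0 \<le> 1 - qf (card WI) p * (1 - ?eta)"
            using qVI q \<open>1 - qf (card WI) p * (1 - ?eta) = 1 - qf (card WI) p + qf (card WI) p * ?eta\<close> by linarith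
          then show "0 \<le> (1 - qf (card WI) p * (1 - ?eta)) ^ card VI" by (rule zero_le_power)
        qed (use qh qVI q in auto)
        finally show "BE \<Omega> p (\<lambda>S. of_bool (Bi S)) \<le> (1 - q) ^ card WI * (1 - q + 2 * real h * p * Q\<^sup>2) ^ card VI" .
        show "0 \<le> BE \<Omega> p (\<lambda>S. of_bool (Bi S))" using p by (intro BE_nonneg) auto
        show "0 \<le> (1 - 2 * q + Q2) ^ card V0" using q Q2 by (intro zero_le_power) auto
      qed
      also have "\<dots> \<le> (1 - q) ^ (2 * (n - (k + r))) * exp (8 * real r * q + 4 * real n * Q2 + 2 * real h * (2 * real h * p * Q\<^sup>2))"
        using q Q2 p lo cVI cV0 by (intro joint_numeric) auto
      finally show "BE \<Omega> p (\<lambda>S. of_bool (B S)) \<le> ?rhs" unfolding h_def .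
    qed
    finally show ?thesis unfolding cR cF .
  qed
qed

section \<open>Structure and probability of pairs with large overlap\<close>

lemma card_le_of_disjoint_meets:
  assumes "finite T" "pairwise disjnt \<B>" "\<And>e. e \<in> \<B> \<Longrightarrow> e \<inter> T \<noteq> {}"
  shows "card \<B> \<le> card T"
proof -
  define \<phi> where "\<phi> e = (SOME x. x \<in> e \<inter> T)" for e
  have \<phi>: "\<phi> e \<in> e \<inter> T" if "e \<in> \<B>" for e
  proof -
    have "\<exists>x. x \<in> e \<inter> T" using assms(3)[OF that] by blast
    then show ?thesis unfolding \<phi>_def by (rule someI_ex)
  qed
  show ?thesis
  proof (rule card_inj_on_le[OF _ _ assms(1)])
    show "inj_on \<phi> \<B>"
    proof (rule inj_onI, rule ccontr)
      fix e e' assume "e \<in> \<B>" "e' \<in> \<B>" "\<phi> e = \<phi> e'" "e \<noteq> e'"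
      then have "disjnt e e'" "\<phi> e \<in> e" "\<phi> e \<in> e'" using \<phi>[of e] \<phi>[of e'] pairwiseD[OF assms(2)] by auto
      then show False unfolding disjnt_def by blast
    qed
    show "\<phi> ` \<B> \<subseteq> T" using \<phi> by auto
  qed
qed

text \<open>In a graph good for both configurations these edges of \<open>M'\<close> join
  \<open>K' - K\<close> to \<open>K - \<Union>M\<close>. Such an edge is forced, so it supplies one
  of the two neighbours in (iii) at no further cost; the number of these edges has to be tracked as
  a parameter.\<close>

definition crossing :: "nat set \<Rightarrow> nat set set \<Rightarrow> nat set \<Rightarrow> nat set set \<Rightarrow> nat set set" where
  "crossing K M K' M' = {e \<in> M'. e \<inter> ((K \<inter> K') - \<Union>M) \<noteq> {}}"

text \<open>A pair in \<open>K'\<close> is a new non-edge unless it lies in \<open>K\<close> or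
  inside \<open>\<Union>M'\<close>. A pair of the latter kind that leaves \<open>K\<close> joins
  \<open>K' - K\<close> to \<open>\<Union>M'\<close>, which gives at most 2 r i exceptions. The
  additive form avoids truncated subtraction.\<close>

lemma new_forbidden:
  assumes cfg: "(K, M) \<in> configs n k r" and cfg': "(K', M') \<in> configs n k r" and i: "card (K' - K) = i"
  shows "((k + r) choose 2) \<le> card (forb K' M' - forb K M) + ((k + r - i) choose 2) + 2 * r * i"
proof -
  note K = cfg_K[OF cfg] and K' = cfg_K[OF cfg'] and U' = cfg_U[OF cfg']
  let ?A = "forb K' M' - forb K M" and ?B = "{e. e \<subseteq> K \<inter> K' \<and> card e = 2}"
  let ?C = "(\<lambda>(w, y). {w, y}) ` ((K' - K) \<times> \<Union>M')"
  have cC: "card ?C \<le> 2 * r * i"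
  proof -
    have "card ?C \<le> card ((K' - K) \<times> \<Union>M')" using K' U' by (intro card_image_le) auto
    then show ?thesis using i U' by (simp add: card_cartesian_product mult_ac)
  qed
  have cB: "card ?B = ((k + r - i) choose 2)"
  proof -
    have "card K' = card (K' - K) + card (K' \<inter> K)" using K' by (metis card_Diff_subset_Int card_mono finite_Int inf_le1 le_add_diff_inverse2)
    then have "card (K \<inter> K') = k + r - i" using K' i by (simp add: Int_commute)
    then show ?thesis using card_pairs[of "K \<inter> K'"] K by simp
  qed
  have "{e. e \<subseteq> K' \<and> card e = 2} \<subseteq> ?A \<union> ?B \<union> ?C"
  proof
    fix e assume e: "e \<in> {e. e \<subseteq> K' \<and> card e = 2}"
    show "e \<in> ?A \<union> ?B \<union> ?C"
    proof (cases "e \<subseteq> K")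
      case True then show ?thesis using e by auto
    next
      case nK: False
      show ?thesis
      proof (cases "e \<subseteq> \<Union>M'")
        case True
        obtain a b where ab: "e = {a, b}" "a \<noteq> b" using e by (auto simp: card_2_iff)
        have "(a \<in> K' - K \<and> b \<in> \<Union>M') \<or> (b \<in> K' - K \<and> a \<in> \<Union>M')" using nK True e ab by auto
        then have "e \<in> ?C"
        proof
          assume "a \<in> K' - K \<and> b \<in> \<Union>M'" then show ?thesis using ab by (intro image_eqI[of _ _ "(a, b)"]) auto
        next
          assume "b \<in> K' - K \<and> a \<in> \<Union>M'" then show ?thesis using ab by (intro image_eqI[of _ _ "(b, a)"]) auto
        qed
        then show ?thesis by blast
      next
        case False then show ?thesis using e nK by (auto simp: forb_def)
      qed
    qed
  qed
  then have "card {e. e \<subseteq> K' \<and> card e = 2} \<le> card (?A \<union> ?B \<union> ?C)"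
    using K K' U' cfg_finite_forb[OF cfg'] finite_pairs[of "K \<inter> K'"] by (intro card_mono) auto
  also have "\<dots> \<le> card ?A + card ?B + card ?C"
    using card_Un_le[of "?A \<union> ?B" ?C] card_Un_le[of ?A ?B] by linarith
  finally show ?thesis using card_pairs[OF K'(3)] K' cB cC by simp
qed

context
  fixes n k r K M K' M' G
  assumes cfg: "(K, M) \<in> configs n k r" and cfg': "(K', M') \<in> configs n k r"
    and GE: "G \<subseteq> all_edges n" and gd: "good n K M G" and gd': "good n K' M' G"
begin

lemma joint_edge_K: "e \<in> G \<Longrightarrow> e \<subseteq> K \<Longrightarrow> e \<subseteq> \<Union>M"
  using gd by (auto simp: good_def)

lemma joint_edge_K': "e \<in> G \<Longrightarrow> e \<subseteq> K' \<Longrightarrow> e \<subseteq> \<Union>M'"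
  using gd' by (auto simp: good_def)

text \<open>The endpoint \<open>y\<close> is in \<open>K\<close> but not in
  \<open>\<Union>M\<close>, so (ii) for \<open>K\<close> forbids the other endpoint to lie in
  \<open>K\<close>.\<close>

lemma crossing_edge:
  assumes "e \<in> crossing K M K' M'"
  obtains w y where "w \<in> K' - K" "y \<in> (K \<inter> K') - \<Union>M" "e = {w, y}"
proof -
  have e: "e \<in> M'" "e \<inter> ((K \<inter> K') - \<Union>M) \<noteq> {}" using assms by (auto simp: crossing_def)
  then obtain y where y: "y \<in> e" "y \<in> (K \<inter> K') - \<Union>M" by auto
  have e2: "e \<subseteq> K'" "card e = 2" using e cfg_M(1)[OF cfg'] by auto
  then obtain w where w: "e = {w, y}" "w \<noteq> y" using y by (auto simp: card_2_iff)
  have "e \<in> G" using e gd' by (auto simp: good_def)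
  then have "w \<notin> K" using joint_edge_K[of e] y w by auto
  then show ?thesis using that w e2 y by auto
qed

text \<open>A crossing edge has exactly one endpoint in \<open>K' - K\<close>, whence the first
  three claims. The fourth balances two uses of \<open>M'\<close>: edges of \<open>M\<close> inside
  \<open>K'\<close> must be covered by \<open>\<Union>M'\<close>, and so are the crossing edges, on
  disjoint vertex sets. Every crossing edge is therefore paid for by an edge of \<open>M\<close>
  that leaves \<open>K'\<close>.\<close>

lemma crossing_card:
  "card (\<Union>(crossing K M K' M') \<inter> (K' - K)) = card (crossing K M K' M')"
  "card (\<Union>M' \<inter> ((K \<inter> K') - \<Union>M)) \<le> card (crossing K M K' M')"
  "card (crossing K M K' M') \<le> card (K' - K)"
  "card (crossing K M K' M') \<le> card ((K - K') \<inter> \<Union>M)"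
proof -
  note M = cfg_M[OF cfg] and M' = cfg_M[OF cfg'] and K = cfg_K[OF cfg] and K' = cfg_K[OF cfg']
  note U = cfg_U[OF cfg] and U' = cfg_U[OF cfg']
  let ?X = "crossing K M K' M'"
  let ?W = "K' - K"
  have X: "?X \<subseteq> M'" "finite ?X" using M' finite_subset[of ?X M'] by (auto simp: crossing_def)
  have pX: "pairwise disjnt ?X" using M'(3) X(1) by (rule pairwise_subset)
  have one: "card (e \<inter> ?W) = 1" if eX: "e \<in> ?X" for e
  proof -
    obtain w y where "w \<in> K' - K" "y \<in> (K \<inter> K') - \<Union>M" "e = {w, y}" using crossing_edge[OF eX] .
    then have "e \<inter> ?W = {w}" by auto
    then show ?thesis by simp
  qed
  have cUX: "card (\<Union>?X) = 2 * card ?X" using X M' pX by (intro card_Union_edges[of _ K']) auto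
  show c1: "card (\<Union>?X \<inter> ?W) = card ?X"
  proof -
    have "\<Union>?X \<inter> ?W = (\<Union>e\<in>?X. e \<inter> ?W)" by auto
    also have "card \<dots> = (\<Sum>e\<in>?X. card (e \<inter> ?W))"
    proof (rule card_UN_disjoint)
      show "\<forall>e\<in>?X. \<forall>e'\<in>?X. e \<noteq> e' \<longrightarrow> (e \<inter> ?W) \<inter> (e' \<inter> ?W) = {}"
        using pX unfolding pairwise_def disjnt_def by blast
    qed (use X K' in auto)
    also have "\<dots> = card ?X" using one by simp
    finally show ?thesis .
  qed
  have finUX: "finite (\<Union>?X)" using X U' finite_subset[of "\<Union>?X" "\<Union>M'"] by auto
  show "card (\<Union>M' \<inter> ((K \<inter> K') - \<Union>M)) \<le> card ?X"
  proof -
    have "\<Union>M' \<inter> ((K \<inter> K') - \<Union>M) \<subseteq> \<Union>?X - (\<Union>?X \<inter> ?W)" by (auto simp: crossing_def)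
    then have "card (\<Union>M' \<inter> ((K \<inter> K') - \<Union>M)) \<le> card (\<Union>?X - (\<Union>?X \<inter> ?W))" using finUX by (intro card_mono) auto
    also have "\<dots> = card (\<Union>?X) - card (\<Union>?X \<inter> ?W)" using finUX by (intro card_Diff_subset) auto
    finally show ?thesis using c1 cUX by simp
  qed
  show "card ?X \<le> card ?W" unfolding c1[symmetric] using K' by (intro card_mono) auto
  \<comment> \<open>These edges lie in \<open>\<Union>M'\<close> by (ii) for \<open>K'\<close>; each
    of the remaining edges of \<open>M\<close> meets \<open>(K - K') \<inter> \<Union>M\<close>, and
    they are disjoint.\<close>
  let ?A = "{e \<in> M. e \<subseteq> K'}"
  have "card (M - ?A) \<le> card ((K - K') \<inter> \<Union>M)"
  proof (rule card_le_of_disjoint_meets)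
    show "pairwise disjnt (M - ?A)" using M(3) by (rule pairwise_subset) auto
    fix e assume "e \<in> M - ?A"
    then show "e \<inter> ((K - K') \<inter> \<Union>M) \<noteq> {}" using M(1) by blast
  qed (use K in auto)
  moreover have "card (M - ?A) = r - card ?A" using M by (subst card_Diff_subset) auto
  moreover have "2 * card ?A + 2 * card ?X \<le> 2 * r"
  proof -
    have "card (\<Union>?A) = 2 * card ?A" using M by (intro card_Union_edges[of _ K]) (auto simp: pairwise_def)
    moreover have "\<Union>?A \<subseteq> \<Union>M'" using gd joint_edge_K' by (auto simp: good_def)
    moreover have "\<Union>?A \<inter> \<Union>?X = {}"
    proof (rule ccontr)
      assume "\<Union>?A \<inter> \<Union>?X \<noteq> {}"
      then obtain z e e' where z: "z \<in> e" "e \<in> M" "z \<in> e'" "e' \<in> ?X" by auto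
      obtain w y where "w \<in> K' - K" "y \<in> (K \<inter> K') - \<Union>M" "e' = {w, y}" using crossing_edge[OF z(4)] .
      then show False using z U(1) by auto
    qed
    moreover have "\<Union>?X \<subseteq> \<Union>M'" using X by auto
    ultimately have "card (\<Union>?A) + card (\<Union>?X) \<le> card (\<Union>M')"
      using U'(3) finUX finite_subset[of "\<Union>?A" "\<Union>M'"] by (subst card_Un_disjoint[symmetric]) (auto intro!: card_mono)
    then show ?thesis using \<open>card (\<Union>?A) = 2 * card ?A\<close> cUX U' by simp
  qed
  ultimately show "card ?X \<le> card ((K - K') \<inter> \<Union>M)" by linarith
qed

end

text \<open>Two kinds of vertices need unlikely edges: those of \<open>K' - K\<close>, each two or,
  at a crossing edge, one; and those of \<open>\<Union>M\<close> outside \<open>K'\<close>, each one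
  besides its matching edge. All targets have at most \<open>2 * i\<close> elements, which gives the
  exponent \<open>2 * i - x + s\<close>. The second kind makes up for the crossing edges, as
  \<open>x \<le> s\<close> by \<open>crossing_card\<close>.\<close>

lemma joint_large_overlap:
  fixes p w :: real
  assumes cfg: "(K, M) \<in> configs n k r" and cfg': "(K', M') \<in> configs n k r"
    and i: "card (K' - K) = i" and f: "card (forb K M) = f" "card (forb K' M') = f"
    and m: "m + 2 * f \<le> n choose 2" "2 * r \<le> m" "0 < m"
    and p: "0 \<le> p" "p \<le> 1" "real m + 3 * w * sqrt m \<le> p * (real (n choose 2) - 2 * r - 2 * f)"
    and w: "0 < w" "w \<le> sqrt m / 2"
    and J: "\<exists>G\<in>graphs_nm n m. good n K M G \<and> good n K' M' G"
  defines "x \<equiv> card (crossing K M K' M')" and "s \<equiv> card ((K - K') \<inter> \<Union>M)"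
  shows "Pr n m (\<lambda>G. good n K M G \<and> good n K' M' G) * (1 - exp (- w\<^sup>2))
    \<le> cc (n choose 2) m (r + card (M' - M)) (f + card (forb K' M' - forb K M)) *
      ((1 - qf (k - r) p) ^ (n - (k + r) - i) * (2 * real i * p) ^ (2 * i - x + s))"
proof -
  note K = cfg_K[OF cfg] and M = cfg_M[OF cfg] and U = cfg_U[OF cfg] and E = cfg_edges[OF cfg]
  note K' = cfg_K[OF cfg'] and M' = cfg_M[OF cfg'] and U' = cfg_U[OF cfg'] and E' = cfg_edges[OF cfg']
  define h where "h = k - r"
  define R where "R = M \<union> M'"
  define Fb where "Fb = forb K M \<union> forb K' M'"
  define I where "I = K - \<Union>M"
  define I' where "I' = K' - \<Union>M'"
  define W where "W = K' - K"
  define VI where "VI = (K - K') - \<Union>M"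
  define WI where "WI = W - \<Union>M'"
  define VU where "VU = (K - K') \<inter> \<Union>M"
  define V0 where "V0 = {1..n} - (K \<union> K')"
  define Xe where "Xe = crossing K M K' M'"
  define Xv where "Xv = \<Union>M' \<inter> ((K \<inter> K') - \<Union>M)"
  define Yv where "Yv = \<Union>M \<inter> ((K' \<inter> K) - \<Union>M')"
  define \<Omega> where "\<Omega> = all_edges n - R - Fb"
  \<comment> \<open>Vertices of \<open>K - K'\<close> outside \<open>\<Union>M\<close> get no
    condition of their own: their edges to \<open>K' - K\<close> are already used from the other
    end. Matching edges are removed because they are forced and not random.\<close>
  define Yf where "Yf z = (if z \<in> V0 then I else if z \<in> W then {y \<in> VI \<union> Xv. {z, y} \<notin> M'} else {y \<in> WI \<union> Yv. {z, y} \<notin> M})" for z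
  \<comment> \<open>One crossing edge already counts as a neighbour of its endpoint in
    \<open>W\<close>; for a vertex of \<open>VU\<close> its edge of \<open>M\<close> may count as
    one.\<close>
  define d where "d z = (if z \<in> V0 then 2 else if z \<in> W then if \<exists>e\<in>Xe. z \<in> e then 1 else 2 else 1 :: nat)" for z
  define Z where "Z = V0 \<union> (W \<union> VU)"
  define B where "B S = (\<forall>z\<in>Z. d z \<le> card (S \<inter> (star z (Yf z) \<inter> \<Omega>)))" for S
  let ?J = "\<lambda>G. good n K M G \<and> good n K' M' G"
  have fin: "finite \<Omega>" by (simp add: \<Omega>_def)
  have I: "finite I" "card I = h" "finite I'" using K K' cfg_I[OF cfg] by (auto simp: I_def I'_def h_def)
  have fins: "finite VI" "finite WI" "finite V0" "finite W" "finite VU" "finite Xv" "finite Yv" "finite Z"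
    using K K' by (auto simp: VI_def WI_def V0_def W_def VU_def Xv_def Yv_def Z_def)
  have graphE: "G \<subseteq> all_edges n" if "G \<in> graphs_nm n m" for G using that by (auto simp: graphs_nm_def)
  obtain G0 where G0: "G0 \<in> graphs_nm n m" "good n K M G0" "good n K' M' G0" using J by auto
  have g0: "M \<subseteq> G0" "G0 \<inter> forb K M = {}" "M' \<subseteq> G0" "G0 \<inter> forb K' M' = {}"
    using good_iff[OF cfg graphE[OF G0(1)]] good_iff[OF cfg' graphE[OF G0(1)]] G0 by auto
  have disj: "R \<inter> Fb = {}" using g0 by (auto simp: R_def Fb_def)
  note cr = crossing_card[OF cfg cfg' graphE[OF G0(1)] G0(2,3), folded Xe_def W_def Xv_def]
  note cr' = crossing_card[OF cfg' cfg graphE[OF G0(1)] G0(3,2), folded Yv_def]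
  have ci: "card (K - K') = i"
    using K K' i card_Diff_subset_Int[of K K'] card_Diff_subset_Int[of K' K] by (auto simp: Int_commute)
  have cV: "card VI \<le> i" "card WI \<le> i" "card W = i"
    using K K' i ci card_mono[of "K - K'" VI] card_mono[of "K' - K" WI] by (auto simp: VI_def WI_def W_def)
  have cXv: "card Xv \<le> i" "card Yv \<le> i" using cr cr' cV ci by auto
  have cR: "card R = r + card (M' - M)"
    unfolding R_def using card_Un_disjoint[of M "M' - M"] M M' by (simp add: Un_Diff_cancel)
  have cF: "card Fb = f + card (forb K' M' - forb K M)"
    unfolding Fb_def using card_Un_disjoint[of "forb K M" "forb K' M' - forb K M"] cfg_finite_forb[OF cfg] cfg_finite_forb[OF cfg'] f
    by (simp add: Un_Diff_cancel)
  have RE: "R \<subseteq> all_edges n" "Fb \<subseteq> all_edges n" using E E' by (auto simp: R_def Fb_def)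
  have cRF: "card R \<le> 2 * r" "card Fb \<le> 2 * f"
    using cR cF card_mono[of M' "M' - M"] M' card_mono[of "forb K' M'" "forb K' M' - forb K M"] cfg_finite_forb[OF cfg'] f by auto
  have cO: "card \<Omega> = (n choose 2) - card R - card Fb" unfolding \<Omega>_def by (rule card_Omega[OF RE disj])
  have inc: "incr \<Omega> B"
  proof (intro allI impI)
    fix S T assume ST: "S \<subseteq> T" "T \<subseteq> \<Omega>" "B S"
    then show "B T" unfolding B_def using incr_card_Int[OF fin ST(1,2)] by blast
  qed
  have "Pr n m ?J \<le> cc (n choose 2) m (card R) (card Fb) * Unif \<Omega> (m - card R) B"
    unfolding \<Omega>_def
  proof (rule Pr_upper[OF RE disj])
    show "card R \<le> m" "m + card Fb \<le> n choose 2" using cRF m by auto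
    fix G assume G: "G \<in> graphs_nm n m" "?J G"
    have GE: "G \<subseteq> all_edges n" using graphE[OF G(1)] .
    have g: "M \<subseteq> G" "G \<inter> forb K M = {}" "\<And>v. v \<in> {1..n} - K \<Longrightarrow> 2 \<le> card (G \<inter> star v I)"
      using good_iff[OF cfg GE] G(2) by (auto simp: I_def)
    have g': "M' \<subseteq> G" "G \<inter> forb K' M' = {}" "\<And>v. v \<in> {1..n} - K' \<Longrightarrow> 2 \<le> card (G \<inter> star v I')"
      using good_iff[OF cfg' GE] G(2) by (auto simp: I'_def)
    have inO: "e \<in> \<Omega>" if "e \<in> G" "e \<notin> R" for e
      using that GE g g' by (auto simp: \<Omega>_def Fb_def)
    have "B (G - R)"
      unfolding B_def
    proof
      fix z assume z: "z \<in> Z"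
      have finZ: "finite ((G - R) \<inter> (star z (Yf z) \<inter> \<Omega>))" using fin by auto
      consider "z \<in> V0" | "z \<in> W" "z \<notin> V0" | "z \<in> VU" "z \<notin> W" "z \<notin> V0" using z by (auto simp: Z_def)
      then show "d z \<le> card ((G - R) \<inter> (star z (Yf z) \<inter> \<Omega>))"
      proof cases
        case 1
        then have Y: "Yf z = I" "d z = 2" by (auto simp: Yf_def d_def)
        have "G \<inter> star z I \<subseteq> (G - R) \<inter> (star z (Yf z) \<inter> \<Omega>)"
        proof
          fix e assume e: "e \<in> G \<inter> star z I"
          then have "z \<in> e" by (auto simp: star_def)
          then have "e \<notin> R" using 1 M(1) M'(1) by (auto simp: R_def V0_def)
          then show "e \<in> (G - R) \<inter> (star z (Yf z) \<inter> \<Omega>)" using e inO Y by auto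
        qed
        then have "card (G \<inter> star z I) \<le> card ((G - R) \<inter> (star z (Yf z) \<inter> \<Omega>))" using finZ by (intro card_mono) auto
        moreover have "z \<in> {1..n} - K" using 1 by (auto simp: V0_def)
        ultimately show ?thesis using g(3)[of z] Y by simp
      next
        case 2
        have Y: "Yf z = {y \<in> VI \<union> Xv. {z, y} \<notin> M'}" using 2 by (auto simp: Yf_def)
        have dz: "d z = (if \<exists>e\<in>Xe. z \<in> e then 1 else 2)" using 2 by (auto simp: d_def)
        have zK: "z \<in> {1..n} - K" "z \<in> K'" using 2 K' by (auto simp: W_def)
        \<comment> \<open>A neighbour of \<open>z\<close> in \<open>K'\<close> must lie in
          \<open>\<Union>M'\<close> by (ii) for \<open>K'\<close>, so it is one of the few vertices
          in \<open>Xv\<close>.\<close>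
        have nb: "y \<in> VI \<union> Xv" if "y \<in> I" "{z, y} \<in> G" for y
        proof (cases "y \<in> K'")
          case True
          then have "{z, y} \<subseteq> \<Union>M'" using joint_edge_K'[OF cfg cfg' GE _ _ that(2)] G(2) zK by auto
          then show ?thesis using True that by (auto simp: Xv_def I_def)
        qed (use that in \<open>auto simp: VI_def I_def\<close>)
        have sub: "(G - M') \<inter> star z I \<subseteq> (G - R) \<inter> (star z (Yf z) \<inter> \<Omega>)"
        proof
          fix e assume e: "e \<in> (G - M') \<inter> star z I"
          then obtain y where y: "e = {z, y}" "y \<in> I" by (auto simp: star_def)
          have "e \<notin> M" using y zK M(1) by auto
          then have "e \<notin> R" using e by (auto simp: R_def)
          moreover have "y \<in> Yf z" using nb[of y] y e unfolding Y by auto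
          ultimately show "e \<in> (G - R) \<inter> (star z (Yf z) \<inter> \<Omega>)" using e inO y by (auto simp: star_def)
        qed
        have g2: "2 \<le> card (G \<inter> star z I)" using g(3)[OF zK(1)] .
        show ?thesis
        proof (cases "\<exists>e\<in>Xe. z \<in> e")
          case False
          have "G \<inter> star z I \<subseteq> (G - M') \<inter> star z I"
          proof
            fix e assume e: "e \<in> G \<inter> star z I"
            then obtain y where y: "e = {z, y}" "y \<in> I" by (auto simp: star_def)
            have "e \<notin> M'"
            proof
              assume eM: "e \<in> M'"
              then have "y \<in> K'" using M'(1) y by auto
              then have "e \<in> Xe" using eM y by (auto simp: Xe_def crossing_def I_def)
              then show False using False y by auto
            qed
            then show "e \<in> (G - M') \<inter> star z I" using e by auto
          qed
          then have "card (G \<inter> star z I) \<le> card ((G - R) \<inter> (star z (Yf z) \<inter> \<Omega>))"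
            using finZ sub by (intro card_mono) auto
          then show ?thesis using g2 dz False by simp
        next
          case True
          \<comment> \<open>At most one edge of a matching contains \<open>z\<close>.\<close>
          have "card (M' \<inter> star z I) \<le> card {z}"
          proof (rule card_le_of_disjoint_meets)
            show "pairwise disjnt (M' \<inter> star z I)" using M'(3) by (rule pairwise_subset) auto
          qed (auto simp: star_def)
          moreover have "card (G \<inter> star z I) \<le> card ((G - M') \<inter> star z I) + card (M' \<inter> star z I)"
          proof -
            have "card (G \<inter> star z I) \<le> card (((G - M') \<inter> star z I) \<union> (M' \<inter> star z I))"
              using I by (intro card_mono) auto
            then show ?thesis using card_Un_le[of "(G - M') \<inter> star z I" "M' \<inter> star z I"] by linarith
          qed
          moreover have "card ((G - M') \<inter> star z I) \<le> card ((G - R) \<inter> (star z (Yf z) \<inter> \<Omega>))"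
            using finZ sub by (intro card_mono) auto
          ultimately show ?thesis using g2 dz True by simp
        qed
      next
        case 3
        have Y: "Yf z = {y \<in> WI \<union> Yv. {z, y} \<notin> M}" "d z = 1" using 3 by (auto simp: Yf_def d_def)
        have zK: "z \<in> {1..n} - K'" "z \<in> K" using 3 K by (auto simp: VU_def)
        have nb: "y \<in> WI \<union> Yv" if "y \<in> I'" "{z, y} \<in> G" for y
        proof (cases "y \<in> K")
          case True
          then have "{z, y} \<subseteq> \<Union>M" using joint_edge_K[OF cfg cfg' GE _ _ that(2)] G(2) zK by auto
          then show ?thesis using True that by (auto simp: Yv_def I'_def)
        qed (use that in \<open>auto simp: WI_def W_def I'_def\<close>)
        have sub: "(G - M) \<inter> star z I' \<subseteq> (G - R) \<inter> (star z (Yf z) \<inter> \<Omega>)"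
        proof
          fix e assume e: "e \<in> (G - M) \<inter> star z I'"
          then obtain y where y: "e = {z, y}" "y \<in> I'" by (auto simp: star_def)
          have "e \<notin> M'" using y zK M'(1) by auto
          then have "e \<notin> R" using e by (auto simp: R_def)
          moreover have "y \<in> Yf z" using nb[of y] y e unfolding Y by auto
          ultimately show "e \<in> (G - R) \<inter> (star z (Yf z) \<inter> \<Omega>)" using e inO y by (auto simp: star_def)
        qed
        have "card (M \<inter> star z I') \<le> card {z}"
        proof (rule card_le_of_disjoint_meets)
          show "pairwise disjnt (M \<inter> star z I')" using M(3) by (rule pairwise_subset) auto
        qed (auto simp: star_def)
        moreover have "card (G \<inter> star z I') \<le> card ((G - M) \<inter> star z I') + card (M \<inter> star z I')"
        proof -
          have "card (G \<inter> star z I') \<le> card (((G - M) \<inter> star z I') \<union> (M \<inter> star z I'))"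
            using I by (intro card_mono) auto
          then show ?thesis using card_Un_le[of "(G - M) \<inter> star z I'" "M \<inter> star z I'"] by linarith
        qed
        moreover have "card ((G - M) \<inter> star z I') \<le> card ((G - R) \<inter> (star z (Yf z) \<inter> \<Omega>))"
          using finZ sub by (intro card_mono) auto
        ultimately show ?thesis using g'(3)[OF zK(1)] Y by simp
      qed
    qed
    then show "R \<subseteq> G \<and> G \<inter> Fb = {} \<and> B (G - R)" using g g' by (auto simp: R_def Fb_def)
  qed
  then have "Pr n m ?J * (1 - exp (- w\<^sup>2)) \<le> cc (n choose 2) m (card R) (card Fb) * Unif \<Omega> (m - card R) B * (1 - exp (- w\<^sup>2))"
    by (rule mult_right_mono) simp
  also have "\<dots> \<le> cc (n choose 2) m (card R) (card Fb) * BE \<Omega> p (\<lambda>S. of_bool (B S))"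
    unfolding mult.assoc
  proof (intro mult_left_mono cc_nonneg Unif_upper[OF fin inc p(1,2), where M = "real m"])
    show "m - card R \<le> card \<Omega>" unfolding cO using cRF m by simp
    have "real (n choose 2) - 2 * r - 2 * f \<le> card \<Omega>" unfolding cO using cRF m by (simp add: of_nat_diff)
    then have "p * (real (n choose 2) - 2 * r - 2 * f) \<le> p * card \<Omega>" using p by (intro mult_left_mono) auto
    then show "real m + 3 * w * sqrt (real m) \<le> p * card \<Omega>" using p by simp
  qed (use m w in auto)
  also have "\<dots> \<le> cc (n choose 2) m (card R) (card Fb) *
      ((1 - qf h p) ^ (n - (k + r) - i) * (2 * real i * p) ^ (2 * i - x + s))"
  proof (rule mult_left_mono[OF _ cc_nonneg])
    have Zd: "V0 \<inter> (W \<union> VU) = {}" "W \<inter> VU = {}" by (auto simp: V0_def W_def VU_def)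
    have y0: "0 \<le> 2 * real i * p" using p by simp
    have cYf: "card (star z (Yf z) \<inter> \<Omega>) \<le> 2 * i" if "z \<in> W \<union> VU" for z
    proof -
      have "Yf z \<subseteq> (if z \<in> W then VI \<union> Xv else WI \<union> Yv)" using that Zd by (auto simp: Yf_def)
      moreover have "finite (if z \<in> W then VI \<union> Xv else WI \<union> Yv)" using fins by auto
      moreover have "card (if z \<in> W then VI \<union> Xv else WI \<union> Yv) \<le> 2 * i"
        using card_Un_le[of VI Xv] card_Un_le[of WI Yv] cV cXv by auto
      ultimately have fc: "finite (Yf z)" "card (Yf z) \<le> 2 * i"
        using finite_subset card_mono order_trans by (blast, meson card_mono order_trans)
      have "card (star z (Yf z) \<inter> \<Omega>) \<le> card (star z (Yf z))" using fc by (intro card_mono) auto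
      then show ?thesis using fc by (simp add: star_card)
    qed
    have small: "BE (star z (Yf z) \<inter> \<Omega>) p (\<lambda>S. of_bool (d z \<le> card S)) \<le> (2 * real i * p) ^ d z" if z: "z \<in> W \<union> VU" for z
    proof -
      let ?C = "star z (Yf z) \<inter> \<Omega>"
      have finC: "finite ?C" using fin by auto
      have "real (card ?C) \<le> 2 * real i" using cYf[OF z] by linarith
      then have le: "card ?C * p \<le> 2 * real i * p" "0 \<le> card ?C * p" using p by (auto intro!: mult_right_mono)
      have "d z = 1 \<or> d z = 2" by (auto simp: d_def)
      then show ?thesis
      proof
        assume "d z = 1" then show ?thesis using BE_card_ge_small(1)[OF finC p(1,2)] le by simp
      next
        assume "d z = 2"
        then show ?thesis using BE_card_ge_small(2)[OF finC p(1,2)] power_mono[OF le, of 2] by simp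
      qed
    qed
    have nn: "0 \<le> BE (star z (Yf z) \<inter> \<Omega>) p (\<lambda>S. of_bool (d z \<le> card S))" for z
      using p by (intro BE_nonneg) auto
    have eW: "(\<Prod>z\<in>W. (2 * real i * p) ^ d z) = (2 * real i * p) ^ (2 * i - x)"
    proof -
      have "(\<Sum>z\<in>W. d z) + card {z \<in> W. \<exists>e\<in>Xe. z \<in> e} = 2 * i"
      proof -
        have "(\<Sum>z\<in>W. d z) + (\<Sum>z\<in>W. if \<exists>e\<in>Xe. z \<in> e then 1 else 0) = (\<Sum>z\<in>W. 2)"
          unfolding sum.distrib[symmetric] using Zd by (intro sum.cong) (auto simp: d_def)
        moreover have "(\<Sum>z\<in>W. if \<exists>e\<in>Xe. z \<in> e then 1 else 0) = card {z \<in> W. \<exists>e\<in>Xe. z \<in> e}"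
          using fins by (simp add: sum.If_cases Int_def)
        ultimately show ?thesis using cV by simp
      qed
      moreover have "{z \<in> W. \<exists>e\<in>Xe. z \<in> e} = \<Union>Xe \<inter> W" by auto
      ultimately have "(\<Sum>z\<in>W. d z) = 2 * i - x" using cr(1) unfolding x_def Xe_def by simp
      then show ?thesis by (simp add: power_sum[symmetric])
    qed
    have eVU: "(\<Prod>z\<in>VU. (2 * real i * p) ^ d z) = (2 * real i * p) ^ s"
    proof -
      have "(\<Prod>z\<in>VU. (2 * real i * p) ^ d z) = (\<Prod>z\<in>VU. 2 * real i * p)"
        using Zd by (intro prod.cong) (auto simp: d_def)
      then show ?thesis by (simp add: s_def VU_def)
    qed
    have eV0: "card V0 = n - (k + r) - i"
    proof -
      have "card (K \<union> K') = (k + r) + i"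
        using card_Un_disjoint[of K "K' - K"] K K' i by auto
      moreover have "K \<union> K' \<subseteq> {1..n}" using K K' by auto
      ultimately show ?thesis unfolding V0_def using K K' by (simp add: card_Diff_subset)
    qed
    have "BE \<Omega> p (\<lambda>S. of_bool (B S)) = (\<Prod>z\<in>Z. BE (star z (Yf z) \<inter> \<Omega>) p (\<lambda>S. of_bool (d z \<le> card S)))"
      unfolding B_def
    proof (rule BE_ball_prod[OF fin fins(8), of "\<lambda>z. star z (Yf z) \<inter> \<Omega>" p "\<lambda>z S. d z \<le> card S"])
      fix v v' assume v: "v \<in> Z" "v' \<in> Z" "v \<noteq> v'"
      \<comment> \<open>Two stars could share only the pair joining their centres, and only if each
        centre is a target of the other. Targets that are centres themselves occur only for centres
        in \<open>VU\<close>; but targets of \<open>VU\<close> lie in \<open>K'\<close>, while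
        \<open>VU\<close> is disjoint from \<open>K'\<close>.\<close>
      have YfZ: "z \<in> VU" if "z \<in> Z" "y \<in> Z" "y \<in> Yf z" for z y
        using that by (auto simp: Yf_def Z_def V0_def W_def VU_def VI_def WI_def Xv_def Yv_def I_def split: if_splits)
      have "\<not> (v' \<in> Yf v \<and> v \<in> Yf v')"
      proof
        assume "v' \<in> Yf v \<and> v \<in> Yf v'"
        then have vu: "v \<in> VU" "v' \<in> VU" "v' \<in> Yf v" using YfZ v by auto
        then show False using Zd by (auto simp: Yf_def VU_def WI_def W_def Yv_def split: if_splits)
      qed
      then show "(star v (Yf v) \<inter> \<Omega>) \<inter> (star v' (Yf v') \<inter> \<Omega>) = {}" using star_disjoint[OF v(3)] by blast
    qed auto
    also have "\<dots> = (\<Prod>z\<in>V0. BE (star z (Yf z) \<inter> \<Omega>) p (\<lambda>S. of_bool (d z \<le> card S))) *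
       ((\<Prod>z\<in>W. BE (star z (Yf z) \<inter> \<Omega>) p (\<lambda>S. of_bool (d z \<le> card S))) *
        (\<Prod>z\<in>VU. BE (star z (Yf z) \<inter> \<Omega>) p (\<lambda>S. of_bool (d z \<le> card S))))"
      unfolding Z_def using Zd fins by (simp add: prod.union_disjoint)
    also have "\<dots> \<le> (1 - qf h p) ^ card V0 * ((\<Prod>z\<in>W. (2 * real i * p) ^ d z) * (\<Prod>z\<in>VU. (2 * real i * p) ^ d z))"
    proof (intro mult_mono prod_mono conjI small nn mult_nonneg_nonneg prod_nonneg zero_le_power y0)
      have "(\<Prod>z\<in>V0. BE (star z (Yf z) \<inter> \<Omega>) p (\<lambda>S. of_bool (d z \<le> card S))) = (\<Prod>z\<in>V0. 1 - qf h p)"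
      proof (rule prod.cong[OF refl])
        fix v assume v: "v \<in> V0"
        have Y: "Yf v = I" "d v = 2" using v by (auto simp: Yf_def d_def)
        have vv: "v \<in> {1..n}" "v \<notin> K" "v \<notin> K'" using v by (auto simp: V0_def)
        have "star v I \<subseteq> all_edges n" using vv K(1) by (intro star_subset_edges) (auto simp: I_def)
        moreover have "star v I \<inter> {e. e \<subseteq> K \<or> e \<subseteq> K'} = {}" using vv by (auto simp: star_def)
        ultimately have "star v I \<subseteq> \<Omega>" using M(1) M'(1) unfolding \<Omega>_def R_def Fb_def forb_def by blast
        then have "star v (Yf v) \<inter> \<Omega> = star v I" using Y by auto
        then show "BE (star v (Yf v) \<inter> \<Omega>) p (\<lambda>S. of_bool (d v \<le> card S)) = 1 - qf h p"
          using Y BE_card_ge2[of "star v I" p] I by (simp add: star_card)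
      qed
      then show "(\<Prod>z\<in>V0. BE (star z (Yf z) \<inter> \<Omega>) p (\<lambda>S. of_bool (d z \<le> card S))) \<le> (1 - qf h p) ^ card V0" by simp
      show "0 \<le> 1 - qf h p" using qf_le_1[OF p(1,2)] by simp
    qed (use p in auto)
    finally show "BE \<Omega> p (\<lambda>S. of_bool (B S)) \<le> (1 - qf h p) ^ (n - (k + r) - i) * (2 * real i * p) ^ (2 * i - x + s)"
      unfolding eW eVU eV0 power_add .
  qed
  finally show ?thesis unfolding cR cF h_def .
qed

section \<open>Counting pairs of configurations\<close>

definition matchings :: "'a set \<Rightarrow> nat \<Rightarrow> 'a set set set" where
  "matchings K r = {M. M \<subseteq> {e. e \<subseteq> K \<and> card e = 2} \<and> card M = r \<and> pairwise disjnt M}"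

text \<open>The number of matchings with \<open>r\<close> edges on \<open>\<kappa>\<close> points:
  choosing one edge first and completing it counts every matching once per edge. Real values make
  the quotient and the ratio estimates direct.\<close>

fun mt :: "nat \<Rightarrow> nat \<Rightarrow> real" where
  "mt \<kappa> 0 = 1"
| "mt \<kappa> (Suc r) = real (\<kappa> choose 2) / real (Suc r) * mt (\<kappa> - 2) r"

lemma finite_matchings: "finite K \<Longrightarrow> finite (matchings K r)"
  unfolding matchings_def by (rule finite_subset[of _ "Pow (Pow K)"]) auto

lemma card_matchings:
  fixes K :: "'a set"
  assumes "finite K"
  shows "real (card (matchings K r)) = mt (card K) r"
  using assms
proof (induction r arbitrary: K)
  case 0
  have "matchings K 0 = {{}}"
  proof -
    have finP: "finite {e. e \<subseteq> K \<and> card e = 2}" by (rule finite_subset[of _ "Pow K"]) (use 0 in auto)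
    have "M = {}" if "M \<subseteq> {e. e \<subseteq> K \<and> card e = 2}" "card M = 0" for M
      using that finite_subset[OF that(1) finP] by simp
    then show ?thesis unfolding matchings_def by auto
  qed
  then show ?case by simp
next
  case (Suc r)
  let ?P = "{e. e \<subseteq> K \<and> card e = 2}"
  have finP: "finite ?P" by (rule finite_subset[of _ "Pow K"]) (use Suc.prems in auto)
  define A where "A = (SIGMA M:matchings K (Suc r). M)"
  define B where "B = (SIGMA e:?P. matchings (K - e) r)"
  have finM: "finite M" if "M \<in> matchings K q" for M q
    using that finite_subset[OF _ finP] by (auto simp: matchings_def)
  have cA: "card A = card (matchings K (Suc r)) * Suc r"
  proof -
    have "card A = (\<Sum>M\<in>matchings K (Suc r). card M)"
      unfolding A_def using finite_matchings[OF Suc.prems] finM by (intro card_SigmaI) auto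
    also have "\<dots> = (\<Sum>M\<in>matchings K (Suc r). Suc r)" by (intro sum.cong) (auto simp: matchings_def)
    finally show ?thesis by simp
  qed
  have cB: "real (card B) = real (card K choose 2) * mt (card K - 2) r"
  proof -
    have "card B = (\<Sum>e\<in>?P. card (matchings (K - e) r))"
      unfolding B_def
    proof (rule card_SigmaI[OF finP], rule ballI)
      fix e show "finite (matchings (K - e) r)" by (rule finite_matchings) (use Suc.prems in simp)
    qed
    then have "real (card B) = (\<Sum>e\<in>?P. real (card (matchings (K - e) r)))" by simp
    also have "\<dots> = (\<Sum>e\<in>?P. mt (card K - 2) r)"
    proof (rule sum.cong[OF refl])
      fix e assume e: "e \<in> ?P"
      then have "finite e" "card (K - e) = card K - 2" using Suc.prems finite_subset[of e K] by (auto simp: card_Diff_subset)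
      then show "real (card (matchings (K - e) r)) = mt (card K - 2) r" using Suc.IH[of "K - e"] Suc.prems by simp
    qed
    also have "\<dots> = real (card ?P) * mt (card K - 2) r" by simp
    also have "card ?P = card K choose 2" using n_subsets[OF Suc.prems] .
    finally show ?thesis .
  qed
  have "bij_betw (\<lambda>(M, e). (e, M - {e})) A B"
  proof (rule bij_betwI[where g = "\<lambda>(e, M). (insert e M, e)"])
    show "(\<lambda>(M, e). (e, M - {e})) \<in> A \<rightarrow> B"
    proof (clarsimp simp: A_def B_def)
      fix M e assume M: "M \<in> matchings K (Suc r)" "e \<in> M"
      then have MP: "M \<subseteq> ?P" "card M = Suc r" "pairwise disjnt M" by (auto simp: matchings_def)
      have "M - {e} \<subseteq> {e'. e' \<subseteq> K - e \<and> card e' = 2}"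
      proof
        fix e' assume e': "e' \<in> M - {e}"
        then have "disjnt e' e" using pairwiseD[OF MP(3), of e' e] M by auto
        then show "e' \<in> {e'. e' \<subseteq> K - e \<and> card e' = 2}" using e' MP(1) by (auto simp: disjnt_def)
      qed
      moreover have "card (M - {e}) = r" using MP M finM[OF M(1)] by simp
      moreover have "pairwise disjnt (M - {e})" using MP(3) by (rule pairwise_subset) auto
      ultimately show "e \<subseteq> K \<and> card e = 2 \<and> M - {e} \<in> matchings (K - e) r"
        using MP M by (auto simp: matchings_def)
    qed
    have ins: "e \<notin> M" if "card e = 2" "M \<in> matchings (K - e) r" for e M
    proof
      assume "e \<in> M"
      then have "e \<subseteq> K - e" using that by (auto simp: matchings_def)
      then have "e = {}" by auto
      then show False using that by simp
    qed
    show "(\<lambda>(e, M). (insert e M, e)) \<in> B \<rightarrow> A"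
    proof (clarsimp simp: A_def B_def)
      fix M e assume e: "e \<subseteq> K" "card e = 2" and M: "M \<in> matchings (K - e) r"
      have MP: "M \<subseteq> {e'. e' \<subseteq> K - e \<and> card e' = 2}" "card M = r" "pairwise disjnt M" using M by (auto simp: matchings_def)
      have "finite M" by (rule finite_subset[OF _ finP]) (use MP in auto)
      then have "card (insert e M) = Suc r" using ins[OF e(2) M] MP by simp
      moreover have "pairwise disjnt (insert e M)" using MP by (auto simp: pairwise_insert disjnt_def)
      ultimately show "insert e M \<in> matchings K (Suc r)" using MP e by (auto simp: matchings_def)
    qed
    show "(case (case x of (M, e) \<Rightarrow> (e, M - {e})) of (e, M) \<Rightarrow> (insert e M, e)) = x" if "x \<in> A" for x
      using that by (auto simp: A_def)
    show "(case (case y of (e, M) \<Rightarrow> (insert e M, e)) of (M, e) \<Rightarrow> (e, M - {e})) = y" if "y \<in> B" for y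
      using that ins by (auto simp: B_def)
  qed
  then have "card A = card B" by (rule bij_betw_same_card)
  then have "real (card (matchings K (Suc r))) * real (Suc r) = real (card K choose 2) * mt (card K - 2) r"
    using cA cB by (simp only: of_nat_mult[symmetric])
  then show ?case by (simp add: field_simps)
qed

lemma mt_nonneg: "0 \<le> mt \<kappa> r"
  by (induction \<kappa> r rule: mt.induct) auto

text \<open>The left side counts the matchings that contain \<open>s\<close> given disjoint edges.
  Each prescribed edge costs at most r divided by the number of remaining pairs; since
  \<open>4 * r \<le> \<kappa>\<close>, at least half of the points always remain, and so at least
  \<kappa>^2 / 8 pairs.\<close>

lemma mt_ratio:
  assumes "s \<le> r" "4 * r \<le> \<kappa>"
  shows "mt (\<kappa> - 2 * s) (r - s) \<le> (8 * real r / (real \<kappa>)\<^sup>2) ^ s * mt \<kappa> r"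
  using assms(1)
proof (induction s)
  case (Suc s)
  define a where "a = \<kappa> - 2 * s"
  define b where "b = r - Suc s"
  have b: "r - s = Suc b" using Suc.prems by (simp add: b_def)
  have a: "\<kappa> - 2 * Suc s = a - 2" by (simp add: a_def)
  have a2: "\<kappa> + 2 \<le> 2 * a" using Suc.prems assms(2) by (simp add: a_def)
  then have a3: "real \<kappa> + 2 \<le> 2 * real a" by linarith
  have k0: "0 < real \<kappa>" using Suc.prems assms(2) by simp
  have ch: "real (a choose 2) \<ge> (real \<kappa>)\<^sup>2 / 8"
  proof -
    have "real (a choose 2) = real a * (real a - 1) / 2"
    proof -
      have "even (a * (a - 1))" by (cases a) auto
      then have "2 * (a choose 2) = a * (a - 1)" by (simp add: choose_two)
      then have "real (2 * (a choose 2)) = real (a * (a - 1))" by (simp only:)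
      then have "2 * real (a choose 2) = real a * real (a - 1)" by simp
      then show ?thesis using a2 by (simp add: of_nat_diff)
    qed
    moreover have "(real \<kappa> / 2) * (real \<kappa> / 2) \<le> real a * (real a - 1)"
      using a3 by (intro mult_mono) auto
    ultimately show ?thesis by (simp add: power2_eq_square)
  qed
  have pos: "0 < real (a choose 2)" proof -
    have "0 < (real \<kappa>)\<^sup>2 / 8" using k0 by simp
    then show ?thesis using ch by linarith
  qed
  have "mt a (Suc b) = real (a choose 2) / real (Suc b) * mt (a - 2) b" by simp
  then have "mt (a - 2) b = real (Suc b) / real (a choose 2) * mt a (Suc b)"
  proof -
    have "z = S / C * (C / S * z)" if "C \<noteq> 0" "S \<noteq> 0" for z S C :: real using that by simp
    from this[of "real (a choose 2)" "real (Suc b)" "mt (a - 2) b"] show ?thesis using pos by simp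
  qed
  also have "\<dots> \<le> (8 * real r / (real \<kappa>)\<^sup>2) * mt a (Suc b)"
  proof (rule mult_right_mono[OF _ mt_nonneg])
    have "real (Suc b) / real (a choose 2) \<le> real r / ((real \<kappa>)\<^sup>2 / 8)"
      using ch k0 Suc.prems by (intro frac_le) (auto simp: b_def)
    then show "real (Suc b) / real (a choose 2) \<le> 8 * real r / (real \<kappa>)\<^sup>2" by (simp add: mult.commute)
  qed
  also have "\<dots> \<le> (8 * real r / (real \<kappa>)\<^sup>2) * ((8 * real r / (real \<kappa>)\<^sup>2) ^ s * mt \<kappa> r)"
    using Suc unfolding b[symmetric] a_def by (intro mult_left_mono) auto
  finally show ?case unfolding a b_def[symmetric] by simp
qed simp

section \<open>Hypergeometric overlaps and common matching edges\<close>

lemma binomial_shift_le: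
  assumes "a \<le> l" "l \<le> \<kappa>" "0 < \<kappa>"
  shows "real ((\<kappa> - a) choose (l - a)) \<le> (real l / real \<kappa>) ^ a * real (\<kappa> choose l)"
  using assms(1)
proof (induction a)
  case (Suc a)
  have lt: "a < l" "a < \<kappa>" using Suc.prems assms by auto
  have "real ((\<kappa> - Suc a) choose (l - Suc a)) = real (l - a) / real (\<kappa> - a) * real ((\<kappa> - a) choose (l - a))"
  proof -
    have "(l - a) * ((\<kappa> - a) choose (l - a)) = (\<kappa> - a) * ((\<kappa> - a - 1) choose (l - a - 1))"
      using lt times_binomial_minus1_eq[of "l - a" "\<kappa> - a"] by simp
    moreover have "\<kappa> - a - 1 = \<kappa> - Suc a" "l - a - 1 = l - Suc a" by simp_all
    ultimately have "real (l - a) * real ((\<kappa> - a) choose (l - a)) = real (\<kappa> - a) * real ((\<kappa> - Suc a) choose (l - Suc a))"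
      by (simp only: of_nat_mult[symmetric])
    then show ?thesis using lt by (simp add: field_simps)
  qed
  also have "\<dots> \<le> real l / real \<kappa> * ((real l / real \<kappa>) ^ a * real (\<kappa> choose l))"
  proof (rule mult_mono)
    have "(real l - real a) * real \<kappa> \<le> real l * (real \<kappa> - real a)"
    proof -
      have "real a * real l \<le> real a * real \<kappa>" using assms by (intro mult_left_mono) auto
      then show ?thesis by (simp add: algebra_simps)
    qed
    then have "(real l - real a) / (real \<kappa> - real a) \<le> real l / real \<kappa>" using lt assms by (intro frac_le_cross) auto
    then show "real (l - a) / real (\<kappa> - a) \<le> real l / real \<kappa>" using lt by (simp add: of_nat_diff)
  qed (use Suc in auto)
  finally show ?case by (simp add: mult_ac)
qed simp

text \<open>The overlap of a fixed and a random \<kappa>-set has binomial moments at most those of a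
  binomial variable with parameters \<kappa> and \<kappa> / n. Expanding (1 + x)^l in binomial
  coefficients and applying Vandermonde reduces the generating function to that of the binomial
  variable.\<close>

lemma hyper_mgf:
  fixes x :: real
  assumes "0 \<le> x" "\<kappa> \<le> n" "0 < \<kappa>"
  shows "(\<Sum>l\<le>\<kappa>. real (\<kappa> choose l) * real ((n - \<kappa>) choose (\<kappa> - l)) * (1 + x) ^ l)
    \<le> real (n choose \<kappa>) * exp (x * (real \<kappa>)\<^sup>2 / n)"
proof -
  let ?c = "\<lambda>l. real ((n - \<kappa>) choose (\<kappa> - l))"
  have n0: "0 < n" using assms by simp
  have "(\<Sum>l\<le>\<kappa>. real (\<kappa> choose l) * ?c l * (1 + x) ^ l) = (\<Sum>l\<le>\<kappa>. \<Sum>s\<le>l. real (\<kappa> choose l) * real (l choose s) * ?c l * x ^ s)"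
  proof (rule sum.cong[OF refl])
    fix l
    have "(1 + x) ^ l = (\<Sum>s\<le>l. real (l choose s) * x ^ s)"
      using binomial_ring[of x 1 l] by (simp add: add.commute)
    then show "real (\<kappa> choose l) * ?c l * (1 + x) ^ l = (\<Sum>s\<le>l. real (\<kappa> choose l) * real (l choose s) * ?c l * x ^ s)"
      by (simp add: sum_distrib_left mult_ac)
  qed
  also have "\<dots> = (\<Sum>l\<le>\<kappa>. \<Sum>s\<le>l. real (\<kappa> choose s) * real ((\<kappa> - s) choose (l - s)) * ?c l * x ^ s)"
  proof (intro sum.cong refl)
    fix l s assume "l \<in> {..\<kappa>}" "s \<in> {..l}"
    then have "(\<kappa> choose l) * (l choose s) = (\<kappa> choose s) * ((\<kappa> - s) choose (l - s))" by (intro choose_mult) auto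
    then have "real (\<kappa> choose l) * real (l choose s) = real (\<kappa> choose s) * real ((\<kappa> - s) choose (l - s))" by (simp only: of_nat_mult[symmetric])
    then show "real (\<kappa> choose l) * real (l choose s) * ?c l * x ^ s = real (\<kappa> choose s) * real ((\<kappa> - s) choose (l - s)) * ?c l * x ^ s" by simp
  qed
  also have "\<dots> = (\<Sum>s\<le>\<kappa>. \<Sum>l\<in>{s..\<kappa>}. real (\<kappa> choose s) * real ((\<kappa> - s) choose (l - s)) * ?c l * x ^ s)"
  proof -
    let ?f = "\<lambda>l s. real (\<kappa> choose s) * real ((\<kappa> - s) choose (l - s)) * ?c l * x ^ s"
    have "(\<Sum>l\<le>\<kappa>. \<Sum>s\<le>l. ?f l s) = (\<Sum>l\<in>{..\<kappa>}. \<Sum>s | s \<in> {..\<kappa>} \<and> s \<le> l. ?f l s)"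
      by (intro sum.cong refl) auto
    moreover have "\<dots> = (\<Sum>s\<in>{..\<kappa>}. \<Sum>l | l \<in> {..\<kappa>} \<and> s \<le> l. ?f l s)"
      by (rule sum.swap_restrict) auto
    moreover have "\<dots> = (\<Sum>s\<le>\<kappa>. \<Sum>l\<in>{s..\<kappa>}. ?f l s)"
      by (intro sum.cong refl) auto
    ultimately show ?thesis by (simp only:)
  qed
  also have "\<dots> \<le> (\<Sum>s\<le>\<kappa>. real (\<kappa> choose s) * (x * (real \<kappa> / n)) ^ s * real (n choose \<kappa>))"
  proof (rule sum_mono)
    fix s assume s: "s \<in> {..\<kappa>}"
    have "(\<Sum>l\<in>{s..\<kappa>}. real ((\<kappa> - s) choose (l - s)) * ?c l) = real (\<Sum>l\<in>{s..\<kappa>}. ((\<kappa> - s) choose (l - s)) * ((n - \<kappa>) choose (\<kappa> - l)))"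
      by simp
    also have "(\<Sum>l\<in>{s..\<kappa>}. ((\<kappa> - s) choose (l - s)) * ((n - \<kappa>) choose (\<kappa> - l))) = (\<Sum>t\<le>\<kappa> - s. ((\<kappa> - s) choose t) * ((n - \<kappa>) choose (\<kappa> - s - t)))"
      by (rule sum.reindex_bij_witness[of _ "\<lambda>t. s + t" "\<lambda>l. l - s"]) (use s in auto)
    also have "\<dots> = (\<kappa> - s + (n - \<kappa>)) choose (\<kappa> - s)" by (rule vandermonde)
    also have "\<kappa> - s + (n - \<kappa>) = n - s" using s assms by simp
    finally have "(\<Sum>l\<in>{s..\<kappa>}. real ((\<kappa> - s) choose (l - s)) * ?c l) \<le> (real \<kappa> / n) ^ s * real (n choose \<kappa>)"
      using binomial_shift_le[of s \<kappa> n] s assms n0 by simp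
    then have main: "real (\<kappa> choose s) * x ^ s * (\<Sum>l\<in>{s..\<kappa>}. real ((\<kappa> - s) choose (l - s)) * ?c l)
      \<le> real (\<kappa> choose s) * x ^ s * ((real \<kappa> / n) ^ s * real (n choose \<kappa>))"
      using assms by (intro mult_left_mono) auto
    show "(\<Sum>l\<in>{s..\<kappa>}. real (\<kappa> choose s) * real ((\<kappa> - s) choose (l - s)) * ?c l * x ^ s) \<le> real (\<kappa> choose s) * (x * (real \<kappa> / n)) ^ s * real (n choose \<kappa>)"
    proof -
      have e1: "(\<Sum>l\<in>{s..\<kappa>}. real (\<kappa> choose s) * real ((\<kappa> - s) choose (l - s)) * ?c l * x ^ s)
        = real (\<kappa> choose s) * x ^ s * (\<Sum>l\<in>{s..\<kappa>}. real ((\<kappa> - s) choose (l - s)) * ?c l)"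
        by (simp add: sum_distrib_left mult_ac)
      have e2: "real (\<kappa> choose s) * (x * (real \<kappa> / n)) ^ s * real (n choose \<kappa>)
        = real (\<kappa> choose s) * x ^ s * ((real \<kappa> / n) ^ s * real (n choose \<kappa>))"
        by (simp only: power_mult_distrib mult.assoc)
      show ?thesis unfolding e1 e2 by (rule main)
    qed
  qed
  also have "\<dots> = real (n choose \<kappa>) * (1 + x * (real \<kappa> / n)) ^ \<kappa>"
    using binomial_ring[of "x * (real \<kappa> / n)" 1 \<kappa>] by (simp add: sum_distrib_left sum_distrib_right add.commute mult_ac)
  also have "\<dots> \<le> real (n choose \<kappa>) * exp (x * (real \<kappa> / n)) ^ \<kappa>"
    using assms by (intro mult_left_mono power_mono exp_ge_add_one_self) auto
  also have "exp (x * (real \<kappa> / n)) ^ \<kappa> = exp (x * (real \<kappa>)\<^sup>2 / n)"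
    by (simp add: exp_of_nat_mult[symmetric] power2_eq_square mult_ac)
  finally show ?thesis .
qed

lemma sum_Pow_power_card:
  fixes x :: real
  assumes "finite A"
  shows "(\<Sum>J\<in>Pow A. x ^ card J) = (1 + x) ^ card A"
  using assms
proof (induction A rule: finite_induct)
  case (insert a A)
  have inj: "inj_on (insert a) (Pow A)" using insert by (auto simp: inj_on_def)
  have "(\<Sum>J\<in>insert a ` Pow A. x ^ card J) = (\<Sum>J\<in>Pow A. x * x ^ card J)"
    unfolding sum.reindex[OF inj] o_def
  proof (rule sum.cong[OF refl])
    fix J assume "J \<in> Pow A"
    then have "finite J" "a \<notin> J" using insert.hyps finite_subset[of J A] by auto
    then show "x ^ card (insert a J) = x * x ^ card J" by simp
  qed
  moreover have "(\<Sum>J\<in>Pow (insert a A). x ^ card J) = (\<Sum>J\<in>Pow A. x ^ card J) + (\<Sum>J\<in>insert a ` Pow A. x ^ card J)"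
    unfolding Pow_insert using insert by (intro sum.union_disjoint) auto
  ultimately show ?case using insert by (simp add: sum_distrib_left[symmetric] algebra_simps)
qed simp

lemma configs_Sigma: "configs n k r = (SIGMA K:{K. K \<subseteq> {1..n} \<and> card K = k + r}. matchings K r)"
proof (rule set_eqI)
  fix c :: "nat set \<times> nat set set"
  obtain K M where "c = (K, M)" by (cases c)
  then show "c \<in> configs n k r \<longleftrightarrow> c \<in> (SIGMA K:{K. K \<subseteq> {1..n} \<and> card K = k + r}. matchings K r)"
    by (simp add: configs_def matchings_def)
qed

lemma card_configs: "real (card (configs n k r)) = real (n choose (k + r)) * mt (k + r) r"
proof -
  let ?S = "{K. K \<subseteq> {1..n} \<and> card K = k + r}"
  have fS: "finite ?S" by (rule finite_subset[of _ "Pow {1..n}"]) auto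
  have fK: "finite K" if "K \<in> ?S" for K using that finite_subset[of K "{1..n}"] by simp
  have "card (configs n k r) = (\<Sum>K\<in>?S. card (matchings K r))"
    unfolding configs_Sigma by (rule card_SigmaI[OF fS]) (use fK finite_matchings in blast)
  then have "real (card (configs n k r)) = (\<Sum>K\<in>?S. real (card (matchings K r)))" by simp
  moreover have "(\<Sum>K\<in>?S. real (card (matchings K r))) = (\<Sum>K\<in>?S. mt (k + r) r)"
  proof (rule sum.cong[OF refl])
    fix K assume K: "K \<in> ?S"
    then show "real (card (matchings K r)) = mt (k + r) r" using card_matchings[OF fK[OF K], of r] by simp
  qed
  moreover have "card ?S = n choose (k + r)" using n_subsets[of "{1..n}" "k + r"] by simp
  ultimately show ?thesis by simp
qed

text \<open>Write the power over \<open>M \<inter> M'\<close> as at most a sum over its subsets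
  \<open>J\<close> and count the configurations whose matching contains a given \<open>J\<close>.
  The set \<open>K'\<close> contains the 2 |J| points of \<open>J\<close> with relative frequency at
  most (l / \<kappa>)^(2 |J|), and \<open>mt_ratio\<close> bounds the matchings. The sum over
  \<open>J\<close> is then an exact binomial power.\<close>

lemma count_small:
  fixes p :: real
  assumes cfg: "(K, M) \<in> configs n k r" and p: "0 < p" and r: "4 * r \<le> k + r" "0 < k + r" and l: "l \<le> k + r"
  defines "\<kappa> \<equiv> k + r"
  shows "(\<Sum>c\<in>{c \<in> configs n k r. card (K \<inter> fst c) = l}. (2 / p) ^ card (M \<inter> snd c))
    \<le> real (\<kappa> choose l) * real ((n - \<kappa>) choose (\<kappa> - l)) * mt \<kappa> r * exp (16 * (real r)\<^sup>2 * (real l)\<^sup>2 / (p * real \<kappa> ^ 4))"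
proof -
  note K = cfg_K[OF cfg] and M = cfg_M[OF cfg]
  let ?C = "{c \<in> configs n k r. card (K \<inter> fst c) = l}"
  let ?H = "real (\<kappa> choose l) * real ((n - \<kappa>) choose (\<kappa> - l)) * mt \<kappa> r"
  define y where "y = (2 / p) * ((8 * real r / (real \<kappa>)\<^sup>2) * (real l / real \<kappa>)\<^sup>2)"
  have y0: "0 \<le> y" using p by (simp add: y_def)
  have cnt: "real (card {c \<in> ?C. J \<subseteq> snd c}) \<le> ?H * ((8 * real r / (real \<kappa>)\<^sup>2) * (real l / real \<kappa>)\<^sup>2) ^ card J" if J: "J \<subseteq> M" for J
  proof -
    define s where "s = card J"
    have finJ: "finite J" using J M finite_subset by auto
    have s: "s \<le> r" using J M card_mono[of M J] by (auto simp: s_def)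
    have UJ: "card (\<Union>J) = 2 * s" "\<Union>J \<subseteq> K" "finite (\<Union>J)"
    proof -
      show "card (\<Union>J) = 2 * s" unfolding s_def using J M by (intro card_Union_edges[of _ K] pairwise_subset[OF M(3)]) auto
      show "\<Union>J \<subseteq> K" using J M by auto
      then show "finite (\<Union>J)" using K finite_subset by auto
    qed
    let ?S = "{K'. K' \<subseteq> {1..n} \<and> card K' = \<kappa> \<and> card (K \<inter> K') = l \<and> \<Union>J \<subseteq> K'}"
    have finS: "finite ?S" by (rule finite_subset[of _ "Pow {1..n}"]) auto
    have finK': "finite K'" if "K' \<in> ?S" for K' using that finite_subset[of K' "{1..n}"] by auto
    have fiber: "real (card {M' \<in> matchings K' r. J \<subseteq> M'}) \<le> (8 * real r / (real \<kappa>)\<^sup>2) ^ s * mt \<kappa> r" if K': "K' \<in> ?S" for K'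
    proof -
      have "card {M' \<in> matchings K' r. J \<subseteq> M'} \<le> card (matchings (K' - \<Union>J) (r - s))"
      proof (rule card_inj_on_le[of "\<lambda>M'. M' - J"])
        show "inj_on (\<lambda>M'. M' - J) {M' \<in> matchings K' r. J \<subseteq> M'}"
        proof (rule inj_on_inverseI[where g = "\<lambda>S. S \<union> J"])
          fix M' assume "M' \<in> {M' \<in> matchings K' r. J \<subseteq> M'}" then show "M' - J \<union> J = M'" by auto
        qed
        show "(\<lambda>M'. M' - J) ` {M' \<in> matchings K' r. J \<subseteq> M'} \<subseteq> matchings (K' - \<Union>J) (r - s)"
        proof clarify
          fix M' assume M': "M' \<in> matchings K' r" "J \<subseteq> M'"
          then have P: "M' \<subseteq> {e. e \<subseteq> K' \<and> card e = 2}" "card M' = r" "pairwise disjnt M'" by (auto simp: matchings_def)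
          have "M' - J \<subseteq> {e. e \<subseteq> K' - \<Union>J \<and> card e = 2}"
          proof
            fix e assume e: "e \<in> M' - J"
            have "e \<inter> e' = {}" if "e' \<in> J" for e'
            proof -
              have "e \<in> M'" "e' \<in> M'" "e \<noteq> e'" using e that M' by auto
              then show ?thesis using pairwiseD[OF P(3)] by (simp add: disjnt_def)
            qed
            then show "e \<in> {e. e \<subseteq> K' - \<Union>J \<and> card e = 2}" using e P(1) by auto
          qed
          moreover have "card (M' - J) = r - s" using P M' finJ by (simp add: card_Diff_subset s_def)
          moreover have "pairwise disjnt (M' - J)" using P(3) by (rule pairwise_subset) auto
          ultimately show "M' - J \<in> matchings (K' - \<Union>J) (r - s)" by (auto simp: matchings_def)
        qed
        show "finite (matchings (K' - \<Union>J) (r - s))" using finK'[OF K'] by (intro finite_matchings) auto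
      qed
      then have "real (card {M' \<in> matchings K' r. J \<subseteq> M'}) \<le> mt (card (K' - \<Union>J)) (r - s)"
        using card_matchings[of "K' - \<Union>J" "r - s"] finK'[OF K'] by simp
      also have "card (K' - \<Union>J) = \<kappa> - 2 * s" using K' UJ by (simp add: card_Diff_subset)
      also have "mt (\<kappa> - 2 * s) (r - s) \<le> (8 * real r / (real \<kappa>)\<^sup>2) ^ s * mt \<kappa> r"
        using s r by (intro mt_ratio) (auto simp: \<kappa>_def)
      finally show ?thesis .
    qed
    \<comment> \<open>If \<open>\<Union>J\<close> has more than \<open>l\<close> points, it does not
      fit into \<open>K \<inter> K'\<close> and there is nothing to count. The case split also keeps
      \<open>l - 2 * s\<close> from being truncated.\<close>
    have cS: "real (card ?S) \<le> (real l / real \<kappa>) ^ (2 * s) * (real (\<kappa> choose l) * real ((n - \<kappa>) choose (\<kappa> - l)))"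
    proof (cases "2 * s \<le> l")
      case False
      have "?S = {}"
      proof (rule ccontr)
        assume "?S \<noteq> {}"
        then obtain K' where "card (K \<inter> K') = l" "\<Union>J \<subseteq> K'" by auto
        then show False using card_mono[of "K \<inter> K'" "\<Union>J"] UJ K False by auto
      qed
      then have "card ?S = 0" by (simp only: card.empty)
      then show ?thesis by (simp only: of_nat_0) simp
    next
      case True
      let ?A = "{A. A \<subseteq> K - \<Union>J \<and> card A = l - 2 * s}" and ?B = "{B. B \<subseteq> {1..n} - K \<and> card B = \<kappa> - l}"
      have "card ?S \<le> card (?A \<times> ?B)"
      proof (rule card_inj_on_le[of "\<lambda>K'. (K \<inter> K' - \<Union>J, K' - K)"])
        show "inj_on (\<lambda>K'. (K \<inter> K' - \<Union>J, K' - K)) ?S"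
        proof (rule inj_on_inverseI[where g = "\<lambda>(A, B). A \<union> \<Union>J \<union> B"])
          fix K' assume "K' \<in> ?S"
          then show "(case (K \<inter> K' - \<Union>J, K' - K) of (A, B) \<Rightarrow> A \<union> \<Union>J \<union> B) = K'" using UJ by auto
        qed
        show "(\<lambda>K'. (K \<inter> K' - \<Union>J, K' - K)) ` ?S \<subseteq> ?A \<times> ?B"
        proof (rule image_subsetI)
          fix K' assume "K' \<in> ?S"
          then have K': "K' \<subseteq> {1..n}" "card K' = \<kappa>" "\<Union>J \<subseteq> K'" "card (K \<inter> K') = l" by auto
          have "finite K'" using finite_subset[OF K'(1)] by simp
          then have "card (K' - K) = \<kappa> - card (K \<inter> K')" using K' by (subst card_Diff_subset_Int) (auto simp: Int_commute)
          moreover have "card (K \<inter> K' - \<Union>J) = card (K \<inter> K') - 2 * s" using UJ K' by (subst card_Diff_subset) auto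
          ultimately show "(K \<inter> K' - \<Union>J, K' - K) \<in> ?A \<times> ?B" using K' by auto
        qed
        show "finite (?A \<times> ?B)" using K by (intro finite_cartesian_product finite_subset[of ?A "Pow K"] finite_subset[of ?B "Pow {1..n}"]) auto
      qed
      also have "\<dots> = ((\<kappa> - 2 * s) choose (l - 2 * s)) * ((n - \<kappa>) choose (\<kappa> - l))"
        using n_subsets[of "K - \<Union>J" "l - 2 * s"] n_subsets[of "{1..n} - K" "\<kappa> - l"] K UJ
        by (simp add: card_cartesian_product card_Diff_subset \<kappa>_def)
      finally have "real (card ?S) \<le> real ((\<kappa> - 2 * s) choose (l - 2 * s)) * real ((n - \<kappa>) choose (\<kappa> - l))"
        by (simp only: of_nat_mult[symmetric] of_nat_le_iff)
      also have "\<dots> \<le> ((real l / real \<kappa>) ^ (2 * s) * real (\<kappa> choose l)) * real ((n - \<kappa>) choose (\<kappa> - l))"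
        using True l r by (intro mult_right_mono binomial_shift_le) (auto simp: \<kappa>_def)
      finally show ?thesis by simp
    qed
    have "{c \<in> ?C. J \<subseteq> snd c} = (SIGMA K':?S. {M' \<in> matchings K' r. J \<subseteq> M'})"
    proof (intro set_eqI iffI)
      fix c assume "c \<in> {c \<in> ?C. J \<subseteq> snd c}"
      then have c: "c \<in> configs n k r" "card (K \<inter> fst c) = l" "J \<subseteq> snd c" by auto
      obtain K' M' where KM: "c = (K', M')" by (cases c)
      have "e \<subseteq> K'" if "e \<in> J" for e using that c KM by (auto simp: configs_def)
      then have "\<Union>J \<subseteq> K'" by (rule Union_least)
      then show "c \<in> (SIGMA K':?S. {M' \<in> matchings K' r. J \<subseteq> M'})"
        using c unfolding KM configs_Sigma \<kappa>_def by simp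
    next
      fix c assume c: "c \<in> (SIGMA K':?S. {M' \<in> matchings K' r. J \<subseteq> M'})"
      obtain K' M' where KM: "c = (K', M')" by (cases c)
      show "c \<in> {c \<in> ?C. J \<subseteq> snd c}" using c unfolding KM configs_Sigma \<kappa>_def by simp
    qed
    then have "real (card {c \<in> ?C. J \<subseteq> snd c}) = (\<Sum>K'\<in>?S. real (card {M' \<in> matchings K' r. J \<subseteq> M'}))"
      using finS finite_matchings[OF finK'] by (simp add: card_SigmaI)
    also have "\<dots> \<le> (\<Sum>K'\<in>?S. (8 * real r / (real \<kappa>)\<^sup>2) ^ s * mt \<kappa> r)" by (intro sum_mono fiber)
    also have "\<dots> = real (card ?S) * ((8 * real r / (real \<kappa>)\<^sup>2) ^ s * mt \<kappa> r)" by simp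
    also have "\<dots> \<le> ((real l / real \<kappa>) ^ (2 * s) * (real (\<kappa> choose l) * real ((n - \<kappa>) choose (\<kappa> - l)))) * ((8 * real r / (real \<kappa>)\<^sup>2) ^ s * mt \<kappa> r)"
      by (intro mult_right_mono cS mult_nonneg_nonneg mt_nonneg) auto
    also have "\<dots> = ?H * ((8 * real r / (real \<kappa>)\<^sup>2) * (real l / real \<kappa>)\<^sup>2) ^ s"
      unfolding power_mult_distrib power_mult by (simp only: mult_ac)
    finally show ?thesis unfolding s_def .
  qed
  have finC: "finite ?C" by simp
  have "(\<Sum>c\<in>?C. (2 / p) ^ card (M \<inter> snd c)) \<le> (\<Sum>c\<in>?C. \<Sum>J\<in>Pow M. of_bool (J \<subseteq> snd c) * (2 / p) ^ card J)"
  proof (rule sum_mono)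
    fix c assume "c \<in> ?C"
    have fin: "finite (M \<inter> snd c)" using M by simp
    \<comment> \<open>Enlarging the base by 1 turns the power into a sum over all subsets, which is
      linear in the indicators of \<open>J \<subseteq> snd c\<close>.\<close>
    have "(2 / p) ^ card (M \<inter> snd c) \<le> (1 + 2 / p) ^ card (M \<inter> snd c)" using p by (intro power_mono) auto
    also have "\<dots> = (\<Sum>J\<in>Pow (M \<inter> snd c). (2 / p) ^ card J)" using sum_Pow_power_card[OF fin] by simp
    also have "\<dots> = (\<Sum>J\<in>Pow M. of_bool (J \<subseteq> snd c) * (2 / p) ^ card J)"
      using M by (intro sum.mono_neutral_cong_left) auto
    finally show "(2 / p) ^ card (M \<inter> snd c) \<le> (\<Sum>J\<in>Pow M. of_bool (J \<subseteq> snd c) * (2 / p) ^ card J)" .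
  qed
  also have "\<dots> = (\<Sum>J\<in>Pow M. \<Sum>c\<in>?C. of_bool (J \<subseteq> snd c) * (2 / p) ^ card J)" by (rule sum.swap)
  also have "\<dots> = (\<Sum>J\<in>Pow M. real (card {c \<in> ?C. J \<subseteq> snd c}) * (2 / p) ^ card J)"
    unfolding sum_distrib_right[symmetric] using sum_of_bool_card[OF finC] by simp
  also have "\<dots> \<le> (\<Sum>J\<in>Pow M. ?H * y ^ card J)"
  proof (rule sum_mono)
    fix J assume "J \<in> Pow M"
    then have "real (card {c \<in> ?C. J \<subseteq> snd c}) * (2 / p) ^ card J \<le> ?H * ((8 * real r / (real \<kappa>)\<^sup>2) * (real l / real \<kappa>)\<^sup>2) ^ card J * (2 / p) ^ card J"
      using p by (intro mult_right_mono cnt) auto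
    also have "\<dots> = ?H * y ^ card J" unfolding y_def power_mult_distrib by (simp only: mult_ac)
    finally show "real (card {c \<in> ?C. J \<subseteq> snd c}) * (2 / p) ^ card J \<le> ?H * y ^ card J" .
  qed
  also have "\<dots> = ?H * (1 + y) ^ r"
    unfolding sum_distrib_left[symmetric] sum_Pow_power_card[OF M(4)] M(2) ..
  also have "\<dots> \<le> ?H * exp y ^ r"
    using y0 by (intro mult_left_mono power_mono exp_ge_add_one_self mult_nonneg_nonneg mt_nonneg) auto
  also have "exp y ^ r = exp (16 * (real r)\<^sup>2 * (real l)\<^sup>2 / (p * real \<kappa> ^ 4))"
    unfolding exp_of_nat_mult[symmetric] y_def by (simp add: power2_eq_square power4_eq_xxxx mult_ac)
  finally show ?thesis .
qed

lemma power_div_fact_le_exp: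
  fixes y :: real
  assumes "0 \<le> y"
  shows "y ^ u / fact u \<le> exp y"
proof -
  have "(\<Sum>n\<in>{u}. y ^ n /\<^sub>R fact n) \<le> (\<Sum>n. y ^ n /\<^sub>R fact n)"
    using assms by (intro sum_le_suminf summable_exp_generic) auto
  then show ?thesis unfolding exp_def by (simp add: divide_inverse mult.commute)
qed

lemma binomial_le_power_div_fact: "real (n choose s) \<le> real n ^ s / fact s"
proof -
  have "real ((n choose s) * fact s) \<le> real (n ^ s)" using binomial_fact_pow by (intro of_nat_mono)
  then show ?thesis by (simp add: field_simps)
qed

lemma inverse_fact_diff_le:
  assumes "s \<le> i"
  shows "1 / fact (i - s) \<le> real i ^ s / fact i"
proof -
  have "fact s * fact (i - s) * (i choose s) = (fact i :: nat)" using assms by (rule binomial_fact_lemma)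
  then have "fact i = fact (i - s) * ((i choose s) * fact s)" by (simp only: mult_ac)
  also have "\<dots> \<le> fact (i - s) * (i ^ s)" using binomial_fact_pow by (intro mult_left_mono) auto
  finally have "real (fact i) \<le> real (fact (i - s) * (i ^ s))" by (rule of_nat_mono)
  then show ?thesis by (simp add: field_simps)
qed

text \<open>Regroups everything into a power per new vertex (exponent \<open>i\<close>) and a power
  per changed matching edge (exponent \<open>u\<close>). Trading 1 / (i - s)! for i^s / i! and 1 /
  (x! (u - x)!) for 2^u / u! leaves the squares of i^i / i! and y^u / u! with y = i + 2 u. They are
  bounded by exponentials, whose product exp (2 i + 2 y) is the origin of \<open>exp 4\<close> in
  both bases.\<close>

lemma count_numeric:
  fixes p \<beta> :: real and n \<kappa> r i u s x :: nat
  assumes p: "0 < p" and \<beta>: "1 \<le> \<beta>" "4 * real \<kappa> * p \<le> \<beta>" and su: "s \<le> i" "s \<le> 2 * u" "x \<le> s" "x \<le> u" "i \<le> \<kappa>"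
  shows "(real n ^ i / fact i) * (real r ^ u / fact u) * 4 ^ u * (real \<kappa> ^ (i - s) / fact (i - s)) *
      ((real i * real \<kappa>) ^ x / fact x) * (((real i + 2 * real u)\<^sup>2) ^ (u - x) / fact (u - x)) *
      ((2 * p) ^ u * (4 * real i * p) ^ (2 * i - x + s))
    \<le> (16 * exp 4 * real n * real \<kappa> * p\<^sup>2) ^ i * (16 * exp 4 * real r * p * \<beta>\<^sup>2) ^ u"
proof -
  define y where "y = real i + 2 * real u"
  define a where "a = i - s"
  define b where "b = s - x"
  define c where "c = u - x"
  have idx: "i = a + b + x" "s = b + x" "u = c + x" "2 * i - x + s = 2 * i + b"
    using su by (auto simp: a_def b_def c_def)
  have y0: "0 \<le> y" "real i \<le> y" by (auto simp: y_def)
  \<comment> \<open>The surplus of s - x small factors restores the powers of \<kappa> lost in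
    \<kappa>^(i - s): each of them together with a factor i is at most \<kappa> \<beta>. The price
    \<beta>^(2 u) is charged to the changed matching edges, since s is at most 2 u.\<close>
  have f1: "real \<kappa> ^ a * (real i * real \<kappa>) ^ x * real i ^ s * (4 * real i * p) ^ b \<le> real \<kappa> ^ i * \<beta> ^ (2 * u) * (real i ^ x)\<^sup>2"
  proof -
    have "real \<kappa> ^ a * (real i * real \<kappa>) ^ x * real i ^ s * (4 * real i * p) ^ b
      = real \<kappa> ^ (a + x) * (real i ^ x)\<^sup>2 * (real i * (4 * real i * p)) ^ b"
      unfolding idx(2) power_add power_mult_distrib power2_eq_square by (simp only: mult_ac)
    also have "\<dots> \<le> real \<kappa> ^ (a + x) * (real i ^ x)\<^sup>2 * (real \<kappa> * \<beta>) ^ b"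
    proof (intro mult_left_mono power_mono)
      have "real i * (4 * real i * p) \<le> real \<kappa> * (4 * real \<kappa> * p)" using su p by (intro mult_mono) auto
      also have "\<dots> \<le> real \<kappa> * \<beta>" using \<beta> by (intro mult_left_mono) auto
      finally show "real i * (4 * real i * p) \<le> real \<kappa> * \<beta>" .
    qed (use p in auto)
    also have "\<dots> = real \<kappa> ^ i * \<beta> ^ b * (real i ^ x)\<^sup>2"
      unfolding idx(1) power_add power_mult_distrib by (simp only: mult_ac)
    also have "\<dots> \<le> real \<kappa> ^ i * \<beta> ^ (2 * u) * (real i ^ x)\<^sup>2"
      using \<beta> su by (intro mult_right_mono mult_left_mono power_increasing) (auto simp: b_def)
    finally show ?thesis .
  qed
  have f2: "real i ^ i / fact i \<le> exp (real i)" "y ^ u / fact u \<le> exp y"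
    using y0 by (auto intro!: power_div_fact_le_exp)
  have f3: "1 / (fact x * fact c) \<le> (2 ^ u / fact u :: real)"
  proof -
    have "fact x * fact c * (u choose x) = (fact u :: nat)" using su unfolding c_def by (intro binomial_fact_lemma) auto
    then have "real (fact x * fact c * (u choose x)) = real (fact u)" by (simp only:)
    then have e: "fact x * fact c * real (u choose x) = fact u" by simp
    have "1 / (fact x * fact c) = real (u choose x) / fact u" unfolding e[symmetric] using su by simp
    also have "real (u choose x) \<le> real (2 ^ u)" by (intro of_nat_mono binomial_le_pow2)
    then have "real (u choose x) / fact u \<le> 2 ^ u / fact u" by (intro divide_right_mono) auto
    finally show ?thesis .
  qed
  have f4: "(real i ^ x)\<^sup>2 * (y\<^sup>2) ^ c \<le> (y ^ u)\<^sup>2"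
  proof -
    have "(real i ^ x)\<^sup>2 * (y\<^sup>2) ^ c \<le> (y ^ x)\<^sup>2 * (y\<^sup>2) ^ c"
      using y0 by (intro mult_right_mono power_mono) auto
    also have "\<dots> = (y ^ u)\<^sup>2" unfolding idx(3) power_add power_mult_distrib power_mult[symmetric] by (simp add: mult_ac)
    finally show ?thesis .
  qed
  have "(real n ^ i / fact i) * (real r ^ u / fact u) * 4 ^ u * (real \<kappa> ^ a / fact a) *
      ((real i * real \<kappa>) ^ x / fact x) * ((y\<^sup>2) ^ c / fact c) * ((2 * p) ^ u * (4 * real i * p) ^ (2 * i + b))
    = ((real n ^ i * (4 * real i * p) ^ (2 * i) / fact i) * (real r ^ u * 4 ^ u * (2 * p) ^ u / fact u)) *
      ((real \<kappa> ^ a * (real i * real \<kappa>) ^ x * (4 * real i * p) ^ b * (y\<^sup>2) ^ c) * ((1 / fact a) * (1 / (fact x * fact c))))"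
    unfolding divide_inverse inverse_mult_distrib power_add by (simp only: mult_ac mult_1_left)
  also have "\<dots> \<le> ((real n ^ i * (4 * real i * p) ^ (2 * i) / fact i) * (real r ^ u * 4 ^ u * (2 * p) ^ u / fact u)) *
      ((real \<kappa> ^ a * (real i * real \<kappa>) ^ x * (4 * real i * p) ^ b * (y\<^sup>2) ^ c) * ((real i ^ s / fact i) * (2 ^ u / fact u)))"
    using p inverse_fact_diff_le[OF su(1)] f3 unfolding a_def[symmetric]
    by (intro mult_left_mono mult_mono) auto
  also have "\<dots> = ((real n ^ i * (4 * real i * p) ^ (2 * i) / fact i / fact i) * (real r ^ u * 4 ^ u * (2 * p) ^ u * 2 ^ u / fact u / fact u)) *
      ((real \<kappa> ^ a * (real i * real \<kappa>) ^ x * real i ^ s * (4 * real i * p) ^ b) * (y\<^sup>2) ^ c)"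
    unfolding divide_inverse by (simp only: mult_ac)
  also have "\<dots> \<le> ((real n ^ i * (4 * real i * p) ^ (2 * i) / fact i / fact i) * (real r ^ u * 4 ^ u * (2 * p) ^ u * 2 ^ u / fact u / fact u)) *
      ((real \<kappa> ^ i * \<beta> ^ (2 * u) * (real i ^ x)\<^sup>2) * (y\<^sup>2) ^ c)"
    using p f1 by (intro mult_left_mono mult_right_mono) auto
  also have "\<dots> \<le> ((real n ^ i * (4 * real i * p) ^ (2 * i) / fact i / fact i) * (real r ^ u * 4 ^ u * (2 * p) ^ u * 2 ^ u / fact u / fact u)) *
      ((real \<kappa> ^ i * \<beta> ^ (2 * u)) * (y ^ u)\<^sup>2)"
    unfolding mult.assoc[of "real \<kappa> ^ i * \<beta> ^ (2 * u)"] using p f4 \<beta> by (intro mult_left_mono) auto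
  also have "\<dots> = (16 * real n * real \<kappa> * p\<^sup>2) ^ i * (real i ^ i / fact i)\<^sup>2 * ((16 * real r * p * \<beta>\<^sup>2) ^ u * (y ^ u / fact u)\<^sup>2)"
  proof -
    have g1: "(4 * real i * p) ^ (2 * i) = (16 * p\<^sup>2) ^ i * (real i ^ i)\<^sup>2"
      by (simp add: power_mult power_mult_distrib[symmetric] power2_eq_square mult_ac)
    have g2: "4 ^ u * (2 * p) ^ u * 2 ^ u = (16 * p) ^ u"
    proof -
      have "4 ^ u * (2 * p) ^ u * 2 ^ u = (4 * (2 * p) * 2) ^ u" by (simp only: power_mult_distrib)
      then show ?thesis by simp
    qed
    have "((real n ^ i * (4 * real i * p) ^ (2 * i) / fact i / fact i) * (real r ^ u * 4 ^ u * (2 * p) ^ u * 2 ^ u / fact u / fact u)) *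
      ((real \<kappa> ^ i * \<beta> ^ (2 * u)) * (y ^ u)\<^sup>2)
      = (real n ^ i * ((16 * p\<^sup>2) ^ i * (real i ^ i)\<^sup>2) / fact i / fact i * (real r ^ u * (4 ^ u * (2 * p) ^ u * 2 ^ u) / fact u / fact u)) *
      ((real \<kappa> ^ i * \<beta> ^ (2 * u)) * (y ^ u)\<^sup>2)"
      unfolding g1 by (simp only: mult.assoc)
    also have "\<dots> = (real n ^ i * (16 * p\<^sup>2) ^ i * real \<kappa> ^ i) * (real i ^ i / fact i)\<^sup>2 * ((real r ^ u * (16 * p) ^ u * \<beta> ^ (2 * u)) * (y ^ u / fact u)\<^sup>2)"
      unfolding g2 by (simp add: power_divide power2_eq_square)
    also have "\<dots> = (16 * real n * real \<kappa> * p\<^sup>2) ^ i * (real i ^ i / fact i)\<^sup>2 * ((16 * real r * p * \<beta>\<^sup>2) ^ u * (y ^ u / fact u)\<^sup>2)"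
      unfolding power_mult power_mult_distrib by (simp only: mult_ac)
    finally show ?thesis .
  qed
  also have "\<dots> \<le> (16 * real n * real \<kappa> * p\<^sup>2) ^ i * (exp (real i))\<^sup>2 * ((16 * real r * p * \<beta>\<^sup>2) ^ u * (exp y)\<^sup>2)"
    using p f2 y0 by (intro mult_mono mult_left_mono power_mono) auto
  also have "\<dots> = (16 * exp 4 * real n * real \<kappa> * p\<^sup>2) ^ i * (16 * exp 4 * real r * p * \<beta>\<^sup>2) ^ u"
  proof -
    have "(exp (real i))\<^sup>2 * (exp y)\<^sup>2 = exp 4 ^ i * exp 4 ^ u"
      unfolding y_def by (simp add: exp_add[symmetric] exp_double[symmetric] exp_of_nat_mult[symmetric] algebra_simps)
    moreover have "A * (exp (real i))\<^sup>2 * (B * (exp y)\<^sup>2) = A * B * ((exp (real i))\<^sup>2 * (exp y)\<^sup>2)" for A B by simp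
    ultimately have "(16 * real n * real \<kappa> * p\<^sup>2) ^ i * (exp (real i))\<^sup>2 * ((16 * real r * p * \<beta>\<^sup>2) ^ u * (exp y)\<^sup>2)
      = (16 * real n * real \<kappa> * p\<^sup>2) ^ i * (16 * real r * p * \<beta>\<^sup>2) ^ u * (exp 4 ^ i * exp 4 ^ u)" by (simp only:)
    then show ?thesis by (simp only: power_mult_distrib mult_ac)
  qed
  finally show ?thesis unfolding a_def b_def[symmetric] c_def y_def idx(4) .
qed

text \<open>\<open>K'\<close> and \<open>M'\<close> are recovered from \<open>K' - K\<close>,
  \<open>M - M'\<close>, the removed vertices inside and outside \<open>\<Union>M\<close>, the
  crossing edges and the other new matching edges. The choices shrink for two reasons: a removed
  vertex of \<open>\<Union>M\<close> lies on an edge of \<open>M - M'\<close>, and a new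
  non-crossing edge lives on \<open>(K' - K) \<union> \<Union>(M - M')\<close>. Without the second
  fact the new edges would have far too many positions.\<close>

lemma count_class:
  assumes cfg: "(K, M) \<in> configs n k r" and sx: "s \<le> i" "x \<le> u"
  shows "real (card {c \<in> configs n k r. card (fst c - K) = i \<and> (\<exists>G\<in>graphs_nm n m. good n K M G \<and> good n (fst c) (snd c) G) \<and>
      card (snd c - M) = u \<and> card ((K - fst c) \<inter> \<Union>M) = s \<and> card (crossing K M (fst c) (snd c)) = x})
    \<le> (real n ^ i / fact i) * (real r ^ u / fact u) * 4 ^ u * (real (k + r) ^ (i - s) / fact (i - s)) *
      ((real i * real (k + r)) ^ x / fact x) * (((real i + 2 * real u)\<^sup>2) ^ (u - x) / fact (u - x))"
    (is "real (card ?C) \<le> _")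
proof -
  note K = cfg_K[OF cfg] and M = cfg_M[OF cfg] and U = cfg_U[OF cfg]
  define PW where "PW = {W. W \<subseteq> {1..n} \<and> card W = i}"
  define PO where "PO = {Q. Q \<subseteq> M \<and> card Q = u}"
  define S1 where "S1 Q = {A. A \<subseteq> \<Union>Q \<and> card A = s}" for Q :: "nat set set"
  define S2 where "S2 = {A. A \<subseteq> K \<and> card A = i - s}"
  define S3 where "S3 W = {A. A \<subseteq> (\<lambda>(w, y). {w, y}) ` (W \<times> K) \<and> card A = x}" for W
  define S4 where "S4 W Q = {A. A \<subseteq> {e. e \<subseteq> W \<union> \<Union>Q \<and> card e = 2} \<and> card A = u - x}" for W :: "nat set" and Q
  define T where "T = (SIGMA wo:PW \<times> PO. S1 (snd wo) \<times> (S2 \<times> (S3 (fst wo) \<times> S4 (fst wo) (snd wo))))"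
  define g where "g = (\<lambda>((W, Q), (A, (B, (N1, N2)))). ((K - (A \<union> B)) \<union> W, (M - Q) \<union> (N1 \<union> N2)))"
  have finW: "finite W" if "W \<in> PW" for W using that finite_subset[of W "{1..n}"] by (simp add: PW_def)
  have finQ: "finite (\<Union>Q)" "card (\<Union>Q) = 2 * u" if "Q \<in> PO" for Q
  proof -
    have q: "Q \<subseteq> M" "card Q = u" using that by (auto simp: PO_def)
    then have "\<Union>Q \<subseteq> \<Union>M" by auto
    then show "finite (\<Union>Q)" by (rule finite_subset[OF _ U(3)])
    show "card (\<Union>Q) = 2 * u" unfolding q(2)[symmetric] using q(1) M by (intro card_Union_edges[of _ K] pairwise_subset[OF M(3)]) auto
  qed
  have cPW: "real (card PW) \<le> real n ^ i / fact i"
    unfolding PW_def using n_subsets[of "{1..n}" i] binomial_le_power_div_fact[of n i] by simp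
  have cPO: "real (card PO) \<le> real r ^ u / fact u"
    unfolding PO_def using n_subsets[OF M(4), of u] M(2) binomial_le_power_div_fact[of r u] by simp
  have c1: "real (card (S1 Q)) \<le> 4 ^ u" if "Q \<in> PO" for Q
  proof -
    have "card (S1 Q) = (2 * u) choose s" unfolding S1_def using n_subsets[OF finQ(1)[OF that]] finQ(2)[OF that] by simp
    then have "card (S1 Q) \<le> 2 ^ (2 * u)" using binomial_le_pow2 by simp
    then have "real (card (S1 Q)) \<le> real (2 ^ (2 * u))" by (rule of_nat_mono)
    then show ?thesis by (simp add: power_mult)
  qed
  have c2: "real (card S2) \<le> real (k + r) ^ (i - s) / fact (i - s)"
    unfolding S2_def using n_subsets[OF K(3)] K(2) binomial_le_power_div_fact[of "k + r" "i - s"] by simp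
  have c3: "real (card (S3 W)) \<le> (real i * real (k + r)) ^ x / fact x" if "W \<in> PW" for W
  proof -
    let ?E = "(\<lambda>(w, y). {w, y}) ` (W \<times> K)"
    have fE: "finite ?E" using finW[OF that] K by auto
    have "card ?E \<le> card (W \<times> K)" using finW[OF that] K by (intro card_image_le) auto
    then have "card ?E \<le> i * (k + r)" using that K by (simp add: PW_def card_cartesian_product)
    then have "real (card ?E) \<le> real (i * (k + r))" by (rule of_nat_mono)
    then have "real (card ?E) ^ x / fact x \<le> (real i * real (k + r)) ^ x / fact x" by (intro divide_right_mono power_mono) auto
    moreover have "card (S3 W) = card ?E choose x" unfolding S3_def by (rule n_subsets[OF fE])
    ultimately show ?thesis using binomial_le_power_div_fact[of "card ?E" x] by simp
  qed
  have c4: "real (card (S4 W Q)) \<le> ((real i + 2 * real u)\<^sup>2) ^ (u - x) / fact (u - x)" if "W \<in> PW" "Q \<in> PO" for W Q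
  proof -
    let ?E = "{e. e \<subseteq> W \<union> \<Union>Q \<and> card e = 2}"
    have fWQ: "finite (W \<union> \<Union>Q)" using finW finQ that by auto
    have fE: "finite ?E" using finite_pairs[OF fWQ] .
    have "card (W \<union> \<Union>Q) \<le> i + 2 * u" using card_Un_le[of W "\<Union>Q"] finQ[OF that(2)] that by (simp add: PW_def)
    then have le: "real (card (W \<union> \<Union>Q)) \<le> real i + 2 * real u" by linarith
    have "real (card ?E) = real (card (W \<union> \<Union>Q) choose 2)" using card_pairs[OF fWQ] by simp
    also have "\<dots> \<le> real (card (W \<union> \<Union>Q)) ^ 2 / fact 2" by (rule binomial_le_power_div_fact)
    also have "\<dots> \<le> real (card (W \<union> \<Union>Q)) ^ 2" by (simp add: fact_numeral)
    also have "\<dots> \<le> (real i + 2 * real u)\<^sup>2" using le by (intro power_mono) auto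
    finally have "real (card ?E) ^ (u - x) / fact (u - x) \<le> ((real i + 2 * real u)\<^sup>2) ^ (u - x) / fact (u - x)"
      by (intro divide_right_mono power_mono) auto
    moreover have "card (S4 W Q) = card ?E choose (u - x)" unfolding S4_def by (rule n_subsets[OF fE])
    ultimately show ?thesis using binomial_le_power_div_fact[of "card ?E" "u - x"] by simp
  qed
  have fPWO: "finite (PW \<times> PO)"
  proof -
    have "finite PW" unfolding PW_def by (rule finite_subset[of _ "Pow {1..n}"]) auto
    moreover have "finite PO" unfolding PO_def by (rule finite_subset[of _ "Pow M"]) (use M in auto)
    ultimately show ?thesis by simp
  qed
  have ffib: "finite (S1 (snd wo) \<times> (S2 \<times> (S3 (fst wo) \<times> S4 (fst wo) (snd wo))))" if "wo \<in> PW \<times> PO" for wo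
  proof -
    have w: "fst wo \<in> PW" "snd wo \<in> PO" using that by auto
    have "finite (S1 (snd wo))" unfolding S1_def by (rule finite_subset[of _ "Pow (\<Union>(snd wo))"]) (use finQ[OF w(2)] in auto)
    moreover have "finite S2" unfolding S2_def by (rule finite_subset[of _ "Pow K"]) (use K in auto)
    moreover have "finite (S3 (fst wo))" unfolding S3_def by (rule finite_subset[of _ "Pow ((\<lambda>(w, y). {w, y}) ` (fst wo \<times> K))"]) (use finW[OF w(1)] K in auto)
    moreover have "finite (S4 (fst wo) (snd wo))"
      unfolding S4_def by (rule finite_subset[of _ "Pow {e. e \<subseteq> fst wo \<union> \<Union>(snd wo) \<and> card e = 2}"]) (use finite_pairs[of "fst wo \<union> \<Union>(snd wo)"] finW[OF w(1)] finQ[OF w(2)] in auto)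
    ultimately show ?thesis by simp
  qed
  have finT: "finite T" unfolding T_def by (intro finite_SigmaI fPWO ffib)
  let ?R = "4 ^ u * ((real (k + r) ^ (i - s) / fact (i - s)) * (((real i * real (k + r)) ^ x / fact x) * (((real i + 2 * real u)\<^sup>2) ^ (u - x) / fact (u - x))))"
  have "real (card T) \<le> ((real n ^ i / fact i) * (real r ^ u / fact u)) * ?R"
  proof -
    have "card T = (\<Sum>wo\<in>PW \<times> PO. card (S1 (snd wo) \<times> (S2 \<times> (S3 (fst wo) \<times> S4 (fst wo) (snd wo)))))"
      unfolding T_def by (rule card_SigmaI[OF fPWO]) (use ffib in blast)
    then have "real (card T) = (\<Sum>wo\<in>PW \<times> PO. real (card (S1 (snd wo))) * (real (card S2) * (real (card (S3 (fst wo))) * real (card (S4 (fst wo) (snd wo))))))"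
      by (simp add: card_cartesian_product)
    also have "\<dots> \<le> (\<Sum>wo\<in>PW \<times> PO. ?R)"
    proof (rule sum_mono)
      fix wo assume "wo \<in> PW \<times> PO"
      then have w: "fst wo \<in> PW" "snd wo \<in> PO" by auto
      show "real (card (S1 (snd wo))) * (real (card S2) * (real (card (S3 (fst wo))) * real (card (S4 (fst wo) (snd wo))))) \<le> ?R"
        by (intro mult_mono c1[OF w(2)] c2 c3[OF w(1)] c4[OF w] mult_nonneg_nonneg) auto
    qed
    also have "\<dots> = (real (card PW) * real (card PO)) * ?R" by (simp add: card_cartesian_product)
    also have "\<dots> \<le> ((real n ^ i / fact i) * (real r ^ u / fact u)) * ?R"
      by (intro mult_right_mono mult_mono cPW cPO mult_nonneg_nonneg) auto
    finally show ?thesis .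
  qed
  moreover have "card ?C \<le> card T"
  proof (rule surj_card_le[OF finT, of _ g], rule subsetI)
    fix c assume "c \<in> ?C"
    then obtain K' M' G where c: "c = (K', M')" "(K', M') \<in> configs n k r" "card (K' - K) = i"
      "G \<in> graphs_nm n m" "good n K M G" "good n K' M' G" "card (M' - M) = u" "card ((K - K') \<inter> \<Union>M) = s" "card (crossing K M K' M') = x"
      by (cases c) auto
    note K' = cfg_K[OF c(2)] and M' = cfg_M[OF c(2)] and U' = cfg_U[OF c(2)]
    have GE: "G \<subseteq> all_edges n" using c(4) by (auto simp: graphs_nm_def)
    let ?X = "crossing K M K' M'"
    have XM: "?X \<subseteq> M' - M" by (auto simp: crossing_def)
    have finX: "finite ?X" using XM M' finite_subset[of ?X "M' - M"] by auto
    have "((K' - K, M - M'), ((K - K') \<inter> \<Union>M, ((K - K') - \<Union>M, (?X, (M' - M) - ?X)))) \<in> T"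
    proof -
      have m1: "K' - K \<in> PW" using c(3) K'(1) by (auto simp: PW_def)
      have "card (M - M') = u"
      proof -
        have "card (M - M') = card M - card (M \<inter> M')" "card (M' - M) = card M' - card (M' \<inter> M)"
          using M M' by (auto simp: card_Diff_subset_Int)
        then show ?thesis using M M' c(7) by (simp add: Int_commute)
      qed
      then have m2: "M - M' \<in> PO" by (auto simp: PO_def)
      have m3: "(K - K') \<inter> \<Union>M \<in> S1 (M - M')"
      proof -
        have "(K - K') \<inter> \<Union>M \<subseteq> \<Union>(M - M')" using M'(1) by blast
        then show ?thesis using c(8) by (simp add: S1_def)
      qed
      have m4: "(K - K') - \<Union>M \<in> S2"
      proof -
        have "card (K - K') = i"
          using K K' c(3) card_Diff_subset_Int[of K K'] card_Diff_subset_Int[of K' K] by (auto simp: Int_commute)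
        then have "card ((K - K') - \<Union>M) = i - s" using c(8) K by (subst card_Diff_subset_Int) auto
        then show ?thesis by (auto simp: S2_def)
      qed
      have m5: "?X \<in> S3 (K' - K)"
      proof -
        have "?X \<subseteq> (\<lambda>(w, y). {w, y}) ` ((K' - K) \<times> K)"
        proof
          fix e assume e: "e \<in> ?X"
          obtain w y where "w \<in> K' - K" "y \<in> (K \<inter> K') - \<Union>M" "e = {w, y}"
            using crossing_edge[OF cfg c(2) GE c(5,6) e] .
          then show "e \<in> (\<lambda>(w, y). {w, y}) ` ((K' - K) \<times> K)" by (intro image_eqI[of _ _ "(w, y)"]) auto
        qed
        then show ?thesis using c(9) by (simp add: S3_def)
      qed
      have m6: "(M' - M) - ?X \<in> S4 (K' - K) (M - M')"
      proof -
        have "e \<subseteq> (K' - K) \<union> \<Union>(M - M')" if e: "e \<in> (M' - M) - ?X" for e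
        proof
          fix z assume z: "z \<in> e"
          have zK': "z \<in> K'" using z e M'(1) by auto
          show "z \<in> (K' - K) \<union> \<Union>(M - M')"
          proof (cases "z \<in> K")
            case True
            then have "z \<in> \<Union>M" using e z zK' by (auto simp: crossing_def)
            then obtain e0 where e0: "e0 \<in> M" "z \<in> e0" by auto
            \<comment> \<open>The edge of \<open>M\<close> at \<open>z\<close> cannot survive in
              \<open>M'\<close>, because the new edge \<open>e\<close> already covers
              \<open>z\<close>.\<close>
            have "e0 \<notin> M'"
            proof
              assume "e0 \<in> M'"
              moreover have "e0 \<noteq> e" using e e0 by auto
              ultimately have "disjnt e0 e" using pairwiseD[OF M'(3), of e0 e] e by auto
              then show False using e0 z by (auto simp: disjnt_def)
            qed
            then show ?thesis using e0 by auto
          qed (use zK' in auto)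
        qed
        moreover have "card e = 2" if "e \<in> (M' - M) - ?X" for e using that M'(1) by auto
        moreover have "card ((M' - M) - ?X) = u - x" using XM finX c by (simp add: card_Diff_subset)
        ultimately show ?thesis by (auto simp: S4_def)
      qed
      show ?thesis unfolding T_def using m1 m2 m3 m4 m5 m6 by simp
    qed
    moreover have "c = g ((K' - K, M - M'), ((K - K') \<inter> \<Union>M, ((K - K') - \<Union>M, (?X, (M' - M) - ?X))))"
    proof -
      have "(K - ((K - K') \<inter> \<Union>M \<union> ((K - K') - \<Union>M))) \<union> (K' - K) = K'" by auto
      moreover have "(M - (M - M')) \<union> (?X \<union> ((M' - M) - ?X)) = M'" using XM by auto
      ultimately show ?thesis unfolding g_def c(1) by simp
    qed
    ultimately show "c \<in> g ` T" by (rule image_eqI[rotated])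
  qed
  ultimately have "real (card ?C) \<le> ((real n ^ i / fact i) * (real r ^ u / fact u)) * ?R" by linarith
  then show ?thesis by (simp only: mult.assoc)
qed

text \<open>Groups the configurations by \<open>u\<close>, \<open>s\<close> and \<open>x\<close>.
  Within a group the weight is constant, and \<open>count_class\<close> with
  \<open>count_numeric\<close> gives B z^u. The sum over \<open>u\<close> converges geometrically,
  so changing the matching costs only a constant factor beyond changing the vertex set.\<close>

lemma count_large:
  fixes p \<beta> :: real
  assumes cfg: "(K, M) \<in> configs n k r" and p: "0 < p" and \<beta>: "1 \<le> \<beta>" "4 * real (k + r) * p \<le> \<beta>"
    and small: "192 * exp 4 * real r * p * \<beta>\<^sup>2 \<le> 1" and i: "i \<le> k + r"
  shows "(\<Sum>c\<in>{c \<in> configs n k r. card (fst c - K) = i \<and> (\<exists>G\<in>graphs_nm n m. good n K M G \<and> good n (fst c) (snd c) G)}.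
      (2 * p) ^ card (snd c - M) * (4 * real i * p) ^ (2 * i - card (crossing K M (fst c) (snd c)) + card ((K - fst c) \<inter> \<Union>M)))
    \<le> 2 * (16 * exp 4 * real n * real (k + r) * p\<^sup>2) ^ i" (is "(\<Sum>c\<in>?C. ?f c) \<le> _")
proof -
  note K = cfg_K[OF cfg] and M = cfg_M[OF cfg] and U = cfg_U[OF cfg]
  define \<tau> where "\<tau> c = (card (snd c - M), card ((K - fst c) \<inter> \<Union>M), card (crossing K M (fst c) (snd c)))" for c :: "nat set \<times> nat set set"
  define T where "T = {(u, s, x). u \<le> r \<and> s \<le> i \<and> s \<le> 2 * u \<and> x \<le> s \<and> x \<le> u}"
  define z where "z = 16 * exp 4 * real r * p * \<beta>\<^sup>2"
  define B where "B = (16 * exp 4 * real n * real (k + r) * p\<^sup>2) ^ i"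
  define w where "w t = (case t of (u, s, x) \<Rightarrow> (2 * p) ^ u * (4 * real i * p) ^ (2 * i - x + s))" for t :: "nat \<times> nat \<times> nat"
  have z: "0 \<le> z" "12 * z \<le> 1" using small p by (auto simp: z_def)
  have B0: "0 \<le> B" unfolding B_def by simp
  have Tsub: "T \<subseteq> (SIGMA u:{..r}. {..2 * u} \<times> {..u})" by (auto simp: T_def)
  have finT: "finite T" by (rule finite_subset[OF Tsub]) auto
  have img: "\<tau> ` ?C \<subseteq> T"
  proof (rule image_subsetI)
    fix c assume "c \<in> ?C"
    then obtain K' M' G where c: "c = (K', M')" "(K', M') \<in> configs n k r" "card (K' - K) = i"
      "G \<in> graphs_nm n m" "good n K M G" "good n K' M' G" by (cases c) auto
    note K' = cfg_K[OF c(2)] and M' = cfg_M[OF c(2)]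
    have GE: "G \<subseteq> all_edges n" using c(4) by (auto simp: graphs_nm_def)
    note cr = crossing_card[OF cfg c(2) GE c(5,6)]
    have a1: "card (M' - M) \<le> r" using card_mono[of M' "M' - M"] M' by auto
    have "card (K - K') = i"
      using K K' c(3) card_Diff_subset_Int[of K K'] card_Diff_subset_Int[of K' K] by (auto simp: Int_commute)
    then have a2: "card ((K - K') \<inter> \<Union>M) \<le> i" using card_mono[of "K - K'" "(K - K') \<inter> \<Union>M"] K by auto
    have a3: "card ((K - K') \<inter> \<Union>M) \<le> 2 * card (M' - M)"
    proof -
      have "(K - K') \<inter> \<Union>M \<subseteq> \<Union>(M - M')" using M'(1) by blast
      moreover have "finite (\<Union>(M - M'))" by (rule finite_subset[OF _ U(3)]) auto
      ultimately have "card ((K - K') \<inter> \<Union>M) \<le> card (\<Union>(M - M'))" by (intro card_mono)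
      also have "\<dots> = 2 * card (M - M')" using M by (intro card_Union_edges[of _ K] pairwise_subset[OF M(3)]) auto
      also have "card (M - M') = card (M' - M)"
      proof -
        have "card (M - M') = card M - card (M \<inter> M')" "card (M' - M) = card M' - card (M' \<inter> M)"
          using M M' by (auto simp: card_Diff_subset_Int)
        then show ?thesis using M M' by (simp add: Int_commute)
      qed
      finally show ?thesis .
    qed
    have "crossing K M K' M' \<subseteq> M' - M" by (auto simp: crossing_def)
    then have a4: "card (crossing K M K' M') \<le> card (M' - M)" using M' by (intro card_mono) auto
    show "\<tau> c \<in> T" unfolding \<tau>_def T_def c(1) using a1 a2 a3 a4 cr(4) by simp
  qed
  have fC: "finite ?C" by simp
  have "(\<Sum>c\<in>?C. ?f c) = (\<Sum>t\<in>T. \<Sum>c\<in>{c \<in> ?C. \<tau> c = t}. ?f c)"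
    using sum.group[OF fC finT img, of ?f] by simp
  also have "\<dots> \<le> (\<Sum>t\<in>T. B * z ^ fst t)"
  proof (rule sum_mono)
    fix t assume t: "t \<in> T"
    obtain u s x where tt: "t = (u, s, x)" by (cases t) auto
    have b: "u \<le> r" "s \<le> i" "s \<le> 2 * u" "x \<le> s" "x \<le> u" using t by (auto simp: T_def tt)
    have "(\<Sum>c\<in>{c \<in> ?C. \<tau> c = t}. ?f c) = (\<Sum>c\<in>{c \<in> ?C. \<tau> c = t}. w t)"
      by (rule sum.cong) (auto simp: \<tau>_def w_def tt)
    also have "\<dots> = real (card {c \<in> ?C. \<tau> c = t}) * w t" by simp
    also have "\<dots> \<le> ((real n ^ i / fact i) * (real r ^ u / fact u) * 4 ^ u * (real (k + r) ^ (i - s) / fact (i - s)) *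
      ((real i * real (k + r)) ^ x / fact x) * (((real i + 2 * real u)\<^sup>2) ^ (u - x) / fact (u - x))) * w t"
    proof (rule mult_right_mono)
      have "{c \<in> ?C. \<tau> c = t} = {c \<in> configs n k r. card (fst c - K) = i \<and> (\<exists>G\<in>graphs_nm n m. good n K M G \<and> good n (fst c) (snd c) G) \<and>
        card (snd c - M) = u \<and> card ((K - fst c) \<inter> \<Union>M) = s \<and> card (crossing K M (fst c) (snd c)) = x}"
        unfolding \<tau>_def tt by (rule Collect_cong) (simp add: conj_assoc)
      then show "real (card {c \<in> ?C. \<tau> c = t}) \<le> (real n ^ i / fact i) * (real r ^ u / fact u) * 4 ^ u * (real (k + r) ^ (i - s) / fact (i - s)) *
        ((real i * real (k + r)) ^ x / fact x) * (((real i + 2 * real u)\<^sup>2) ^ (u - x) / fact (u - x))"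
        using count_class[OF cfg b(2,5), of m] by simp
      show "0 \<le> w t" using p by (simp add: w_def tt)
    qed
    also have "\<dots> \<le> B * z ^ u"
      unfolding B_def z_def w_def tt prod.case using count_numeric[OF p \<beta> b(2,3,4,5) i, of n r] .
    finally show "(\<Sum>c\<in>{c \<in> ?C. \<tau> c = t}. ?f c) \<le> B * z ^ fst t" by (simp add: tt)
  qed
  also have "\<dots> = B * (\<Sum>t\<in>T. z ^ fst t)" by (simp add: sum_distrib_left)
  also have "\<dots> \<le> B * 2"
  proof (rule mult_left_mono[OF _ B0])
    have "(\<Sum>t\<in>T. z ^ fst t) \<le> (\<Sum>t\<in>(SIGMA u:{..r}. {..2 * u} \<times> {..u}). z ^ fst t)"
      using Tsub z by (intro sum_mono2) auto
    also have "\<dots> = (\<Sum>u\<le>r. \<Sum>sx\<in>{..2 * u} \<times> {..u}. z ^ u)"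
      by (subst sum.Sigma) (auto intro!: sum.cong)
    also have "\<dots> = (\<Sum>u\<le>r. real ((2 * u + 1) * (u + 1)) * z ^ u)"
      by (simp add: card_cartesian_product)
    also have "\<dots> \<le> (\<Sum>u\<le>r. (1/2) ^ u)"
    proof (rule sum_mono)
      fix u
      \<comment> \<open>The number of pairs (s, x) for given \<open>u\<close> is absorbed in 6^u.
        The constant 192 = 12 * 16 in the hypothesis makes z at most 1/12, hence 6 z at most
        1/2.\<close>
      have "(2 * u + 1) * (u + 1) \<le> 6 ^ u"
      proof (induction u)
        case (Suc u)
        have "(2 * Suc u + 1) * (Suc u + 1) \<le> 6 * ((2 * u + 1) * (u + 1))" by (simp add: algebra_simps)
        then show ?case using Suc by simp
      qed simp
      then have "real ((2 * u + 1) * (u + 1)) \<le> real (6 ^ u)" by (rule of_nat_mono)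
      then have "real ((2 * u + 1) * (u + 1)) * z ^ u \<le> 6 ^ u * z ^ u" using z by (intro mult_right_mono) auto
      also have "\<dots> = (6 * z) ^ u" by (simp add: power_mult_distrib)
      also have "\<dots> \<le> (1/2) ^ u" using z by (intro power_mono) auto
      finally show "real ((2 * u + 1) * (u + 1)) * z ^ u \<le> (1/2) ^ u" .
    qed
    also have "\<dots> \<le> 2"
    proof -
      have "(\<Sum>u\<le>r. (1/2 :: real) ^ u) = 2 - (1/2) ^ r" by (induction r) auto
      then show ?thesis by simp
    qed
    finally show "(\<Sum>t\<in>T. z ^ fst t) \<le> 2" .
  qed
  finally show ?thesis by (simp add: B_def mult.commute)
qed

section \<open>Second moment bound\<close>

text \<open>Chernoff bound for one value of the overlap: a single term of a sum of nonnegative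
  terms, with \<open>x\<close> still free.\<close>

lemma hyper_single:
  fixes x :: real
  assumes "0 \<le> x" "\<kappa> \<le> n" "0 < \<kappa>" "l \<le> \<kappa>"
  shows "real (\<kappa> choose l) * real ((n - \<kappa>) choose (\<kappa> - l)) * (1 + x) ^ l \<le> real (n choose \<kappa>) * exp (x * ((real \<kappa>)\<^sup>2 / n))"
proof -
  have "real (\<kappa> choose l) * real ((n - \<kappa>) choose (\<kappa> - l)) * (1 + x) ^ l
    \<le> (\<Sum>l\<le>\<kappa>. real (\<kappa> choose l) * real ((n - \<kappa>) choose (\<kappa> - l)) * (1 + x) ^ l)"
    using assms by (intro member_le_sum) auto
  then show ?thesis using hyper_mgf[OF assms(1,2,3)] by simp
qed

text \<open>Three ranges of \<open>l\<close>. Up to \<mu> + sqrt \<mu> v the exponent is at most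
  \<open>e5\<close>, and the total mass gives the main term. Up to 100 \<mu> the Gaussian decay of
  the hypergeometric weights beats the linearised exponent. Beyond that the Poisson decay (exp 1 *
  \<mu> / l)^l beats exp (2 p l^2), because \<open>L\<close> is small enough for its square root to
  suffice.\<close>

lemma hyper_sum:
  fixes p \<psi> \<Phi> v e5 \<rho> \<theta> \<epsilon>2 :: real and n \<kappa> L :: nat
  defines "\<mu> \<equiv> (real \<kappa>)\<^sup>2 / n"
  assumes \<kappa>: "\<kappa> \<le> n" "0 < \<kappa>" "L \<le> \<kappa>" and p: "0 < p" "0 \<le> \<psi>" "\<psi> \<le> 4 * p" "0 \<le> \<Phi>" and v: "1 \<le> v"
    and a1: "\<psi> * (\<mu> + sqrt \<mu> * v)\<^sup>2 / 2 - \<Phi> \<le> e5"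
    and a2: "\<psi> \<le> p * (1 + \<epsilon>2)" "0 \<le> \<epsilon>2" "p * \<mu>\<^sup>2 / 2 - 1/2 \<le> \<Phi>" "10000 * p * \<epsilon>2 * \<mu>\<^sup>2 \<le> 1"
    and a3: "40800 * p * \<mu> * sqrt \<mu> \<le> v"
    and a4: "exp (1 - v\<^sup>2 / 800) \<le> \<theta>" "exp (- v) \<le> \<theta>"
    and a5: "exp 1 / sqrt v \<le> \<rho>\<^sup>2" "0 \<le> \<rho>" "\<rho> \<le> 1/2"
    and a6: "4 * p * real L \<le> ln (1 / (2 * exp 1 * p * \<mu>))"
  shows "(\<Sum>l\<le>L. real (\<kappa> choose l) * real ((n - \<kappa>) choose (\<kappa> - l)) * exp (\<psi> * (real l)\<^sup>2 / 2 - \<Phi>))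
    \<le> real (n choose \<kappa>) * (exp e5 + 2 * \<rho> + (real L + 1) * \<theta>)"
proof -
  let ?H = "\<lambda>l. real (\<kappa> choose l) * real ((n - \<kappa>) choose (\<kappa> - l))"
  let ?C = "real (n choose \<kappa>)"
  have \<mu>: "0 < \<mu>" using \<kappa> by (simp add: \<mu>_def)
  have sm: "0 < sqrt \<mu>" "sqrt \<mu> * sqrt \<mu> = \<mu>" using \<mu> by auto
  define T where "T = \<mu> + sqrt \<mu> * v"
  have T: "0 < T" "\<mu> \<le> T" "sqrt \<mu> * v \<le> T" using \<mu> sm v by (auto simp: T_def add_pos_pos)
  have \<theta>0: "0 \<le> \<theta>" using a4(2) exp_gt_zero[of "- v"] by linarith
  have C0: "0 \<le> ?C" by simp
  have bnd: "?H l * exp (\<psi> * (real l)\<^sup>2 / 2 - \<Phi>) \<le> ?C * ((if l = 0 then 0 else \<rho> ^ l) + \<theta>)"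
    if l: "l \<le> L" and lT: "T < real l" for l
  proof -
    have l0: "0 < real l" "l \<noteq> 0" using lT T by auto
    have l\<kappa>: "l \<le> \<kappa>" using l \<kappa> by simp
    show ?thesis
    proof (cases "real l < 100 * \<mu>")
      case True
      \<comment> \<open>The minimiser of - d x + 100 \<mu> x^2, where d = l - \<mu>; the minimum is
        - d^2 / (400 \<mu>).\<close>
      define x where "x = (real l - \<mu>) / (200 * \<mu>)"
      define d where "d = real l - \<mu>"
      have d: "0 < d" "sqrt \<mu> * v \<le> d" "d \<le> 99 * \<mu>" "x = d / (200 * \<mu>)" using lT True sm T by (auto simp: d_def T_def x_def)
      have x: "0 \<le> x" "x \<le> 1" unfolding d(4) using d(1,3) \<mu> by (auto simp: field_simps)
      have "?H l * (1 + x) ^ l \<le> ?C * exp (x * \<mu>)" using hyper_single[OF x(1) \<kappa>(1,2) l\<kappa>] by (simp add: \<mu>_def)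
      then have "?H l \<le> ?C * exp (x * \<mu>) * inverse ((1 + x) ^ l)" using x by (simp add: field_simps)
      also have "\<dots> \<le> ?C * exp (x * \<mu>) * exp (- (real l * (x - x\<^sup>2)))"
      proof (intro mult_left_mono mult_nonneg_nonneg)
        have "x - x\<^sup>2 \<le> ln (1 + x)" using x by (intro ln_one_plus_pos_lower_bound)
        then have "real l * (x - x\<^sup>2) \<le> real l * ln (1 + x)" by (intro mult_left_mono) auto
        moreover have "inverse ((1 + x) ^ l) = exp (- (real l * ln (1 + x)))" using x by (simp add: exp_minus exp_of_nat_mult)
        ultimately show "inverse ((1 + x) ^ l) \<le> exp (- (real l * (x - x\<^sup>2)))" by simp
      qed auto
      also have "\<dots> = ?C * exp (x * \<mu> - real l * (x - x\<^sup>2))" by (simp add: exp_add[symmetric] mult.assoc)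
      also have "\<dots> \<le> ?C * exp (- (d\<^sup>2 / (400 * \<mu>)))"
      proof -
        have "real l * x\<^sup>2 \<le> 100 * \<mu> * x\<^sup>2" using True by (intro mult_right_mono) auto
        then have "x * \<mu> - real l * (x - x\<^sup>2) \<le> - (d * x) + 100 * \<mu> * x\<^sup>2" by (simp add: d_def algebra_simps)
        also have "\<dots> = - (d\<^sup>2 / (400 * \<mu>))" unfolding d(4) using \<mu> by (simp add: field_simps power2_eq_square)
        finally show ?thesis by (intro mult_left_mono) auto
      qed
      finally have H: "?H l \<le> ?C * exp (- (d\<^sup>2 / (400 * \<mu>)))" .
      \<comment> \<open>p (l^2 - \<mu>^2) / 2 is at most 50.5 p \<mu> d because l + \<mu> is below
        101 \<mu>. The added 1 collects 1/2 from the excess of \<open>\<psi>\<close> over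
        \<open>p\<close> and 1/2 from the lower bound on \<open>\<Phi>\<close>.\<close>
      have ex: "\<psi> * (real l)\<^sup>2 / 2 - \<Phi> \<le> 51 * p * \<mu> * d + 1"
      proof -
        have l2: "(real l)\<^sup>2 \<le> 10000 * \<mu>\<^sup>2"
        proof -
          have "(real l)\<^sup>2 \<le> (100 * \<mu>)\<^sup>2" using True by (intro power_mono) auto
          then show ?thesis by (simp add: power_mult_distrib)
        qed
        have "\<psi> * (real l)\<^sup>2 \<le> p * (1 + \<epsilon>2) * (real l)\<^sup>2" using a2 by (intro mult_right_mono) auto
        also have "\<dots> = p * (real l)\<^sup>2 + p * \<epsilon>2 * (real l)\<^sup>2" by (simp add: algebra_simps)
        also have "p * \<epsilon>2 * (real l)\<^sup>2 \<le> p * \<epsilon>2 * (10000 * \<mu>\<^sup>2)" using l2 p a2 by (intro mult_left_mono) auto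
        finally have 1: "\<psi> * (real l)\<^sup>2 \<le> p * (real l)\<^sup>2 + 1" using a2(4) by (simp add: mult_ac)
        have "(real l)\<^sup>2 - \<mu>\<^sup>2 = d * (real l + \<mu>)" by (simp add: d_def power2_eq_square algebra_simps)
        also have "\<dots> \<le> d * (101 * \<mu>)" using True d by (intro mult_left_mono) auto
        finally have "p * ((real l)\<^sup>2 - \<mu>\<^sup>2) \<le> p * (d * (101 * \<mu>))" using p by (intro mult_left_mono) auto
        moreover have "p * (d * (101 * \<mu>)) \<le> 2 * (51 * p * \<mu> * d)" using p d \<mu> by simp
        ultimately show ?thesis using 1 a2(3) by (simp add: algebra_simps)
      qed
      \<comment> \<open>The linear growth may use up at most half of the Gaussian decay; 40800 = 51
        * 800.\<close>
      have key: "51 * p * \<mu> \<le> d / (800 * \<mu>)"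
      proof -
        have "51 * p * \<mu> * (800 * \<mu>) = sqrt \<mu> * (40800 * p * \<mu> * sqrt \<mu>)"
          using sm(2) by (simp add: algebra_simps)
        also have "\<dots> \<le> sqrt \<mu> * v" using a3 sm by (intro mult_left_mono) auto
        also have "\<dots> \<le> d" by (rule d(2))
        finally show ?thesis using \<mu> by (simp add: pos_le_divide_eq)
      qed
      have "- (d\<^sup>2 / (400 * \<mu>)) + (51 * p * \<mu> * d + 1) \<le> 1 - v\<^sup>2 / 800"
      proof -
        have "51 * p * \<mu> * d \<le> d / (800 * \<mu>) * d" using key d by (intro mult_right_mono) auto
        also have "\<dots> = d\<^sup>2 / (800 * \<mu>)" by (simp add: power2_eq_square)
        finally have "- (d\<^sup>2 / (400 * \<mu>)) + (51 * p * \<mu> * d + 1) \<le> 1 - d\<^sup>2 / (800 * \<mu>)" by (simp add: field_simps)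
        moreover have "(sqrt \<mu> * v)\<^sup>2 \<le> d\<^sup>2" using d sm v by (intro power_mono) auto
        then have "\<mu> * v\<^sup>2 / (800 * \<mu>) \<le> d\<^sup>2 / (800 * \<mu>)" using \<mu> by (intro divide_right_mono) (auto simp: power_mult_distrib)
        then have "v\<^sup>2 / 800 \<le> d\<^sup>2 / (800 * \<mu>)" using \<mu> by simp
        ultimately show ?thesis by linarith
      qed
      then have "exp (- (d\<^sup>2 / (400 * \<mu>))) * exp (51 * p * \<mu> * d + 1) \<le> \<theta>"
        using a4(1) unfolding exp_add[symmetric] by (meson exp_le_cancel_iff order_trans)
      moreover have "?H l * exp (\<psi> * (real l)\<^sup>2 / 2 - \<Phi>) \<le> (?C * exp (- (d\<^sup>2 / (400 * \<mu>)))) * exp (51 * p * \<mu> * d + 1)"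
        by (rule mult_mono[OF H]) (use ex in auto)
      ultimately have "?H l * exp (\<psi> * (real l)\<^sup>2 / 2 - \<Phi>) \<le> ?C * \<theta>"
        using mult_left_mono[OF _ C0] by (smt (verit) mult.assoc)
      also have "\<dots> \<le> ?C * ((if l = 0 then 0 else \<rho> ^ l) + \<theta>)" using a5 by (intro mult_left_mono) auto
      finally show ?thesis .
    next
      case False
      define z where "z = exp 1 * \<mu> / real l"
      have z: "0 < z" using \<mu> l0 by (simp add: z_def)
      have "1 \<le> real l / \<mu>" using False \<mu> by (simp add: field_simps)
      then have "?H l * (1 + (real l / \<mu> - 1)) ^ l \<le> ?C * exp ((real l / \<mu> - 1) * \<mu>)"
        using hyper_single[of "real l / \<mu> - 1", OF _ \<kappa>(1,2) l\<kappa>] by (simp add: \<mu>_def)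
      then have "?H l * (real l / \<mu>) ^ l \<le> ?C * exp (real l - \<mu>)" using \<mu> by (simp add: left_diff_distrib)
      also have "\<dots> \<le> ?C * exp 1 ^ l" using \<mu> by (intro mult_left_mono) (auto simp: exp_of_nat_mult[symmetric])
      finally have Hz: "?H l \<le> ?C * z ^ l"
        using l0 \<mu> by (simp add: z_def power_divide power_mult_distrib field_simps)
      have Ez: "exp (\<psi> * (real l)\<^sup>2 / 2 - \<Phi>) \<le> inverse (sqrt z) ^ l"
      proof -
        \<comment> \<open>Makes exp (2 p l^2) at most z^(-l/2). If p l is at most 1/2, the constant
          bound z \<le> exp (-2) suffices, which holds because l is at least 100 \<mu>. Otherwise 1
          / l is below 2 p, which turns z into a multiple of p \<mu>, and the hypothesis on
          \<open>L\<close> applies.\<close>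
        have lnz: "4 * p * real l \<le> - ln z"
        proof (cases "p * real l \<le> 1/2")
          case True
          have "z \<le> exp 1 / 100" using False \<mu> l0 by (simp add: z_def field_simps)
          also have "\<dots> \<le> exp (- 2)"
          proof -
            have "exp (3::real) = exp 1 ^ 3" by (simp add: exp_of_nat_mult[symmetric])
            also have "\<dots> \<le> 3 ^ 3" using e_less_272 by (intro power_mono) auto
            finally have "exp (3::real) \<le> 100" by simp
            then show ?thesis using exp_add[of "-2::real" 3] by (simp add: field_simps)
          qed
          finally have "ln z \<le> - 2" using z by (metis exp_gt_zero ln_exp ln_le_cancel_iff)
          then show ?thesis using True by linarith
        next
          case c: False
          then have pl: "1/2 < p * real l" by simp
          have "exp 1 * \<mu> * 1 \<le> exp 1 * \<mu> * (2 * (p * real l))" using pl \<mu> by (intro mult_left_mono) auto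
          then have "z \<le> 2 * exp 1 * p * \<mu>" using l0 unfolding z_def by (simp add: pos_divide_le_eq mult_ac)
          then have "ln z \<le> ln (2 * exp 1 * p * \<mu>)" using z p \<mu> by (intro ln_mono) auto
          also have "\<dots> = - ln (1 / (2 * exp 1 * p * \<mu>))" using p \<mu> by (simp add: ln_div)
          finally have "ln (1 / (2 * exp 1 * p * \<mu>)) \<le> - ln z" by simp
          moreover have "4 * p * real l \<le> 4 * p * real L" using l p by (intro mult_left_mono) auto
          ultimately show ?thesis using a6 by linarith
        qed
        have "\<psi> * (real l)\<^sup>2 / 2 - \<Phi> \<le> 4 * p * (real l)\<^sup>2 / 2 - 0"
          using p by (intro diff_mono divide_right_mono mult_right_mono) auto
        also have "\<dots> = real l * (4 * p * real l / 2)" by (simp add: power2_eq_square)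
        also have "\<dots> \<le> real l * (- ln z / 2)" using lnz by (intro mult_left_mono) auto
        finally have "exp (\<psi> * (real l)\<^sup>2 / 2 - \<Phi>) \<le> exp (real l * (- ln z / 2))" by simp
        also have "\<dots> = exp (- ln z / 2) ^ l" by (rule exp_of_nat_mult)
        also have "exp (- ln z / 2) = inverse (sqrt z)"
        proof -
          have "sqrt z = exp (ln z / 2)" using z by (simp add: powr_half_sqrt[symmetric] powr_def)
          then show ?thesis by (simp add: exp_minus[symmetric])
        qed
        finally show ?thesis .
      qed
      have "?H l * exp (\<psi> * (real l)\<^sup>2 / 2 - \<Phi>) \<le> (?C * z ^ l) * inverse (sqrt z) ^ l"
        by (rule mult_mono[OF Hz Ez]) (use z in auto)
      also have "\<dots> = ?C * (sqrt z) ^ l"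
      proof -
        have "z * inverse (sqrt z) = sqrt z" using z by (simp add: field_simps)
        then show ?thesis by (simp only: mult.assoc power_mult_distrib[symmetric])
      qed
      also have "\<dots> \<le> ?C * ((if l = 0 then 0 else \<rho> ^ l) + \<theta>)"
      proof (rule mult_left_mono[OF _ C0])
        show "sqrt z ^ l \<le> (if l = 0 then 0 else \<rho> ^ l) + \<theta>"
        \<comment> \<open>For small \<mu> the terms form a geometric series in
          \<open>\<rho>\<close>, because l exceeds sqrt \<mu> v. For large \<mu> each term is below
          exp (- l), hence below exp (- v), and \<open>\<theta>\<close> covers it.\<close>
        proof (cases "\<mu> \<le> v")
          case True
          have "z \<le> exp 1 / sqrt v"
          proof -
            have "sqrt \<mu> * v \<le> real l" using T lT by linarith
            then have "z \<le> exp 1 * \<mu> / (sqrt \<mu> * v)" unfolding z_def using \<mu> sm v l0 by (intro divide_left_mono mult_pos_pos) auto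
            also have "\<dots> = exp 1 * (sqrt \<mu> / v)" using sm v by (subst (1) sm(2)[symmetric]) (simp add: field_simps)
            also have "\<dots> \<le> exp 1 * (sqrt v / v)" using True v by (intro mult_left_mono divide_right_mono) auto
            also have "sqrt v / v = 1 / sqrt v" using v by (simp add: field_simps)
            finally show ?thesis by simp
          qed
          then have "z \<le> \<rho>\<^sup>2" using a5 by linarith
          then have "sqrt z \<le> \<rho>" using a5 by (simp add: real_le_lsqrt)
          then have "sqrt z ^ l \<le> \<rho> ^ l" using z by (intro power_mono) auto
          then show ?thesis using \<theta>0 l0 by auto
        next
          case nv: False
          have "z \<le> exp 1 / 100" using False \<mu> l0 by (simp add: z_def field_simps)
          also have "\<dots> \<le> exp (- 2)"
          proof -
            have "exp (3::real) = exp 1 ^ 3" by (simp add: exp_of_nat_mult[symmetric])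
            also have "\<dots> \<le> 3 ^ 3" using e_less_272 by (intro power_mono) auto
            finally have "exp (3::real) \<le> 100" by simp
            then show ?thesis using exp_add[of "-2::real" 3] by (simp add: field_simps)
          qed
          also have "exp (- 2 :: real) = (exp (- 1))\<^sup>2" by (simp add: exp_double[symmetric])
          finally have "sqrt z \<le> exp (- 1)" by (simp add: real_le_lsqrt)
          then have "sqrt z ^ l \<le> exp (- 1) ^ l" using z by (intro power_mono) auto
          also have "\<dots> = exp (- real l)" by (simp add: exp_of_nat_mult[symmetric])
          also have "\<dots> \<le> exp (- v)" using nv T lT by simp
          finally have "sqrt z ^ l \<le> \<theta>" using a4(2) by linarith
          then show ?thesis using a5 by (simp add: add_increasing)
        qed
      qed
      finally show ?thesis .
    qed
  qed
  have "(\<Sum>l\<le>L. ?H l * exp (\<psi> * (real l)\<^sup>2 / 2 - \<Phi>)) \<le> (\<Sum>l\<le>L. ?H l * exp e5 + ?C * ((if l = 0 then 0 else \<rho> ^ l) + \<theta>))"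
  proof (rule sum_mono)
    fix l assume "l \<in> {..L}"
    then have l: "l \<le> L" by simp
    show "?H l * exp (\<psi> * (real l)\<^sup>2 / 2 - \<Phi>) \<le> ?H l * exp e5 + ?C * ((if l = 0 then 0 else \<rho> ^ l) + \<theta>)"
    proof (cases "T < real l")
      case True
      then show ?thesis using bnd[OF l True] by (simp add: add_increasing)
    next
      case False
      have "\<psi> * (real l)\<^sup>2 \<le> \<psi> * T\<^sup>2" using False p by (intro mult_left_mono power_mono) auto
      then have "\<psi> * (real l)\<^sup>2 / 2 - \<Phi> \<le> e5" using a1 unfolding T_def[symmetric] by simp
      then have "?H l * exp (\<psi> * (real l)\<^sup>2 / 2 - \<Phi>) \<le> ?H l * exp e5" by (intro mult_left_mono) auto
      moreover have "0 \<le> ?C * ((if l = 0 then 0 else \<rho> ^ l) + \<theta>)" using a5 \<theta>0 by auto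
      ultimately show ?thesis by linarith
    qed
  qed
  also have "\<dots> = exp e5 * (\<Sum>l\<le>L. ?H l) + ?C * ((\<Sum>l\<le>L. if l = 0 then 0 else \<rho> ^ l) + (real L + 1) * \<theta>)"
    by (simp add: sum.distrib sum_distrib_left sum_distrib_right algebra_simps)
  also have "\<dots> \<le> exp e5 * ?C + ?C * (2 * \<rho> + (real L + 1) * \<theta>)"
  proof (intro add_mono mult_left_mono)
    have "(\<Sum>l\<le>L. ?H l) \<le> (\<Sum>l\<le>\<kappa>. ?H l)" using \<kappa> by (intro sum_mono2) auto
    also have "\<dots> \<le> ?C" using hyper_mgf[of 0 \<kappa> n] \<kappa> by simp
    finally show "(\<Sum>l\<le>L. ?H l) \<le> ?C" .
    have "(\<Sum>l\<le>L. if l = 0 then 0 else \<rho> ^ l) \<le> 2 * \<rho> - 2 * \<rho> ^ Suc L"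
    proof (induction L)
      case (Suc L)
      have "\<rho> * \<rho> ^ Suc L \<le> (1/2) * \<rho> ^ Suc L" using a5 by (intro mult_right_mono) auto
      then show ?case using Suc by simp
    qed (use a5 in auto)
    then show "(\<Sum>l\<le>L. if l = 0 then 0 else \<rho> ^ l) \<le> 2 * \<rho>" using a5 zero_le_power[of \<rho> "Suc L"] by linarith
  qed auto
  finally show ?thesis by (simp add: algebra_simps)
qed

lemma choose_two_real: "real (a choose 2) = real a * (real a - 1) / 2"
proof -
  have "even (a * (a - 1))" by (cases a) auto
  then have "2 * (a choose 2) = a * (a - 1)" by (simp add: choose_two)
  then have "real (2 * (a choose 2)) = real (a * (a - 1))" by (simp only:)
  then show ?thesis by (cases a) (simp_all add: algebra_simps)
qed

lemma configs_inter_card: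
  assumes "(K, M) \<in> configs n k r" "(K', M') \<in> configs n k r"
  shows "card (K' - K) = (k + r) - card (K \<inter> K')" "card (K \<inter> K') \<le> k + r"
proof -
  note K = cfg_K[OF assms(1)] and K' = cfg_K[OF assms(2)]
  show "card (K' - K) = (k + r) - card (K \<inter> K')" using K K' by (simp add: card_Diff_subset_Int Int_commute)
  show "card (K \<inter> K') \<le> k + r" using K card_mono[of K "K \<inter> K'"] by simp
qed

text \<open>The non-asymptotic form, with all error terms as parameters. \<open>\<psi>\<close> is
  the coefficient of l^2 / 2: its first part comes from common non-edges, its second from common
  matching edges via \<open>count_small\<close>. \<open>\<Phi>\<close> is the compensating term of
  \<open>cc_joint_ratio\<close>. Upper bounds at density \<open>pp\<close> and lower bounds at
  \<open>pm\<close> are compared through \<open>e1\<close>. The term linear in the expectation comes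
  from the large overlaps.\<close>

lemma second_moment_bound:
  fixes n m k r L h0 :: nat and w pp pm e1 E1 E2 S \<beta> :: real
  defines "\<kappa> \<equiv> k + r" and "h \<equiv> k - r" and "N \<equiv> n choose 2" and "f \<equiv> ((k + r) choose 2) - ((2 * r) choose 2)"
  defines "p \<equiv> real m / real N" and "q \<equiv> qf h pp" and "Q \<equiv> qf h0 pp"
  defines "Q2 \<equiv> (1 - pp) ^ (2 * h - L - 2) * (1 + 2 * real h * pp + (2 * real h * pp)\<^sup>2)"
  defines "\<psi> \<equiv> real m / (real N - real m - 2 * real f) + 32 * (real r)\<^sup>2 / (p * real \<kappa> ^ 4)"
  defines "\<Phi> \<equiv> (real f)\<^sup>2 * (real m - 2 * real r) / (real N)\<^sup>2"
  defines "\<Lambda> \<equiv> exp (- ((p - 2 * real r / real N) * ((real \<kappa> + real L) / 2 - 2 * real r)))"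
  defines "\<tau> \<equiv> exp (- e1) - exp (- w\<^sup>2)"
  assumes g1: "4 * r \<le> \<kappa>" "\<kappa> \<le> n" "0 < \<kappa>" "L < \<kappa>" "h0 + 1 + 2 * r + L \<le> \<kappa>" "2 + L \<le> 2 * h" "2 \<le> h"
    and g2: "m + 2 * f < N" "4 * r \<le> m" "0 < m" "4 * r + 2 * f \<le> N"
    and g3: "0 < w" "w \<le> sqrt m / 2"
    and g4: "0 \<le> pm" "pm \<le> pp" "pp \<le> 1" "pm * real N \<le> real m - real r - 2 * w * sqrt m"
      "pm * (1 + w / sqrt m) / (1 + pm * (w / sqrt m)) \<le> pp" "real m + 3 * w * sqrt m \<le> pp * (real N - 2 * real r - 2 * real f)" "pp \<le> 2 * p"
    and g5: "qf h pm \<le> 1/2" "Q \<le> 1/2" "2 * real n * (qf h pm - q) \<le> e1"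
    and g6: "1/2 \<le> \<tau>" "exp (- w\<^sup>2) \<le> 1/2"
    and g7: "8 * real r * q + 4 * real n * Q2 + 2 * real h * (2 * real h * pp * Q\<^sup>2) \<le> E1"
    and g8: "2 * real r * real f / (real N - 2 * real r - real f) \<le> E2"
    and g9: "(\<Sum>l\<le>L. real (\<kappa> choose l) * real ((n - \<kappa>) choose (\<kappa> - l)) * exp (\<psi> * (real l)\<^sup>2 / 2 - \<Phi>)) \<le> real (n choose \<kappa>) * S"
    and g10: "1 \<le> \<beta>" "4 * real \<kappa> * p \<le> \<beta>" "192 * exp 4 * real r * p * \<beta>\<^sup>2 \<le> 1" "64 * exp 4 * real n * real \<kappa> * p\<^sup>2 * \<Lambda> \<le> 1"
      "2 * real r / real N \<le> p"
  shows "VarX n m k r \<le> (exp (E1 + E2) * S / ((1 - exp (- w\<^sup>2)) * \<tau>\<^sup>2) - 1) * (EX_X n m k r)\<^sup>2 + 16 * EX_X n m k r"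
proof -
  define C where "C = configs n k r"
  define c0 where "c0 = cc N m r f"
  define Gg where "Gg = (1 - q) ^ (n - \<kappa>)"
  define LB where "LB = c0 * Gg * \<tau>"
  define ew where "ew = 1 - exp (- w\<^sup>2)"
  define P2 where "P2 c c' = Pr n m (\<lambda>G. good n (fst c) (snd c) G \<and> good n (fst c') (snd c') G)" for c c'
  let ?mt = "mt \<kappa> r"
  have ew: "1/2 \<le> ew" "0 < ew" using g6 by (auto simp: ew_def)
  have N0: "0 < N" using g2 by simp
  have p0: "0 < p" using g2 N0 by (simp add: p_def)
  have m_le: "m \<le> n choose 2" using g2 by (simp add: N_def)
  have pp: "0 \<le> pp" "pp \<le> 1" using g4 by auto
  have c00: "0 \<le> c0" by (simp add: c0_def cc_nonneg)
  have q: "0 \<le> q" "q \<le> 1/2" "q \<le> qf h pm"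
  proof -
    show "0 \<le> q" unfolding q_def using pp by (rule qf_nonneg)
    show "q \<le> qf h pm" unfolding q_def using g4 g1 by (intro qf_lipschitz(1)) auto
    then show "q \<le> 1/2" using g5 by simp
  qed
  have Gg0: "0 \<le> Gg" unfolding Gg_def using q by (intro zero_le_power) simp
  have \<tau>0: "0 < \<tau>" using g6 by simp
  have LB0: "0 \<le> LB" unfolding LB_def using c00 Gg0 \<tau>0 by simp
  have fC: "finite C" by (simp add: C_def)
  have fcard: "card (forb K M) = f" if "(K, M) \<in> C" for K M
    using cfg_forb_card that unfolding C_def f_def by blast
  have cards: "card C = real (n choose \<kappa>) * ?mt" unfolding C_def \<kappa>_def by (rule card_configs)
  \<comment> \<open>All upper bounds are stated in terms of \<open>Gg\<close>, which uses the
    density \<open>pp\<close>; here the passage from \<open>pm\<close> to \<open>pp\<close> costs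
    \<open>exp (- e1)\<close>, and the tilted tail costs \<open>exp (- w\<^sup>2)\<close>.\<close>
  have H1: "LB \<le> Pr n m (good n (fst c) (snd c))" if c: "c \<in> C" for c
  proof -
    obtain K M where KM: "c = (K, M)" by (cases c)
    have cfg: "(K, M) \<in> configs n k r" using c KM by (simp add: C_def)
    have f: "card (forb K M) = f" using fcard c KM by simp
    have "cc N m r f * ((1 - qf h pm) ^ (n - \<kappa>) - exp (- w\<^sup>2) * (1 - qf h pp) ^ (n - \<kappa>)) \<le> Pr n m (good n K M)"
      unfolding N_def h_def \<kappa>_def f[symmetric]
    proof (rule single_lower[OF cfg])
      show "m + card (forb K M) \<le> n choose 2" "r \<le> m" "0 < m" using g2 f by (auto simp: N_def)
      show "pm * real (n choose 2) \<le> real m - real r - 2 * w * sqrt (real m)" using g4 by (simp add: N_def)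
      show "w \<le> sqrt (real m)" using g3 by simp
      show "2 \<le> k - r" using g1 by (simp add: h_def)
    qed (use g3 g4 in auto)
    moreover have "Gg * \<tau> \<le> (1 - qf h pm) ^ (n - \<kappa>) - exp (- w\<^sup>2) * (1 - qf h pp) ^ (n - \<kappa>)"
    proof -
      have "1 - q \<le> (1 - qf h pm) * exp (2 * (qf h pm - q))"
      proof -
        have "(1 - qf h pm) * (1 + 2 * (qf h pm - q)) \<le> (1 - qf h pm) * exp (2 * (qf h pm - q))"
          using g5 exp_ge_add_one_self[of "2 * (qf h pm - q)"] by (intro mult_left_mono) auto
        moreover have "(qf h pm - q) \<le> (1 - qf h pm) * (2 * (qf h pm - q))"
          using mult_right_mono[of "1/2" "1 - qf h pm" "2 * (qf h pm - q)"] g5 q by simp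
        ultimately show ?thesis by (simp add: algebra_simps)
      qed
      then have "Gg \<le> ((1 - qf h pm) * exp (2 * (qf h pm - q))) ^ (n - \<kappa>)"
        unfolding Gg_def using q by (intro power_mono) auto
      also have "\<dots> = (1 - qf h pm) ^ (n - \<kappa>) * exp (real (n - \<kappa>) * (2 * (qf h pm - q)))"
        by (simp only: power_mult_distrib exp_of_nat_mult)
      also have "\<dots> \<le> (1 - qf h pm) ^ (n - \<kappa>) * exp e1"
      proof -
        have "real (n - \<kappa>) * (2 * (qf h pm - q)) \<le> real n * (2 * (qf h pm - q))" using q by (intro mult_right_mono) auto
        then have "real (n - \<kappa>) * (2 * (qf h pm - q)) \<le> e1" using g5(3) by (simp only: mult_ac)
        then show ?thesis using g5 by (intro mult_left_mono) auto
      qed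
      finally have "Gg * exp (- e1) \<le> (1 - qf h pm) ^ (n - \<kappa>)" by (simp add: exp_minus field_simps)
      then show ?thesis unfolding \<tau>_def Gg_def q_def by (simp add: algebra_simps)
    qed
    ultimately have "c0 * (Gg * \<tau>) \<le> Pr n m (good n K M)"
      unfolding c0_def using cc_nonneg[of N m r f] by (meson mult_left_mono order_trans)
    then show ?thesis by (simp add: LB_def KM mult.assoc)
  qed
  have P2_nn: "0 \<le> P2 c c'" for c c' by (simp add: P2_def Pr_nonneg)
  \<comment> \<open>Small overlaps: sorting by \<open>l\<close> leaves the hypergeometric weights
    times an exponential of l^2, which hypothesis \<open>g9\<close> controls.\<close>
  have H2: "(\<Sum>c'\<in>{c' \<in> C. card (fst c \<inter> fst c') \<le> L}. P2 c c') \<le> c0\<^sup>2 * Gg\<^sup>2 * (exp (E1 + E2) / ew) * (real (card C) * S)" if c: "c \<in> C" for c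
  proof -
    obtain K M where KM: "c = (K, M)" by (cases c)
    have cfg: "(K, M) \<in> configs n k r" using c KM by (simp add: C_def)
    let ?D = "\<lambda>l. {c' \<in> C. card (K \<inter> fst c') = l}"
    let ?z = "c0\<^sup>2 * Gg\<^sup>2 * (exp (E1 + E2) / ew)"
    have z0: "0 \<le> ?z" using ew by (intro mult_nonneg_nonneg) auto
    have one: "P2 c c' \<le> ?z * exp ((real m / (real N - real m - 2 * real f)) * (real l)\<^sup>2 / 2 - \<Phi>) * (2 / p) ^ card (M \<inter> snd c')"
      if l: "l \<le> L" and c': "c' \<in> ?D l" for l c'
    proof -
      obtain K' M' where KM': "c' = (K', M')" by (cases c')
      have cfg': "(K', M') \<in> configs n k r" using c' KM' by (simp add: C_def)
      have lc: "card (K \<inter> K') = l" using c' KM' by simp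
      have f: "card (forb K M) = f" "card (forb K' M') = f" using fcard c c' KM KM' by auto
      define j where "j = card (M \<inter> M')"
      define g where "g = card (forb K M \<inter> forb K' M')"
      have jr: "j \<le> r" unfolding j_def using card_mono[OF cfg_M(4)[OF cfg], of "M \<inter> M'"] cfg_M(2)[OF cfg] by simp
      have gf: "g \<le> f" unfolding g_def using card_mono[OF cfg_finite_forb[OF cfg], of "forb K M \<inter> forb K' M'"] f by simp
      \<comment> \<open>A common non-edge lies inside \<open>K \<inter> K'\<close>.\<close>
      have gl: "real g \<le> (real l)\<^sup>2 / 2"
      proof -
        have fKK: "finite (K \<inter> K')" using cfg_K[OF cfg] by simp
        have "forb K M \<inter> forb K' M' \<subseteq> {e. e \<subseteq> K \<inter> K' \<and> card e = 2}" by (auto simp: forb_def)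
        then have "g \<le> card {e. e \<subseteq> K \<inter> K' \<and> card e = 2}" unfolding g_def using finite_pairs[OF fKK] by (intro card_mono)
        then have "g \<le> l choose 2" using card_pairs[OF fKK] lc by simp
        then have "real g \<le> real (l choose 2)" by (rule of_nat_mono)
        also have "\<dots> \<le> (real l)\<^sup>2 / 2" unfolding choose_two_real by (simp add: power2_eq_square algebra_simps)
        finally show ?thesis .
      qed
      have Q2l: "(1 - pp) ^ (2 * h - l - 2) * (1 + 2 * real h * pp + (2 * real h * pp)\<^sup>2) \<le> Q2"
        unfolding Q2_def using l pp g1 by (intro mult_right_mono power_decreasing add_nonneg_nonneg) auto
      have "P2 c c' * ew \<le> cc N m (2 * r - j) (2 * f - g) * ((1 - q) ^ (2 * (n - \<kappa>)) * exp (8 * real r * q + 4 * real n * ((1 - pp) ^ (2 * h - l - 2) * (1 + 2 * real h * pp + (2 * real h * pp)\<^sup>2)) + 2 * real h * (2 * real h * pp * Q\<^sup>2)))"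
        unfolding P2_def KM KM' fst_conv snd_conv ew_def N_def q_def Q_def h_def \<kappa>_def j_def g_def
      proof (rule joint_small_overlap[OF cfg cfg' lc f])
        show "m + 2 * f \<le> n choose 2" "2 * r \<le> m" "0 < m" using g2 by (auto simp: N_def)
        show "real m + 3 * w * sqrt (real m) \<le> pp * (real (n choose 2) - 2 * r - 2 * f)" using g4 by (simp add: N_def)
        show "h0 + 1 + 2 * r + l \<le> k + r" "2 \<le> 2 * (k - r) - l" using g1 l by (auto simp: \<kappa>_def h_def)
        show "qf h0 pp \<le> 1 / 2" using g5 by (simp add: Q_def)
      qed (use g3 pp in auto)
      also have "\<dots> \<le> cc N m (2 * r - j) (2 * f - g) * (Gg\<^sup>2 * exp E1)"
      proof (intro mult_left_mono cc_nonneg)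
        have "8 * real r * q + 4 * real n * ((1 - pp) ^ (2 * h - l - 2) * (1 + 2 * real h * pp + (2 * real h * pp)\<^sup>2)) + 2 * real h * (2 * real h * pp * Q\<^sup>2) \<le> E1"
          using g7 mult_left_mono[OF Q2l, of "4 * real n"] by simp
        moreover have "(1 - q) ^ (2 * (n - \<kappa>)) = Gg\<^sup>2" unfolding Gg_def by (simp add: power_mult[symmetric] mult.commute)
        ultimately show "(1 - q) ^ (2 * (n - \<kappa>)) * exp (8 * real r * q + 4 * real n * ((1 - pp) ^ (2 * h - l - 2) * (1 + 2 * real h * pp + (2 * real h * pp)\<^sup>2)) + 2 * real h * (2 * real h * pp * Q\<^sup>2)) \<le> Gg\<^sup>2 * exp E1"
          by (simp add: mult_left_mono)
      qed
      also have "\<dots> \<le> (c0\<^sup>2 * (2 / p) ^ j * exp (E2 + ((real m / (real N - real m - 2 * real f)) * (real l)\<^sup>2 / 2 - \<Phi>))) * (Gg\<^sup>2 * exp E1)"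
      proof (rule mult_right_mono)
        have "cc N m (2 * r - j) (2 * f - g) \<le> c0\<^sup>2 * (2 / p) ^ j *
          exp (2 * real r * real f / (real N - 2 * real r - real f) + real g * (real m / (real N - real m - 2 * real f)) - \<Phi>)"
          unfolding c0_def \<Phi>_def using cc_joint_ratio[OF jr gf g2(2,1,3) p_def[THEN meta_eq_to_obj_eq]] by simp
        also have "\<dots> \<le> c0\<^sup>2 * (2 / p) ^ j * exp (E2 + ((real m / (real N - real m - 2 * real f)) * (real l)\<^sup>2 / 2 - \<Phi>))"
        proof (intro mult_left_mono iffD2[OF exp_le_cancel_iff])
          have "real (m + 2 * f) < real N" using g2(1) by (simp only: of_nat_less_iff)
          then have "0 \<le> real m / (real N - real m - 2 * real f)" by simp
          from mult_right_mono[OF gl this]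
          show "2 * real r * real f / (real N - 2 * real r - real f) + real g * (real m / (real N - real m - 2 * real f)) - \<Phi>
            \<le> E2 + ((real m / (real N - real m - 2 * real f)) * (real l)\<^sup>2 / 2 - \<Phi>)" using g8 by (simp add: mult.commute)
        qed (use p0 in auto)
        finally show "cc N m (2 * r - j) (2 * f - g) \<le> c0\<^sup>2 * (2 / p) ^ j * exp (E2 + ((real m / (real N - real m - 2 * real f)) * (real l)\<^sup>2 / 2 - \<Phi>))" .
      qed auto
      finally have "P2 c c' \<le> (c0\<^sup>2 * (2 / p) ^ j * exp (E2 + ((real m / (real N - real m - 2 * real f)) * (real l)\<^sup>2 / 2 - \<Phi>))) * (Gg\<^sup>2 * exp E1) / ew"
        using ew by (simp add: pos_le_divide_eq)
      also have "\<dots> = ?z * exp ((real m / (real N - real m - 2 * real f)) * (real l)\<^sup>2 / 2 - \<Phi>) * (2 / p) ^ j"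
        unfolding exp_add by simp
      finally show ?thesis unfolding j_def KM' by simp
    qed
    have "(\<Sum>c'\<in>{c' \<in> C. card (fst c \<inter> fst c') \<le> L}. P2 c c') = (\<Sum>l\<le>L. \<Sum>c'\<in>?D l. P2 c c')"
    proof -
      have "(\<Sum>l\<le>L. \<Sum>c'\<in>{c' \<in> {c' \<in> C. card (fst c \<inter> fst c') \<le> L}. card (K \<inter> fst c') = l}. P2 c c') = (\<Sum>c'\<in>{c' \<in> C. card (fst c \<inter> fst c') \<le> L}. P2 c c')"
        using fC KM by (intro sum.group) auto
      moreover have "{c' \<in> {c' \<in> C. card (fst c \<inter> fst c') \<le> L}. card (K \<inter> fst c') = l} = ?D l" if "l \<le> L" for l
        using that KM by auto
      ultimately show ?thesis by simp
    qed
    also have "\<dots> \<le> (\<Sum>l\<le>L. ?z * ?mt * (real (\<kappa> choose l) * real ((n - \<kappa>) choose (\<kappa> - l)) * exp (\<psi> * (real l)\<^sup>2 / 2 - \<Phi>)))"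
    proof (rule sum_mono)
      fix l assume "l \<in> {..L}"
      then have l: "l \<le> L" by simp
      let ?e = "exp ((real m / (real N - real m - 2 * real f)) * (real l)\<^sup>2 / 2 - \<Phi>)"
      have "(\<Sum>c'\<in>?D l. P2 c c') \<le> (\<Sum>c'\<in>?D l. ?z * ?e * (2 / p) ^ card (M \<inter> snd c'))"
        by (intro sum_mono one l)
      also have "\<dots> = ?z * ?e * (\<Sum>c'\<in>?D l. (2 / p) ^ card (M \<inter> snd c'))" by (simp add: sum_distrib_left)
      also have "\<dots> \<le> ?z * ?e * (real (\<kappa> choose l) * real ((n - \<kappa>) choose (\<kappa> - l)) * ?mt * exp (16 * (real r)\<^sup>2 * (real l)\<^sup>2 / (p * real \<kappa> ^ 4)))"
        unfolding C_def \<kappa>_def using g1 l ew by (intro mult_left_mono count_small[OF cfg p0] mult_nonneg_nonneg) (auto simp: \<kappa>_def)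
      also have "\<dots> = ?z * ?mt * (real (\<kappa> choose l) * real ((n - \<kappa>) choose (\<kappa> - l)) * exp (\<psi> * (real l)\<^sup>2 / 2 - \<Phi>))"
      proof -
        have "\<psi> * (real l)\<^sup>2 / 2 - \<Phi> = ((real m / (real N - real m - 2 * real f)) * (real l)\<^sup>2 / 2 - \<Phi>) + 16 * (real r)\<^sup>2 * (real l)\<^sup>2 / (p * real \<kappa> ^ 4)"
          unfolding \<psi>_def by (simp add: distrib_right add_divide_distrib)
        then show ?thesis by (simp only: exp_add mult_ac)
      qed
      finally show "(\<Sum>c'\<in>?D l. P2 c c') \<le> ?z * ?mt * (real (\<kappa> choose l) * real ((n - \<kappa>) choose (\<kappa> - l)) * exp (\<psi> * (real l)\<^sup>2 / 2 - \<Phi>))" .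
    qed
    also have "\<dots> = ?z * ?mt * (\<Sum>l\<le>L. real (\<kappa> choose l) * real ((n - \<kappa>) choose (\<kappa> - l)) * exp (\<psi> * (real l)\<^sup>2 / 2 - \<Phi>))"
      by (simp add: sum_distrib_left)
    also have "\<dots> \<le> ?z * ?mt * (real (n choose \<kappa>) * S)"
      using g9 ew mt_nonneg by (intro mult_left_mono mult_nonneg_nonneg) auto
    also have "\<dots> = ?z * (real (card C) * S)" unfolding cards by simp
    finally show ?thesis .
  qed
  \<comment> \<open>Large overlaps: the bound is a constant multiple of the single probability, so
    after summing over \<open>c\<close> this range contributes only a multiple of the
    expectation.\<close>
  have H3: "(\<Sum>c'\<in>{c' \<in> C. \<not> card (fst c \<inter> fst c') \<le> L}. P2 c c') \<le> c0 * Gg * (4 / ew)" if c: "c \<in> C" for c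
  proof -
    obtain K M where KM: "c = (K, M)" by (cases c)
    have cfg: "(K, M) \<in> configs n k r" using c KM by (simp add: C_def)
    define D where "D i = {c' \<in> C. card (fst c' - K) = i \<and> (\<exists>G\<in>graphs_nm n m. good n K M G \<and> good n (fst c') (snd c') G)}" for i
    have fD: "finite (D i)" for i using fC by (simp add: D_def)
    have one: "P2 c c' \<le> c0 * Gg / ew * (2 * \<Lambda>) ^ i * ((2 * p) ^ card (snd c' - M) * (4 * real i * p) ^ (2 * i - card (crossing K M (fst c') (snd c')) + card ((K - fst c') \<inter> \<Union>M)))"
      if i: "i < \<kappa> - L" and c': "c' \<in> D i" for i c'
    proof -
      obtain K' M' where KM': "c' = (K', M')" by (cases c')
      have cfg': "(K', M') \<in> configs n k r" using c' KM' by (simp add: D_def C_def)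
      have ic: "card (K' - K) = i" using c' KM' by (simp add: D_def)
      have f: "card (forb K M) = f" "card (forb K' M') = f" using fcard c c' KM KM' by (auto simp: D_def)
      define u where "u = card (M' - M)"
      define x where "x = card (forb K' M' - forb K M)"
      define e where "e = 2 * i - card (crossing K M K' M') + card ((K - K') \<inter> \<Union>M)"
      have ur: "u \<le> r" unfolding u_def using card_mono[OF cfg_M(4)[OF cfg'], of "M' - M"] cfg_M(2)[OF cfg'] by simp
      have xf: "x \<le> f" unfolding x_def using card_mono[OF cfg_finite_forb[OF cfg'], of "forb K' M' - forb K M"] f by simp
      have "P2 c c' * ew \<le> cc N m (r + u) (f + x) * ((1 - q) ^ (n - \<kappa> - i) * (2 * real i * pp) ^ e)"
        unfolding P2_def KM KM' fst_conv snd_conv ew_def N_def q_def h_def \<kappa>_def u_def x_def e_def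
      proof (rule joint_large_overlap[OF cfg cfg' ic f])
        show "m + 2 * f \<le> n choose 2" "2 * r \<le> m" "0 < m" using g2 by (auto simp: N_def)
        show "real m + 3 * w * sqrt (real m) \<le> pp * (real (n choose 2) - 2 * r - 2 * f)" using g4 by (simp add: N_def)
        show "\<exists>G\<in>graphs_nm n m. good n K M G \<and> good n K' M' G" using c' KM' by (simp add: D_def)
      qed (use g3 pp in auto)
      also have "\<dots> \<le> (c0 * (2 * p) ^ u * \<Lambda> ^ i) * ((Gg * 2 ^ i) * (4 * real i * p) ^ e)"
      proof (intro mult_mono)
        have "cc N m (r + u) (f + x) \<le> c0 * (2 * p) ^ u * exp (- (real x * (p - 2 * real r / real N)))"
          unfolding c0_def using cc_add_upper[of r u m f x N r p] g2 N0 ur xf by (simp add: p_def)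
        also have "\<dots> \<le> c0 * (2 * p) ^ u * \<Lambda> ^ i"
        proof (intro mult_left_mono)
          \<comment> \<open>The pairs lost from K to the intersection number i (\<kappa> - (i + 1) /
            2), and i is at most \<kappa> - L - 1; thus every new vertex brings at least (\<kappa> +
            L) / 2 - 2 r new non-edges. The summand L / 2 is the gain from the cut-off.\<close>
          have xl: "real i * ((real \<kappa> + real L) / 2 - 2 * real r) \<le> real x"
          proof -
            have "(\<kappa> choose 2) \<le> x + ((\<kappa> - i) choose 2) + 2 * r * i"
              unfolding x_def \<kappa>_def using new_forbidden[OF cfg cfg' ic] .
            then have "real (\<kappa> choose 2) \<le> real (x + ((\<kappa> - i) choose 2) + 2 * r * i)" by (rule of_nat_mono)
            then have "real \<kappa> * (real \<kappa> - 1) / 2 \<le> real x + (real \<kappa> - real i) * (real \<kappa> - real i - 1) / 2 + 2 * real r * real i"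
              using i by (simp add: choose_two_real of_nat_diff)
            then have "real i * (real \<kappa> - (real i + 1) / 2 - 2 * real r) \<le> real x" by (simp add: field_simps)
            moreover have "(real \<kappa> + real L) / 2 - 2 * real r \<le> real \<kappa> - (real i + 1) / 2 - 2 * real r"
            proof -
              have "i + 1 + L \<le> \<kappa>" using i by simp
              then have "real (i + 1 + L) \<le> real \<kappa>" by (rule of_nat_mono)
              then show ?thesis by (simp add: field_simps)
            qed
            then have "real i * ((real \<kappa> + real L) / 2 - 2 * real r) \<le> real i * (real \<kappa> - (real i + 1) / 2 - 2 * real r)" by (intro mult_left_mono) auto
            ultimately show ?thesis by linarith
          qed
          have "exp (- (real x * (p - 2 * real r / real N))) \<le> exp (- (real i * ((real \<kappa> + real L) / 2 - 2 * real r) * (p - 2 * real r / real N)))"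
            using mult_right_mono[OF xl, of "p - 2 * real r / real N"] g10(5) by simp
          also have "\<dots> = \<Lambda> ^ i" unfolding \<Lambda>_def by (simp add: exp_of_nat_mult[symmetric] mult_ac)
          finally show "exp (- (real x * (p - 2 * real r / real N))) \<le> \<Lambda> ^ i" .
        qed (use c00 p0 in auto)
        finally show "cc N m (r + u) (f + x) \<le> c0 * (2 * p) ^ u * \<Lambda> ^ i" .
        \<comment> \<open>There are i fewer outside vertices than for a single configuration; a
          missing factor is at least 1/2.\<close>
        show "(1 - q) ^ (n - \<kappa> - i) \<le> Gg * 2 ^ i"
        proof -
          have "(1 - q) ^ (n - \<kappa> - i) * (1/2) ^ i \<le> (1 - q) ^ (n - \<kappa> - i) * (1 - q) ^ i"
            using q by (intro mult_left_mono power_mono) auto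
          also have "\<dots> \<le> Gg" unfolding Gg_def power_add[symmetric] using q by (intro power_decreasing) auto
          finally show ?thesis by (simp add: power_one_over field_simps)
        qed
        show "(2 * real i * pp) ^ e \<le> (4 * real i * p) ^ e"
        proof (intro power_mono)
          have "2 * real i * pp \<le> 2 * real i * (2 * p)" using g4(7) by (intro mult_left_mono) auto
          then show "2 * real i * pp \<le> 4 * real i * p" by simp
        qed (use pp in auto)
        show "0 \<le> (1 - q) ^ (n - \<kappa> - i) * (2 * real i * pp) ^ e" using q pp by (intro mult_nonneg_nonneg zero_le_power) auto
        show "0 \<le> Gg * 2 ^ i" using Gg0 by simp
        show "0 \<le> c0 * (2 * p) ^ u * \<Lambda> ^ i" using c00 p0 by (simp add: \<Lambda>_def)
        show "0 \<le> (2 * real i * pp) ^ e" using pp by simp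
      qed
      finally have "P2 c c' \<le> (c0 * (2 * p) ^ u * \<Lambda> ^ i) * ((Gg * 2 ^ i) * (4 * real i * p) ^ e) / ew"
        using ew by (simp add: pos_le_divide_eq)
      also have "\<dots> = c0 * Gg / ew * (2 * \<Lambda>) ^ i * ((2 * p) ^ u * (4 * real i * p) ^ e)"
        by (simp add: power_mult_distrib)
      finally show ?thesis unfolding u_def e_def KM' by simp
    qed
    have zero: "P2 c c' = 0" if "c' \<in> C" "c' \<notin> D (card (fst c' - K))" for c'
    proof -
      have "\<not> (\<exists>G\<in>graphs_nm n m. good n K M G \<and> good n (fst c') (snd c') G)" using that by (simp add: D_def)
      then have "{G \<in> graphs_nm n m. good n K M G \<and> good n (fst c') (snd c') G} = {}" by blast
      then show ?thesis unfolding P2_def Pr_def KM by simp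
    qed
    have "(\<Sum>c'\<in>{c' \<in> C. \<not> card (fst c \<inter> fst c') \<le> L}. P2 c c') \<le> (\<Sum>i<\<kappa> - L. \<Sum>c'\<in>D i. P2 c c')"
    proof -
      have "(\<Sum>c'\<in>{c' \<in> C. \<not> card (fst c \<inter> fst c') \<le> L}. P2 c c') = (\<Sum>i<\<kappa> - L. \<Sum>c'\<in>{c' \<in> {c' \<in> C. \<not> card (fst c \<inter> fst c') \<le> L}. card (fst c' - K) = i}. P2 c c')"
      proof (rule sum.group[symmetric])
        show "(\<lambda>c'. card (fst c' - K)) ` {c' \<in> C. \<not> card (fst c \<inter> fst c') \<le> L} \<subseteq> {..<\<kappa> - L}"
        proof (rule image_subsetI)
          fix c' assume c': "c' \<in> {c' \<in> C. \<not> card (fst c \<inter> fst c') \<le> L}"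
          have "card (fst c' - K) = \<kappa> - card (K \<inter> fst c')" "card (K \<inter> fst c') \<le> \<kappa>"
            using configs_inter_card[OF cfg, of "fst c'" "snd c'"] c' by (auto simp: C_def \<kappa>_def)
          then show "card (fst c' - K) \<in> {..<\<kappa> - L}" using c' KM by auto
        qed
      qed (use fC in auto)
      also have "\<dots> \<le> (\<Sum>i<\<kappa> - L. \<Sum>c'\<in>D i. P2 c c')"
      proof (rule sum_mono)
        fix i
        let ?A = "{c' \<in> {c' \<in> C. \<not> card (fst c \<inter> fst c') \<le> L}. card (fst c' - K) = i}"
        have "(\<Sum>c'\<in>?A. P2 c c') = (\<Sum>c'\<in>?A \<inter> D i. P2 c c')"
          using fC zero by (intro sum.mono_neutral_right) auto
        also have "\<dots> \<le> (\<Sum>c'\<in>D i. P2 c c')" using fD P2_nn by (intro sum_mono2) auto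
        finally show "(\<Sum>c'\<in>?A. P2 c c') \<le> (\<Sum>c'\<in>D i. P2 c c')" .
      qed
      finally show ?thesis .
    qed
    also have "\<dots> \<le> (\<Sum>i<\<kappa> - L. c0 * Gg / ew * 2 * (1/2) ^ i)"
    proof (rule sum_mono)
      fix i assume "i \<in> {..<\<kappa> - L}"
      then have i: "i < \<kappa> - L" by simp
      let ?a = "c0 * Gg / ew * (2 * \<Lambda>) ^ i"
      have a0: "0 \<le> ?a" using c00 Gg0 ew by (simp add: \<Lambda>_def)
      have "(\<Sum>c'\<in>D i. P2 c c') \<le> (\<Sum>c'\<in>D i. ?a * ((2 * p) ^ card (snd c' - M) * (4 * real i * p) ^ (2 * i - card (crossing K M (fst c') (snd c')) + card ((K - fst c') \<inter> \<Union>M))))"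
        by (intro sum_mono one i)
      also have "\<dots> = ?a * (\<Sum>c'\<in>D i. (2 * p) ^ card (snd c' - M) * (4 * real i * p) ^ (2 * i - card (crossing K M (fst c') (snd c')) + card ((K - fst c') \<inter> \<Union>M)))"
        by (rule sum_distrib_left[symmetric])
      also have "\<dots> \<le> ?a * (2 * (16 * exp 4 * real n * real \<kappa> * p\<^sup>2) ^ i)"
        unfolding D_def C_def \<kappa>_def using g10 i a0 unfolding \<kappa>_def
        by (intro mult_left_mono count_large[OF cfg p0]) auto
      also have "\<dots> = c0 * Gg / ew * 2 * (32 * exp 4 * real n * real \<kappa> * p\<^sup>2 * \<Lambda>) ^ i"
      proof -
        have "(2 * \<Lambda>) ^ i * (16 * exp 4 * real n * real \<kappa> * p\<^sup>2) ^ i = (32 * exp 4 * real n * real \<kappa> * p\<^sup>2 * \<Lambda>) ^ i"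
          unfolding power_mult_distrib[symmetric] by (simp add: mult_ac)
        then show ?thesis by simp
      qed
      \<comment> \<open>The constant 64 in \<open>g10\<close> is twice the 32 obtained here, so the
        base is at most 1/2 and the sum over \<open>i\<close> converges.\<close>
      also have "\<dots> \<le> c0 * Gg / ew * 2 * (1/2) ^ i"
        using g10(4) c00 Gg0 ew p0 by (intro mult_left_mono power_mono) (auto simp: \<Lambda>_def)
      finally show "(\<Sum>c'\<in>D i. P2 c c') \<le> c0 * Gg / ew * 2 * (1/2) ^ i" .
    qed
    also have "\<dots> = c0 * Gg / ew * 2 * (\<Sum>i<\<kappa> - L. (1/2) ^ i)" by (simp add: sum_distrib_left)
    also have "\<dots> \<le> c0 * Gg / ew * 2 * 2"
    proof (intro mult_left_mono)
      have "(\<Sum>i<a. (1/2 :: real) ^ i) = 2 - 2 * (1/2) ^ a" for a by (induction a) auto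
      then show "(\<Sum>i<\<kappa> - L. (1/2 :: real) ^ i) \<le> 2" by simp
    qed (use c00 Gg0 ew in auto)
    finally show ?thesis by (simp add: mult_ac)
  qed
  define E0 where "E0 = EX_X n m k r"
  have E0: "real (card C) * LB \<le> E0"
  proof -
    have "(\<Sum>c\<in>C. LB) \<le> (\<Sum>c\<in>C. Pr n m (good n (fst c) (snd c)))" by (intro sum_mono H1)
    then show ?thesis unfolding E0_def EX_eq[OF m_le] C_def by simp
  qed
  have S0: "0 \<le> real (n choose \<kappa>) * S"
    by (rule order_trans[OF _ g9]) (auto intro!: sum_nonneg)
  have S1: "0 \<le> S"
  proof -
    have "0 < real (n choose \<kappa>)" using g1 by simp
    then show ?thesis using S0 by (simp add: zero_le_mult_iff)
  qed
  have "(\<Sum>c\<in>C. \<Sum>c'\<in>C. P2 c c') \<le> (\<Sum>c\<in>C. c0\<^sup>2 * Gg\<^sup>2 * (exp (E1 + E2) / ew) * (real (card C) * S) + c0 * Gg * (4 / ew))"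
  proof (rule sum_mono)
    fix c assume c: "c \<in> C"
    have "(\<Sum>c'\<in>C. P2 c c') = (\<Sum>c'\<in>{c' \<in> C. card (fst c \<inter> fst c') \<le> L}. P2 c c') + (\<Sum>c'\<in>{c' \<in> C. \<not> card (fst c \<inter> fst c') \<le> L}. P2 c c')"
      using fC by (subst sum.union_disjoint[symmetric]) (auto intro!: sum.cong)
    then show "(\<Sum>c'\<in>C. P2 c c') \<le> c0\<^sup>2 * Gg\<^sup>2 * (exp (E1 + E2) / ew) * (real (card C) * S) + c0 * Gg * (4 / ew)"
      using H2[OF c] H3[OF c] by linarith
  qed
  \<comment> \<open>Replaces \<open>c0 * Gg\<close> by \<open>LB / \<tau>\<close>. Both terms then
    increase with \<open>card C * LB\<close>, which is at most the expectation.\<close>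
  also have "\<dots> = (exp (E1 + E2) * S / (ew * \<tau>\<^sup>2)) * (real (card C) * LB)\<^sup>2 + 4 / (ew * \<tau>) * (real (card C) * LB)"
    unfolding LB_def using \<tau>0 ew by (simp add: field_simps power2_eq_square)
  also have "\<dots> \<le> (exp (E1 + E2) * S / (ew * \<tau>\<^sup>2)) * E0\<^sup>2 + 16 * E0"
  proof (intro add_mono mult_mono power_mono E0)
    have "1/2 * (1/2) \<le> ew * \<tau>" using ew g6 by (intro mult_mono) auto
    then show "4 / (ew * \<tau>) \<le> 16" using ew \<tau>0 by (simp add: pos_divide_le_eq mult_ac)
  qed (use S1 ew LB0 in auto)
  finally have "(\<Sum>c\<in>C. \<Sum>c'\<in>C. P2 c c') \<le> (exp (E1 + E2) * S / (ew * \<tau>\<^sup>2)) * E0\<^sup>2 + 16 * E0" .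
  then show ?thesis unfolding VarX_eq[OF m_le] P2_def C_def E0_def ew_def by (simp add: algebra_simps)
qed

section \<open>Asymptotics\<close>

lemma ln_power_powr_tendsto_0:
  fixes s :: real
  assumes "0 < s"
  shows "(\<lambda>n::nat. ln (real n) ^ a * real n powr - s) \<longlonglongrightarrow> 0"
proof -
  have "(\<lambda>n::nat. ln (real n) powr real a * real n powr - s) \<longlonglongrightarrow> 0" using assms by real_asymp
  moreover have "\<forall>\<^sub>F n::nat in sequentially. ln (real n) powr real a * real n powr - s = ln (real n) ^ a * real n powr - s"
    using eventually_gt_at_top[of 2] by eventually_elim (auto simp: powr_realpow)
  ultimately show ?thesis by (rule Lim_transform_eventually)
qed

lemma one_minus_power_le_exp:
  fixes x :: real
  assumes "0 \<le> x" "x \<le> 1"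
  shows "(1 - x) ^ j \<le> exp (- (x * real j))"
proof -
  have "(1 - x) ^ j \<le> exp (- x) ^ j" using assms exp_ge_add_one_self[of "- x"] by (intro power_mono) auto
  moreover have "exp (- x) ^ j = exp (real j * (- x))" by (rule exp_of_nat_mult[symmetric])
    ultimately show ?thesis by (simp add: mult.commute)
qed

lemma qf_le_exp:
  assumes "1 \<le> h" "0 \<le> x" "x \<le> 1"
  shows "qf h x \<le> exp (- x * (real h - 1)) * (1 + real h * x)"
proof -
    have 1: "(1 - x) ^ h \<le> (1 - x) ^ (h - 1)" using assms by (intro power_decreasing) auto
  have 2: "(1 - x) ^ (h - 1) \<le> exp (- x * (real h - 1))" using one_minus_power_le_exp[of x "h - 1"] assms by (simp add: of_nat_diff)
  have "qf h x \<le> (1 - x) ^ (h - 1) * (1 + real h * x)" using 1 unfolding qf_def by (simp add: algebra_simps)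
  also have "\<dots> \<le> exp (- x * (real h - 1)) * (1 + real h * x)" using 2 assms by (intro mult_right_mono) auto
  finally show ?thesis .
qed

text \<open>The form in which the asymptotic hypotheses enter. Condition (star) is condensed into an
  upper bound on p k and into \<open>exp_pk\<close>, which says that a vertex has no neighbour in a
  k-set with probability roughly at most (log n / (n p))^2. The cap on \<open>\<epsilon>\<close>
  leaves room in the exponents that stay away from the critical value.\<close>

locale regime =
  fixes \<epsilon> C :: real and m k r :: "nat \<Rightarrow> nat" and p :: "nat \<Rightarrow> real"
  assumes eps: "0 < \<epsilon>" "\<epsilon> \<le> 1/100"
    and p_def: "\<And>n. p n = real (m n) / real (n choose 2)"
    and p_half: "\<forall>\<^sub>F n in sequentially. p n \<le> 1/2"
    and p_lower: "\<forall>\<^sub>F n in sequentially. real n powr (-3/4 + \<epsilon>) \<le> p n"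
    and pk_upper: "\<forall>\<^sub>F n in sequentially. p n * real (k n) \<le> 2 * ln (real n)"
    and exp_pk: "\<forall>\<^sub>F n in sequentially. exp (- (p n * real (k n))) \<le> (ln (real n) / (real n * p n))\<^sup>2"
    and r_upper: "\<forall>\<^sub>F n in sequentially. real (r n) \<le> C * (ln (real n) ^ 3 / (real n * (p n)\<^sup>2))"
begin

text \<open>The scale for all error terms: products add the exponents, and whether the result
  vanishes is a linear condition on them.\<close>

definition mon :: "nat \<Rightarrow> real \<Rightarrow> real \<Rightarrow> nat \<Rightarrow> real" where
  "mon a b c n = ln (real n) ^ a * real n powr b * p n powr c"

definition \<kappa> :: "nat \<Rightarrow> nat" where "\<kappa> n = k n + r n"
definition NN :: "nat \<Rightarrow> real" where "NN n = real (n choose 2)"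
definition ff :: "nat \<Rightarrow> nat" where "ff n = ((k n + r n) choose 2) - ((2 * r n) choose 2)"
definition lg :: "nat \<Rightarrow> real" where "lg n = ln (real n)"
definition sm :: "nat \<Rightarrow> real" where "sm n = sqrt (real (m n))"

lemma mon_mult: "mon a b c n * mon a' b' c' n = mon (a + a') (b + b') (c + c') n"
  unfolding mon_def power_add powr_add by (simp add: mult_ac)

lemma O_mult:
  assumes "f \<in> O(mon a b c)" "g \<in> O(mon a' b' c')"
  shows "(\<lambda>n. f n * g n) \<in> O(mon (a + a') (b + b') (c + c'))"
  using landau_o.big_mult[OF assms] unfolding mon_mult by simp

lemma O_I:
  assumes "\<forall>\<^sub>F n in sequentially. 0 \<le> f n \<and> f n \<le> D * mon a b c n"
  shows "f \<in> O(mon a b c)"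
proof (rule bigoI[of _ D])
  show "\<forall>\<^sub>F n in sequentially. norm (f n) \<le> D * norm (mon a b c n)"
    using assms eventually_ge_at_top[of 1]
  proof eventually_elim
    case (elim n)
    then have "0 \<le> mon a b c n" unfolding mon_def by simp
    then show ?case using elim by simp
  qed
qed

text \<open>For c at most 0 the lower bound on \<open>p\<close> gives p^c at most n^(- (3/4 -
  \<epsilon>) c). The resulting power of n is negative by assumption and beats any power of log
  n.\<close>

lemma tz:
  assumes f: "f \<in> O(mon a b c)" and c: "c \<le> 0" and b: "b - (3/4 - \<epsilon>) * c < 0"
  shows "f \<longlonglongrightarrow> 0"
proof -
  let ?s = "- (b - (3/4 - \<epsilon>) * c)"
  have "mon a b c \<longlonglongrightarrow> 0"
  proof (rule tendsto_sandwich[OF _ _ tendsto_const ln_power_powr_tendsto_0[of ?s a]])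
    show "\<forall>\<^sub>F n in sequentially. 0 \<le> mon a b c n"
      using eventually_ge_at_top[of 1] by eventually_elim (simp add: mon_def)
    show "\<forall>\<^sub>F n in sequentially. mon a b c n \<le> ln (real n) ^ a * real n powr - ?s"
      using eventually_ge_at_top[of 1] p_lower
    proof eventually_elim
      case (elim n)
      have "p n powr c \<le> (real n powr (-3/4 + \<epsilon>)) powr c"
        using elim c by (intro powr_mono2') auto
      also have "\<dots> = real n powr ((-3/4 + \<epsilon>) * c)" by (simp add: powr_powr)
      finally have "mon a b c n \<le> ln (real n) ^ a * real n powr b * real n powr ((-3/4 + \<epsilon>) * c)"
        unfolding mon_def using elim by (intro mult_left_mono) auto
      also have "\<dots> = ln (real n) ^ a * real n powr - ?s" by (simp add: powr_add[symmetric] algebra_simps)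
      finally show ?case .
    qed
  qed (use b in auto)
  then have "mon a b c \<in> o(\<lambda>_. 1)" by (intro smalloI_tendsto) auto
  with f have "f \<in> o(\<lambda>_. 1)" by (rule landau_o.big_small_trans)
  then show ?thesis by (rule smalloD_tendsto[where g = "\<lambda>_. 1", simplified])
qed

lemma tz_le:
  assumes "f \<longlonglongrightarrow> (0::real)" "0 < (e::real)" shows "\<forall>\<^sub>F n in sequentially. f n \<le> e"
  using order_tendstoD(2)[OF assms] by eventually_elim simp

lemma base0: "\<forall>\<^sub>F n in sequentially. 100 \<le> n \<and> 100 \<le> lg n \<and> 0 < p n \<and> p n \<le> 1/2 \<and> real n powr (-3/4) \<le> p n
    \<and> real n ^ 2 / 4 \<le> NN n \<and> NN n \<le> real n ^ 2 / 2 \<and> real (m n) = p n * NN n"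
proof -
  have 1: "\<forall>\<^sub>F n::nat in sequentially. 100 \<le> ln (real n)" by real_asymp
  show ?thesis using 1 p_half p_lower eventually_ge_at_top[of 100]
  proof eventually_elim
    case (elim n)
    have a: "real n powr (-3/4) \<le> real n powr (-3/4 + \<epsilon>)" using elim eps by (intro powr_mono) auto
    have b: "0 < real n powr (-3/4)" using elim by simp
    have c: "NN n = real n * (real n - 1) / 2" unfolding NN_def choose_two_real ..
    have "real n * (real n / 2) \<le> real n * (real n - 1)" using elim by (intro mult_left_mono) auto
    then have d: "real n ^ 2 / 4 \<le> NN n" unfolding c power2_eq_square by simp
    have "0 < NN n" unfolding c using elim by simp
    then have "real (m n) = p n * NN n" unfolding p_def[of n] NN_def by simp
    moreover have "NN n \<le> real n ^ 2 / 2" unfolding c power2_eq_square by (simp add: algebra_simps)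
    moreover have "real n powr (-3/4) \<le> p n" "0 < p n" using a b elim by linarith+
    ultimately show ?case using d elim unfolding lg_def by simp
  qed
qed

lemma O_n: "real \<in> O(mon 0 1 0)"
  by (rule O_I[of _ 1]) (rule eventually_mono[OF base0], simp add: mon_def)

lemma O_p: "p \<in> O(mon 0 0 1)"
  by (rule O_I[of _ 1]) (rule eventually_mono[OF base0], simp add: mon_def)

lemma O_lg: "lg \<in> O(mon 1 0 0)"
  by (rule O_I[of _ 1]) (rule eventually_mono[OF base0], simp add: mon_def lg_def)

lemma O_inv_N: "(\<lambda>n. 1 / NN n) \<in> O(mon 0 (-2) 0)"
proof (rule O_I[of _ 4])
  show "\<forall>\<^sub>F n in sequentially. 0 \<le> 1 / NN n \<and> 1 / NN n \<le> 4 * mon 0 (-2) 0 n"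
    using base0
  proof eventually_elim
    case (elim n)
    have 0: "0 < real n ^ 2 / 4" using elim by simp
    then have "1 / NN n \<le> 1 / (real n ^ 2 / 4)" using elim by (intro frac_le) linarith+
    moreover have "1 / (real n ^ 2 / 4) = 4 * mon 0 (-2) 0 n" using elim unfolding mon_def by (simp add: powr_minus divide_simps)
    moreover have "0 < NN n" using elim 0 by linarith
    ultimately show ?case by simp
  qed
qed

lemma O_r: "(\<lambda>n. real (r n)) \<in> O(mon 3 (-1) (-2))"
proof (rule O_I[of _ C])
  show "\<forall>\<^sub>F n in sequentially. 0 \<le> real (r n) \<and> real (r n) \<le> C * mon 3 (-1) (-2) n"
    using base0 r_upper 
  proof eventually_elim
    case (elim n)
    have "mon 3 (-1) (-2) n = ln (real n) ^ 3 / (real n * (p n)\<^sup>2)"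
      using elim unfolding mon_def by (simp add: powr_minus_divide)
    then show ?case using elim by simp
  qed
qed

text \<open>n p is at least n^(1/4), so the right side of \<open>exp_pk\<close> is at most n^(-1/8)
  for large n.\<close>

lemma pk_lower: "\<forall>\<^sub>F n in sequentially. lg n / 8 \<le> p n * real (k n)"
proof -
  have 1: "\<forall>\<^sub>F n::nat in sequentially. ln (real n) / (real n * real n powr (-3/4)) \<le> real n powr (-1/16)" by real_asymp
  show ?thesis using 1 base0 exp_pk
  proof eventually_elim
    case (elim n)
    have "ln (real n) / (real n * p n) \<le> ln (real n) / (real n * real n powr (-3/4))"
      using elim by (intro divide_left_mono mult_left_mono mult_pos_pos) (auto simp: lg_def)
    then have "(ln (real n) / (real n * p n))\<^sup>2 \<le> (real n powr (-1/16))\<^sup>2"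
      using elim by (intro power_mono) (auto simp: lg_def)
    also have "\<dots> = real n powr (-1/8)" by (simp add: power2_eq_square powr_add[symmetric])
    also have "\<dots> = exp (- (lg n / 8))" using elim unfolding powr_def lg_def by simp
    finally show ?case using elim by (smt (verit) exp_le_cancel_iff)
  qed
qed

lemma pr_tendsto: "(\<lambda>n. p n * real (r n)) \<longlonglongrightarrow> 0"
  using O_mult[OF O_p O_r] by (rule tz) (use eps in auto)

lemma base1: "\<forall>\<^sub>F n in sequentially. p n * real (r n) \<le> 1/1000 \<and> 1000 * real (r n) \<le> real (k n) \<and>
    p n * real (k n) \<le> 2 * lg n \<and> p n * real (\<kappa> n) \<le> 3 * lg n \<and> lg n / 8 \<le> p n * real (k n)
    \<and> real (\<kappa> n) \<le> 2 * real (k n) \<and> 20 \<le> real (k n)"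
  using tz_le[OF pr_tendsto, of "1/1000", simplified] base0 pk_upper pk_lower
proof eventually_elim
  case (elim n)
  have "p n * (1000 * real (r n)) \<le> p n * real (k n)" using elim by linarith
  then have a: "1000 * real (r n) \<le> real (k n)" using elim mult_le_cancel_left_pos[of "p n"] by blast
  have "p n * real (k n) \<le> 1/2 * real (k n)" using elim by (intro mult_right_mono) auto
  then have b: "20 \<le> real (k n)" using elim by linarith
    have "p n * real (\<kappa> n) = p n * real (k n) + p n * real (r n)" by (simp add: \<kappa>_def distrib_left)
    then have c: "p n * real (\<kappa> n) \<le> 3 * lg n" using elim by (simp add: lg_def)
    have "real (\<kappa> n) \<le> 2 * real (k n)" using a unfolding \<kappa>_def of_nat_add by linarith
    then show ?case using elim a b c by (simp add: lg_def)
qed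

lemma O_kappa: "(\<lambda>n. real (\<kappa> n)) \<in> O(mon 1 0 (-1))"
proof (rule O_I[of _ 3])
  show "\<forall>\<^sub>F n in sequentially. 0 \<le> real (\<kappa> n) \<and> real (\<kappa> n) \<le> 3 * mon 1 0 (-1) n"
    using base0 base1
  proof eventually_elim
    case (elim n)
    have "real (\<kappa> n) = (p n * real (\<kappa> n)) / p n" using elim by simp
    also have "\<dots> \<le> 3 * lg n / p n" using elim by (intro divide_right_mono) auto
    also have "\<dots> = 3 * mon 1 0 (-1) n" using elim unfolding mon_def lg_def by (simp add: powr_minus_divide)
    finally show ?case by simp
  qed
qed

lemma f_upper: "real (ff n) \<le> (real (\<kappa> n))\<^sup>2 / 2"
proof -
  have "real (ff n) \<le> real (\<kappa> n choose 2)" unfolding ff_def \<kappa>_def by simp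
  then show ?thesis unfolding choose_two_real by (simp add: power2_eq_square algebra_simps)
qed

lemma f_lower: "(real (\<kappa> n))\<^sup>2 / 2 - (real (\<kappa> n) + 4 * (real (r n))\<^sup>2) / 2 \<le> real (ff n)"
proof -
  have "real (\<kappa> n choose 2) - real ((2 * r n) choose 2) \<le> real (ff n)" unfolding ff_def \<kappa>_def by linarith
  moreover have "real (\<kappa> n) * (real (\<kappa> n) - 1) / 2 - real (2 * r n) * (real (2 * r n) - 1) / 2
    = (real (\<kappa> n))\<^sup>2 / 2 - (real (\<kappa> n) + 4 * (real (r n))\<^sup>2) / 2 + real (r n)"
    by (simp add: power2_eq_square field_simps)
  ultimately show ?thesis unfolding choose_two_real by linarith
qed

lemma O_f: "(\<lambda>n. real (ff n)) \<in> O(mon 2 0 (-2))"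
proof -
  have "(\<lambda>n. real (ff n)) \<in> O(\<lambda>n. real (\<kappa> n) * real (\<kappa> n))"
    using f_upper by (intro bigoI[of _ "1/2"]) (auto simp: power2_eq_square)
  also have "(\<lambda>n. real (\<kappa> n) * real (\<kappa> n)) \<in> O(mon 2 0 (-2))" using O_mult[OF O_kappa O_kappa] by (simp add: numeral_2_eq_2)
  finally show ?thesis .
qed

text \<open>sqrt m / N is, up to constants, one standard deviation of the edge density of a product
  random graph; this equals sqrt (p / N).\<close>

lemma O_smN: "(\<lambda>n. sm n / NN n) \<in> O(mon 0 (-1) (1/2))"
proof (rule O_I[of _ 2])
  show "\<forall>\<^sub>F n in sequentially. 0 \<le> sm n / NN n \<and> sm n / NN n \<le> 2 * mon 0 (-1) (1/2) n"
    using base0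
  proof eventually_elim
    case (elim n)
    have 0: "0 < real n ^ 2 / 4" using elim by simp
    then have N: "0 < NN n" using elim by linarith
    have s: "sqrt (real n ^ 2 / 4) \<le> sqrt (NN n)" using elim by simp
    then have s: "real n / 2 \<le> sqrt (NN n)" by (simp add: real_sqrt_divide)
    have "sm n / NN n = sqrt (p n) / sqrt (NN n)"
      
    proof -
      have "sm n / NN n = sqrt (p n) * (sqrt (NN n) / NN n)" unfolding sm_def using elim by (simp add: real_sqrt_mult)
      also have "sqrt (NN n) / NN n = 1 / sqrt (NN n)" using N by (simp add: sqrt_divide_self_eq inverse_eq_divide)
      finally show ?thesis by simp
    qed
    also have "\<dots> \<le> sqrt (p n) / (real n / 2)" using s elim N by (intro divide_left_mono mult_pos_pos) auto
    also have "\<dots> = 2 * mon 0 (-1) (1/2) n" using elim unfolding mon_def by (simp add: powr_minus_divide powr_half_sqrt)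
    finally show ?case using N unfolding sm_def by simp
  qed
qed

lemma O_invm: "(\<lambda>n. 1 / sm n) \<in> O(mon 0 (-1) (-1/2))"
proof (rule O_I[of _ 2])
  show "\<forall>\<^sub>F n in sequentially. 0 \<le> 1 / sm n \<and> 1 / sm n \<le> 2 * mon 0 (-1) (-1/2) n"
    using base0
  proof eventually_elim
    case (elim n)
    have 0: "0 < real n ^ 2 / 4" using elim by simp
    then have N: "0 < NN n" using elim by linarith
    have s: "sqrt (real n ^ 2 / 4) \<le> sqrt (NN n)" using elim by simp
    then have s: "real n / 2 \<le> sqrt (NN n)" by (simp add: real_sqrt_divide)
    have "sqrt (p n) * (real n / 2) \<le> sm n" unfolding sm_def using elim s by (auto simp: real_sqrt_mult)
    moreover have "0 < sqrt (p n) * (real n / 2)" using elim by simp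
    ultimately have "1 / sm n \<le> 1 / (sqrt (p n) * (real n / 2))" by (intro frac_le) linarith+
    also have "\<dots> = 2 * mon 0 (-1) (-1/2) n" using elim unfolding mon_def by (simp add: powr_minus_divide powr_half_sqrt)
    finally show ?case unfolding sm_def by simp
  qed
qed

text \<open>The cut-off between small and large overlap. A fraction \<open>\<epsilon>\<close> of
  \<open>\<kappa>\<close> costs n^(3 \<epsilon>) in \<open>QQ\<close> and \<open>Q2\<close> and
  gains (n p)^(-\<epsilon>) in \<open>Lam\<close>; both stay affordable with the spare \<epsilon> in
  the lower bound on \<open>p\<close>.\<close>

definition LL :: "nat \<Rightarrow> nat" where "LL n = nat \<lfloor>\<epsilon> * real (\<kappa> n)\<rfloor>"
definition hh :: "nat \<Rightarrow> nat" where "hh n = k n - r n"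
definition h0 :: "nat \<Rightarrow> nat" where "h0 n = \<kappa> n - LL n - 2 * r n - 1"
text \<open>\<open>uu\<close> is \<open>lg n\<close> standard deviations on the scale of densities;
  \<open>yy\<close> is the relative loss of available pairs when two configurations fix
  theirs.\<close>

definition uu :: "nat \<Rightarrow> real" where "uu n = lg n * (sm n / NN n)"
definition yy :: "nat \<Rightarrow> real" where "yy n = (2 * real (r n) + 2 * real (ff n)) * (1 / NN n)"
text \<open>\<open>pm\<close> and \<open>pp\<close> are the densities of the two product measures between which the uniform
  measure is sandwiched, at distance about \<open>lg n\<close> standard deviations from \<open>p\<close>.\<close>

definition pp :: "nat \<Rightarrow> real" where "pp n = (real (m n) + 3 * lg n * sm n) / (NN n - 2 * real (r n) - 2 * real (ff n))"
definition pm :: "nat \<Rightarrow> real" where "pm n = (real (m n) - real (r n) - 2 * lg n * sm n) / NN n"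

lemma O_le:
  assumes "g \<in> O(mon a b c)" "\<forall>\<^sub>F n in sequentially. 0 \<le> f n \<and> f n \<le> D * g n"
  shows "f \<in> O(mon a b c)"
proof -
  have "f \<in> O(g)"
    by (rule bigoI[of _ "\<bar>D\<bar>"]) (rule eventually_mono[OF assms(2)], simp, metis abs_ge_self abs_mult order_trans)
  then show ?thesis using assms(1) by (rule landau_o.big_trans)
qed

lemma O_cong: "f \<in> O(mon a b c) \<Longrightarrow> a = a' \<Longrightarrow> b = b' \<Longrightarrow> c = c' \<Longrightarrow> f \<in> O(mon a' b' c')"
  by simp

lemma O_inv_p: "(\<lambda>n. 1 / p n) \<in> O(mon 0 0 (-1))"
  by (rule O_I[of _ 1]) (rule eventually_mono[OF base0], simp add: mon_def powr_minus_divide)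

lemma O_powr: "(\<lambda>n. real n powr b) \<in> O(mon 0 b 0)"
  by (rule O_I[of _ 1]) (rule eventually_mono[OF base0], simp add: mon_def)

lemma O_epk: "(\<lambda>n. exp (- (p n * real (k n)))) \<in> O(mon 2 (-2) (-2))"
proof (rule O_I[of _ 1])
  show "\<forall>\<^sub>F n in sequentially. 0 \<le> exp (- (p n * real (k n))) \<and> exp (- (p n * real (k n))) \<le> 1 * mon 2 (-2) (-2) n"
    using base0 exp_pk
  proof eventually_elim
    case (elim n)
    have "(ln (real n) / (real n * p n))\<^sup>2 = mon 2 (-2) (-2) n"
      using elim unfolding mon_def by (simp add: powr_minus_divide power_divide power_mult_distrib)
    then show ?case using elim by simp
  qed
qed

lemma O_uu: "uu \<in> O(mon 1 (-1) (1/2))"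
  using O_mult[OF O_lg O_smN] unfolding uu_def by simp

text \<open>Among these, the bounds on \<open>\<kappa> * r / N\<close> and
  \<open>\<kappa> * uu\<close> say that the density shifts are negligible even when multiplied by
  the size of a configuration, so they change exp (- p k) by constant factors only.\<close>

lemma base2: "\<forall>\<^sub>F n in sequentially. 100 * real (ff n) \<le> NN n \<and> 100 * real (r n) \<le> NN n \<and> 100 * real (r n) \<le> real (m n)
   \<and> 100 * lg n \<le> sm n \<and> 100 * real (\<kappa> n) \<le> real n \<and> real (\<kappa> n) * (real (r n) * (1 / NN n)) \<le> 1/100 \<and> real (\<kappa> n) * uu n \<le> 1/100
   \<and> real (LL n) \<le> \<epsilon> * real (\<kappa> n) \<and> \<epsilon> * real (\<kappa> n) - 1 \<le> real (LL n) \<and> 100 * real (LL n) \<le> real (\<kappa> n)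
   \<and> real (hh n) = real (k n) - real (r n) \<and> real (h0 n) = real (\<kappa> n) - real (LL n) - 2 * real (r n) - 1
   \<and> sm n * sm n = real (m n) \<and> real (k n) + real (r n) = real (\<kappa> n)"
proof -
  have "(\<lambda>n. real (ff n) * (1 / NN n)) \<longlonglongrightarrow> 0" using O_mult[OF O_f O_inv_N] by (rule tz) (use eps in auto)
  note a1 = tz_le[OF this, of "1/100", simplified]
  have rN: "(\<lambda>n. real (r n) * (1 / NN n)) \<longlonglongrightarrow> 0" using O_mult[OF O_r O_inv_N] by (rule tz) (use eps in auto)
  note a2 = tz_le[OF this, of "1/100", simplified]
  have "(\<lambda>n. real (r n) * (1 / NN n) * (1 / p n)) \<longlonglongrightarrow> 0" using O_mult[OF O_mult[OF O_r O_inv_N] O_inv_p] by (rule tz) (use eps in auto)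
  note a3 = tz_le[OF this, of "1/100", simplified]
  have "(\<lambda>n. lg n * (1 / sm n)) \<longlonglongrightarrow> 0" using O_mult[OF O_lg O_invm] by (rule tz) (use eps in auto)
  note a4 = tz_le[OF this, of "1/100", simplified]
  have "(\<lambda>n. real (\<kappa> n) * real n powr (-1)) \<longlonglongrightarrow> 0" using O_mult[OF O_kappa O_powr] by (rule tz) (use eps in auto)
  note a5 = tz_le[OF this, of "1/100", simplified]
  have "(\<lambda>n. real (\<kappa> n) * (real (r n) * (1 / NN n))) \<longlonglongrightarrow> 0"
    using O_mult[OF O_kappa O_mult[OF O_r O_inv_N]] by (rule tz) (use eps in auto)
  note a6 = tz_le[OF this, of "1/100", simplified]
  have "(\<lambda>n. real (\<kappa> n) * uu n) \<longlonglongrightarrow> 0" using O_mult[OF O_kappa O_uu] by (rule tz) (use eps in auto)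
  note a7 = tz_le[OF this, of "1/100", simplified]
  show ?thesis using a1 a2 a3 a4 a5 a6 a7 base0 base1
  proof eventually_elim
    case (elim n)
    have "0 < real n ^ 2 / 4" using elim by simp
    then have N: "0 < NN n" using elim by linarith
    have m0: "0 < real (m n)" using elim N by simp
    then have s0: "0 < sm n" unfolding sm_def by simp
    have c1: "100 * real (ff n) \<le> NN n" "100 * real (r n) \<le> NN n" using elim(1,2) N by (simp_all add: field_simps)
    have "real (r n) \<le> 1/100 * (NN n * p n)" using elim(3) N elim(8) by (simp add: field_simps)
    then have c2: "100 * real (r n) \<le> real (m n)" using elim(8) by (simp add: mult.commute)
    have c3: "100 * lg n \<le> sm n" using elim(4) s0 by (simp add: field_simps)
    have n0: "0 < real n" using elim(8) by simp
    have "real (\<kappa> n) / real n \<le> 1/100" using elim(5) by (simp add: powr_minus_divide)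
    then have c4: "100 * real (\<kappa> n) \<le> real n" using n0 by (simp add: field_simps)
    have e0: "0 \<le> \<epsilon> * real (\<kappa> n)" using eps by simp
    then have c5: "real (LL n) \<le> \<epsilon> * real (\<kappa> n)" "\<epsilon> * real (\<kappa> n) - 1 \<le> real (LL n)" unfolding LL_def by linarith+
    have "\<epsilon> * real (\<kappa> n) \<le> 1/100 * real (\<kappa> n)" using eps by (intro mult_right_mono) auto
    then have c6: "100 * real (LL n) \<le> real (\<kappa> n)" using c5 by linarith
    have c7: "real (hh n) = real (k n) - real (r n)" using elim(9) unfolding hh_def by linarith
    have k1: "real (\<kappa> n) = real (k n) + real (r n)" unfolding \<kappa>_def by simp
    have c8: "real (h0 n) = real (\<kappa> n) - real (LL n) - 2 * real (r n) - 1" using elim(9) c6 k1 unfolding h0_def by linarith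
    have c9: "sm n * sm n = real (m n)" unfolding sm_def by simp
    show ?case using c1 c2 c3 c4 c5 c6 c7 c8 c9 k1 elim(6,7) by simp
  qed
qed

text \<open>The last conjunct lets (1 - pm)^(hh - 2) be compared with exp (- p k) at the cost of a
  factor exp 2: all shifts in density and in size are collected there.\<close>

lemma base3: "\<forall>\<^sub>F n in sequentially. 0 < NN n \<and> 0 < sm n \<and> 0 \<le> uu n \<and> 0 \<le> yy n \<and> yy n \<le> 1/20 \<and> 0 \<le> pm n \<and> pm n \<le> p n \<and> p n \<le> pp n \<and> pp n \<le> 2 * p n
   \<and> pm n = p n - real (r n) * (1 / NN n) - 2 * uu n \<and> pp n \<le> p n + 2 * (p n * yy n) + 6 * uu n
   \<and> pm n * (1 + lg n / sm n) / (1 + pm n * (lg n / sm n)) \<le> pp n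
   \<and> p n * real (k n) - 2 \<le> pm n * (real (hh n) - 2)"
  using base0 base1 base2
proof eventually_elim
  case (elim n)
  have "0 < real n ^ 2 / 4" using elim(1) by simp
  then have N: "0 < NN n" using elim(1) by linarith
  have m0: "0 < real (m n)" using elim(1) N by simp
  then have s0: "0 < sm n" unfolding sm_def by simp
  have l0: "0 < lg n" using elim(1) by simp
  have hp: "p n = real (m n) / NN n" using elim(1) N by simp
  define rN where "rN = real (r n) * (1 / NN n)"
  have rN0: "0 \<le> rN" unfolding rN_def using N by simp
  have rNp: "100 * rN \<le> p n" using elim(3) N unfolding rN_def hp by (simp add: divide_right_mono)
  have u0: "0 \<le> uu n" unfolding uu_def using N s0 l0 by simp
  \<comment> \<open>Since p = (sm)^2 / N, the shift is relatively small: \<open>lg n / sm n\<close>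
    times \<open>p\<close>.\<close>
  have us: "uu n = p n * (lg n / sm n)"
  proof -
    have "p n = sm n * sm n / NN n" using elim(3) hp by simp
    then show ?thesis unfolding uu_def using s0 by simp
  qed
  have "lg n / sm n \<le> 1/100" using elim(3) s0 by (simp add: field_simps)
  then have up: "100 * uu n \<le> p n" unfolding us using elim(1) mult_left_mono[of "lg n / sm n" "1/100" "p n"] by linarith
  have y0: "0 \<le> yy n" unfolding yy_def using N by simp
  have y1: "yy n \<le> 1/20" unfolding yy_def using elim(3) N by (simp add: field_simps)
  have pm: "pm n = p n - rN - 2 * uu n" unfolding pm_def rN_def uu_def hp using N by (simp add: field_simps)
  have Ny: "NN n - 2 * real (r n) - 2 * real (ff n) = NN n * (1 - yy n)" unfolding yy_def using N by (simp add: field_simps)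
  have mN: "real (m n) + 3 * lg n * sm n = NN n * (p n + 3 * uu n)" unfolding uu_def hp using N by (simp add: field_simps)
  have pp: "pp n = (p n + 3 * uu n) / (1 - yy n)" unfolding pp_def Ny mN using N by simp
  have p0: "0 \<le> p n" using elim(1) by simp
  have "p n * (yy n * yy n) \<le> p n * (yy n * (1/20))" using p0 y0 y1 by (intro mult_left_mono)
  moreover have "0 \<le> p n * yy n" using p0 y0 by simp
  moreover have "uu n * yy n \<le> uu n * (1/20)" using u0 y1 by (intro mult_left_mono)
  ultimately have "p n + 3 * uu n \<le> (p n + 2 * (p n * yy n) + 6 * uu n) * (1 - yy n)"
    using u0 by (simp add: algebra_simps)
  then have pp2: "pp n \<le> p n + 2 * (p n * yy n) + 6 * uu n" unfolding pp using y1 by (simp add: pos_divide_le_eq)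
  have pp1: "p n \<le> pp n" unfolding pp using y0 y1 u0 elim(1) mult_nonneg_nonneg[of "p n" "yy n"] by (simp add: pos_le_divide_eq algebra_simps)
  have "p n * yy n \<le> p n * (1/20)" using elim(1) y1 by (intro mult_left_mono) auto
  then have pp3: "pp n \<le> 2 * p n" using pp2 up u0 by linarith
  have pm0: "0 \<le> pm n" "pm n \<le> p n" unfolding pm using rNp up u0 rN0 elim(1) by linarith+
  have s1: "0 \<le> lg n / sm n" using l0 s0 by simp
  have "pm n * (1 + lg n / sm n) = pm n + pm n * (lg n / sm n)" by (simp add: distrib_left)
  also have "\<dots> \<le> pm n + uu n" unfolding us using pm0 s1 by (intro add_left_mono mult_right_mono) auto
  also have "\<dots> \<le> pp n" using pp1 u0 rN0 unfolding pm by linarith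
  finally have "pm n * (1 + lg n / sm n) \<le> pp n * 1" by simp
  also have "\<dots> \<le> pp n * (1 + pm n * (lg n / sm n))" using pp1 p0 mult_nonneg_nonneg[OF pm0(1) s1] by (intro mult_left_mono) linarith+
  finally have g: "pm n * (1 + lg n / sm n) / (1 + pm n * (lg n / sm n)) \<le> pp n"
    using mult_nonneg_nonneg[OF pm0(1) s1] by (subst pos_divide_le_eq) linarith+
  have h1: "real (hh n) - 2 \<le> real (\<kappa> n)" "0 \<le> real (hh n) - 2" using elim(2,3) by linarith+
  have "rN * (real (hh n) - 2) \<le> rN * real (\<kappa> n)" "uu n * (real (hh n) - 2) \<le> uu n * real (\<kappa> n)"
    using h1 rN0 u0 by (auto intro: mult_left_mono)
  moreover have "rN * real (\<kappa> n) \<le> 1/100" "uu n * real (\<kappa> n) \<le> 1/100" using elim(3) unfolding rN_def by (simp_all add: mult_ac)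
  moreover have "pm n * (real (hh n) - 2) = p n * (real (hh n) - 2) - rN * (real (hh n) - 2) - 2 * (uu n * (real (hh n) - 2))"
    unfolding pm by (simp add: algebra_simps)
  moreover have "p n * (real (hh n) - 2) = p n * (real (k n) - real (r n) - 2)" using elim(3) by simp
  moreover have "p n * (real (k n) - real (r n) - 2) = p n * real (k n) - p n * real (r n) - 2 * p n" by (simp add: algebra_simps)
  ultimately have "p n * real (k n) - 2 \<le> pm n * (real (hh n) - 2)" using elim(1,2) by linarith
  then show ?case using N s0 u0 y0 y1 pm0 pp1 pp3 pm[unfolded rN_def] pp2 g by blast
qed

section \<open>Orders of magnitude of the failure probabilities\<close>

definition qm where "qm n = qf (hh n) (pm n)"
definition qp where "qp n = qf (hh n) (pp n)"
definition QQ where "QQ n = qf (h0 n) (pp n)"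
definition Q2 where "Q2 n = (1 - pp n) ^ (2 * hh n - LL n - 2) * (1 + 2 * real (hh n) * pp n + (2 * real (hh n) * pp n)\<^sup>2)"
definition d2 where "d2 n = (1 - pm n) ^ (hh n - 2)"

lemma O_d2: "d2 \<in> O(mon 2 (-2) (-2))"
proof (rule O_le[OF O_epk, of _ "exp 2"])
  show "\<forall>\<^sub>F n in sequentially. 0 \<le> d2 n \<and> d2 n \<le> exp 2 * exp (- (p n * real (k n)))"
    using base0 base1 base2 base3
  proof eventually_elim
    case (elim n)
    have "d2 n \<le> exp (- (pm n * real (hh n - 2)))" unfolding d2_def using elim by (intro one_minus_power_le_exp) linarith+
    also have "real (hh n - 2) = real (hh n) - 2" using elim by linarith
    also have "exp (- (pm n * (real (hh n) - 2))) \<le> exp (2 - p n * real (k n))" unfolding exp_le_cancel_iff using elim(4) by linarith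
    also have "\<dots> = exp 2 * exp (- (p n * real (k n)))" by (simp add: exp_add[symmetric])
    finally show ?case using elim unfolding d2_def by simp
  qed
qed

lemma O_qm: "qm \<in> O(mon 3 (-2) (-2))"
proof -
  have o: "(\<lambda>n. lg n * exp (- (p n * real (k n)))) \<in> O(mon 3 (-2) (-2))" by (rule O_cong[OF O_mult[OF O_lg O_epk]]) simp_all
  show ?thesis
  proof (rule O_le[OF o, of _ "4 * exp 2"])
    show "\<forall>\<^sub>F n in sequentially. 0 \<le> qm n \<and> qm n \<le> 4 * exp 2 * (lg n * exp (- (p n * real (k n))))"
      using base0 base1 base2 base3
    proof eventually_elim
      case (elim n)
      have "0 \<le> qm n" unfolding qm_def using elim by (intro qf_nonneg) linarith+
      have 1: "qm n \<le> exp (- pm n * (real (hh n) - 1)) * (1 + real (hh n) * pm n)"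
        unfolding qm_def using elim by (intro qf_le_exp) linarith+
      have "pm n * (real (hh n) - 1) = pm n * (real (hh n) - 2) + pm n" by (simp add: algebra_simps)
      then have "p n * real (k n) - 2 \<le> pm n * (real (hh n) - 1)" using elim(4) by linarith
      then have "exp (- pm n * (real (hh n) - 1)) \<le> exp (2 - p n * real (k n))" by simp
      also have "\<dots> = exp 2 * exp (- (p n * real (k n)))" by (simp add: exp_add[symmetric])
      finally have 2: "exp (- pm n * (real (hh n) - 1)) \<le> exp 2 * exp (- (p n * real (k n)))" .
      have "real (hh n) * pm n \<le> real (\<kappa> n) * p n" using elim by (intro mult_mono) auto
      then have 3: "1 + real (hh n) * pm n \<le> 4 * lg n" using elim(1,2) by (simp add: mult.commute)
      have "qm n \<le> (exp 2 * exp (- (p n * real (k n)))) * (4 * lg n)"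
        using 1 mult_mono[OF 2 3] elim by auto
      then show ?case using \<open>0 \<le> qm n\<close> by (simp add: mult_ac)
    qed
  qed
qed

lemma O_qp: "qp \<in> O(mon 3 (-2) (-2))"
proof (rule O_le[OF O_qm, of _ 1])
  show "\<forall>\<^sub>F n in sequentially. 0 \<le> qp n \<and> qp n \<le> 1 * qm n"
    using base0 base1 base2 base3
  proof eventually_elim
    case (elim n)
    have "0 \<le> qp n" unfolding qp_def using elim by (intro qf_nonneg) linarith+
    moreover have "qp n \<le> qm n" unfolding qp_def qm_def using elim by (intro qf_lipschitz(1)) linarith+
    ultimately show ?case by simp
  qed
qed

text \<open>Compared with \<open>qm\<close> the set is smaller by about \<open>LL\<close>. As p LL
  is at most 3 \<epsilon> log n, this multiplies exp (- p k) by at most n^(3 \<epsilon>) up to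
  constants.\<close>

lemma O_QQ: "QQ \<in> O(mon 3 (-2 + 3 * \<epsilon>) (-2))"
proof -
  have o: "(\<lambda>n. real n powr (3 * \<epsilon>) * (lg n * exp (- (p n * real (k n))))) \<in> O(mon 3 (-2 + 3 * \<epsilon>) (-2))"
    by (rule O_cong[OF O_mult[OF O_powr O_mult[OF O_lg O_epk]]]) simp_all
  show ?thesis
  proof (rule O_le[OF o, of _ "7 * exp 2"])
    show "\<forall>\<^sub>F n in sequentially. 0 \<le> QQ n \<and> QQ n \<le> 7 * exp 2 * (real n powr (3 * \<epsilon>) * (lg n * exp (- (p n * real (k n)))))"
      using base0 base1 base2 base3
    proof eventually_elim
      case (elim n)
      have "0 \<le> QQ n" unfolding QQ_def using elim by (intro qf_nonneg) linarith+
      have 1: "QQ n \<le> exp (- pp n * (real (h0 n) - 1)) * (1 + real (h0 n) * pp n)"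
        unfolding QQ_def using elim by (intro qf_le_exp) linarith+
      have "p n * real (LL n) \<le> p n * (\<epsilon> * real (\<kappa> n))" using elim by (intro mult_left_mono) auto
      also have "\<dots> = \<epsilon> * (p n * real (\<kappa> n))" by simp
      also have "\<dots> \<le> \<epsilon> * (3 * lg n)" using elim eps by (intro mult_left_mono) auto
      finally have a: "p n * real (LL n) \<le> 3 * \<epsilon> * lg n" by simp
      have j: "real (h0 n) - 1 = real (k n) - real (r n) - real (LL n) - 2" using elim(3) by linarith
      have "p n * (real (h0 n) - 1) = p n * real (k n) - p n * real (r n) - p n * real (LL n) - 2 * p n"
        unfolding j by (simp add: algebra_simps)
      then have b: "p n * real (k n) - 3 * \<epsilon> * lg n - 2 \<le> p n * (real (h0 n) - 1)" using a elim(1,2) by linarith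
      have "p n * (real (h0 n) - 1) \<le> pp n * (real (h0 n) - 1)" using elim by (intro mult_right_mono) linarith+
      then have "exp (- pp n * (real (h0 n) - 1)) \<le> exp (3 * \<epsilon> * lg n + 2 - p n * real (k n))" using b by simp
      also have "\<dots> = exp 2 * (real n powr (3 * \<epsilon>) * exp (- (p n * real (k n))))"
        using elim unfolding powr_def lg_def by (simp add: exp_add[symmetric])
      finally have 2: "exp (- pp n * (real (h0 n) - 1)) \<le> exp 2 * (real n powr (3 * \<epsilon>) * exp (- (p n * real (k n))))" .
      have "real (h0 n) * pp n \<le> real (\<kappa> n) * (2 * p n)" using elim by (intro mult_mono) auto
      also have "\<dots> = 2 * (p n * real (\<kappa> n))" by simp
      finally have 3: "1 + real (h0 n) * pp n \<le> 7 * lg n" using elim(1,2) by linarith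
      have "QQ n \<le> (exp 2 * (real n powr (3 * \<epsilon>) * exp (- (p n * real (k n))))) * (7 * lg n)"
        using 1 mult_mono[OF 2 3] elim by auto
      then show ?case using \<open>0 \<le> QQ n\<close> by (simp add: mult_ac)
    qed
  qed
qed

text \<open>A double failure concerns about 2 k - LL vertices. It has the order of the square of a
  single failure, again with the loss n^(3 \<epsilon>) caused by the overlap.\<close>

lemma O_Q2: "Q2 \<in> O(mon 6 (-4 + 3 * \<epsilon>) (-4))"
proof -
  have o: "(\<lambda>n. real n powr (3 * \<epsilon>) * ((lg n * exp (- (p n * real (k n)))) * (lg n * exp (- (p n * real (k n)))))) \<in> O(mon 6 (-4 + 3 * \<epsilon>) (-4))"
    by (rule O_cong[OF O_mult[OF O_powr O_mult[OF O_mult[OF O_lg O_epk] O_mult[OF O_lg O_epk]]]]) simp_all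
  show ?thesis
  proof (rule O_le[OF o, of _ "200 * exp 4"])
    show "\<forall>\<^sub>F n in sequentially. 0 \<le> Q2 n \<and> Q2 n \<le> 200 * exp 4 * (real n powr (3 * \<epsilon>) * ((lg n * exp (- (p n * real (k n)))) * (lg n * exp (- (p n * real (k n))))))"
      using base0 base1 base2 base3
    proof eventually_elim
      case (elim n)
      let ?x = "2 * real (hh n) * pp n"
      have x0: "0 \<le> ?x" using elim by simp
      have "real (hh n) * pp n \<le> real (\<kappa> n) * (2 * p n)" using elim by (intro mult_mono) auto
      then have x1: "?x \<le> 12 * lg n" using elim(2) by (simp add: mult.commute mult.left_commute)
      have "?x\<^sup>2 \<le> (12 * lg n)\<^sup>2" using x0 x1 by (intro power_mono)
      then have "?x\<^sup>2 \<le> 144 * (lg n * lg n)" by (simp add: power2_eq_square)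
      moreover have "100 * lg n \<le> lg n * lg n" using elim(1) by (intro mult_right_mono) auto
      ultimately have 3: "1 + ?x + ?x\<^sup>2 \<le> 200 * (lg n * lg n)" using x1 elim(1) by linarith
      have "0 \<le> Q2 n" unfolding Q2_def using elim x0 by (intro mult_nonneg_nonneg add_nonneg_nonneg zero_le_power) auto
      have "p n * real (LL n) \<le> p n * (\<epsilon> * real (\<kappa> n))" using elim by (intro mult_left_mono) auto
      also have "\<dots> = \<epsilon> * (p n * real (\<kappa> n))" by simp
      also have "\<dots> \<le> \<epsilon> * (3 * lg n)" using elim eps by (intro mult_left_mono) auto
      finally have a: "p n * real (LL n) \<le> 3 * \<epsilon> * lg n" by simp
      have "real (2 * hh n - LL n - 2) = 2 * real (hh n) - real (LL n) - 2" using elim by linarith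
      moreover have "real (hh n) = real (k n) - real (r n)" using elim(3) by blast
      ultimately have j: "real (2 * hh n - LL n - 2) = 2 * (real (k n) - real (r n)) - real (LL n) - 2" by (simp only:)
      have "p n * real (2 * hh n - LL n - 2) = 2 * (p n * real (k n)) - 2 * (p n * real (r n)) - p n * real (LL n) - 2 * p n"
        unfolding j by (simp add: algebra_simps)
      then have b: "2 * (p n * real (k n)) - 3 * \<epsilon> * lg n - 4 \<le> p n * real (2 * hh n - LL n - 2)" using a elim(1,2) by linarith
      have "p n * real (2 * hh n - LL n - 2) \<le> pp n * real (2 * hh n - LL n - 2)" using elim by (intro mult_right_mono) linarith+
      then have "exp (- (pp n * real (2 * hh n - LL n - 2))) \<le> exp (3 * \<epsilon> * lg n + 4 - 2 * (p n * real (k n)))" using b by simp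
      also have "\<dots> = exp 4 * (real n powr (3 * \<epsilon>) * (exp (- (p n * real (k n))) * exp (- (p n * real (k n)))))"
        using elim unfolding powr_def lg_def by (simp add: exp_add[symmetric])
      finally have "exp (- (pp n * real (2 * hh n - LL n - 2))) \<le> exp 4 * (real n powr (3 * \<epsilon>) * (exp (- (p n * real (k n))) * exp (- (p n * real (k n)))))" .
      moreover have "(1 - pp n) ^ (2 * hh n - LL n - 2) \<le> exp (- (pp n * real (2 * hh n - LL n - 2)))"
        using elim by (intro one_minus_power_le_exp) linarith+
      ultimately have 2: "(1 - pp n) ^ (2 * hh n - LL n - 2) \<le> exp 4 * (real n powr (3 * \<epsilon>) * (exp (- (p n * real (k n))) * exp (- (p n * real (k n)))))"
        by linarith
      have "Q2 n \<le> (exp 4 * (real n powr (3 * \<epsilon>) * (exp (- (p n * real (k n))) * exp (- (p n * real (k n)))))) * (200 * (lg n * lg n))"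
        unfolding Q2_def by (rule mult_mono[OF 2 3]) (use x0 in auto)
      then show ?case using \<open>0 \<le> Q2 n\<close> by (simp add: mult_ac)
    qed
  qed
qed

section \<open>The error terms of the second moment bound and their limits\<close>

definition mu where "mu n = (real (\<kappa> n))\<^sup>2 / real n"
definition smu where "smu n = real (\<kappa> n) * real n powr (-1/2)"
text \<open>The number of standard deviations sqrt \<mu> allowed around the mean overlap. A small
  power of n makes \<open>theta\<close> smaller than any power of n, and p \<mu>^(3/2) still leaves
  n^(2 \<epsilon>) to spare, of which this uses n^\<epsilon>.\<close>

definition vv where "vv n = real n powr \<epsilon>"
definition e1 where "e1 n = 2 * real n * (qm n - qp n)"
definition E1 where "E1 n = 8 * real (r n) * qp n + 4 * real n * Q2 n + 2 * real (hh n) * (2 * real (hh n) * pp n * (QQ n)\<^sup>2)"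
definition E2 where "E2 n = 2 * real (r n) * real (ff n) / (NN n - 2 * real (r n) - real (ff n))"
text \<open>The relative excess of \<open>psi\<close> over \<open>p\<close>: four times t = p + 2 f
  / N, from 1 / (1 - t) \<le> 1 + 4 t, plus the share of the common matching edges.\<close>

definition eps2 where "eps2 n = 4 * p n + 8 * (real (ff n) * (1 / NN n)) + 32 * ((real (r n))\<^sup>2 / ((p n)\<^sup>2 * real (\<kappa> n) ^ 4))"
text \<open>How far \<open>Phi\<close> can fall below p \<mu>^2 / 2: the lower-order terms of
  \<open>ff\<close> and the summand 2 r in m - 2 r.\<close>

definition e4 where "e4 n = p n * (real (\<kappa> n))\<^sup>2 * (real (\<kappa> n) + 4 * (real (r n))\<^sup>2) / (real n)\<^sup>2 + 2 * real (r n) * (real (ff n))\<^sup>2 / (NN n)\<^sup>2"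
definition e5 where "e5 n = 4 * (p n * (mu n * smu n) * vv n) + 2 * (p n * mu n * (vv n * vv n)) + p n * eps2 n * (mu n)\<^sup>2 / 2 + e4 n"
definition rho where "rho n = sqrt (exp 1 / sqrt (vv n))"
definition theta where "theta n = exp (1 - (vv n)\<^sup>2 / 800) + exp (- vv n)"
definition SS where "SS n = exp (e5 n) + 2 * rho n + (real (LL n) + 1) * theta n"
definition tau where "tau n = exp (- e1 n) - exp (- (lg n)\<^sup>2)"
definition Lam where "Lam n = exp (- ((p n - 2 * real (r n) / NN n) * ((real (\<kappa> n) + real (LL n)) / 2 - 2 * real (r n))))"

lemma tendsto_0_le:
  assumes "g \<longlonglongrightarrow> (0::real)" "\<forall>\<^sub>F n in sequentially. 0 \<le> f n \<and> f n \<le> g n"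
  shows "f \<longlonglongrightarrow> 0"
  by (rule tendsto_sandwich[OF _ _ tendsto_const assms(1)]) (rule eventually_mono[OF assms(2)], simp)+

lemma O_mu: "mu \<in> O(mon 2 (-1) (-2))"
proof (rule O_le[of "\<lambda>n. real (\<kappa> n) * real (\<kappa> n) * real n powr (-1)" _ _ _ _ 1])
  show "(\<lambda>n. real (\<kappa> n) * real (\<kappa> n) * real n powr (-1)) \<in> O(mon 2 (-1) (-2))"
    by (rule O_cong[OF O_mult[OF O_mult[OF O_kappa O_kappa] O_powr]]) simp_all
  show "\<forall>\<^sub>F n in sequentially. 0 \<le> mu n \<and> mu n \<le> 1 * (real (\<kappa> n) * real (\<kappa> n) * real n powr (-1))"
    by (rule eventually_mono[OF base0]) (simp add: mu_def powr_minus_divide power2_eq_square)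
qed

lemma O_smu: "smu \<in> O(mon 1 (-1/2) (-1))"
  unfolding smu_def by (rule O_cong[OF O_mult[OF O_kappa O_powr]]) simp_all

lemma O_vv: "vv \<in> O(mon 0 \<epsilon> 0)"
  unfolding vv_def by (rule O_powr)

lemma O_rN: "(\<lambda>n. real (r n) * (1 / NN n)) \<in> O(mon 3 (-3) (-2))"
  by (rule O_cong[OF O_mult[OF O_r O_inv_N]]) simp_all

lemma O_fN: "(\<lambda>n. real (ff n) * (1 / NN n)) \<in> O(mon 2 (-2) (-2))"
  by (rule O_cong[OF O_mult[OF O_f O_inv_N]]) simp_all

text \<open>\<open>qf_lipschitz\<close> bounds the change of \<open>qf\<close> by the density gap
  times \<kappa>^2 p (1 - pm)^(hh - 2), and the gap splits into the parts with \<open>yy\<close>,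
  \<open>uu\<close> and r / N. The part with p f / N is critical: it is of order n^(-3) p^(-4) up to
  logarithms.\<close>

lemma e1_tendsto: "e1 \<longlonglongrightarrow> 0" and e1_nonneg: "\<forall>\<^sub>F n in sequentially. 0 \<le> e1 n"
proof -
  let ?G = "\<lambda>n. real n * (real (\<kappa> n) * real (\<kappa> n)) * p n * d2 n"
  have G: "?G \<in> O(mon 4 (-1) (-3))"
    by (rule O_cong[OF O_mult[OF O_mult[OF O_mult[OF O_n O_mult[OF O_kappa O_kappa]] O_p] O_d2]]) simp_all
  have t1: "(\<lambda>n. ?G n * (p n * (real (r n) * (1 / NN n)))) \<longlonglongrightarrow> 0"
    using O_mult[OF G O_mult[OF O_p O_rN]] by (rule tz) (use eps in auto)
  have t2: "(\<lambda>n. ?G n * (p n * (real (ff n) * (1 / NN n)))) \<longlonglongrightarrow> 0"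
    using O_mult[OF G O_mult[OF O_p O_fN]] by (rule tz) (use eps in auto)
  have t3: "(\<lambda>n. ?G n * uu n) \<longlonglongrightarrow> 0" using O_mult[OF G O_uu] by (rule tz) (use eps in auto)
  have t4: "(\<lambda>n. ?G n * (real (r n) * (1 / NN n))) \<longlonglongrightarrow> 0"
    using O_mult[OF G O_rN] by (rule tz) (use eps in auto)
  let ?B = "\<lambda>n. 16 * (?G n * (p n * (real (r n) * (1 / NN n)))) + 16 * (?G n * (p n * (real (ff n) * (1 / NN n)))) + 32 * (?G n * uu n) + 4 * (?G n * (real (r n) * (1 / NN n)))"
  have "?B \<longlonglongrightarrow> 16 * 0 + 16 * 0 + 32 * 0 + 4 * 0"
    by (intro tendsto_add tendsto_mult t1 t2 t3 t4 tendsto_const)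
  then have B: "?B \<longlonglongrightarrow> 0" by simp
  have ev: "\<forall>\<^sub>F n in sequentially. 0 \<le> e1 n \<and> e1 n \<le> ?B n"
    using base0 base1 base2 base3
  proof eventually_elim
    case (elim n)
    have h: "2 \<le> hh n" using elim(2,3) by linarith
    have p1: "0 \<le> pm n" "pm n \<le> pp n" "pp n \<le> 1" using elim(1,4) by linarith+
    have d0: "0 \<le> d2 n" unfolding d2_def using p1 by simp
    have q1: "qp n \<le> qm n" and q2: "qm n - qp n \<le> (pp n - pm n) * (real (hh n) ^ 2 * pp n * (1 - pm n) ^ (hh n - 2))"
      unfolding qp_def qm_def using qf_lipschitz[OF h p1] by simp_all
    have hk: "real (hh n) \<le> real (\<kappa> n)" using elim(2,3) by linarith
    have "real (hh n) ^ 2 * pp n * (1 - pm n) ^ (hh n - 2) \<le> (real (\<kappa> n) * real (\<kappa> n)) * (2 * p n) * d2 n"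
      unfolding power2_eq_square d2_def[symmetric] using hk elim(1,4) d0 by (intro mult_mono) (auto intro: mult_mono)
    moreover have dd: "pp n - pm n \<le> 2 * (p n * yy n) + 8 * uu n + real (r n) * (1 / NN n)" using elim(4) by linarith
    moreover have "0 \<le> real (hh n) ^ 2 * pp n * (1 - pm n) ^ (hh n - 2)" using p1 by simp
    moreover have "0 \<le> 2 * (p n * yy n) + 8 * uu n + real (r n) * (1 / NN n)" using dd p1 by linarith
    ultimately have "(pp n - pm n) * (real (hh n) ^ 2 * pp n * (1 - pm n) ^ (hh n - 2))
      \<le> (2 * (p n * yy n) + 8 * uu n + real (r n) * (1 / NN n)) * ((real (\<kappa> n) * real (\<kappa> n)) * (2 * p n) * d2 n)"
      using mult_mono by blast
    then have "e1 n \<le> 2 * real n * ((2 * (p n * yy n) + 8 * uu n + real (r n) * (1 / NN n)) * ((real (\<kappa> n) * real (\<kappa> n)) * (2 * p n) * d2 n))"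
      unfolding e1_def using q2 by (intro mult_left_mono) auto
    also have "\<dots> = ?B n" unfolding yy_def by (simp add: algebra_simps)
    finally show ?case using q1 unfolding e1_def by simp
  qed
  show "e1 \<longlonglongrightarrow> 0" by (rule tendsto_0_le[OF B ev])
  show "\<forall>\<^sub>F n in sequentially. 0 \<le> e1 n" using ev by eventually_elim simp
qed

text \<open>Both r q and n Q2 are critical, of order n^(-3) p^(-4) up to logarithms, and the second
  carries n^(3 \<epsilon>) in addition. The bound on p^(-4) provides n^(-4 \<epsilon>), which
  outweighs this loss.\<close>

lemma E1_tendsto: "E1 \<longlonglongrightarrow> 0"
proof -
  have t1: "(\<lambda>n. real (r n) * qp n) \<longlonglongrightarrow> 0" using O_mult[OF O_r O_qp] by (rule tz) (use eps in auto)
  have t2: "(\<lambda>n. real n * Q2 n) \<longlonglongrightarrow> 0" using O_mult[OF O_n O_Q2] by (rule tz) (use eps in auto)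
  have t3: "(\<lambda>n. (real (\<kappa> n) * real (\<kappa> n)) * p n * (QQ n * QQ n)) \<longlonglongrightarrow> 0"
    using O_mult[OF O_mult[OF O_mult[OF O_kappa O_kappa] O_p] O_mult[OF O_QQ O_QQ]] by (rule tz) (use eps in auto)
  have "(\<lambda>n. 2 * real (hh n) * (2 * real (hh n) * pp n * (QQ n)\<^sup>2)) \<longlonglongrightarrow> 0"
  proof (rule tendsto_0_le)
    show "(\<lambda>n. 8 * ((real (\<kappa> n) * real (\<kappa> n)) * p n * (QQ n * QQ n))) \<longlonglongrightarrow> 0" using tendsto_mult_right_zero[OF t3] .
    show "\<forall>\<^sub>F n in sequentially. 0 \<le> 2 * real (hh n) * (2 * real (hh n) * pp n * (QQ n)\<^sup>2)
      \<and> 2 * real (hh n) * (2 * real (hh n) * pp n * (QQ n)\<^sup>2) \<le> 8 * ((real (\<kappa> n) * real (\<kappa> n)) * p n * (QQ n * QQ n))"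
      using base0 base1 base2 base3
    proof eventually_elim
      case (elim n)
      have hk: "real (hh n) \<le> real (\<kappa> n)" using elim(2,3) by linarith
      have "(real (hh n) * real (hh n)) * pp n \<le> (real (\<kappa> n) * real (\<kappa> n)) * (2 * p n)"
        using hk elim by (intro mult_mono) auto
      then have "4 * (((real (hh n) * real (hh n)) * pp n) * (QQ n * QQ n)) \<le> 4 * (((real (\<kappa> n) * real (\<kappa> n)) * (2 * p n)) * (QQ n * QQ n))"
        by (intro mult_left_mono mult_right_mono) auto
      moreover have "0 \<le> pp n" using elim by linarith
      ultimately show ?case by (auto simp: power2_eq_square mult_ac)
    qed
  qed
  from tendsto_add[OF tendsto_add[OF tendsto_mult_right_zero[OF t1, of 8] tendsto_mult_right_zero[OF t2, of 4]] this]
  show ?thesis unfolding E1_def by (simp add: mult.assoc)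
qed

lemma E2_tendsto: "E2 \<longlonglongrightarrow> 0"
proof (rule tendsto_0_le)
  have "(\<lambda>n. real (r n) * (real (ff n) * (1 / NN n))) \<longlonglongrightarrow> 0" using O_mult[OF O_r O_fN] by (rule tz) (use eps in auto)
  then show "(\<lambda>n. 4 * (real (r n) * (real (ff n) * (1 / NN n)))) \<longlonglongrightarrow> 0" by (rule tendsto_mult_right_zero)
  show "\<forall>\<^sub>F n in sequentially. 0 \<le> E2 n \<and> E2 n \<le> 4 * (real (r n) * (real (ff n) * (1 / NN n)))"
    using base2 base3
  proof eventually_elim
    case (elim n)
    have d: "NN n / 2 \<le> NN n - 2 * real (r n) - real (ff n)" using elim by linarith
    then have "E2 n \<le> 2 * real (r n) * real (ff n) / (NN n / 2)" unfolding E2_def using elim(2) by (intro frac_le) auto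
    moreover have "0 \<le> E2 n" unfolding E2_def using d elim(2) by (intro divide_nonneg_nonneg) auto
    ultimately show ?case by simp
  qed
qed

text \<open>The first product is p \<mu>^(3/2) v, of order n^(-3/2 + \<epsilon>) p^(-2) up to
  logarithms: the condition that p (l^2 - \<mu>^2) stays small when l deviates by v standard
  deviations. The power 12/100 in the third is what the bound on 4 p LL in
  \<open>sum_exp_le_SS\<close> requires.\<close>

lemma pmu_small: "(\<lambda>n. p n * (mu n * smu n) * vv n) \<longlonglongrightarrow> 0" "(\<lambda>n. p n * mu n * (vv n * vv n)) \<longlonglongrightarrow> 0"
  "(\<lambda>n. p n * mu n * real n powr (12/100)) \<longlonglongrightarrow> 0"
  subgoal using O_mult[OF O_mult[OF O_p O_mult[OF O_mu O_smu]] O_vv] by (rule tz) (use eps in auto)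
  subgoal using O_mult[OF O_mult[OF O_p O_mu] O_mult[OF O_vv O_vv]] by (rule tz) (use eps in auto)
  subgoal using O_mult[OF O_mult[OF O_p O_mu] O_powr] by (rule tz) (use eps in auto)
  done

lemma pe2_tendsto: "(\<lambda>n. p n * eps2 n * (mu n)\<^sup>2) \<longlonglongrightarrow> 0"
proof -
  have t1: "(\<lambda>n. (p n * mu n) * (p n * mu n)) \<longlonglongrightarrow> 0" using O_mult[OF O_mult[OF O_p O_mu] O_mult[OF O_p O_mu]] by (rule tz) (use eps in auto)
  have t2: "(\<lambda>n. p n * (mu n * mu n) * (real (ff n) * (1 / NN n))) \<longlonglongrightarrow> 0" using O_mult[OF O_mult[OF O_p O_mult[OF O_mu O_mu]] O_fN] by (rule tz) (use eps in auto)
  have t3: "(\<lambda>n. (real (r n) * real (r n)) * (1 / p n) * real n powr (-2)) \<longlonglongrightarrow> 0" using O_mult[OF O_mult[OF O_mult[OF O_r O_r] O_inv_p] O_powr] by (rule tz) (use eps in auto)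
  from tendsto_add[OF tendsto_add[OF tendsto_mult_right_zero[OF t1, of 4] tendsto_mult_right_zero[OF t2, of 8]] tendsto_mult_right_zero[OF t3, of 32]]
  have "(\<lambda>n. 4 * ((p n * mu n) * (p n * mu n)) + 8 * (p n * (mu n * mu n) * (real (ff n) * (1 / NN n))) + 32 * ((real (r n) * real (r n)) * (1 / p n) * real n powr (-2))) \<longlonglongrightarrow> 0"
    by simp
  moreover have "\<forall>\<^sub>F n in sequentially. 4 * ((p n * mu n) * (p n * mu n)) + 8 * (p n * (mu n * mu n) * (real (ff n) * (1 / NN n))) + 32 * ((real (r n) * real (r n)) * (1 / p n) * real n powr (-2))
    = p n * eps2 n * (mu n)\<^sup>2"
    using base0 base1
  proof eventually_elim
    case (elim n)
    have k0: "0 < real (\<kappa> n)" using elim(2) unfolding \<kappa>_def by simp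
    have n0: "0 < real n" using elim by simp
    have a: "mu n * mu n = real (\<kappa> n) ^ 4 / (real n * real n)" unfolding mu_def by (simp add: power2_eq_square eval_nat_numeral)
    define Z where "Z = (real (r n))\<^sup>2 / ((p n)\<^sup>2 * real (\<kappa> n) ^ 4)"
    have b: "p n * Z * (mu n * mu n) = (real (r n) * real (r n)) * (1 / p n) * real n powr (-2)"
      unfolding a Z_def using k0 elim(1) n0 by (simp add: powr_minus_divide power2_eq_square)
    have "p n * eps2 n * (mu n)\<^sup>2 = 4 * ((p n * mu n) * (p n * mu n)) + 8 * (p n * (mu n * mu n) * (real (ff n) * (1 / NN n))) + 32 * (p n * Z * (mu n * mu n))"
      unfolding eps2_def Z_def[symmetric] unfolding power2_eq_square[of "mu n"] by (simp add: algebra_simps)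
    then show ?case unfolding b by simp
  qed
  ultimately show ?thesis by (rule Lim_transform_eventually)
qed

lemma e4_tendsto: "e4 \<longlonglongrightarrow> 0"
proof -
  have t1: "(\<lambda>n. p n * (real (\<kappa> n) * real (\<kappa> n)) * real (\<kappa> n) * real n powr (-2)) \<longlonglongrightarrow> 0"
    using O_mult[OF O_mult[OF O_mult[OF O_p O_mult[OF O_kappa O_kappa]] O_kappa] O_powr] by (rule tz) (use eps in auto)
  have t2: "(\<lambda>n. p n * (real (\<kappa> n) * real (\<kappa> n)) * (real (r n) * real (r n)) * real n powr (-2)) \<longlonglongrightarrow> 0"
    using O_mult[OF O_mult[OF O_mult[OF O_p O_mult[OF O_kappa O_kappa]] O_mult[OF O_r O_r]] O_powr] by (rule tz) (use eps in auto)
  have t3: "(\<lambda>n. real (r n) * ((real (ff n) * (1 / NN n)) * (real (ff n) * (1 / NN n)))) \<longlonglongrightarrow> 0"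
    using O_mult[OF O_r O_mult[OF O_fN O_fN]] by (rule tz) (use eps in auto)
  from tendsto_add[OF tendsto_add[OF t1 tendsto_mult_right_zero[OF t2, of 4]] tendsto_mult_right_zero[OF t3, of 2]]
  have "(\<lambda>n. p n * (real (\<kappa> n) * real (\<kappa> n)) * real (\<kappa> n) * real n powr (-2) + 4 * (p n * (real (\<kappa> n) * real (\<kappa> n)) * (real (r n) * real (r n)) * real n powr (-2))
     + 2 * (real (r n) * ((real (ff n) * (1 / NN n)) * (real (ff n) * (1 / NN n))))) \<longlonglongrightarrow> 0" by simp
  moreover have "\<forall>\<^sub>F n in sequentially. p n * (real (\<kappa> n) * real (\<kappa> n)) * real (\<kappa> n) * real n powr (-2) + 4 * (p n * (real (\<kappa> n) * real (\<kappa> n)) * (real (r n) * real (r n)) * real n powr (-2))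
     + 2 * (real (r n) * ((real (ff n) * (1 / NN n)) * (real (ff n) * (1 / NN n)))) = e4 n"
    using base0
  proof eventually_elim
    case (elim n)
    then show ?case unfolding e4_def by (simp add: powr_minus_divide power2_eq_square distrib_left add_divide_distrib mult_ac)
  qed
  ultimately show ?thesis by (rule Lim_transform_eventually)
qed

lemma e5_tendsto: "e5 \<longlonglongrightarrow> 0"
proof -
  have "(\<lambda>n. p n * eps2 n * (mu n)\<^sup>2 / 2) \<longlonglongrightarrow> 0" using tendsto_divide[OF pe2_tendsto tendsto_const[of 2]] by simp
  from tendsto_add[OF tendsto_add[OF tendsto_add[OF tendsto_mult_right_zero[OF pmu_small(1), of 4] tendsto_mult_right_zero[OF pmu_small(2), of 2]] this] e4_tendsto]
  show ?thesis unfolding e5_def by simp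
qed

lemma rho_tendsto: "rho \<longlonglongrightarrow> 0"
proof -
  have "(\<lambda>n::nat. sqrt (exp 1 / sqrt (real n powr \<epsilon>))) \<longlonglongrightarrow> 0" using eps(1) by real_asymp
  then show ?thesis unfolding rho_def vv_def .
qed

lemma ntheta_tendsto: "(\<lambda>n. real n * theta n) \<longlonglongrightarrow> 0"
proof -
  have "(\<lambda>n::nat. real n * (exp (1 - (real n powr \<epsilon>)\<^sup>2 / 800) + exp (- (real n powr \<epsilon>)))) \<longlonglongrightarrow> 0" using eps(1) by real_asymp
  then show ?thesis unfolding theta_def vv_def .
qed

lemma SS_tendsto: "SS \<longlonglongrightarrow> 1"
proof -
  have "(\<lambda>n. (real (LL n) + 1) * theta n) \<longlonglongrightarrow> 0"
  proof (rule tendsto_0_le[OF ntheta_tendsto])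
    show "\<forall>\<^sub>F n in sequentially. 0 \<le> (real (LL n) + 1) * theta n \<and> (real (LL n) + 1) * theta n \<le> real n * theta n"
      using base0 base2
    proof eventually_elim
      case (elim n)
      have "0 \<le> theta n" unfolding theta_def by (intro add_nonneg_nonneg) auto
      moreover have "real (LL n) + 1 \<le> real n" using elim by linarith
      ultimately show ?case by (simp add: mult_right_mono)
    qed
  qed
  from tendsto_add[OF tendsto_add[OF tendsto_exp[OF e5_tendsto] tendsto_mult_right_zero[OF rho_tendsto, of 2]] this]
  show ?thesis unfolding SS_def by simp
qed

lemma exp_lg2: "(\<lambda>n. exp (- (lg n)\<^sup>2)) \<longlonglongrightarrow> 0"
  unfolding lg_def by real_asymp

lemma tau_tendsto: "tau \<longlonglongrightarrow> 1"
  using tendsto_diff[OF tendsto_exp[OF tendsto_minus[OF e1_tendsto]] exp_lg2] unfolding tau_def by simp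

text \<open>At overlap cut-off zero \<open>Lam\<close> would be about exp (- p k / 2), at most of
  order log n / (n p), and the product only a power of log n. The summand LL / 2 raises the exponent
  to (1 + \<epsilon>) / 2, so that an additional (n p)^(-\<epsilon>) appears.\<close>

lemma Lam_small: "(\<lambda>n. real n * real (\<kappa> n) * (p n)\<^sup>2 * Lam n) \<longlonglongrightarrow> 0"
proof (rule tendsto_0_le)
  let ?T = "\<lambda>n. real n powr (-1-\<epsilon>) * p n powr (-1-\<epsilon>) * (lg n)\<^sup>2"
  \<comment> \<open>The exponent check for the product below comes down to -\<epsilon> + (3/4 -
    \<epsilon>) \<epsilon> < 0.\<close>
  have ee: "- (\<epsilon> / 4) < \<epsilon> * \<epsilon>" using eps mult_pos_pos[OF eps(1) eps(1)] by linarith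
  have "?T \<in> O(mon 2 (-1-\<epsilon>) (-1-\<epsilon>))"
    by (rule O_I[of _ 1]) (rule eventually_mono[OF base0], simp add: mon_def lg_def mult_ac)
  from O_mult[OF O_mult[OF O_mult[OF O_n O_kappa] O_mult[OF O_p O_p]] this]
  have "(\<lambda>n. real n * real (\<kappa> n) * (p n * p n) * ?T n) \<longlonglongrightarrow> 0"
    by (rule tz) (use eps ee in \<open>simp_all add: algebra_simps\<close>)
  then show "(\<lambda>n. exp 2 * (real n * real (\<kappa> n) * (p n * p n) * ?T n)) \<longlonglongrightarrow> 0" by (rule tendsto_mult_right_zero)
  show "\<forall>\<^sub>F n in sequentially. 0 \<le> real n * real (\<kappa> n) * (p n)\<^sup>2 * Lam n \<and> real n * real (\<kappa> n) * (p n)\<^sup>2 * Lam n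
     \<le> exp 2 * (real n * real (\<kappa> n) * (p n * p n) * ?T n)"
    using base0 base1 base2 base3 exp_pk
  proof eventually_elim
    case (elim n)
    let ?rN = "real (r n) * (1 / NN n)" and ?K = "real (\<kappa> n)" and ?L = "real (LL n)"
    have rN: "0 \<le> ?rN" using elim(4) by simp
    have "(p n - 2 * q) * (x / 2 - 2 * s) = p n * x / 2 - 2 * (p n * s) - q * x + 4 * (q * s)" for q x s :: real
      by (simp add: field_simps)
    from this[of ?rN "?K + ?L" "real (r n)"] have "(p n - 2 * real (r n) / NN n) * ((?K + ?L) / 2 - 2 * real (r n))
      = p n * (?K + ?L) / 2 - 2 * (p n * real (r n)) - ?rN * (?K + ?L) + 4 * (?rN * real (r n))"
      by simp
    moreover have "100 * ?L \<le> ?K" using elim(3) by blast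
    then have "?L \<le> ?K" by linarith
    then have "?rN * (?K + ?L) \<le> ?rN * (2 * ?K)" using rN by (intro mult_left_mono) auto
    moreover note this
    moreover have "?rN * (2 * ?K) = 2 * (?K * ?rN)" by simp
    moreover have "0 \<le> ?rN * real (r n)" by (rule mult_nonneg_nonneg[OF rN]) simp
    moreover have "p n * (?K + \<epsilon> * ?K - 1) \<le> p n * (?K + ?L)" using elim(1,3) by (intro mult_left_mono) linarith+
    moreover have "p n * (?K + \<epsilon> * ?K - 1) = (1 + \<epsilon>) * (p n * ?K) - p n" by (simp add: algebra_simps)
    moreover have "(1 + \<epsilon>) * (p n * real (k n)) \<le> (1 + \<epsilon>) * (p n * ?K)" using elim(1) eps unfolding \<kappa>_def by (intro mult_left_mono) auto
    ultimately have b: "(1 + \<epsilon>) * (p n * real (k n)) / 2 - 2 \<le> (p n - 2 * real (r n) / NN n) * ((?K + ?L) / 2 - 2 * real (r n))"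
      using elim(1,2,3) by linarith
    have "Lam n \<le> exp (2 + ((1 + \<epsilon>) / 2) * (- (p n * real (k n))))" unfolding Lam_def exp_le_cancel_iff using b by (simp add: mult.commute)
    also have "\<dots> = exp 2 * exp (- (p n * real (k n))) powr ((1 + \<epsilon>) / 2)" unfolding exp_add by (simp add: powr_def)
    finally have c: "Lam n \<le> exp 2 * exp (- (p n * real (k n))) powr ((1 + \<epsilon>) / 2)" .
    have "exp (- (p n * real (k n))) powr ((1 + \<epsilon>) / 2) \<le> ((lg n / (real n * p n))\<^sup>2) powr ((1 + \<epsilon>) / 2)"
      using elim(5) eps unfolding lg_def by (intro powr_mono2) auto
    also have "\<dots> = (lg n / (real n * p n)) powr (1 + \<epsilon>)"
    proof -
      have "0 < lg n / (real n * p n)" using elim(1) by simp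
      then have "(lg n / (real n * p n))\<^sup>2 = (lg n / (real n * p n)) powr 2" by (simp add: powr_numeral)
      moreover have "2 * ((1 + \<epsilon>) / 2) = 1 + \<epsilon>" by simp
      ultimately show ?thesis by (simp only: powr_powr)
    qed
    also have "\<dots> = lg n powr (1 + \<epsilon>) * (real n powr (-1-\<epsilon>) * p n powr (-1-\<epsilon>))"
    proof -
      have "(lg n / (real n * p n)) powr (1 + \<epsilon>) = lg n powr (1 + \<epsilon>) / (real n powr (1 + \<epsilon>) * p n powr (1 + \<epsilon>))"
        using elim(1) by (simp add: powr_divide powr_mult)
      moreover have "-1-\<epsilon> = - (1 + \<epsilon>)" by simp
      ultimately show ?thesis by (simp only: powr_minus_divide) simp
    qed
    also have "\<dots> \<le> (lg n)\<^sup>2 * (real n powr (-1-\<epsilon>) * p n powr (-1-\<epsilon>))"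
    proof -
      have "lg n powr (1 + \<epsilon>) \<le> lg n powr 2" using elim(1) eps by (intro powr_mono) auto
      also have "\<dots> = (lg n)\<^sup>2" using elim(1) by (simp add: powr_numeral)
      finally show ?thesis by (intro mult_right_mono) auto
    qed
    finally have "exp (- (p n * real (k n))) powr ((1 + \<epsilon>) / 2) \<le> ?T n" by (simp add: mult_ac)
    with c have c: "Lam n \<le> exp 2 * ?T n" by (smt (verit) exp_gt_zero mult_left_mono)
    have "real n * real (\<kappa> n) * (p n)\<^sup>2 * Lam n \<le> real n * real (\<kappa> n) * (p n)\<^sup>2 * (exp 2 * ?T n)"
      using c by (intro mult_left_mono) auto
    moreover have "0 \<le> Lam n" unfolding Lam_def by simp
    moreover have "0 \<le> real n * real (\<kappa> n) * (p n)\<^sup>2 * Lam n" unfolding Lam_def by (intro mult_nonneg_nonneg) auto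
    ultimately show ?case by (simp add: power2_eq_square mult_ac)
  qed
qed

lemma rpb_small: "(\<lambda>n. real (r n) * p n * (lg n * lg n)) \<longlonglongrightarrow> 0"
  using O_mult[OF O_mult[OF O_r O_p] O_mult[OF O_lg O_lg]] by (rule tz) (use eps in auto)


definition psi where "psi n = real (m n) / (NN n - real (m n) - 2 * real (ff n)) + 32 * (real (r n))\<^sup>2 / (p n * real (\<kappa> n) ^ 4)"
definition Phi where "Phi n = (real (ff n))\<^sup>2 * (real (m n) - 2 * real (r n)) / (NN n)\<^sup>2"

text \<open>The bounds on \<open>psi\<close> and \<open>Phi\<close> contain the cancellation at the
  mean: \<open>psi\<close> exceeds \<open>p\<close> only slightly, and \<open>Phi\<close> is almost
  p \<mu>^2 / 2, because ff is close to \<kappa>^2 / 2 and N is at most n^2 / 2.\<close>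

lemma base4: "\<forall>\<^sub>F n in sequentially. 0 < real n \<and> 0 < real (\<kappa> n) \<and> 0 \<le> eps2 n \<and> eps2 n \<le> 3 \<and> 0 \<le> psi n \<and> psi n \<le> p n * (1 + eps2 n)
    \<and> 0 \<le> Phi n \<and> p n * (mu n)\<^sup>2 / 2 - e4 n \<le> Phi n \<and> 0 < mu n \<and> sqrt (mu n) = smu n \<and> smu n * smu n = mu n \<and> 1 \<le> vv n"
  using base0 base1 base2 base3
proof eventually_elim
  case (elim n)
  have n0: "0 < real n" using elim(1) by simp
  have p0: "0 < p n" "p n \<le> 1/2" using elim(1) by blast+
  have N0: "0 < NN n" using elim(4) by blast
  have k0: "0 < real (\<kappa> n)" "12 \<le> p n * real (\<kappa> n)" "1000 * real (r n) \<le> real (\<kappa> n)"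
  proof -
    show r: "1000 * real (r n) \<le> real (\<kappa> n)" using elim(2) unfolding \<kappa>_def by simp
    show "0 < real (\<kappa> n)" using elim(2) unfolding \<kappa>_def by simp
    have "p n * real (k n) \<le> p n * real (\<kappa> n)" using p0 unfolding \<kappa>_def by (intro mult_left_mono) auto
    then show "12 \<le> p n * real (\<kappa> n)" using elim(1,2) by linarith
  qed
  define Z where "Z = (real (r n))\<^sup>2 / ((p n)\<^sup>2 * real (\<kappa> n) ^ 4)"
  have Z0: "0 \<le> Z" unfolding Z_def by simp
  have "(real (r n))\<^sup>2 \<le> (real (\<kappa> n) / 1000 * 1)\<^sup>2" using k0 by (intro power_mono) auto
  also have "\<dots> \<le> (real (\<kappa> n) / 1000 * (p n * real (\<kappa> n)))\<^sup>2" using k0 by (intro power_mono mult_left_mono) auto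
  also have "\<dots> = ((p n)\<^sup>2 * real (\<kappa> n) ^ 4) / 1000000" by (simp add: power2_eq_square eval_nat_numeral)
  finally have Z1: "Z \<le> 1/1000000" unfolding Z_def using p0 k0 by (simp add: pos_divide_le_eq)
  define F where "F = real (ff n) * (1 / NN n)"
  have F0: "0 \<le> F" "F \<le> 1/100" unfolding F_def using N0 elim(3) by (auto simp: pos_divide_le_eq)
  have eps2: "eps2 n = 4 * p n + 8 * F + 32 * Z" unfolding eps2_def F_def Z_def ..
  have e: "0 \<le> eps2 n" "eps2 n \<le> 3" unfolding eps2 using p0 F0 Z0 Z1 by linarith+
  have m: "real (m n) = p n * NN n" using elim(1) by blast
  define t where "t = p n + 2 * F"
  have t: "0 \<le> t" "t \<le> 3/4" unfolding t_def using p0 F0 by linarith+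
  have D: "NN n - real (m n) - 2 * real (ff n) = NN n * (1 - t)" unfolding m t_def F_def using N0 by (simp add: algebra_simps)
  have "t * t \<le> t * (3/4)" using t by (intro mult_left_mono)
  then have "1 \<le> (1 + 4 * t) * (1 - t)" using t by (simp add: algebra_simps)
  then have "1 / (1 - t) \<le> 1 + 4 * t" using t by (simp add: pos_divide_le_eq)
  then have "p n * (1 / (1 - t)) \<le> p n * (1 + 4 * t)" using p0 by (intro mult_left_mono) auto
  moreover have "real (m n) / (NN n - real (m n) - 2 * real (ff n)) = p n * (1 / (1 - t))" unfolding D unfolding m using N0 by simp
  moreover have Zp: "32 * (real (r n))\<^sup>2 / (p n * real (\<kappa> n) ^ 4) = p n * (32 * Z)" unfolding Z_def using p0 by (simp add: power2_eq_square)
  ultimately have psi: "psi n \<le> p n * (1 + eps2 n)" unfolding psi_def eps2 t_def by (simp add: algebra_simps)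
  have psi0: "0 \<le> psi n" unfolding psi_def Zp D using p0 N0 t Z0 by (intro add_nonneg_nonneg divide_nonneg_nonneg mult_nonneg_nonneg) (simp_all add: mult_nonneg_nonneg)
  have Phi0: "0 \<le> Phi n" unfolding Phi_def using elim(3) by (intro divide_nonneg_nonneg mult_nonneg_nonneg) auto
  define x where "x = (real (\<kappa> n))\<^sup>2 / 2"
  define y where "y = (real (\<kappa> n) + 4 * (real (r n))\<^sup>2) / 2"
  have x0: "0 \<le> x" and y0: "0 \<le> y" unfolding x_def y_def by auto
  have fl: "x - y \<le> real (ff n)" unfolding x_def y_def by (rule f_lower)
  \<comment> \<open>Squaring the lower bound \<open>x - y\<close> is legitimate only when it is
    nonnegative; in the other case the left side is not positive.\<close>
  have f2: "x * x - 2 * x * y \<le> (real (ff n))\<^sup>2"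
  proof (cases "y \<le> x")
    case True
    then have "(x - y)\<^sup>2 \<le> (real (ff n))\<^sup>2" using fl by (intro power_mono) auto
    moreover have "(x - y)\<^sup>2 = x * x - 2 * x * y + y * y" by (simp add: power2_eq_square algebra_simps)
    moreover have "0 \<le> y * y" by simp
    ultimately show ?thesis by linarith
  next
    case False
    then have "x * x \<le> x * y" using x0 by (intro mult_left_mono) auto
    moreover have "0 \<le> x * y" using x0 y0 by simp
    moreover have "0 \<le> (real (ff n))\<^sup>2" by simp
    ultimately show ?thesis by linarith
  qed
  have "p n * (mu n)\<^sup>2 / 2 - p n * (real (\<kappa> n))\<^sup>2 * (real (\<kappa> n) + 4 * (real (r n))\<^sup>2) / (real n)\<^sup>2
    = p n * (x * x - 2 * x * y) * (2 / (real n)\<^sup>2)"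
    unfolding mu_def x_def y_def using n0 by (simp add: power2_eq_square field_simps)
  also have "\<dots> \<le> p n * (real (ff n))\<^sup>2 * (2 / (real n)\<^sup>2)" using f2 p0 by (intro mult_right_mono mult_left_mono) auto
  also have "\<dots> \<le> p n * (real (ff n))\<^sup>2 * (1 / NN n)"
  proof -
    have "2 / (real n)\<^sup>2 \<le> 1 / NN n" using elim(1) N0 n0 by (intro frac_le_cross) auto
    then show ?thesis using p0 by (intro mult_left_mono) auto
  qed
  finally have "p n * (mu n)\<^sup>2 / 2 - e4 n \<le> p n * (real (ff n))\<^sup>2 * (1 / NN n) - 2 * real (r n) * (real (ff n))\<^sup>2 / (NN n)\<^sup>2"
    unfolding e4_def by linarith
  also have "\<dots> = Phi n" unfolding Phi_def m using N0 by (simp add: power2_eq_square field_simps)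
  finally have Phi: "p n * (mu n)\<^sup>2 / 2 - e4 n \<le> Phi n" .
  have mu0: "0 < mu n" unfolding mu_def using k0 n0 by simp
  have smu: "smu n = real (\<kappa> n) / sqrt (real n)" unfolding smu_def using n0 by (simp add: powr_minus_divide powr_half_sqrt)
  have s1: "sqrt (mu n) = smu n" unfolding smu mu_def by (simp add: real_sqrt_divide)
  have s2: "smu n * smu n = mu n" unfolding s1[symmetric] using mu0 by simp
  have v: "1 \<le> vv n" unfolding vv_def using elim(1) eps by (intro ge_one_powr_ge_zero) auto
  show ?case using n0 k0 e psi psi0 Phi0 Phi mu0 s1 s2 v by blast
qed

lemma sum_exp_le_SS: "\<forall>\<^sub>F n in sequentially.
  (\<Sum>l\<le>LL n. real (\<kappa> n choose l) * real ((n - \<kappa> n) choose (\<kappa> n - l)) * exp (psi n * (real l)\<^sup>2 / 2 - Phi n)) \<le> real (n choose \<kappa> n) * SS n"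
  using base0 base1 base2 base4 tz_le[OF e4_tendsto, of "1/2", simplified] tz_le[OF pe2_tendsto, of "1/10000", simplified]
    tz_le[OF pmu_small(1), of "1/40800", simplified] tz_le[OF pmu_small(3), of "1 / (2 * exp 1)", simplified] tz_le[OF rho_tendsto, of "1/2", simplified]
proof eventually_elim
  case (elim n)
  have p0: "0 < p n" using elim(1) by blast
  have b: "0 < real n" "0 < real (\<kappa> n)" "0 \<le> eps2 n" "eps2 n \<le> 3" "0 \<le> psi n" "psi n \<le> p n * (1 + eps2 n)"
    "0 \<le> Phi n" "p n * (mu n)\<^sup>2 / 2 - e4 n \<le> Phi n" "0 < mu n" "sqrt (mu n) = smu n" "smu n * smu n = mu n" "1 \<le> vv n"
    using elim(4) by blast+
  have s0: "0 \<le> smu n" unfolding b(10)[symmetric] using b(9) by simp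
  have c: "\<kappa> n \<le> n" "0 < \<kappa> n" "LL n \<le> \<kappa> n"
  proof -
    have "100 * real (\<kappa> n) \<le> real n" "100 * real (LL n) \<le> real (\<kappa> n)" using elim(3) by blast+
    then show "\<kappa> n \<le> n" "0 < \<kappa> n" "LL n \<le> \<kappa> n" using b(2) by linarith+
  qed
  have psi4: "psi n \<le> 4 * p n"
  proof -
    have "p n * (1 + eps2 n) \<le> p n * 4" using p0 b(4) by (intro mult_left_mono) auto
    then show ?thesis using b(6) by linarith
  qed
  have a1: "psi n * (mu n + sqrt (mu n) * vv n)\<^sup>2 / 2 - Phi n \<le> e5 n"
  proof -
    have sq: "(mu n + smu n * vv n)\<^sup>2 = (mu n)\<^sup>2 + (2 * (mu n * smu n * vv n) + mu n * (vv n * vv n))"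
    proof -
      have "(mu n + smu n * vv n)\<^sup>2 = (mu n)\<^sup>2 + (2 * (mu n * smu n * vv n) + (smu n * smu n) * (vv n * vv n))"
        by (simp add: power2_eq_square algebra_simps)
      then show ?thesis unfolding b(11) .
    qed
    let ?X = "2 * (mu n * smu n * vv n) + mu n * (vv n * vv n)"
    have X0: "0 \<le> ?X" using b s0 by simp
    have "psi n * (mu n)\<^sup>2 \<le> p n * (1 + eps2 n) * (mu n)\<^sup>2" using b(6) by (intro mult_right_mono) auto
    moreover have "psi n * ?X \<le> 4 * p n * ?X" using psi4 X0 by (rule mult_right_mono)
    moreover have "psi n * (mu n + sqrt (mu n) * vv n)\<^sup>2 = psi n * (mu n)\<^sup>2 + psi n * ?X" unfolding b(10) sq by (rule distrib_left)
    moreover have "p n * (1 + eps2 n) * (mu n)\<^sup>2 = p n * (mu n)\<^sup>2 + p n * eps2 n * (mu n)\<^sup>2" by (simp add: algebra_simps)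
    moreover have "4 * p n * ?X = 8 * (p n * (mu n * smu n) * vv n) + 4 * (p n * mu n * (vv n * vv n))" by (simp add: algebra_simps)
    ultimately show ?thesis unfolding e5_def using b(8) by linarith
  qed
  have a2: "p n * (mu n)\<^sup>2 / 2 - 1/2 \<le> Phi n" using b(8) elim(5) by linarith
  have a2': "10000 * p n * eps2 n * (mu n)\<^sup>2 \<le> 1" using elim(6) by simp
  have a3: "40800 * p n * mu n * sqrt (mu n) \<le> vv n"
  proof -
    have "0 \<le> p n * (mu n * smu n)" using p0 b s0 by simp
    then have "p n * (mu n * smu n) * 1 \<le> p n * (mu n * smu n) * vv n" using b(12) by (intro mult_left_mono)
    then have "40800 * (p n * (mu n * smu n)) \<le> 1" using elim(7) by linarith
    then show ?thesis unfolding b(10) using b(12) by (simp add: mult.assoc)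
  qed
  have a4: "exp (1 - (vv n)\<^sup>2 / 800) \<le> theta n" "exp (- vv n) \<le> theta n" unfolding theta_def by auto
  have a5: "exp 1 / sqrt (vv n) \<le> (rho n)\<^sup>2" "0 \<le> rho n" "rho n \<le> 1/2" using elim(9) b(12) unfolding rho_def by auto
  \<comment> \<open>LL is at most \<kappa> / 100 and p \<kappa> at most 3 log n, so 4 p LL is at
    most 12/100 log n.\<close>
  have a6: "4 * p n * real (LL n) \<le> ln (1 / (2 * exp 1 * p n * mu n))"
  proof -
    have x0: "0 < 2 * exp 1 * p n * mu n" using p0 b(9) by simp
    have "p n * mu n * real n powr (12/100) \<le> 1 / (2 * exp 1)" using elim(8) by simp
    then have "2 * exp 1 * p n * mu n * real n powr (12/100) \<le> 1" by (simp add: field_simps)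
    then have "real n powr (12/100) \<le> 1 / (2 * exp 1 * p n * mu n)" using x0 by (simp add: pos_le_divide_eq mult.commute)
    then have "ln (real n powr (12/100)) \<le> ln (1 / (2 * exp 1 * p n * mu n))" using b(1) by (intro ln_mono) auto
    moreover have "ln (real n powr (12/100)) = 12/100 * lg n" unfolding lg_def using b(1) by (simp add: ln_powr)
    moreover have "p n * (100 * real (LL n)) \<le> p n * real (\<kappa> n)" using elim(3) p0 by (intro mult_left_mono) auto
    ultimately show ?thesis using elim(2) by linarith
  qed
  show ?case unfolding SS_def
    by (rule hyper_sum[of "\<kappa> n" n "LL n" "p n" "psi n" "Phi n" "vv n" "e5 n" "eps2 n" "theta n" "rho n", folded mu_def,
        OF c p0 b(5) psi4 b(7) b(12) a1 b(6) b(3) a2 a2' a3 a4 a5 a6])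
qed

lemma variance_bound: "\<exists>\<eta>. \<eta> \<longlonglongrightarrow> (0::real) \<and> (\<forall>\<^sub>F n in sequentially.
  VarX n (m n) (k n) (r n) \<le> \<eta> n * (EX_X n (m n) (k n) (r n))\<^sup>2 + 16 * EX_X n (m n) (k n) (r n))"
proof (intro exI conjI)
  let ?\<eta> = "\<lambda>n. exp (E1 n + E2 n) * SS n / ((1 - exp (- (lg n)\<^sup>2)) * (tau n)\<^sup>2) - 1"
  have "?\<eta> \<longlonglongrightarrow> exp (0 + 0) * 1 / ((1 - 0) * 1\<^sup>2) - 1"
    by (intro tendsto_intros E1_tendsto E2_tendsto SS_tendsto exp_lg2 tau_tendsto) auto
  then show "?\<eta> \<longlonglongrightarrow> 0" by simp
  have qm0: "qm \<longlonglongrightarrow> 0" by (rule tz[OF O_qm]) (use eps in auto)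
  have QQ0: "QQ \<longlonglongrightarrow> 0" by (rule tz[OF O_QQ]) (use eps in auto)
  have tau1: "\<forall>\<^sub>F n in sequentially. 1/2 < tau n" by (rule order_tendstoD(1)[OF tau_tendsto]) simp
  show "\<forall>\<^sub>F n in sequentially. VarX n (m n) (k n) (r n) \<le> ?\<eta> n * (EX_X n (m n) (k n) (r n))\<^sup>2 + 16 * EX_X n (m n) (k n) (r n)"
    using base0 base1 base2 base3 sum_exp_le_SS tau1 tz_le[OF qm0, of "1/2", simplified] tz_le[OF QQ0, of "1/2", simplified]
      tz_le[OF exp_lg2, of "1/2", simplified] tz_le[OF rpb_small, of "1 / (192 * exp 4 * 144)", simplified]
      tz_le[OF Lam_small, of "1 / (64 * exp 4)", simplified]
  proof eventually_elim
    case (elim n)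
    have p0: "0 < p n" "p n \<le> 1/2" and m: "real (m n) = p n * NN n" and l: "100 \<le> lg n" using elim(1) by blast+
    have N0: "0 < NN n" and pm: "0 \<le> pm n" "pm n \<le> p n" "p n \<le> pp n" "pp n \<le> 2 * p n" and s0: "0 < sm n"
      and pmp: "pm n * (1 + lg n / sm n) / (1 + pm n * (lg n / sm n)) \<le> pp n" using elim(4) by blast+
    have k: "1000 * real (r n) \<le> real (k n)" "20 \<le> real (k n)" "p n * real (\<kappa> n) \<le> 3 * lg n" using elim(2) by blast+
    have c: "100 * real (ff n) \<le> NN n" "100 * real (r n) \<le> NN n" "100 * real (r n) \<le> real (m n)" "100 * lg n \<le> sm n"
      "100 * real (\<kappa> n) \<le> real n" "100 * real (LL n) \<le> real (\<kappa> n)" "real (hh n) = real (k n) - real (r n)"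
      "real (h0 n) = real (\<kappa> n) - real (LL n) - 2 * real (r n) - 1" "real (k n) + real (r n) = real (\<kappa> n)" using elim(3) by blast+
    have mN: "real (m n) \<le> NN n / 2" unfolding m using p0 N0 by (simp add: mult_right_mono)
    have m0: "0 < real (m n)" unfolding m using p0 N0 by simp
    have g1: "4 * r n \<le> \<kappa> n" "\<kappa> n \<le> n" "0 < \<kappa> n" "LL n < \<kappa> n" "h0 n + 1 + 2 * r n + LL n \<le> \<kappa> n" "2 + LL n \<le> 2 * hh n" "2 \<le> hh n"
      using k c by linarith+
    have g2: "m n + 2 * ff n < n choose 2" "4 * r n \<le> m n" "0 < m n" "4 * r n + 2 * ff n \<le> n choose 2"
    proof -
      have "real (m n + 2 * ff n) < real (n choose 2)" "real (4 * r n + 2 * ff n) \<le> real (n choose 2)"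
        unfolding NN_def[symmetric] of_nat_add of_nat_mult of_nat_numeral using c mN N0 by linarith+
      then show "m n + 2 * ff n < n choose 2" "4 * r n + 2 * ff n \<le> n choose 2" by (simp_all only: of_nat_less_iff of_nat_le_iff)
      show "4 * r n \<le> m n" "0 < m n" using c m0 by linarith+
    qed
    have g3: "0 < lg n" "lg n \<le> sm n / 2" using l c by linarith+
    have g4: "pm n \<le> pp n" "pp n \<le> 1" using pm p0 by linarith+
    have g4': "pm n * NN n \<le> real (m n) - real (r n) - 2 * lg n * sm n" unfolding pm_def using N0 by simp
    have D: "NN n - 2 * real (r n) - 2 * real (ff n) > 0" using c N0 by linarith
    have g4'': "real (m n) + 3 * lg n * sm n \<le> pp n * (NN n - 2 * real (r n) - 2 * real (ff n))" unfolding pp_def using D by simp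
    have g10: "1 \<le> 12 * lg n" "4 * real (\<kappa> n) * p n \<le> 12 * lg n" using l k by (simp_all add: mult.commute)
    have g10': "192 * exp 4 * real (r n) * p n * (12 * lg n)\<^sup>2 \<le> 1"
    proof -
      have "real (r n) * p n * (lg n * lg n) \<le> 1 / (192 * exp 4 * 144)" using elim(10) by simp
      then have "(192 * exp 4 * 144) * (real (r n) * p n * (lg n * lg n)) \<le> 1" by (simp add: pos_le_divide_eq mult.commute)
      then show ?thesis by (simp add: power2_eq_square mult_ac)
    qed
    have g10'': "64 * exp 4 * real n * real (\<kappa> n) * (p n)\<^sup>2 * Lam n \<le> 1"
    proof -
      have "real n * real (\<kappa> n) * (p n)\<^sup>2 * Lam n \<le> 1 / (64 * exp 4)" using elim(11) by simp
      then have "(64 * exp 4) * (real n * real (\<kappa> n) * (p n)\<^sup>2 * Lam n) \<le> 1" by (simp add: pos_le_divide_eq mult.commute)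
      then show ?thesis by (simp add: mult_ac)
    qed
    have "2 * real (r n) \<le> p n * NN n" using c m by linarith
    then have g10''': "2 * real (r n) / NN n \<le> p n" using N0 by (simp add: pos_divide_le_eq)
    \<comment> \<open>The instance takes \<open>w = lg n\<close>, which makes
      \<open>exp (- w\<^sup>2)\<close> smaller than any power of n while the densities shift only by
      a logarithmic factor times a standard deviation, and \<open>\<beta> = 12 * lg n\<close>, an
      upper bound for 4 \<kappa> p.\<close>
    note SM = second_moment_bound[where m = "m n" and k = "k n" and r = "r n" and n = n,
      folded ff_def, folded p_def, folded NN_def \<kappa>_def hh_def sm_def, folded psi_def Phi_def]
    show ?case unfolding tau_def
      by (rule SM[of "LL n" "h0 n" "lg n" "pm n" "pp n" "e1 n" "E1 n" "E2 n" "SS n" "12 * lg n",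
        OF g1 g2 g3 pm(1) g4 g4' pmp g4'' pm(4)])
        (use elim(5-9) g10 g10' g10'' g10''' in \<open>simp_all add: qm_def qp_def QQ_def Q2_def e1_def E1_def E2_def tau_def Lam_def\<close>)
  qed
qed

end

section \<open>The first moment for density at least 1/2\<close>

lemma one_minus_le_exp_square:
  fixes x :: real
  assumes "0 \<le> x" "x \<le> 1"
  shows "1 - x \<le> exp (- (x + x\<^sup>2 / 4))"
proof -
  have "(1 - x / 2)\<^sup>2 \<le> (exp (- (x / 2)))\<^sup>2" using assms exp_ge_add_one_self[of "- (x / 2)"] by (intro power_mono) auto
  also have "\<dots> = exp (- x)" by (simp add: power2_eq_square exp_add[symmetric])
  finally have "1 - x + x\<^sup>2 / 4 \<le> exp (- x)" by (simp add: power2_eq_square algebra_simps)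
  moreover have "exp (- x) * (x\<^sup>2 / 4) \<le> 1 * (x\<^sup>2 / 4)" using assms by (intro mult_right_mono) auto
  ultimately have "1 - x \<le> exp (- x) * (1 + - (x\<^sup>2 / 4))" by (simp add: algebra_simps)
  also have "\<dots> \<le> exp (- x) * exp (- (x\<^sup>2 / 4))" by (intro mult_left_mono exp_ge_add_one_self) auto
  also have "\<dots> = exp (- (x + x\<^sup>2 / 4))" by (simp add: exp_add[symmetric])
  finally show ?thesis .
qed

lemma EX_X_no_matching_le:
  assumes m: "m \<le> n choose 2" and N: "0 < n choose 2"
  shows "EX_X n m k 0 \<le> real n ^ k * (1 - real m / real (n choose 2)) ^ (k choose 2)"
proof -
  let ?N = "n choose 2" and ?B = "(1 - real m / real (n choose 2)) ^ (k choose 2)"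
  have P: "Pr n m (good n (fst c) (snd c)) \<le> ?B" if c: "c \<in> configs n k 0" for c
  proof -
    obtain K M where KM: "c = (K, M)" by (cases c)
    have cfg: "(K, M) \<in> configs n k 0" using c KM by simp
    have s: "{G \<in> graphs_nm n m. good n K M G} \<subseteq> {G. G \<subseteq> all_edges n - forb K M \<and> card G = m}"
      using good_iff[OF cfg] unfolding graphs_nm_def by auto
    have "finite (Pow (all_edges n))" by simp
    then have "finite {G. G \<subseteq> all_edges n - forb K M \<and> card G = m}" by (rule rev_finite_subset) blast
    from card_mono[OF this s] have "card {G \<in> graphs_nm n m. good n K M G} \<le> card {G. G \<subseteq> all_edges n - forb K M \<and> card G = m}" .
    also have "\<dots> = card (all_edges n - forb K M) choose m" by (intro n_subsets) simp
    also have "card (all_edges n - forb K M) = ?N - (k choose 2)"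
      using cfg_edges(2)[OF cfg] cfg_finite_forb[OF cfg] cfg_forb_card[OF cfg] by (simp add: card_Diff_subset binomial_eq_0)
    finally have "card {G \<in> graphs_nm n m. good n K M G} \<le> (?N - (k choose 2)) choose m" .
    then have "Pr n m (good n K M) \<le> cc ?N m 0 (k choose 2)"
      unfolding Pr_def cc_def card_graphs by (intro divide_right_mono) auto
    also have "\<dots> \<le> ?B" by (rule cc_0_upper[OF m N])
    finally show ?thesis unfolding KM by simp
  qed
  have "EX_X n m k 0 \<le> (\<Sum>c\<in>configs n k 0. ?B)" unfolding EX_eq[OF m] by (intro sum_mono P)
  also have "\<dots> = real (n choose k) * ?B" using card_configs[of n k 0] by simp
  also have "\<dots> \<le> real n ^ k * ?B"
  proof (rule mult_right_mono)
    have "n choose k \<le> n ^ k"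
    proof (cases "k \<le> n")
      case True
      then show ?thesis by (rule binomial_le_pow)
    next
      case False
      then show ?thesis by (simp add: binomial_eq_0)
    qed
    then show "real (n choose k) \<le> real n ^ k" by (metis of_nat_le_iff of_nat_power)
  qed (use m N in simp)
  finally show ?thesis .
qed

text \<open>For p at least 1/2 the quadratic term of log (1 - p) improves exp (- p) to exp (- 9 p /
  8). A k-set is then independent with probability at most exp (- 9/16 p k (k - 1)), and n^k choices
  do not compensate once p (k - 1) is at least 16/9 log n.\<close>

lemma EX_X_dense_le_1:
  assumes m: "m \<le> n choose 2" and N: "0 < n choose 2" and p: "p = real m / real (n choose 2)" "1/2 \<le> p"
    and k: "16/9 * ln (real n) \<le> p * (real k - 1)" and n: "0 < n"
  shows "EX_X n m k 0 \<le> 1"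
proof -
  have p1: "p \<le> 1" unfolding p using m N by simp
  have "p * (1/2) \<le> p * p" using p by (intro mult_left_mono) auto
  then have "9/8 * p \<le> p + p\<^sup>2 / 4" unfolding power2_eq_square by simp
  then have "exp (- (p + p\<^sup>2 / 4)) \<le> exp (- (9/8 * p))" by simp
  moreover have "1 - p \<le> exp (- (p + p\<^sup>2 / 4))" using p p1 by (intro one_minus_le_exp_square) linarith+
  ultimately have "1 - p \<le> exp (- (9/8 * p))" by linarith
  then have "(1 - p) ^ (k choose 2) \<le> exp (- (9/8 * p)) ^ (k choose 2)" using p1 by (intro power_mono) auto
  also have "\<dots> = exp (real (k choose 2) * - (9/8 * p))" by (rule exp_of_nat_mult[symmetric])
  finally have 1: "(1 - p) ^ (k choose 2) \<le> exp (real (k choose 2) * - (9/8 * p))" .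
  have 2: "real n ^ k = exp (real k * ln (real n))" using n by (simp add: exp_of_nat_mult)
  have "EX_X n m k 0 \<le> real n ^ k * (1 - p) ^ (k choose 2)" unfolding p by (rule EX_X_no_matching_le[OF m N])
  also have "\<dots> \<le> real n ^ k * exp (real (k choose 2) * - (9/8 * p))" using 1 by (intro mult_left_mono) auto
  also have "\<dots> = exp (real k * (ln (real n) - 9/16 * (p * (real k - 1))))"
    unfolding 2 exp_add[symmetric] choose_two_real by (simp add: algebra_simps)
  also have "\<dots> \<le> exp 0" unfolding exp_le_cancel_iff using k by (intro mult_nonneg_nonpos) auto
  finally show ?thesis by simp
qed

theorem theorem1p2:
  fixes \<epsilon> :: real and m k r :: "nat \<Rightarrow> nat" and p :: "nat \<Rightarrow> real"
  assumes eps: "\<epsilon> > 0"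
    and m_range: "\<forall>\<^sub>F n in sequentially.
                    real n powr (5/4 + \<epsilon>) < real (m n) \<and> real (m n) < real n powr (4/3 + \<epsilon>)"
    and m_le: "\<forall>\<^sub>F n in sequentially. m n \<le> n choose 2"
    and p_def: "\<And>n. p n = real (m n) / real (n choose 2)"
    and star: "\<exists>a :: nat \<Rightarrow> real. a \<longlonglongrightarrow> 0 \<and>
                 (\<forall>\<^sub>F n in sequentially. real (k n) = 2 / p n *
                    (ln (real n * p n) - ln (ln (real n * p n)) + ln (exp 1 / 2) + a n))"
    and r_bound: "(\<lambda>n. real (r n)) \<in> O(\<lambda>n. (ln (real n)) ^ 3 / (real n * (p n)\<^sup>2))"
    and EX_inf: "filterlim (\<lambda>n. EX_X n (m n) (k n) (r n)) at_top sequentially"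
  shows "(\<lambda>n. VarX n (m n) (k n) (r n)) \<in> o(\<lambda>n. (EX_X n (m n) (k n) (r n))\<^sup>2)"
proof -
  \<comment> \<open>A smaller exponent weakens the lower bound on \<open>p\<close>, so
    \<open>\<epsilon>\<close> may be capped at the value that \<open>regime\<close> asks
    for.\<close>
  define \<epsilon>' where "\<epsilon>' = min \<epsilon> (1/100)"
  have e': "0 < \<epsilon>'" "\<epsilon>' \<le> 1/100" "\<epsilon>' \<le> \<epsilon>" unfolding \<epsilon>'_def using eps by auto
  obtain a where a: "a \<longlonglongrightarrow> 0" and k: "\<forall>\<^sub>F n in sequentially. real (k n) = 2 / p n *
      (ln (real n * p n) - ln (ln (real n * p n)) + ln (exp 1 / 2) + a n)" using star by blast
  obtain C where C: "\<forall>\<^sub>F n in sequentially. norm (real (r n)) \<le> C * norm (ln (real n) ^ 3 / (real n * (p n)\<^sup>2))"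
    using landau_o.bigE[OF r_bound] by blast
  have N: "0 < real (n choose 2)" "real (n choose 2) \<le> real n ^ 2" if "2 \<le> n" for n
    using that unfolding choose_two_real by (auto simp: power2_eq_square algebra_simps)
  have p_lower: "\<forall>\<^sub>F n in sequentially. real n powr (-3/4 + \<epsilon>') \<le> p n"
    using m_range eventually_ge_at_top[of 2]
  proof eventually_elim
    case (elim n)
    have "real n powr (-3/4 + \<epsilon>') = real n powr (5/4 + \<epsilon>') / real n ^ 2"
      using elim(2) by (simp add: powr_diff[symmetric] powr_numeral[symmetric] del: powr_numeral)
    also have "\<dots> \<le> real (m n) / real n ^ 2"
    proof (rule divide_right_mono)
      have "real n powr (5/4 + \<epsilon>') \<le> real n powr (5/4 + \<epsilon>)" using elim(2) e' by (intro powr_mono) auto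
      then show "real n powr (5/4 + \<epsilon>') \<le> real (m n)" using elim(1) by linarith
    qed simp
    also have "\<dots> \<le> p n" unfolding p_def[of n] using N[OF elim(2)] by (intro divide_left_mono) auto
    finally show ?case .
  qed
  have x_ev: "\<forall>\<^sub>F n in sequentially. 2 \<le> n \<and> 0 < p n \<and> p n \<le> 1 \<and> ln (real n) / 4 \<le> ln (real n * p n) \<and> ln (real n * p n) \<le> ln (real n)
      \<and> 2 \<le> ln (ln (real n * p n)) \<and> - (1/10) \<le> a n \<and> a n \<le> 1/10"
  proof -
    have 1: "\<forall>\<^sub>F n::nat in sequentially. 2 \<le> ln (ln (real n) / 4)" by real_asymp
    have 2: "\<forall>\<^sub>F n in sequentially. - (1/10) < a n" "\<forall>\<^sub>F n in sequentially. a n < 1/10"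
      by (rule order_tendstoD[OF a], simp)+
    show ?thesis using 1 p_lower m_le eventually_ge_at_top[of 2] 2
    proof eventually_elim
      case (elim n)
      have n: "0 < real n" "1 < real n" using elim(4) by auto
      have p0: "0 < p n" using elim(2) n by (smt (verit) powr_gt_zero)
      have p1: "p n \<le> 1" unfolding p_def[of n] using elim(3) N[OF elim(4)] by simp
      have "real n powr (1/4) = real n * real n powr (-3/4)" using n by (simp add: powr_mult_base)
      also have "\<dots> \<le> real n * real n powr (-3/4 + \<epsilon>')" using n e' by (intro mult_left_mono powr_mono) auto
      also have "\<dots> \<le> real n * p n" using elim(2) n by (intro mult_left_mono) auto
      finally have "ln (real n powr (1/4)) \<le> ln (real n * p n)" using n by (intro ln_mono) auto
      then have x: "ln (real n) / 4 \<le> ln (real n * p n)" using n by (simp add: ln_powr)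
      have "real n * p n \<le> real n" using n p1 by simp
      then have x2: "ln (real n * p n) \<le> ln (real n)" using n p0 by (intro ln_mono) auto
      have "ln (ln (real n) / 4) \<le> ln (ln (real n * p n))" using x n by (intro ln_mono) auto
      then show ?case using elim p0 p1 x x2 by linarith
    qed
  qed
  have pk: "\<forall>\<^sub>F n in sequentially. p n * real (k n) = 2 * (ln (real n * p n) - ln (ln (real n * p n)) + (1 - ln 2) + a n)"
    using k x_ev
  proof eventually_elim
    case (elim n)
    then show ?case by (simp add: ln_div)
  qed
  have l2: "ln 2 \<le> (25/36 :: real)" "0 \<le> ln (2::real)" using ln2_le_25_over_36 by auto
  \<comment> \<open>For large \<epsilon> the range of \<open>m\<close> admits densities close to 1.
    These are excluded by the diverging first moment: at density above 1/2 the bound on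
    \<open>r\<close> tends to 0, so \<open>r = 0\<close>, and then the expectation would be at most
    1.\<close>
  have p_half: "\<forall>\<^sub>F n in sequentially. p n \<le> 1/2"
  proof -
    have 1: "\<forall>\<^sub>F n::nat in sequentially. 4 * \<bar>C\<bar> * (ln (real n) ^ 3 / real n) < 1" by real_asymp
    have 2: "\<forall>\<^sub>F n::nat in sequentially. 16/9 * ln (real n) \<le> 2 * (ln (real n / 2) - ln (ln (real n)) - 1) - 1" by real_asymp
    have 3: "\<forall>\<^sub>F n in sequentially. 1 < EX_X n (m n) (k n) (r n)" using EX_inf by (simp add: filterlim_at_top_dense)
    show ?thesis using 1 2 3 x_ev pk C m_le
    proof eventually_elim
      case (elim n)
      show ?case
      proof (rule ccontr)
        assume "\<not> p n \<le> 1/2"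
        then have ph: "1/2 < p n" by simp
        have n: "2 \<le> n" "1 < real n" and p1: "p n \<le> 1" using elim(4) by auto
        have "1/4 \<le> (p n)\<^sup>2" using ph power_mono[of "1/2" "p n" 2] by (simp add: power2_eq_square)
        then have "real n * (1/4) \<le> real n * (p n)\<^sup>2" by (intro mult_left_mono) auto
        then have "ln (real n) ^ 3 / (real n * (p n)\<^sup>2) \<le> ln (real n) ^ 3 / (real n * (1/4))" using n by (intro frac_le) auto
        then have Cl: "\<bar>C\<bar> * (ln (real n) ^ 3 / (real n * (p n)\<^sup>2)) \<le> \<bar>C\<bar> * (ln (real n) ^ 3 / (real n * (1/4)))" by (intro mult_left_mono) auto
        have "real (r n) \<le> \<bar>C\<bar> * (ln (real n) ^ 3 / (real n * (p n)\<^sup>2))"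
        proof -
          have nn: "0 \<le> ln (real n) ^ 3 / (real n * (p n)\<^sup>2)" using n by simp
          then have "real (r n) \<le> C * (ln (real n) ^ 3 / (real n * (p n)\<^sup>2))" using elim(6) n by simp
          also have "\<dots> \<le> \<bar>C\<bar> * (ln (real n) ^ 3 / (real n * (p n)\<^sup>2))" using nn by (intro mult_right_mono) auto
          finally show ?thesis .
        qed
        also note Cl
        also have "\<bar>C\<bar> * (ln (real n) ^ 3 / (real n * (1/4))) = 4 * \<bar>C\<bar> * (ln (real n) ^ 3 / real n)" by simp
        also note elim(1)
        finally have "real (r n) < 1" .
        then have r0: "r n = 0" by simp
        have "0 < ln (real n)" using n by simp
        then have x0: "0 < ln (real n * p n)" using elim(4) by linarith
        have "ln (real n / 2) \<le> ln (real n * p n)" using n ph by (intro ln_mono) auto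
        moreover have "ln (ln (real n * p n)) \<le> ln (ln (real n))" using elim(4) x0 by (intro ln_mono) auto
        moreover have "- (1/10) \<le> a n" using elim(4) by blast
        \<comment> \<open>p k is nearly 2 log n at such densities, and 16/9 is below 2.\<close>
        ultimately have "16/9 * ln (real n) \<le> p n * (real (k n) - 1)"
          using elim(2,5) p1 l2 by (simp add: right_diff_distrib)
        then have "EX_X n (m n) (k n) 0 \<le> 1"
          using EX_X_dense_le_1[of "m n" n "p n" "k n"] elim(7) N(1)[OF n(1)] p_def[of n] ph n by simp
        then show False using elim(3) r0 by simp
      qed
    qed
  qed
  interpret regime \<epsilon>' C m k r p
  proof
    show "\<forall>\<^sub>F n in sequentially. p n * real (k n) \<le> 2 * ln (real n)"
      using x_ev pk
    proof eventually_elim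
      case (elim n)
      \<comment> \<open>The iterated logarithm, eventually at least 2, outweighs the constant 1 -
        log 2 and the error \<open>a n\<close>.\<close>
      have "2 * (x - l + (1 - t) + b) \<le> 2 * y" if "x \<le> y" "2 \<le> l" "0 \<le> t" "b \<le> 1/10" for x l t b y :: real
        using that by simp
      then show ?case unfolding elim(2) using elim(1) l2 by blast
    qed
    show "\<forall>\<^sub>F n in sequentially. exp (- (p n * real (k n))) \<le> (ln (real n) / (real n * p n))\<^sup>2"
      using x_ev pk
    proof eventually_elim
      case (elim n)
      let ?x = "ln (real n * p n)"
      have n: "2 \<le> n" "1 < real n" "0 < p n" using elim(1) by auto
      have "0 < ln (real n)" using n by simp
      then have x0: "0 < ?x" using elim(1) by linarith
      have "- (2 * (x - l + (1 - t) + b)) \<le> 2 * (l - x)" if "t \<le> 25/36" "- (1/10) \<le> b" for x l t b :: real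
        using that by simp
      then have "exp (- (p n * real (k n))) \<le> exp (2 * (ln ?x - ?x))"
        unfolding exp_le_cancel_iff elim(2) using elim(1) l2 by blast
      also have "\<dots> = (exp (ln ?x - ?x))\<^sup>2" by (rule exp_double)
      also have "exp (ln ?x - ?x) = ?x / (real n * p n)" using x0 n by (simp add: exp_diff)
      also have "(?x / (real n * p n))\<^sup>2 \<le> (ln (real n) / (real n * p n))\<^sup>2"
        using elim(1) x0 n by (intro power_mono divide_right_mono) auto
      finally show ?case .
    qed
    show "\<forall>\<^sub>F n in sequentially. real (r n) \<le> C * (ln (real n) ^ 3 / (real n * (p n)\<^sup>2))"
      using C eventually_ge_at_top[of 2] by eventually_elim simp
  qed (use e' p_half p_lower p_def in auto)
  obtain \<eta> where \<eta>: "\<eta> \<longlonglongrightarrow> 0" and V: "\<forall>\<^sub>F n in sequentially.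
      VarX n (m n) (k n) (r n) \<le> \<eta> n * (EX_X n (m n) (k n) (r n))\<^sup>2 + 16 * EX_X n (m n) (k n) (r n)"
    using variance_bound by blast
  show ?thesis
  proof (rule landau_o.smallI)
    \<comment> \<open>Half of \<open>c\<close> pays for \<open>\<eta>\<close>, the other half for
      the linear term: 16 E is at most (c / 2) E^2 once E is at least 32 / c.\<close>
    fix c :: real assume c: "0 < c"
    have 1: "\<forall>\<^sub>F n in sequentially. \<eta> n < c / 2" using order_tendstoD(2)[OF \<eta>, of "c / 2"] c by simp
    have 2: "\<forall>\<^sub>F n in sequentially. 32 / c < EX_X n (m n) (k n) (r n)" using EX_inf by (simp add: filterlim_at_top_dense)
    show "\<forall>\<^sub>F n in sequentially. norm (VarX n (m n) (k n) (r n)) \<le> c * norm ((EX_X n (m n) (k n) (r n))\<^sup>2)"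
      using 1 2 V
    proof eventually_elim
      case (elim n)
      let ?E = "EX_X n (m n) (k n) (r n)"
      have E0: "0 < ?E" using elim(2) c by (smt (verit) divide_pos_pos)
      have "32 \<le> c * ?E" using elim(2) c by (simp add: pos_divide_less_eq mult.commute)
      then have "32 * ?E \<le> c * ?E * ?E" using E0 by (intro mult_right_mono) auto
      then have "16 * ?E \<le> c / 2 * ?E\<^sup>2" by (simp add: power2_eq_square)
      moreover have "\<eta> n * ?E\<^sup>2 \<le> c / 2 * ?E\<^sup>2" using elim(1) by (intro mult_right_mono) auto
      moreover have "0 \<le> VarX n (m n) (k n) (r n)" unfolding VarX_def by (rule measure_pmf.variance_positive)
      ultimately show ?case using elim(3) by simp
    qed
  qed
qed

end
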